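(* Let $T$ be a complete first-order theory with monster model $\mathfrak{C}$ and let $A\subseteq B$. Let $p\in S(B)$ be a stable type which does not fork over $A$. Then $p\restriction A$ is stable.
   Context: $T$ is a complete first-order theory and $\mathfrak{C}$ is its monster model; all parameter sets are subsets of $\mathfrak{C}$. A partial type $\pi(x)$ over $A$ is stable if every extension $q\in S(C)$ of $\pi$, over every $C\supseteq A$, is definable. *)

theory Defs
  imports Main
begin

section \<open>First-order logic with equality\<close>

text \<open>
  Constants are function symbols of arity 0.  The symbols of a language are explicit sets, since
  a HOL type is never empty while a language may have no function or no relation symbols.
\<close>

record ('f, 'r) language =
  funs :: "'f set"
  fun_ar :: "'f \<Rightarrow> nat"
  rels :: "'r set"
  rel_ar :: "'r \<Rightarrow> nat"

datatype 'f tm = Var nat | Fun 'f "'f tm list"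

datatype ('f, 'r) fm =
    Eq "'f tm" "'f tm"
  | Rel 'r "'f tm list"
  | Neg "('f, 'r) fm"
  | Conj "('f, 'r) fm" "('f, 'r) fm"
  | Ex nat "('f, 'r) fm"

fun wf_tm :: "('f, 'r) language \<Rightarrow> 'f tm \<Rightarrow> bool" where
  "wf_tm L (Var x) = True"
| "wf_tm L (Fun f ts) = (f \<in> funs L \<and> length ts = fun_ar L f \<and> (\<forall>t\<in>set ts. wf_tm L t))"

primrec wf_fm :: "('f, 'r) language \<Rightarrow> ('f, 'r) fm \<Rightarrow> bool" where
  "wf_fm L (Eq s t) = (wf_tm L s \<and> wf_tm L t)"
| "wf_fm L (Rel r ts) = (r \<in> rels L \<and> length ts = rel_ar L r \<and> (\<forall>t\<in>set ts. wf_tm L t))"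
| "wf_fm L (Neg \<phi>) = wf_fm L \<phi>"
| "wf_fm L (Conj \<phi> \<psi>) = (wf_fm L \<phi> \<and> wf_fm L \<psi>)"
| "wf_fm L (Ex x \<phi>) = wf_fm L \<phi>"

fun fv_tm :: "'f tm \<Rightarrow> nat set" where
  "fv_tm (Var x) = {x}"
| "fv_tm (Fun f ts) = (\<Union>t\<in>set ts. fv_tm t)"

primrec fv :: "('f, 'r) fm \<Rightarrow> nat set" where
  "fv (Eq s t) = fv_tm s \<union> fv_tm t"
| "fv (Rel r ts) = (\<Union>t\<in>set ts. fv_tm t)"
| "fv (Neg \<phi>) = fv \<phi>"
| "fv (Conj \<phi> \<psi>) = fv \<phi> \<union> fv \<psi>"
| "fv (Ex x \<phi>) = fv \<phi> - {x}"

text \<open>The formulas $\varphi(x_0, \dots, x_{n-1})$ of \<open>L\<close>; for \<open>n = 0\<close> these are the sentences.\<close>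

definition fms :: "('f, 'r) language \<Rightarrow> nat \<Rightarrow> ('f, 'r) fm set" where
  "fms L n = {\<phi>. wf_fm L \<phi> \<and> fv \<phi> \<subseteq> {..<n}}"

record ('f, 'r, 'a) struct =
  universe :: "'a set"
  fn :: "'f \<Rightarrow> 'a list \<Rightarrow> 'a"
  rl :: "'r \<Rightarrow> 'a list \<Rightarrow> bool"

definition tuples :: "'a set \<Rightarrow> nat \<Rightarrow> 'a list set" where
  "tuples A n = {as. length as = n \<and> set as \<subseteq> A}"

definition is_struct :: "('f, 'r) language \<Rightarrow> ('f, 'r, 'a) struct \<Rightarrow> bool" where
  "is_struct L M \<longleftrightarrow> universe M \<noteq> {} \<and>
     (\<forall>f\<in>funs L. \<forall>as\<in>tuples (universe M) (fun_ar L f). fn M f as \<in> universe M)"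

primrec eval :: "('f, 'r, 'a) struct \<Rightarrow> (nat \<Rightarrow> 'a) \<Rightarrow> 'f tm \<Rightarrow> 'a" where
  "eval M e (Var x) = e x"
| "eval M e (Fun f ts) = fn M f (map (eval M e) ts)"

primrec sat :: "('f, 'r, 'a) struct \<Rightarrow> (nat \<Rightarrow> 'a) \<Rightarrow> ('f, 'r) fm \<Rightarrow> bool" where
  "sat M e (Eq s t) = (eval M e s = eval M e t)"
| "sat M e (Rel r ts) = rl M r (map (eval M e) ts)"
| "sat M e (Neg \<phi>) = (\<not> sat M e \<phi>)"
| "sat M e (Conj \<phi> \<psi>) = (sat M e \<phi> \<and> sat M e \<psi>)"
| "sat M e (Ex x \<phi>) = (\<exists>a\<in>universe M. sat M (e(x := a)) \<phi>)"

text \<open>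
  \<open>holds M \<phi> as\<close> is $M \models \varphi(a_0, \dots, a_{n-1})$.  It is only used for formulas in
  \<open>fms L n\<close> and tuples of length \<open>n\<close>, so that the values of the assignment beyond the end of
  the list do not matter.
\<close>

definition holds :: "('f, 'r, 'a) struct \<Rightarrow> ('f, 'r) fm \<Rightarrow> 'a list \<Rightarrow> bool" where
  "holds M \<phi> as = sat M (\<lambda>i. as ! i) \<phi>"

section \<open>Complete theories\<close>

definition models :: "('f, 'r) language \<Rightarrow> ('f, 'r, 'a) struct \<Rightarrow> ('f, 'r) fm set \<Rightarrow> bool" where
  "models L M T \<longleftrightarrow> is_struct L M \<and> (\<forall>\<phi>\<in>T. holds M \<phi> [])"

text \<open>
  Entailment and consistency have to name a type for the universes of the structures considered.
  The type of formulas has cardinality at least $|L| + \aleph_0$, so by the downward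
  Loewenheim--Skolem theorem every structure is elementarily equivalent to one whose
  universe is a set of elements of this type; finite structures are included.
\<close>

definition entails :: "('f, 'r) language \<Rightarrow> ('f, 'r) fm set \<Rightarrow> ('f, 'r) fm \<Rightarrow> bool" where
  "entails L T \<phi> \<longleftrightarrow>
     (\<forall>N :: ('f, 'r, ('f, 'r) fm) struct. models L N T \<longrightarrow> holds N \<phi> [])"

definition complete_theory :: "('f, 'r) language \<Rightarrow> ('f, 'r) fm set \<Rightarrow> bool" where
  "complete_theory L T \<longleftrightarrow> T \<subseteq> fms L 0 \<and>
     (\<exists>N :: ('f, 'r, ('f, 'r) fm) struct. models L N T) \<and>
     (\<forall>\<phi>\<in>fms L 0. entails L T \<phi> \<or> entails L T (Neg \<phi>))"

section \<open>Parameters and types\<close>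

text \<open>The language $L(A)$, with a new constant \<open>Inr a\<close> for every \<open>a \<in> A\<close>.\<close>

definition lang_over :: "('f, 'r) language \<Rightarrow> 'a set \<Rightarrow> ('f + 'a, 'r) language" where
  "lang_over L A =
     \<lparr>funs = Inl ` funs L \<union> Inr ` A, fun_ar = case_sum (fun_ar L) (\<lambda>a. 0),
      rels = rels L, rel_ar = rel_ar L\<rparr>"

text \<open>The expansion of \<open>M\<close> in which the constant \<open>Inr a\<close> names the element \<open>a\<close>.\<close>

definition named :: "('f, 'r, 'a) struct \<Rightarrow> ('f + 'a, 'r, 'a) struct" where
  "named M = \<lparr>universe = universe M, fn = case_sum (fn M) (\<lambda>a as. a), rl = rl M\<rparr>"

abbreviation fms_over :: "('f, 'r) language \<Rightarrow> 'a set \<Rightarrow> nat \<Rightarrow> ('f + 'a, 'r) fm set" where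
  "fms_over L A n \<equiv> fms (lang_over L A) n"

text \<open>
  \<open>subst_fm \<sigma> \<phi>\<close> replaces each free variable \<open>x\<close> of the \<open>L\<close>-formula \<open>\<phi>\<close> with \<open>\<sigma> x = Some a\<close> by
  the constant for \<open>a\<close>.  Only constants are substituted, so no variable is captured.
\<close>

primrec subst_tm :: "(nat \<Rightarrow> 'a option) \<Rightarrow> 'f tm \<Rightarrow> ('f + 'a) tm" where
  "subst_tm \<sigma> (Var x) = (case \<sigma> x of None \<Rightarrow> Var x | Some a \<Rightarrow> Fun (Inr a) [])"
| "subst_tm \<sigma> (Fun f ts) = Fun (Inl f) (map (subst_tm \<sigma>) ts)"

primrec subst_fm :: "(nat \<Rightarrow> 'a option) \<Rightarrow> ('f, 'r) fm \<Rightarrow> ('f + 'a, 'r) fm" where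
  "subst_fm \<sigma> (Eq s t) = Eq (subst_tm \<sigma> s) (subst_tm \<sigma> t)"
| "subst_fm \<sigma> (Rel r ts) = Rel r (map (subst_tm \<sigma>) ts)"
| "subst_fm \<sigma> (Neg \<phi>) = Neg (subst_fm \<sigma> \<phi>)"
| "subst_fm \<sigma> (Conj \<phi> \<psi>) = Conj (subst_fm \<sigma> \<phi>) (subst_fm \<sigma> \<psi>)"
| "subst_fm \<sigma> (Ex x \<phi>) = Ex x (subst_fm (\<sigma>(x := None)) \<phi>)"

text \<open>
  For $\varphi(x, y)$ with $x = (x_0, \dots, x_{n-1})$ and $y = (x_n, \dots, x_{n+m-1})$, and an
  \<open>m\<close>-tuple \<open>b\<close>, \<open>inst n \<phi> b\<close> is the formula $\varphi(x, b)$.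
\<close>

definition inst :: "nat \<Rightarrow> ('f, 'r) fm \<Rightarrow> 'a list \<Rightarrow> ('f + 'a, 'r) fm" where
  "inst n \<phi> b = subst_fm (\<lambda>i. if n \<le> i \<and> i < n + length b then Some (b ! (i - n)) else None) \<phi>"

lemma eval_subst_tm:
  "eval (named M) e (subst_tm \<sigma> t) = eval M (\<lambda>i. case \<sigma> i of None \<Rightarrow> e i | Some a \<Rightarrow> a) t"
proof (induction t)
  case (Var x)
  then show ?case by (simp add: named_def split: option.split)
next
  case (Fun f ts)
  then have "map (eval (named M) e) (map (subst_tm \<sigma>) ts)
    = map (eval M (\<lambda>i. case \<sigma> i of None \<Rightarrow> e i | Some a \<Rightarrow> a)) ts"
    by simp
  moreover have "fn (named M) (Inl f) = fn M f" by (simp add: named_def)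
  ultimately show ?case by (simp only: subst_tm.simps eval.simps)
qed

lemma sat_subst_fm:
  "sat (named M) e (subst_fm \<sigma> \<phi>) = sat M (\<lambda>i. case \<sigma> i of None \<Rightarrow> e i | Some a \<Rightarrow> a) \<phi>"
proof (induction \<phi> arbitrary: \<sigma> e)
  case (Ex x \<phi>)
  have "(\<lambda>i. case (\<sigma>(x := None)) i of None \<Rightarrow> (e(x := a)) i | Some b \<Rightarrow> b)
    = (\<lambda>i. case \<sigma> i of None \<Rightarrow> e i | Some b \<Rightarrow> b)(x := a)" for a
    by (rule ext) (simp split: option.split)
  moreover have "universe (named M) = universe M" by (simp add: named_def)
  ultimately show ?case using Ex.IH by simp
next
  case (Rel r ts)
  have "rl (named M) = rl M" by (simp add: named_def)
  then show ?case by (simp add: eval_subst_tm comp_def)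
qed (simp_all add: eval_subst_tm)

lemma eval_cong: "(\<And>i. i \<in> fv_tm t \<Longrightarrow> e i = e' i) \<Longrightarrow> eval M e t = eval M e' t"
proof (induction t)
  case (Fun f ts)
  then have "map (eval M e) ts = map (eval M e') ts" by auto
  then show ?case by (simp only: eval.simps)
qed simp

lemma sat_cong: "(\<And>i. i \<in> fv \<phi> \<Longrightarrow> e i = e' i) \<Longrightarrow> sat M e \<phi> = sat M e' \<phi>"
proof (induction \<phi> arbitrary: e e')
  case (Eq s t)
  then show ?case using eval_cong[of s e e' M] eval_cong[of t e e' M] by simp
next
  case (Rel r ts)
  then have "map (eval M e) ts = map (eval M e') ts" by (auto intro!: eval_cong)
  then show ?case by (simp only: sat.simps)
next
  case (Neg \<phi>)
  have "sat M e \<phi> = sat M e' \<phi>" by (rule Neg.IH) (simp add: Neg.prems)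
  then show ?case by simp
next
  case (Conj \<phi> \<psi>)
  have "sat M e \<phi> = sat M e' \<phi>" by (rule Conj.IH(1)) (simp add: Conj.prems)
  moreover have "sat M e \<psi> = sat M e' \<psi>" by (rule Conj.IH(2)) (simp add: Conj.prems)
  ultimately show ?case by simp
next
  case (Ex x \<phi>)
  have "sat M (e(x := a)) \<phi> = sat M (e'(x := a)) \<phi>" for a
    by (rule Ex.IH) (simp add: Ex.prems)
  then show ?case by simp
qed

lemma holds_inst:
  assumes "\<phi> \<in> fms L (n + length b)" and "length a = n"
  shows "holds (named M) (inst n \<phi> b) a \<longleftrightarrow> holds M \<phi> (a @ b)"
  unfolding holds_def inst_def sat_subst_fm
  using assms by (intro sat_cong) (auto simp: fms_def nth_append)

text \<open>A set of formulas over \<open>A\<close> consistent with the elementary diagram of \<open>M\<close>.\<close>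

definition partial_type ::
    "('f, 'r) language \<Rightarrow> ('f, 'r, 'a) struct \<Rightarrow> 'a set \<Rightarrow> nat \<Rightarrow> ('f + 'a, 'r) fm set \<Rightarrow> bool" where
  "partial_type L M A n \<pi> \<longleftrightarrow> \<pi> \<subseteq> fms_over L A n \<and>
     (\<forall>\<pi>\<^sub>0 \<subseteq> \<pi>. finite \<pi>\<^sub>0 \<longrightarrow> (\<exists>a\<in>tuples (universe M) n. \<forall>\<chi>\<in>\<pi>\<^sub>0. holds (named M) \<chi> a))"

text \<open>The space $S_n(A)$ of complete \<open>n\<close>-types over \<open>A\<close>.\<close>

definition S ::
    "('f, 'r) language \<Rightarrow> ('f, 'r, 'a) struct \<Rightarrow> nat \<Rightarrow> 'a set \<Rightarrow> ('f + 'a, 'r) fm set set" where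
  "S L M n A = {p. partial_type L M A n p \<and> (\<forall>\<chi>\<in>fms_over L A n. \<chi> \<in> p \<or> Neg \<chi> \<in> p)}"

definition tp ::
    "('f, 'r) language \<Rightarrow> ('f, 'r, 'a) struct \<Rightarrow> 'a list \<Rightarrow> 'a set \<Rightarrow> ('f + 'a, 'r) fm set" where
  "tp L M b A = {\<chi> \<in> fms_over L A (length b). holds (named M) \<chi> b}"

definition realizes ::
    "('f, 'r, 'a) struct \<Rightarrow> nat \<Rightarrow> 'a list \<Rightarrow> ('f + 'a, 'r) fm set \<Rightarrow> bool" where
  "realizes M n a \<pi> \<longleftrightarrow> a \<in> tuples (universe M) n \<and> (\<forall>\<chi>\<in>\<pi>. holds (named M) \<chi> a)"

definition restrict_type ::
    "('f, 'r) language \<Rightarrow> nat \<Rightarrow> ('f + 'a, 'r) fm set \<Rightarrow> 'a set \<Rightarrow> ('f + 'a, 'r) fm set" where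
  "restrict_type L n p A = p \<inter> fms_over L A n"

section \<open>The monster model\<close>

text \<open>
  A set is small if its cardinality is less than \<open>\<kappa>\<close>, a cardinal presented, as in the library,
  by a well-order on an arbitrary type.
\<close>

definition small :: "'k rel \<Rightarrow> 'a set \<Rightarrow> bool" where
  "small \<kappa> A \<longleftrightarrow> (card_of A, \<kappa>) \<in> ordLess"

definition saturated :: "('f, 'r) language \<Rightarrow> 'k rel \<Rightarrow> ('f, 'r, 'a) struct \<Rightarrow> bool" where
  "saturated L \<kappa> M \<longleftrightarrow>
     (\<forall>A \<subseteq> universe M. small \<kappa> A \<longrightarrow> (\<forall>p \<in> S L M 1 A. \<exists>a. realizes M 1 a p))"

definition elementary_map ::
    "('f, 'r) language \<Rightarrow> ('f, 'r, 'a) struct \<Rightarrow> 'a set \<Rightarrow> ('a \<Rightarrow> 'a) \<Rightarrow> bool" where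
  "elementary_map L M A h \<longleftrightarrow> h ` A \<subseteq> universe M \<and>
     (\<forall>m. \<forall>\<phi>\<in>fms L m. \<forall>a\<in>tuples A m. holds M \<phi> a \<longleftrightarrow> holds M \<phi> (map h a))"

definition automorphism ::
    "('f, 'r) language \<Rightarrow> ('f, 'r, 'a) struct \<Rightarrow> ('a \<Rightarrow> 'a) \<Rightarrow> bool" where
  "automorphism L M \<sigma> \<longleftrightarrow> bij_betw \<sigma> (universe M) (universe M) \<and>
     (\<forall>f\<in>funs L. \<forall>as\<in>tuples (universe M) (fun_ar L f). \<sigma> (fn M f as) = fn M f (map \<sigma> as)) \<and>
     (\<forall>r\<in>rels L. \<forall>as\<in>tuples (universe M) (rel_ar L r). rl M r as \<longleftrightarrow> rl M r (map \<sigma> as))"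

definition strongly_homogeneous ::
    "('f, 'r) language \<Rightarrow> 'k rel \<Rightarrow> ('f, 'r, 'a) struct \<Rightarrow> bool" where
  "strongly_homogeneous L \<kappa> M \<longleftrightarrow>
     (\<forall>A \<subseteq> universe M. \<forall>h. small \<kappa> A \<longrightarrow> elementary_map L M A h \<longrightarrow>
        (\<exists>\<sigma>. automorphism L M \<sigma> \<and> (\<forall>a\<in>A. \<sigma> a = h a)))"

text \<open>
  The size of the theory is the number of \<open>L\<close>-formulas, that is $|L| + \aleph_0$; no more than
  $\kappa > |L| + \aleph_0$ is asked of \<open>\<kappa>\<close>.
\<close>

definition monster_model ::
    "('f, 'r) language \<Rightarrow> ('f, 'r) fm set \<Rightarrow> 'k rel \<Rightarrow> ('f, 'r, 'a) struct \<Rightarrow> bool" where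
  "monster_model L T \<kappa> M \<longleftrightarrow>
     Card_order \<kappa> \<and> small \<kappa> {\<phi>. wf_fm L \<phi>} \<and>
     models L M T \<and> saturated L \<kappa> M \<and> strongly_homogeneous L \<kappa> M"

section \<open>Definability, stability, forking\<close>

text \<open>
  \<open>q \<in> S\<^sub>n(C)\<close> is definable (over \<open>C\<close>): every \<open>\<phi>(x, y)\<close> has a definition \<open>\<psi>(y)\<close> over \<open>C\<close>.  The
  variables of \<open>\<psi>\<close> are $x_0, \dots, x_{m-1}$, standing for the \<open>m\<close>-tuple \<open>y\<close>.
\<close>

definition definable_type ::
    "('f, 'r) language \<Rightarrow> ('f, 'r, 'a) struct \<Rightarrow> nat \<Rightarrow> 'a set \<Rightarrow> ('f + 'a, 'r) fm set \<Rightarrow> bool" where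
  "definable_type L M n C q \<longleftrightarrow>
     (\<forall>m. \<forall>\<phi>\<in>fms L (n + m). \<exists>\<psi>\<in>fms_over L C m.
        \<forall>c\<in>tuples C m. inst n \<phi> c \<in> q \<longleftrightarrow> holds (named M) \<psi> c)"

definition stable_type ::
    "('f, 'r) language \<Rightarrow> 'k rel \<Rightarrow> ('f, 'r, 'a) struct \<Rightarrow> nat \<Rightarrow> 'a set \<Rightarrow>
     ('f + 'a, 'r) fm set \<Rightarrow> bool" where
  "stable_type L \<kappa> M n A \<pi> \<longleftrightarrow> partial_type L M A n \<pi> \<and>
     (\<forall>C. A \<subseteq> C \<longrightarrow> C \<subseteq> universe M \<longrightarrow> small \<kappa> C \<longrightarrow>
        (\<forall>q \<in> S L M n C. \<pi> \<subseteq> q \<longrightarrow> definable_type L M n C q))"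

text \<open>
  \<open>\<phi>(x, b)\<close> divides over \<open>A\<close>.  Inconsistency is counted by indices, so a constant sequence does
  not witness dividing unless \<open>\<phi>(x, b)\<close> itself is inconsistent.
\<close>

definition divides ::
    "('f, 'r) language \<Rightarrow> ('f, 'r, 'a) struct \<Rightarrow> nat \<Rightarrow> 'a set \<Rightarrow> ('f, 'r) fm \<Rightarrow> 'a list \<Rightarrow> bool" where
  "divides L M n A \<phi> b \<longleftrightarrow>
     (\<exists>k. \<exists>s :: nat \<Rightarrow> 'a list.
        (\<forall>i. s i \<in> tuples (universe M) (length b) \<and> tp L M (s i) A = tp L M b A) \<and>
        (\<forall>I. finite I \<and> card I = k \<longrightarrow>
           \<not> (\<exists>a\<in>tuples (universe M) n. \<forall>i\<in>I. holds (named M) (inst n \<phi> (s i)) a)))"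

text \<open>
  \<open>\<pi>\<close> forks over \<open>A\<close>: it implies a finite disjunction of formulas, with parameters from
  anywhere in the monster model, each of which divides over \<open>A\<close>.  For a \<open>\<pi>\<close> over a small set,
  implication means implication for all realizations in the monster model.
\<close>

definition forks ::
    "('f, 'r) language \<Rightarrow> ('f, 'r, 'a) struct \<Rightarrow> nat \<Rightarrow> 'a set \<Rightarrow> ('f + 'a, 'r) fm set \<Rightarrow> bool" where
  "forks L M n A \<pi> \<longleftrightarrow>
     (\<exists>D :: (('f, 'r) fm \<times> 'a list) set. finite D \<and>
        (\<forall>(\<phi>, b)\<in>D. set b \<subseteq> universe M \<and> \<phi> \<in> fms L (n + length b) \<and> divides L M n A \<phi> b) \<and>
        (\<forall>a. realizes M n a \<pi> \<longrightarrow> (\<exists>(\<phi>, b)\<in>D. holds (named M) (inst n \<phi> b) a)))"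

end

theory Submission
  imports Defs "HOL-Library.Ramsey" "HOL-Library.Countable"
begin

text \<open>
  The proof combines two facts.  A type whose definable neighbourhoods bound the length of the
  ladders of every formula (finite sequences with the order property) has only definable
  extensions, by Shelah's local rank
  (\<open>definable_of_noladder\<close>), and conversely a stable type has neighbourhoods without
  long ladders (\<open>stable_noladder\<close>).  So suppose that \<open>a0\<close> realizes the stable nonforking type \<open>p\<close>;
  it has to be shown that the type of \<open>a0\<close> over \<open>A\<close> has no long ladders (\<open>noladder_A\<close>).

  Since \<open>p\<close> does not fork, it extends to a global type without dividing formulas, represented by an
  ultrafilter \<open>Q\<close> on tuples (\<open>nonforking_uq\<close>).  Ladders are bounded even for blocks of
  realizations of \<open>p\<close>, hence \<open>Q\<close> is definable over a small set, its powers commute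
  (\<open>Qp_commute\<close>), and it is generically stable in a uniform way: a formula of \<open>Q\<close> fails at a
  bounded number of entries of a generic sequence (\<open>majority_fm\<close>, \<open>majority_lrel\<close>).

  By the majority rule, the definition of the \<open>\<phi>\<close>-part of \<open>Q\<close> is determined by a long generic tuple.
  As no formula of \<open>Q\<close> divides over \<open>A\<close>, the entries of this tuple can be removed one at
  a time, and the definition has finitely many conjugates over \<open>A\<close>
  (\<open>few_conjugates\<close>).  In other words the canonical base of \<open>Q\<close> is algebraic over \<open>A\<close>.
  In place of this base, which consists of imaginary elements, the proof uses the group
  \<open>G0\<close> of the automorphisms over \<open>A\<close> that fix \<open>Q\<close>.  The set \<open>RR j\<close> of the \<open>G0\<close>-conjugates of
  generic \<open>j\<close>-tuples is a single orbit (\<open>RR_conj\<close>), and consists of the tuples that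
  satisfy every invariant definable relation of the \<open>j\<close>-th power (\<open>RR_of_invariant\<close>).

  The heart of the argument is \<open>common_conjugate\<close>: for finitely many realizations
  \<open>a\<close> with \<open>[a] \<in> RR 1\<close>, in whatever way they depend on each other, each formula of \<open>Q\<close> has one
  conjugate under \<open>G0\<close> that holds at all of them.  To see this, choose automorphisms
  \<open>\<sigma>\<^sub>0, \<sigma>\<^sub>1, \<dots>\<close> in \<open>G0\<close> such that for every single \<open>a\<close> the sequence \<open>\<sigma>\<^sub>0 a, \<sigma>\<^sub>1 a, \<dots>\<close> is independent
  (\<open>spread\<close>).  By the majority rule the formula fails at few entries of each of these sequences,
  so for some \<open>l\<close> it holds at all \<open>\<sigma>\<^sub>l a\<close>.

  If there were long ladders in the type of \<open>a0\<close> over \<open>A\<close>, then by the pigeonhole principle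
  for the finitely many conjugates of finitely many definitions, and by compactness, there
  would be an infinite ladder whose left entries all belong to \<open>RR 1\<close> (\<open>ladder_RR\<close>).  An
  automorphism moves any finite part of it into a formula of \<open>p\<close> that bounds the
  length of ladders, which is a contradiction.
\<close>

section \<open>Ultrafilter quantifiers\<close>

text \<open>
  An ultrafilter on the whole type is used as a generalized quantifier: \<open>W P\<close> says that \<open>P\<close>
  holds for almost every \<open>x\<close>.  Commuting with the Boolean operations is all that
  is needed, and in this form iterated (Fubini) products are iterated quantifiers.
\<close>

definition uq :: "(('x \<Rightarrow> bool) \<Rightarrow> bool) \<Rightarrow> bool" where
  "uq W \<longleftrightarrow> (\<forall>P R. W (\<lambda>x. P x \<and> R x) \<longleftrightarrow> W P \<and> W R) \<and> (\<forall>P. W (\<lambda>x. \<not> P x) \<longleftrightarrow> \<not> W P)"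

lemma uq_conj: "uq W \<Longrightarrow> W (\<lambda>x. P x \<and> R x) \<longleftrightarrow> W P \<and> W R"
  by (simp add: uq_def)

lemma uq_conjI: "uq W \<Longrightarrow> W P \<Longrightarrow> W R \<Longrightarrow> W (\<lambda>x. P x \<and> R x)"
  by (simp add: uq_def)

lemma uq_not: "uq W \<Longrightarrow> W (\<lambda>x. \<not> P x) \<longleftrightarrow> \<not> W P"
  by (simp add: uq_def)

lemma uq_False: "uq W \<Longrightarrow> \<not> W (\<lambda>x. False)"
  using uq_conj[of W "\<lambda>x. False" "\<lambda>x. True"] uq_not[of W "\<lambda>x. True"] by auto

lemma uq_True: "uq W \<Longrightarrow> W (\<lambda>x. True)"
  using uq_False uq_not[of W "\<lambda>x. False"] by auto

lemma uq_const: "uq W \<Longrightarrow> W (\<lambda>x. b) \<longleftrightarrow> b"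
  using uq_True[of W] uq_False[of W] by (cases b) auto

lemma uq_mono: "uq W \<Longrightarrow> W P \<Longrightarrow> (\<And>x. P x \<Longrightarrow> R x) \<Longrightarrow> W R"
proof -
  assume "uq W" "W P" and PR: "\<And>x. P x \<Longrightarrow> R x"
  have "P = (\<lambda>x. P x \<and> R x)" using PR by auto
  with \<open>W P\<close> have "W (\<lambda>x. P x \<and> R x)" by simp
  then show "W R" using uq_conj[OF \<open>uq W\<close>, of P R] by simp
qed

lemma uq_ex: "uq W \<Longrightarrow> W P \<Longrightarrow> \<exists>x. P x"
  using uq_mono[of W P "\<lambda>x. False"] uq_False[of W] by blast

lemma uq_disj: "uq W \<Longrightarrow> W (\<lambda>x. P x \<or> R x) \<longleftrightarrow> W P \<or> W R"
  using uq_not[of W "\<lambda>x. \<not> P x \<and> \<not> R x"] uq_conj[of W "\<lambda>x. \<not> P x" "\<lambda>x. \<not> R x"]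
    uq_not[of W P] uq_not[of W R] by simp

lemma uq_ball: "finite I \<Longrightarrow> uq W \<Longrightarrow> W (\<lambda>x. \<forall>i\<in>I. P i x) \<longleftrightarrow> (\<forall>i\<in>I. W (P i))"
proof (induction I rule: finite_induct)
  case empty
  then show ?case using uq_True[of W] by simp
next
  case (insert i I)
  then show ?case using uq_conj[of W "P i" "\<lambda>x. \<forall>i\<in>I. P i x"] by simp
qed

lemma uq_bex: "finite I \<Longrightarrow> uq W \<Longrightarrow> W (\<lambda>x. \<exists>i\<in>I. P i x) \<longleftrightarrow> (\<exists>i\<in>I. W (P i))"
proof (induction I rule: finite_induct)
  case empty
  then show ?case using uq_False[of W] by simp
next
  case (insert i I)
  then show ?case using uq_disj[of W "P i" "\<lambda>x. \<exists>i\<in>I. P i x"] by simp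
qed

lemma uq_cong: "uq W \<Longrightarrow> W T \<Longrightarrow> (\<And>x. T x \<Longrightarrow> P x = R x) \<Longrightarrow> W P = W R"
  using uq_conj[of W T P] uq_conj[of W T R] uq_mono[of W "\<lambda>x. T x \<and> P x" "\<lambda>x. T x \<and> R x"]
    uq_mono[of W "\<lambda>x. T x \<and> R x" "\<lambda>x. T x \<and> P x"] by auto

lemma uq_principal: "uq (\<lambda>P. P a)"
  by (simp add: uq_def)

text \<open>The ultrafilter lemma, by Zorn's lemma for families with the finite intersection property.\<close>

lemma uq_exists:
  assumes fip: "\<And>F. finite F \<Longrightarrow> F \<subseteq> \<F> \<Longrightarrow> \<exists>x. \<forall>P\<in>F. P x"
  shows "\<exists>W :: ('x \<Rightarrow> bool) \<Rightarrow> bool. uq W \<and> (\<forall>P\<in>\<F>. W P)"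
proof -
  define \<A> where "\<A> = {\<G> :: ('x \<Rightarrow> bool) set. \<F> \<subseteq> \<G> \<and>
    (\<forall>F. finite F \<longrightarrow> F \<subseteq> \<G> \<longrightarrow> (\<exists>x. \<forall>P\<in>F. P x))}"
  have "\<F> \<in> \<A>" using fip by (auto simp: \<A>_def)
  moreover have "\<Union>\<C> \<in> \<A>" if ne: "\<C> \<noteq> {}" and ch: "subset.chain \<A> \<C>" for \<C>
  proof -
    have sub: "\<C> \<subseteq> \<A>" using ch by (simp add: subset_chain_def)
    have "\<exists>x. \<forall>P\<in>F. P x" if F: "finite F" "F \<subseteq> \<Union>\<C>" for F
    proof -
      obtain \<G> where "\<G> \<in> \<C>" "F \<subseteq> \<G>"
        using finite_subset_Union_chain[OF F ne ch] by blast
      then show ?thesis using F(1) sub by (auto simp: \<A>_def)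
    qed
    moreover have "\<F> \<subseteq> \<Union>\<C>" using ne sub by (auto simp: \<A>_def)
    ultimately show ?thesis by (simp add: \<A>_def)
  qed
  ultimately obtain \<G> where G: "\<G> \<in> \<A>" and max: "\<And>\<H>. \<H> \<in> \<A> \<Longrightarrow> \<G> \<subseteq> \<H> \<Longrightarrow> \<H> = \<G>"
    using subset_Zorn_nonempty[of \<A>] by blast
  have fipG: "\<exists>x. \<forall>P\<in>F. P x" if "finite F" "F \<subseteq> \<G>" for F
    using G that by (simp add: \<A>_def)
  have mem: "P \<in> \<G>" if P: "\<And>F. finite F \<Longrightarrow> F \<subseteq> \<G> \<Longrightarrow> \<exists>x. P x \<and> (\<forall>R\<in>F. R x)" for P
  proof -
    have "insert P \<G> \<in> \<A>"
    proof -
      have "\<exists>x. \<forall>R\<in>F. R x" if "finite F" "F \<subseteq> insert P \<G>" for F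
        using P[of "F - {P}"] that by blast
      then show ?thesis using G by (auto simp: \<A>_def)
    qed
    then show ?thesis using max[of "insert P \<G>"] by auto
  qed
  have up: "R \<in> \<G>" if "finite F" "F \<subseteq> \<G>" "\<And>x. \<forall>P\<in>F. P x \<Longrightarrow> R x" for F R
  proof (rule mem)
    fix F' assume F': "finite F'" "F' \<subseteq> \<G>"
    show "\<exists>x. R x \<and> (\<forall>R\<in>F'. R x)" using fipG[of "F \<union> F'"] F' that(1,2) that(3) by blast
  qed
  define W where "W P \<longleftrightarrow> P \<in> \<G>" for P
  have "uq W"
    unfolding uq_def W_def
  proof (intro conjI allI)
    fix P R :: "'x \<Rightarrow> bool"
    have "P \<in> \<G>" "R \<in> \<G>" if "(\<lambda>x. P x \<and> R x) \<in> \<G>"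
      by (rule up[of "{\<lambda>x. P x \<and> R x}"]; use that in simp)+
    moreover have "(\<lambda>x. P x \<and> R x) \<in> \<G>" if "P \<in> \<G>" "R \<in> \<G>"
      by (rule up[of "{P, R}"]; use that in simp)
    ultimately show "((\<lambda>x. P x \<and> R x) \<in> \<G>) = (P \<in> \<G> \<and> R \<in> \<G>)" by blast
  next
    fix P :: "'x \<Rightarrow> bool"
    have "\<not> ((\<lambda>x. \<not> P x) \<in> \<G> \<and> P \<in> \<G>)" using fipG[of "{P, \<lambda>x. \<not> P x}"] by auto
    moreover have "(\<lambda>x. \<not> P x) \<in> \<G>" if nP: "P \<notin> \<G>"
    proof -
      obtain F where F: "finite F" "F \<subseteq> \<G>" "\<And>x. \<forall>R\<in>F. R x \<Longrightarrow> \<not> P x" using mem[of P] nP by blast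
      then show ?thesis using up[of F "\<lambda>x. \<not> P x"] by blast
    qed
    ultimately show "((\<lambda>x. \<not> P x) \<in> \<G>) = (P \<notin> \<G>)" by blast
  qed
  moreover have "\<forall>P\<in>\<F>. W P" using G by (auto simp: \<A>_def W_def)
  ultimately show ?thesis by blast
qed

text \<open>The iterated product of \<open>W\<close> with itself, an ultrafilter on the lists of length \<open>j\<close>.\<close>

primrec qpow :: "(('x \<Rightarrow> bool) \<Rightarrow> bool) \<Rightarrow> nat \<Rightarrow> ('x list \<Rightarrow> bool) \<Rightarrow> bool" where
  "qpow W 0 P = P []"
| "qpow W (Suc j) P = W (\<lambda>x. qpow W j (\<lambda>xs. P (x # xs)))"

lemma uq_qpow: "uq W \<Longrightarrow> uq (qpow W j)"
proof (induction j)
  case 0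
  then show ?case by (simp add: uq_def)
next
  case (Suc j)
  have q: "uq (qpow W j)" using Suc by simp
  show ?case unfolding uq_def
    using Suc.prems by (simp add: uq_conj[OF q] uq_not[OF q] uq_conj[OF Suc.prems] uq_not[OF Suc.prems])
qed

lemma qpow_members:
  assumes "uq W" and "W T"
  shows "qpow W j (\<lambda>xs. length xs = j \<and> (\<forall>x\<in>set xs. T x))"
proof (induction j)
  case (Suc j)
  have q: "uq (qpow W j)" using assms(1) by (rule uq_qpow)
  have "qpow W j (\<lambda>xs. length (x # xs) = Suc j \<and> (\<forall>y\<in>set (x # xs). T y))" if "T x" for x
    using Suc.IH by (rule uq_mono[OF q]) (use that in auto)
  then show ?case using assms by (auto intro: uq_mono[of W T])
qed simp

lemma qpow_length: "uq W \<Longrightarrow> qpow W j (\<lambda>xs. length xs = j)"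
  using qpow_members[of W "\<lambda>x. True" j] uq_True[of W] by simp

lemma qpow_cong:
  assumes "uq W" and "W T" and "\<And>xs. length xs = j \<Longrightarrow> \<forall>x\<in>set xs. T x \<Longrightarrow> P xs = R xs"
  shows "qpow W j P = qpow W j R"
  using uq_cong[OF uq_qpow[OF assms(1)], OF qpow_members[OF assms(1,2)], of j P R] assms(3) by blast

lemma qpow_add: "uq W \<Longrightarrow> qpow W (a + b) P = qpow W a (\<lambda>xs. qpow W b (\<lambda>ys. P (xs @ ys)))"
  by (induction a arbitrary: P) simp_all

lemma qpow_Suc_end: "uq W \<Longrightarrow> qpow W (Suc a) P = qpow W a (\<lambda>xs. W (\<lambda>x. P (xs @ [x])))"
  using qpow_add[of W a 1 P] by simp

lemma qpow_concat:
  assumes "uq W"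
  shows "qpow W (j * L) P = qpow (qpow W j) L (\<lambda>bs. P (concat bs))"
proof (induction L arbitrary: P)
  case (Suc L)
  have "qpow W (j * Suc L) P = qpow W j (\<lambda>xs. qpow W (j * L) (\<lambda>ys. P (xs @ ys)))"
    using qpow_add[OF assms, of j "j * L" P] by simp
  then show ?case using Suc.IH by simp
qed simp

lemma qpow_all:
  assumes "uq W" and "W T"
  shows "qpow W j (\<lambda>xs. \<forall>l<j. T (xs ! l))"
  by (rule uq_mono[OF uq_qpow[OF assms(1)], OF qpow_members[OF assms]]) auto

text \<open>Variables that do not occur may be dropped.\<close>

lemma qpow_nths:
  assumes "uq W" and "V \<subseteq> {..<L}"
  shows "qpow W L (\<lambda>xs. P (nths xs V)) = qpow W (card V) P"
  using assms(2)
proof (induction L arbitrary: V P)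
  case (Suc L)
  define V' where "V' = {i. Suc i \<in> V}"
  have V': "V' \<subseteq> {..<L}" using Suc.prems by (auto simp: V'_def)
  have fin: "finite V'" using V' finite_subset by blast
  have eq: "V = (if 0 \<in> V then {0} else {}) \<union> Suc ` V'"
    by (auto simp: V'_def image_iff) (metis not0_implies_Suc)+
  show ?case
  proof (cases "0 \<in> V")
    case True
    have "card V = Suc (card V')"
      using fin True by (subst eq) (simp add: card_image)
    moreover have "nths (x # xs) V = x # nths xs V'" for x :: 'a and xs
      using True by (simp add: nths_Cons V'_def)
    ultimately show ?thesis using Suc.IH[OF V', where P = "\<lambda>ys. P (x # ys)" for x] by simp
  next
    case False
    have "card V = card V'"
      using False by (subst eq) (simp add: card_image)
    moreover have "nths (x # xs) V = nths xs V'" for x :: 'a and xs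
      using False by (simp add: nths_Cons V'_def)
    ultimately show ?thesis using Suc.IH[OF V', where P = P] uq_const[OF assms(1)] by simp
  qed
qed simp

section \<open>Ladders\<close>

text \<open>
  A ladder witnesses the order property; the diagonal is left open, so that
  reversing a ladder for \<open>\<mu>\<close> gives one for its negation.
\<close>

definition ladder :: "('y \<Rightarrow> 'z \<Rightarrow> bool) \<Rightarrow> nat \<Rightarrow> (nat \<Rightarrow> 'y) \<Rightarrow> (nat \<Rightarrow> 'z) \<Rightarrow> bool" where
  "ladder \<mu> N b c \<longleftrightarrow> (\<forall>i<N. \<forall>l<N. (i < l \<longrightarrow> \<mu> (b i) (c l)) \<and> (l < i \<longrightarrow> \<not> \<mu> (b i) (c l)))"

definition noladder :: "('y \<Rightarrow> 'z \<Rightarrow> bool) \<Rightarrow> nat \<Rightarrow> ('y \<Rightarrow> bool) \<Rightarrow> 'z set \<Rightarrow> bool" where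
  "noladder \<mu> N Y Z \<longleftrightarrow> \<not> (\<exists>b c. (\<forall>i<N. Y (b i)) \<and> (\<forall>i<N. c i \<in> Z) \<and> ladder \<mu> N b c)"

lemma ladder_rev: "ladder (\<lambda>y z. \<not> \<mu> y z) N b c \<Longrightarrow> ladder \<mu> N (\<lambda>i. b (N - Suc i)) (\<lambda>i. c (N - Suc i))"
  unfolding ladder_def by (auto simp: diff_less_mono2)

lemma noladder_rev:
  assumes "noladder \<mu> N Y Z" and "\<forall>i<N. Y (b i)" and "\<forall>i<N. c i \<in> Z"
  shows "\<not> ladder (\<lambda>y z. \<not> \<mu> y z) N b c"
proof
  assume "ladder (\<lambda>y z. \<not> \<mu> y z) N b c"
  from ladder_rev[OF this] have "ladder \<mu> N (\<lambda>i. b (N - Suc i)) (\<lambda>i. c (N - Suc i))" .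
  moreover have "\<forall>i<N. Y (b (N - Suc i))" "\<forall>i<N. c (N - Suc i) \<in> Z" using assms(2,3) by simp_all
  ultimately have "\<exists>b c. (\<forall>i<N. Y (b i)) \<and> (\<forall>i<N. c i \<in> Z) \<and> ladder \<mu> N b c"
    by (intro exI conjI)
  then show False using assms(1) unfolding noladder_def by simp
qed

text \<open>
  Generic stability, majority form.  If \<open>N\<close> entries of an independent sequence fail \<open>\<mu>\<close> at \<open>c\<close>
  although \<open>\<mu>\<close> holds generically at \<open>c\<close>, then \<open>N\<close> further independent entries satisfy it.
  Windows of length \<open>N\<close> in the resulting pattern of \<open>2N\<close> values realize every initial
  segment pattern, and since all of them have the same generic type they
  are realized over a single window: a ladder.
\<close>

lemma majority:
  assumes W: "uq W" "W Y" and nl: "noladder \<mu> N Y Z"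
  shows "qpow W L (\<lambda>b. \<forall>c\<in>Z. W (\<lambda>y. \<mu> y c) \<longrightarrow> card {l. l < L \<and> \<not> \<mu> (b ! l) c} < N)"
proof (rule ccontr)
  note q = uq_qpow[OF W(1)]
  define P where "P b \<longleftrightarrow> (\<exists>c\<in>Z. W (\<lambda>y. \<mu> y c) \<and> (\<forall>l<N. \<not> \<mu> (b ! l) c))" for b
  define I where "I = {S. S \<subseteq> {..<L} \<and> card S = N}"
  have finI: "finite I" unfolding I_def by simp
  assume "\<not> ?thesis"
  then have "qpow W L (\<lambda>b. \<not> (\<forall>c\<in>Z. W (\<lambda>y. \<mu> y c) \<longrightarrow> card {l. l < L \<and> \<not> \<mu> (b ! l) c} < N))"
    using uq_not[OF q, of L "\<lambda>b. \<forall>c\<in>Z. W (\<lambda>y. \<mu> y c) \<longrightarrow> card {l. l < L \<and> \<not> \<mu> (b ! l) c} < N"] by blast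
  from qpow_length[OF W(1)] this have "qpow W L (\<lambda>b. length b = L \<and>
      \<not> (\<forall>c\<in>Z. W (\<lambda>y. \<mu> y c) \<longrightarrow> card {l. l < L \<and> \<not> \<mu> (b ! l) c} < N))"
    by (rule uq_conjI[OF q])
  then have "qpow W L (\<lambda>b. \<exists>S\<in>I. P (nths b S))"
  proof (rule uq_mono[OF q], elim conjE)
    fix b assume b: "length b = L" "\<not> (\<forall>c\<in>Z. W (\<lambda>y. \<mu> y c) \<longrightarrow> card {l. l < L \<and> \<not> \<mu> (b ! l) c} < N)"
    then obtain c where c: "c \<in> Z" "W (\<lambda>y. \<mu> y c)" "N \<le> card {l. l < L \<and> \<not> \<mu> (b ! l) c}" by force
    then obtain V where V: "V \<subseteq> {l. l < L \<and> \<not> \<mu> (b ! l) c}" "card V = N"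
      by (meson obtain_subset_with_card_n)
    then have SI: "V \<in> I" by (auto simp: I_def)
    have "set (nths b V) = {b ! i |i. i < length b \<and> i \<in> V}" by (rule set_nths)
    then have all: "\<forall>y\<in>set (nths b V). \<not> \<mu> y c" using V by auto
    have len: "length (nths b V) = N"
    proof -
      have "{i. i < length b \<and> i \<in> V} = V" using V b(1) by auto
      then show ?thesis using V by (simp add: length_nths)
    qed
    have "\<forall>l<N. \<not> \<mu> (nths b V ! l) c" using all len by (metis nth_mem)
    then show "\<exists>V\<in>I. P (nths b V)" using SI c by (auto simp: P_def)
  qed
  then obtain V where "V \<in> I" "qpow W L (\<lambda>b. P (nths b V))" unfolding uq_bex[OF finI q] by blast
  then have PN: "qpow W N P" using qpow_nths[OF W(1), of V L P] by (auto simp: I_def)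
  define D where "D = (\<lambda>b. \<exists>c\<in>Z. (\<forall>l<N. \<not> \<mu> (b ! l) c) \<and> (\<forall>l<N. \<mu> (b ! (N + l)) c))"
  have "qpow W N (\<lambda>b. P b \<and> length b = N)"
    using PN qpow_length[OF W(1)] by (rule uq_conjI[OF q])
  then have "qpow W N (\<lambda>b. qpow W N (\<lambda>b'. D (b @ b')))"
  proof (rule uq_mono[OF q], elim conjE)
    fix b assume "P b" and len: "length b = N"
    then obtain c where c: "c \<in> Z" "W (\<lambda>y. \<mu> y c)" "\<forall>l<N. \<not> \<mu> (b ! l) c" by (auto simp: P_def)
    show "qpow W N (\<lambda>b'. D (b @ b'))"
      using qpow_all[OF W(1) c(2), of N] by (rule uq_mono[OF q])
        (use c len in \<open>auto simp: D_def nth_append\<close>)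
  qed
  then have D2: "qpow W (N + N) D" by (simp add: qpow_add[OF W(1)])
  have window: "qpow W N (\<lambda>b. \<exists>c\<in>Z. \<forall>l<N. \<mu> (b ! l) c \<longleftrightarrow> i \<le> l)" (is "qpow W N ?R") if i: "i \<in> {..<N}" for i
  proof -
    have sum: "N + N = (N - i) + (N + i)" using i by auto
    have "qpow W (N - i) (\<lambda>u. qpow W N (\<lambda>b. qpow W i (\<lambda>v. D (u @ b @ v))))"
      using D2 unfolding sum by (simp add: qpow_add[OF W(1)])
    with qpow_length[OF W(1)]
    have "qpow W (N - i) (\<lambda>u. length u = N - i \<and> qpow W N (\<lambda>b. qpow W i (\<lambda>v. D (u @ b @ v))))"
      by (rule uq_conjI[OF q])
    then obtain u where u: "length u = N - i" "qpow W N (\<lambda>b. qpow W i (\<lambda>v. D (u @ b @ v)))"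
      using uq_ex[OF q] by blast
    have "qpow W N (\<lambda>b. length b = N \<and> qpow W i (\<lambda>v. D (u @ b @ v)))"
      using qpow_length[OF W(1)] u(2) by (rule uq_conjI[OF q])
    then show ?thesis
    proof (rule uq_mono[OF q], elim conjE)
      fix b assume len: "length b = N" and "qpow W i (\<lambda>v. D (u @ b @ v))"
      then obtain v where "D (u @ b @ v)" using uq_ex[OF q] by blast
      then obtain c where c: "c \<in> Z" "\<forall>l<N. \<not> \<mu> ((u @ b @ v) ! l) c"
        "\<forall>l<N. \<mu> ((u @ b @ v) ! (N + l)) c"
        by (auto simp: D_def)
      have nth: "(u @ b @ v) ! (N - i + l) = b ! l" if "l < N" for l
        using that u(1) len by (simp add: nth_append)
      have "\<mu> (b ! l) c \<longleftrightarrow> i \<le> l" if l: "l < N" for l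
      proof (cases "i \<le> l")
        case True
        then have "N - i + l = N + (l - i)" "l - i < N" using i l by auto
        then show ?thesis using c(3) nth[OF l] True by metis
      next
        case False
        then have "N - i + l < N" using i by auto
        then show ?thesis using c(2) nth[OF l] False by metis
      qed
      then show "?R b" using c(1) by blast
    qed
  qed
  have "qpow W N (\<lambda>b. \<forall>i\<in>{..<N}. \<exists>c\<in>Z. \<forall>l<N. \<mu> (b ! l) c \<longleftrightarrow> i \<le> l)"
    using window by (simp add: uq_ball[OF _ q])
  then have "qpow W N (\<lambda>b. (\<forall>l<N. Y (b ! l)) \<and> (\<forall>i\<in>{..<N}. \<exists>c\<in>Z. \<forall>l<N. \<mu> (b ! l) c \<longleftrightarrow> i \<le> l))"
    by (rule uq_conjI[OF q, OF qpow_all[OF W]])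
  then obtain b where b: "\<forall>l<N. Y (b ! l)" "\<forall>i\<in>{..<N}. \<exists>c\<in>Z. \<forall>l<N. \<mu> (b ! l) c \<longleftrightarrow> i \<le> l"
    using uq_ex[OF q] by blast
  obtain c where c: "\<And>i. i < N \<Longrightarrow> c i \<in> Z" "\<And>i l. i < N \<Longrightarrow> l < N \<Longrightarrow> \<mu> (b ! l) (c i) \<longleftrightarrow> i \<le> l"
    using b(2) by (metis lessThan_iff)
  have "ladder (\<lambda>y z. \<not> \<mu> y z) N ((!) b) c" using c(2) by (auto simp: ladder_def)
  then show False using noladder_rev[OF nl] b(1) c(1) by blast
qed

text \<open>
  Two ultrafilters commute on a relation without long ladders: alternating realizations of
  the two quantifiers in the opposite orders would build a ladder.
\<close>

lemma uq_commute:
  assumes W: "uq W" "W Y" and Q: "uq Q" "Q X" and nl: "noladder \<mu> N Y Z" and XZ: "\<And>x. X x \<Longrightarrow> x \<in> Z"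
    and wq: "W (\<lambda>y. Q (\<lambda>x. \<mu> y x))"
  shows "Q (\<lambda>x. W (\<lambda>y. \<mu> y x))"
proof (rule ccontr)
  assume "\<not> ?thesis"
  then have qw: "Q (\<lambda>x. W (\<lambda>y. \<not> \<mu> y x))" by (simp add: uq_not[OF W(1)] uq_not[OF Q(1)])
  have "\<exists>b a. (\<forall>i<k. Y (b i) \<and> X (a i) \<and> Q (\<lambda>x. \<mu> (b i) x) \<and> W (\<lambda>y. \<not> \<mu> y (a i))) \<and>
      (\<forall>i<k. \<forall>l<k. \<mu> (b i) (a l) \<longleftrightarrow> i \<le> l)" for k :: nat
  proof (induction k)
    case (Suc k)
    then obtain b a where ih: "\<forall>i<k. Y (b i) \<and> X (a i) \<and> Q (\<lambda>x. \<mu> (b i) x) \<and> W (\<lambda>y. \<not> \<mu> y (a i))"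
      "\<forall>i<k. \<forall>l<k. \<mu> (b i) (a l) \<longleftrightarrow> i \<le> l" by blast
    have "W (\<lambda>y. \<forall>i\<in>{..<k}. \<not> \<mu> y (a i))" using ih by (simp add: uq_ball[OF _ W(1)])
    then have "W (\<lambda>y. Y y \<and> Q (\<lambda>x. \<mu> y x) \<and> (\<forall>i\<in>{..<k}. \<not> \<mu> y (a i)))"
      using W(2) wq by (simp add: uq_conj[OF W(1)])
    then obtain y where y: "Y y" "Q (\<lambda>x. \<mu> y x)" "\<forall>i\<in>{..<k}. \<not> \<mu> y (a i)" using uq_ex[OF W(1)] by blast
    have "Q (\<lambda>x. \<forall>i\<in>{..<k}. \<mu> (b i) x)" using ih by (simp add: uq_ball[OF _ Q(1)])
    then have "Q (\<lambda>x. X x \<and> W (\<lambda>y. \<not> \<mu> y x) \<and> \<mu> y x \<and> (\<forall>i\<in>{..<k}. \<mu> (b i) x))"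
      using Q(2) qw y by (simp add: uq_conj[OF Q(1)])
    then obtain x where x: "X x" "W (\<lambda>y. \<not> \<mu> y x)" "\<mu> y x" "\<forall>i\<in>{..<k}. \<mu> (b i) x"
      using uq_ex[OF Q(1)] by blast
    show ?case
      by (rule exI[of _ "b(k := y)"], rule exI[of _ "a(k := x)"])
        (use ih x y in \<open>auto simp: less_Suc_eq\<close>)
  qed simp
  from this[of N] obtain b a where ba: "\<forall>i<N. Y (b i)" "\<forall>i<N. X (a i)"
    "\<forall>i<N. \<forall>l<N. \<mu> (b i) (a l) \<longleftrightarrow> i \<le> l" by blast
  then have "ladder \<mu> N b a" by (auto simp: ladder_def)
  then show False using nl ba XZ unfolding noladder_def by blast
qed

section \<open>Binary trees\<close>

text \<open>
  \<open>tree \<mu> Z r X\<close> says that Shelah's rank of \<open>X\<close> with respect to splitting by instances of \<open>\<mu>\<close>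
  with parameters in \<open>Z\<close> is at least \<open>r\<close>.
\<close>

fun tree :: "('x \<Rightarrow> 'z \<Rightarrow> bool) \<Rightarrow> 'z set \<Rightarrow> nat \<Rightarrow> ('x \<Rightarrow> bool) \<Rightarrow> bool" where
  "tree \<mu> Z 0 X = (\<exists>x. X x)"
| "tree \<mu> Z (Suc r) X = (\<exists>c\<in>Z. tree \<mu> Z r (\<lambda>x. X x \<and> \<mu> x c) \<and> tree \<mu> Z r (\<lambda>x. X x \<and> \<not> \<mu> x c))"

lemma tree_mono: "tree \<mu> Z r X \<Longrightarrow> (\<And>x. X x \<Longrightarrow> X' x) \<Longrightarrow> Z \<subseteq> Z' \<Longrightarrow> tree \<mu> Z' r X'"
proof (induction r arbitrary: X X')
  case (Suc r)
  then obtain c where c: "c \<in> Z" "tree \<mu> Z r (\<lambda>x. X x \<and> \<mu> x c)" "tree \<mu> Z r (\<lambda>x. X x \<and> \<not> \<mu> x c)" by auto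
  have "tree \<mu> Z' r (\<lambda>x. X' x \<and> \<mu> x c)" by (rule Suc.IH[OF c(2)]) (use Suc.prems in auto)
  moreover have "tree \<mu> Z' r (\<lambda>x. X' x \<and> \<not> \<mu> x c)" by (rule Suc.IH[OF c(3)]) (use Suc.prems in auto)
  ultimately show ?case using c(1) Suc.prems(3) by auto
qed auto

lemma tree_nonempty: "tree \<mu> Z r X \<Longrightarrow> \<exists>x. X x"
proof (induction r arbitrary: X)
  case (Suc r)
  then obtain c where "tree \<mu> Z r (\<lambda>x. X x \<and> \<mu> x c)" by auto
  from Suc.IH[OF this] show ?case by blast
qed simp

lemma tree_Suc_D: "tree \<mu> Z (Suc r) X \<Longrightarrow> tree \<mu> Z r X"
  by (auto intro: tree_mono)

lemma tree_le: "tree \<mu> Z r X \<Longrightarrow> r' \<le> r \<Longrightarrow> tree \<mu> Z r' X"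
  by (induction r) (auto simp: le_Suc_eq dest: tree_Suc_D simp del: tree.simps)

text \<open>A two-coloring of the nodes of a tall tree has a fairly tall monochromatic subtree.\<close>

lemma tree_partition:
  "tree \<mu> (Z1 \<union> Z2) (h + k) X \<Longrightarrow> tree \<mu> Z1 h X \<or> tree \<mu> Z2 k X"
proof (induction "h + k" arbitrary: h k X)
  case 0
  then show ?case by simp
next
  case (Suc r)
  show ?case
  proof (cases "h = 0 \<or> k = 0")
    case True
    then show ?thesis using tree_nonempty[OF Suc.prems] by auto
  next
    case False
    then obtain h' k' where hk: "h = Suc h'" "k = Suc k'" by (meson not0_implies_Suc)
    have r: "r = h' + k" "r = h + k'" using Suc.hyps(2) hk by auto
    have "tree \<mu> (Z1 \<union> Z2) (Suc r) X" using Suc.prems Suc.hyps(2) by simp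
    then obtain c where c: "c \<in> Z1 \<union> Z2" "tree \<mu> (Z1 \<union> Z2) r (\<lambda>x. X x \<and> \<mu> x c)"
      "tree \<mu> (Z1 \<union> Z2) r (\<lambda>x. X x \<and> \<not> \<mu> x c)" by auto
    show ?thesis
    proof (cases "c \<in> Z1")
      case True
      have "tree \<mu> Z1 h' (\<lambda>x. X x \<and> \<mu> x c) \<or> tree \<mu> Z2 k (\<lambda>x. X x \<and> \<mu> x c)"
        "tree \<mu> Z1 h' (\<lambda>x. X x \<and> \<not> \<mu> x c) \<or> tree \<mu> Z2 k (\<lambda>x. X x \<and> \<not> \<mu> x c)"
        using Suc.hyps(1)[OF r(1)] c(2,3) r(1) by blast+
      then show ?thesis
        using True tree_mono[of \<mu> Z2 k _ X Z2] unfolding hk(1) tree.simps(2) by blast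
    next
      case False
      then have "c \<in> Z2" using c(1) by auto
      moreover have "tree \<mu> Z1 h (\<lambda>x. X x \<and> \<mu> x c) \<or> tree \<mu> Z2 k' (\<lambda>x. X x \<and> \<mu> x c)"
        "tree \<mu> Z1 h (\<lambda>x. X x \<and> \<not> \<mu> x c) \<or> tree \<mu> Z2 k' (\<lambda>x. X x \<and> \<not> \<mu> x c)"
        using Suc.hyps(1)[OF r(2)] c(2,3) r(2) by blast+
      ultimately show ?thesis
        using tree_mono[of \<mu> Z1 h _ X Z1] unfolding hk(2) tree.simps(2) by blast
    qed
  qed
qed

text \<open>
  Going down the tree, an element \<open>x\<close> is fixed and the remaining nodes are colored
  by whether \<open>x\<close> satisfies them; the root of the monochromatic subtree then sends the rest of
  the tree to the side opposite to \<open>x\<close>.  The two colors contribute to a ladder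
  and to a ladder of the negation.
\<close>

lemma tree_ladders:
  "tree \<mu> Z (4 ^ (a + b)) X \<Longrightarrow>
    (\<exists>x c. (\<forall>i<a. X (x i) \<and> c i \<in> Z) \<and> ladder \<mu> a x c) \<or>
    (\<exists>x c. (\<forall>i<b. X (x i) \<and> c i \<in> Z) \<and> ladder (\<lambda>x c. \<not> \<mu> x c) b x c)"
proof (induction "a + b" arbitrary: a b X Z)
  case 0
  then show ?case by (auto simp: ladder_def)
next
  case (Suc r)
  have step: "\<exists>x' c'. (\<forall>i<Suc a'. X (x' i) \<and> c' i \<in> Z) \<and> ladder \<nu> (Suc a') x' c'"
    if x: "X x0" "c0 \<in> Z"
      and ih: "\<exists>x c. (\<forall>i<a'. (X (x i) \<and> \<not> \<nu> (x i) c0) \<and> c i \<in> {c\<in>Z. \<nu> x0 c}) \<and> ladder \<nu> a' x c"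
    for \<nu> :: "'a \<Rightarrow> 'b \<Rightarrow> bool" and x0 c0 a'
  proof -
    from ih obtain x c where "\<forall>i<a'. (X (x i) \<and> \<not> \<nu> (x i) c0) \<and> c i \<in> {c\<in>Z. \<nu> x0 c}" "ladder \<nu> a' x c"
      by blast
    with x show ?thesis
      by (intro exI[of _ "case_nat x0 x"] exI[of _ "case_nat c0 c"])
        (auto simp: ladder_def split: nat.split)
  qed
  have keep: "\<exists>x' c'. (\<forall>i<a'. X (x' i) \<and> c' i \<in> Z) \<and> ladder \<nu> a' x' c'"
    if "\<exists>x c. (\<forall>i<a'. (X (x i) \<and> R (x i)) \<and> c i \<in> {c\<in>Z. T c}) \<and> ladder \<nu> a' x c"
    for \<nu> :: "'a \<Rightarrow> 'b \<Rightarrow> bool" and a' R T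
    using that by blast
  show ?case
  proof (cases "a = 0 \<or> b = 0")
    case True
    then show ?thesis by (auto simp: ladder_def)
  next
    case False
    then obtain a' b' where ab: "a = Suc a'" "b = Suc b'" by (meson not0_implies_Suc)
    have r: "r = a' + b" "r = a + b'" using Suc.hyps(2) ab by auto
    obtain x0 where x0: "X x0" using tree_nonempty[OF Suc.prems] by blast
    have "(4::nat) ^ (a + b) = 4 * 4 ^ r" "(1::nat) \<le> 4 ^ r" using Suc.hyps(2)[symmetric] by simp_all
    then have "Suc (4 ^ r) + Suc (4 ^ r) \<le> (4::nat) ^ (a + b)" by linarith
    then have "tree \<mu> Z (Suc (4 ^ r) + Suc (4 ^ r)) X" using Suc.prems tree_le by blast
    moreover have "{c\<in>Z. \<mu> x0 c} \<union> {c\<in>Z. \<not> \<mu> x0 c} = Z" by auto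
    ultimately have "tree \<mu> {c\<in>Z. \<mu> x0 c} (Suc (4 ^ r)) X \<or> tree \<mu> {c\<in>Z. \<not> \<mu> x0 c} (Suc (4 ^ r)) X"
      using tree_partition[of \<mu> "{c\<in>Z. \<mu> x0 c}" "{c\<in>Z. \<not> \<mu> x0 c}" "Suc (4 ^ r)" "Suc (4 ^ r)" X] by simp
    then show ?thesis
    proof
      assume "tree \<mu> {c\<in>Z. \<mu> x0 c} (Suc (4 ^ r)) X"
      then obtain c0 where c0: "c0 \<in> Z" "tree \<mu> {c\<in>Z. \<mu> x0 c} (4 ^ r) (\<lambda>x. X x \<and> \<not> \<mu> x c0)" by auto
      have "(\<exists>x c. (\<forall>i<a'. (X (x i) \<and> \<not> \<mu> (x i) c0) \<and> c i \<in> {c\<in>Z. \<mu> x0 c}) \<and> ladder \<mu> a' x c) \<or>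
        (\<exists>x c. (\<forall>i<b. (X (x i) \<and> \<not> \<mu> (x i) c0) \<and> c i \<in> {c\<in>Z. \<mu> x0 c}) \<and> ladder (\<lambda>x c. \<not> \<mu> x c) b x c)"
        by (rule Suc.hyps(1)[OF r(1)]) (use c0(2) r(1) in simp)
      then show ?thesis
        using step[OF x0 c0(1), of a' \<mu>] keep[of b "\<lambda>x. \<not> \<mu> x c0" "\<lambda>c. \<mu> x0 c" "\<lambda>x c. \<not> \<mu> x c"]
        unfolding ab(1) by blast
    next
      assume "tree \<mu> {c\<in>Z. \<not> \<mu> x0 c} (Suc (4 ^ r)) X"
      then obtain c0 where c0: "c0 \<in> Z" "tree \<mu> {c\<in>Z. \<not> \<mu> x0 c} (4 ^ r) (\<lambda>x. X x \<and> \<mu> x c0)" by auto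
      have "(\<exists>x c. (\<forall>i<a. (X (x i) \<and> \<mu> (x i) c0) \<and> c i \<in> {c\<in>Z. \<not> \<mu> x0 c}) \<and> ladder \<mu> a x c) \<or>
        (\<exists>x c. (\<forall>i<b'. (X (x i) \<and> \<mu> (x i) c0) \<and> c i \<in> {c\<in>Z. \<not> \<mu> x0 c}) \<and> ladder (\<lambda>x c. \<not> \<mu> x c) b' x c)"
        by (rule Suc.hyps(1)[OF r(2)]) (use c0(2) r(2) in simp)
      then show ?thesis
        using step[OF x0 c0(1), of b' "\<lambda>x c. \<not> \<mu> x c"] keep[of a "\<lambda>x. \<mu> x c0" "\<lambda>c. \<not> \<mu> x0 c" \<mu>]
        unfolding ab(2) by simp blast
    qed
  qed
qed

lemma noladder_no_tree:
  assumes "noladder \<mu> N X Z"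
  shows "\<not> tree \<mu> Z (4 ^ (N + N)) X"
proof
  assume "tree \<mu> Z (4 ^ (N + N)) X"
  from tree_ladders[OF this] show False
  proof
    assume "\<exists>x c. (\<forall>i<N. X (x i) \<and> c i \<in> Z) \<and> ladder \<mu> N x c"
    then have "\<exists>x c. (\<forall>i<N. X (x i)) \<and> (\<forall>i<N. c i \<in> Z) \<and> ladder \<mu> N x c" by auto
    then show False using assms unfolding noladder_def by simp
  next
    assume "\<exists>x c. (\<forall>i<N. X (x i) \<and> c i \<in> Z) \<and> ladder (\<lambda>x c. \<not> \<mu> x c) N x c"
    then obtain x c where "\<forall>i<N. X (x i)" "\<forall>i<N. c i \<in> Z" "ladder (\<lambda>x c. \<not> \<mu> x c) N x c" by auto
    then show False using noladder_rev[OF assms] by simp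
  qed
qed

section \<open>Definable relations\<close>

lemma finite_fv_tm: "finite (fv_tm t)"
  by (induction t) auto

lemma finite_fv: "finite (fv \<phi>)"
  by (induction \<phi>) (auto simp: finite_fv_tm)

lemma rename_tm: "\<exists>t'. (wf_tm L t \<longrightarrow> wf_tm L t') \<and> fv_tm t' \<subseteq> f ` fv_tm t \<and> (\<forall>e. eval M e t' = eval M (\<lambda>i. e (f i)) t)"
proof (induction t)
  case (Var x)
  then show ?case by (intro exI[of _ "Var (f x)"]) simp
next
  case (Fun g ts)
  then have "\<forall>t\<in>set ts. \<exists>t'. (wf_tm L t \<longrightarrow> wf_tm L t') \<and> fv_tm t' \<subseteq> f ` fv_tm t \<and> (\<forall>e. eval M e t' = eval M (\<lambda>i. e (f i)) t)"
    by blast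
  from bchoice[OF this] obtain h where h: "\<forall>t\<in>set ts. (wf_tm L t \<longrightarrow> wf_tm L (h t)) \<and>
    fv_tm (h t) \<subseteq> f ` fv_tm t \<and> (\<forall>e. eval M e (h t) = eval M (\<lambda>i. e (f i)) t)" ..
  have "map (eval M e) (map h ts) = map (eval M (\<lambda>i. e (f i))) ts" for e using h by simp
  then have "\<forall>e. eval M e (Fun g (map h ts)) = eval M (\<lambda>i. e (f i)) (Fun g ts)" by (simp only: eval.simps simp_thms)
  moreover have "wf_tm L (Fun g ts) \<longrightarrow> wf_tm L (Fun g (map h ts))" using h by auto
  moreover have "fv_tm (Fun g (map h ts)) \<subseteq> f ` fv_tm (Fun g ts)"
    using h by (simp add: image_UN) blast
  ultimately show ?case by blast
qed

lemma rename_tms: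
  "\<exists>ts'. length ts' = length ts \<and> ((\<forall>t\<in>set ts. wf_tm L t) \<longrightarrow> (\<forall>t\<in>set ts'. wf_tm L t)) \<and>
     (\<Union>t\<in>set ts'. fv_tm t) \<subseteq> f ` (\<Union>t\<in>set ts. fv_tm t) \<and>
     (\<forall>e. map (eval M e) ts' = map (eval M (\<lambda>i. e (f i))) ts)"
proof (induction ts)
  case (Cons t ts)
  then obtain ts' where ts': "length ts' = length ts" "(\<forall>t\<in>set ts. wf_tm L t) \<longrightarrow> (\<forall>t\<in>set ts'. wf_tm L t)"
     "(\<Union>t\<in>set ts'. fv_tm t) \<subseteq> f ` (\<Union>t\<in>set ts. fv_tm t)"
     "\<forall>e. map (eval M e) ts' = map (eval M (\<lambda>i. e (f i))) ts" by blast
  obtain t' where t': "wf_tm L t \<longrightarrow> wf_tm L t'" "fv_tm t' \<subseteq> f ` fv_tm t" "\<forall>e. eval M e t' = eval M (\<lambda>i. e (f i)) t"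
    using rename_tm by blast
  show ?case
    by (rule exI[of _ "t' # ts'"]) (use t' ts' in \<open>auto simp: image_Un\<close>)
qed simp

text \<open>
  Renaming of free variables; a bound variable is first replaced by one that does not occur.
\<close>

lemma rename_fm:
  "wf_fm L \<phi> \<Longrightarrow> \<exists>\<phi>'. wf_fm L \<phi>' \<and> fv \<phi>' \<subseteq> f ` fv \<phi> \<and> (\<forall>e. sat M e \<phi>' = sat M (\<lambda>i. e (f i)) \<phi>)"
proof (induction \<phi> arbitrary: f)
  case (Eq s t)
  obtain s' where s': "wf_tm L s \<longrightarrow> wf_tm L s'" "fv_tm s' \<subseteq> f ` fv_tm s" "\<forall>e. eval M e s' = eval M (\<lambda>i. e (f i)) s"
    using rename_tm by blast
  obtain t' where t': "wf_tm L t \<longrightarrow> wf_tm L t'" "fv_tm t' \<subseteq> f ` fv_tm t" "\<forall>e. eval M e t' = eval M (\<lambda>i. e (f i)) t"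
    using rename_tm by blast
  show ?case using s' t' Eq by (intro exI[of _ "Eq s' t'"]) auto
next
  case (Rel r ts)
  obtain ts' where ts': "length ts' = length ts" "(\<forall>t\<in>set ts. wf_tm L t) \<longrightarrow> (\<forall>t\<in>set ts'. wf_tm L t)"
     "(\<Union>t\<in>set ts'. fv_tm t) \<subseteq> f ` (\<Union>t\<in>set ts. fv_tm t)"
     "\<forall>e. map (eval M e) ts' = map (eval M (\<lambda>i. e (f i))) ts" using rename_tms by blast
  then show ?case using Rel by (intro exI[of _ "Rel r ts'"]) simp
next
  case (Neg \<phi>)
  then obtain \<phi>' where "wf_fm L \<phi>'" "fv \<phi>' \<subseteq> f ` fv \<phi>" "\<forall>e. sat M e \<phi>' = sat M (\<lambda>i. e (f i)) \<phi>"
    by (metis wf_fm.simps(3))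
  then show ?case by (intro exI[of _ "Neg \<phi>'"]) auto
next
  case (Conj \<phi> \<psi>)
  then obtain \<phi>' \<psi>' where "wf_fm L \<phi>'" "fv \<phi>' \<subseteq> f ` fv \<phi>" "\<forall>e. sat M e \<phi>' = sat M (\<lambda>i. e (f i)) \<phi>"
    "wf_fm L \<psi>'" "fv \<psi>' \<subseteq> f ` fv \<psi>" "\<forall>e. sat M e \<psi>' = sat M (\<lambda>i. e (f i)) \<psi>"
    by (metis wf_fm.simps(4))
  then show ?case by (intro exI[of _ "Conj \<phi>' \<psi>'"]) auto
next
  case (Ex x \<phi>)
  obtain z where z: "z \<notin> f ` fv \<phi>" using finite_fv ex_new_if_finite[OF infinite_UNIV_nat] by (metis finite_imageI)
  define g where "g = f(x := z)"
  obtain \<phi>' where p: "wf_fm L \<phi>'" "fv \<phi>' \<subseteq> g ` fv \<phi>" "\<forall>e. sat M e \<phi>' = sat M (\<lambda>i. e (g i)) \<phi>"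
    using Ex.IH[of g] Ex.prems by auto
  have "sat M (e(z := a)) \<phi>' = sat M ((\<lambda>i. e (f i))(x := a)) \<phi>" for e a
    unfolding p(3)[rule_format]
    by (rule sat_cong) (use z in \<open>auto simp: g_def image_iff\<close>)
  moreover have "fv \<phi>' - {z} \<subseteq> f ` (fv \<phi> - {x})"
    using p(2) by (auto simp: g_def image_iff split: if_splits)
  ultimately show ?case using p(1) by (intro exI[of _ "Ex z \<phi>'"]) auto
qed

primrec exs :: "nat \<Rightarrow> ('f, 'r) fm \<Rightarrow> ('f, 'r) fm" where
  "exs 0 \<phi> = \<phi>"
| "exs (Suc m) \<phi> = exs m (Ex m \<phi>)"

lemma wf_exs: "wf_fm L (exs m \<phi>) = wf_fm L \<phi>"
  by (induction m arbitrary: \<phi>) auto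

lemma fv_exs: "fv (exs m \<phi>) = fv \<phi> - {..<m}"
  by (induction m arbitrary: \<phi>) (auto simp: less_Suc_eq)

lemma tuples_Suc_snoc: "c \<in> tuples A (Suc m) \<longleftrightarrow> (\<exists>a\<in>tuples A m. \<exists>x\<in>A. c = a @ [x])"
proof
  assume c: "c \<in> tuples A (Suc m)"
  then have "length c = Suc m" by (simp add: tuples_def)
  moreover from this have "c = butlast c @ [last c]" by (metis append_butlast_last_id list.size(3) nat.distinct(1))
  moreover from this have "set (butlast c) \<subseteq> set c" "last c \<in> set c"
    by (meson in_set_butlastD subsetI) (metis last_in_set list.size(3) nat.distinct(1) \<open>length c = Suc m\<close>)
  ultimately show "\<exists>a\<in>tuples A m. \<exists>x\<in>A. c = a @ [x]"
    using c by (intro bexI[of _ "butlast c"] bexI[of _ "last c"]) (auto simp: tuples_def)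
qed (auto simp: tuples_def)

lemma bex_tuples_Suc: "(\<exists>a\<in>tuples A (Suc m). Q a) \<longleftrightarrow> (\<exists>a\<in>tuples A m. \<exists>x\<in>A. Q (a @ [x]))"
  by (metis tuples_Suc_snoc)

lemma sat_exs: "sat M e (exs m \<phi>) \<longleftrightarrow> (\<exists>a\<in>tuples (universe M) m. sat M (\<lambda>i. if i < m then a ! i else e i) \<phi>)"
proof (induction m arbitrary: \<phi>)
  case 0
  have "tuples (universe M) 0 = {[]}" by (auto simp: tuples_def)
  then show ?case by simp
next
  case (Suc m)
  have "sat M ((\<lambda>i. if i < m then a ! i else e i)(m := x)) \<phi> =
      sat M (\<lambda>i. if i < Suc m then (a @ [x]) ! i else e i) \<phi>" if "a \<in> tuples (universe M) m" for a x
  proof (rule sat_cong)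
    fix i
    show "((\<lambda>i. if i < m then a ! i else e i)(m := x)) i = (if i < Suc m then (a @ [x]) ! i else e i)"
      using that by (auto simp: tuples_def nth_append)
  qed
  then have *: "(\<exists>x\<in>universe M. sat M ((\<lambda>i. if i < m then a ! i else e i)(m := x)) \<phi>) \<longleftrightarrow>
      (\<exists>x\<in>universe M. sat M (\<lambda>i. if i < Suc m then (a @ [x]) ! i else e i) \<phi>)" if "a \<in> tuples (universe M) m" for a
    using that by simp
  have "sat M e (exs (Suc m) \<phi>) \<longleftrightarrow> (\<exists>a\<in>tuples (universe M) m. \<exists>x\<in>universe M.
      sat M (\<lambda>i. if i < Suc m then (a @ [x]) ! i else e i) \<phi>)"
    using * by (simp add: Suc.IH cong: bex_cong)
  also have "\<dots> \<longleftrightarrow> (\<exists>a\<in>tuples (universe M) (Suc m). sat M (\<lambda>i. if i < Suc m then a ! i else e i) \<phi>)"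
    by (rule bex_tuples_Suc[symmetric])
  finally show ?case .
qed

text \<open>
  An atom is a parameter or an entry of a tuple of variables.  An environment assigns to the
  variable \<open>v\<close> a tuple of length \<open>ar v\<close>, so that the quantifiers below range
  over tuples.
\<close>

type_synonym ('a, 'v) atom = "'a + 'v \<times> nat"

definition val :: "('v \<Rightarrow> 'a list) \<Rightarrow> ('a, 'v) atom \<Rightarrow> 'a" where
  "val E t = (case t of Inl a \<Rightarrow> a | Inr (v, k) \<Rightarrow> E v ! k)"

lemma val_simps [simp]: "val E (Inl a) = a" "val E (Inr (v, k)) = E v ! k"
  by (simp_all add: val_def)

definition atoms :: "('v \<Rightarrow> nat) \<Rightarrow> 'a set \<Rightarrow> 'v set \<Rightarrow> ('a, 'v) atom set" where
  "atoms ar C J = Inl ` C \<union> {Inr (v, k) | v k. v \<in> J \<and> k < ar v}"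

lemma atoms_mono: "C \<subseteq> C' \<Longrightarrow> J \<subseteq> J' \<Longrightarrow> atoms ar C J \<subseteq> atoms ar C' J'"
  by (auto simp: atoms_def)

lemma atoms_iff [simp]: "Inl a \<in> atoms ar C J \<longleftrightarrow> a \<in> C" "Inr (v, k) \<in> atoms ar C J \<longleftrightarrow> v \<in> J \<and> k < ar v"
  by (auto simp: atoms_def)

locale fo_structure =
  fixes L :: "('f, 'r) language" and M :: "('f, 'r, 'a) struct"
  assumes struct: "is_struct L M"
begin

abbreviation U where "U \<equiv> universe M"
abbreviation tup where "tup m \<equiv> tuples (universe M) m"

lemma U_nonempty: "U \<noteq> {}"
  using struct by (simp add: is_struct_def)

definition envs :: "('v \<Rightarrow> nat) \<Rightarrow> ('v \<Rightarrow> 'a list) set" where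
  "envs ar = {E. \<forall>v. E v \<in> tup (ar v)}"

lemma envs_nonempty: "envs ar \<noteq> {}"
proof -
  obtain u where "u \<in> U" using U_nonempty by blast
  then have "(\<lambda>v. replicate (ar v) u) \<in> envs ar" by (auto simp: envs_def tuples_def)
  then show ?thesis by blast
qed

lemma envs_upd: "E \<in> envs ar \<Longrightarrow> a \<in> tup (ar v) \<Longrightarrow> E(v := a) \<in> envs ar"
  by (simp add: envs_def)

lemma envs_length: "E \<in> envs ar \<Longrightarrow> length (E v) = ar v"
  by (simp add: envs_def tuples_def)

lemma envs_tup: "E \<in> envs ar \<Longrightarrow> E v \<in> tup (ar v)"
  by (simp add: envs_def)

text \<open>
  Definability is a property of HOL predicates on environments, closed under the operations below, so
  that definable sets can be handled without writing down formulas.  The set \<open>J\<close> of variables may be infinite, as compactness requires, although a formula mentions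
  finitely many.
\<close>

definition dfn :: "('v \<Rightarrow> nat) \<Rightarrow> 'a set \<Rightarrow> 'v set \<Rightarrow> (('v \<Rightarrow> 'a list) \<Rightarrow> bool) \<Rightarrow> bool" where
  "dfn ar C J P \<longleftrightarrow> (\<exists>\<phi> w. wf_fm L \<phi> \<and> (\<forall>i\<in>fv \<phi>. w i \<in> atoms ar C J) \<and>
     (\<forall>E\<in>envs ar. P E \<longleftrightarrow> sat M (\<lambda>i. val E (w i)) \<phi>))"

lemma dfnI: "wf_fm L \<phi> \<Longrightarrow> (\<And>i. i \<in> fv \<phi> \<Longrightarrow> w i \<in> atoms ar C J) \<Longrightarrow>
    (\<And>E. E \<in> envs ar \<Longrightarrow> P E \<longleftrightarrow> sat M (\<lambda>i. val E (w i)) \<phi>) \<Longrightarrow> dfn ar C J P"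
  unfolding dfn_def by blast

lemma dfnE:
  assumes "dfn ar C J P"
  obtains \<phi> w where "wf_fm L \<phi>" "\<And>i. i \<in> fv \<phi> \<Longrightarrow> w i \<in> atoms ar C J"
    "\<And>E. E \<in> envs ar \<Longrightarrow> P E \<longleftrightarrow> sat M (\<lambda>i. val E (w i)) \<phi>"
  using assms unfolding dfn_def by blast

lemma dfn_mono: "dfn ar C J P \<Longrightarrow> C \<subseteq> C' \<Longrightarrow> J \<subseteq> J' \<Longrightarrow> dfn ar C' J' P"
  using atoms_mono[of C C' J J' ar] by (elim dfnE) (rule dfnI, blast+)

lemma dfn_cong: "dfn ar C J P \<Longrightarrow> (\<And>E. E \<in> envs ar \<Longrightarrow> R E = P E) \<Longrightarrow> dfn ar C J R"
  by (elim dfnE) (rule dfnI, auto)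

lemma val_agree:
  assumes "t \<in> atoms ar C J" and "\<And>v. v \<in> J \<Longrightarrow> E v = E' v"
  shows "val E t = val E' t"
  using assms by (cases t) (auto simp: atoms_def)

lemma dfn_agree:
  assumes "dfn ar C J P" and E: "E \<in> envs ar" "E' \<in> envs ar" "\<And>v. v \<in> J \<Longrightarrow> E v = E' v"
  shows "P E = P E'"
proof -
  obtain \<phi> w where w: "wf_fm L \<phi>" "\<And>i. i \<in> fv \<phi> \<Longrightarrow> w i \<in> atoms ar C J"
    "\<And>E. E \<in> envs ar \<Longrightarrow> P E \<longleftrightarrow> sat M (\<lambda>i. val E (w i)) \<phi>" using assms(1) unfolding dfn_def by blast
  have "sat M (\<lambda>i. val E (w i)) \<phi> = sat M (\<lambda>i. val E' (w i)) \<phi>"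
    by (rule sat_cong) (use w(2) E(3) val_agree in blast)
  then show ?thesis using w(3) E by simp
qed

lemma dfn_finite_support:
  assumes "dfn ar C J P"
  shows "\<exists>C0 J0. finite C0 \<and> C0 \<subseteq> C \<and> finite J0 \<and> J0 \<subseteq> J \<and> dfn ar C0 J0 P"
proof -
  obtain \<phi> w where w: "wf_fm L \<phi>" "\<And>i. i \<in> fv \<phi> \<Longrightarrow> w i \<in> atoms ar C J"
    "\<And>E. E \<in> envs ar \<Longrightarrow> P E \<longleftrightarrow> sat M (\<lambda>i. val E (w i)) \<phi>" using assms unfolding dfn_def by blast
  define C0 where "C0 = {a. Inl a \<in> w ` fv \<phi>}"
  define J0 where "J0 = {v. \<exists>k. Inr (v, k) \<in> w ` fv \<phi>}"
  have fin: "finite (w ` fv \<phi>)" by (simp add: finite_fv)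
  have "Inl ` C0 \<subseteq> w ` fv \<phi>" by (auto simp: C0_def)
  then have "finite C0" using fin finite_subset finite_imageD inj_Inl by metis
  moreover have "J0 \<subseteq> (\<lambda>t. fst (projr t)) ` w ` fv \<phi>"
    unfolding J0_def by (auto simp: image_iff) (metis fst_conv sum.sel(2))
  then have "finite J0" using fin finite_subset by blast
  moreover have "C0 \<subseteq> C"
  proof
    fix a assume "a \<in> C0"
    then obtain i where "i \<in> fv \<phi>" "Inl a = w i" by (auto simp: C0_def)
    then show "a \<in> C" using w(2)[of i] by (metis atoms_iff(1))
  qed
  moreover have "J0 \<subseteq> J"
  proof
    fix v assume "v \<in> J0"
    then obtain i k where "i \<in> fv \<phi>" "Inr (v, k) = w i" by (auto simp: J0_def)
    then show "v \<in> J" using w(2)[of i] by (metis atoms_iff(2))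
  qed
  moreover have "w i \<in> atoms ar C0 J0" if i: "i \<in> fv \<phi>" for i
  proof (cases "w i")
    case (Inl a)
    then show ?thesis using i by (force simp: C0_def)
  next
    case (Inr vk)
    obtain v k where "vk = (v, k)" by fastforce
    then show ?thesis using i Inr w(2)[OF i] by (force simp: J0_def)
  qed
  then have "dfn ar C0 J0 P" using w by (intro dfnI[of \<phi> w]) auto
  ultimately show ?thesis by blast
qed

lemma dfn_not: "dfn ar C J P \<Longrightarrow> dfn ar C J (\<lambda>E. \<not> P E)"
proof (elim dfnE)
  fix \<phi> w assume "wf_fm L \<phi>" "\<And>i. i \<in> fv \<phi> \<Longrightarrow> w i \<in> atoms ar C J"
    "\<And>E. E \<in> envs ar \<Longrightarrow> P E \<longleftrightarrow> sat M (\<lambda>i. val E (w i)) \<phi>"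
  then show ?thesis by (intro dfnI[of "Neg \<phi>" w]) auto
qed

lemma dfn_conj:
  assumes "dfn ar C J P" and "dfn ar C J R"
  shows "dfn ar C J (\<lambda>E. P E \<and> R E)"
proof -
  obtain \<phi> w where w: "wf_fm L \<phi>" "\<And>i. i \<in> fv \<phi> \<Longrightarrow> w i \<in> atoms ar C J"
    "\<And>E. E \<in> envs ar \<Longrightarrow> P E \<longleftrightarrow> sat M (\<lambda>i. val E (w i)) \<phi>" using assms(1) unfolding dfn_def by blast
  obtain \<psi> x where x: "wf_fm L \<psi>" "\<And>i. i \<in> fv \<psi> \<Longrightarrow> x i \<in> atoms ar C J"
    "\<And>E. E \<in> envs ar \<Longrightarrow> R E \<longleftrightarrow> sat M (\<lambda>i. val E (x i)) \<psi>" using assms(2) unfolding dfn_def by blast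
  obtain \<phi>' where p: "wf_fm L \<phi>'" "fv \<phi>' \<subseteq> (\<lambda>i. 2 * i) ` fv \<phi>" "\<forall>e. sat M e \<phi>' = sat M (\<lambda>i. e (2 * i)) \<phi>"
    using rename_fm[OF w(1)] by blast
  obtain \<psi>' where q: "wf_fm L \<psi>'" "fv \<psi>' \<subseteq> (\<lambda>i. 2 * i + 1) ` fv \<psi>" "\<forall>e. sat M e \<psi>' = sat M (\<lambda>i. e (2 * i + 1)) \<psi>"
    using rename_fm[OF x(1)] by blast
  show ?thesis
    by (rule dfnI[of "Conj \<phi>' \<psi>'" "\<lambda>i. if even i then w (i div 2) else x (i div 2)"])
      (use p q w x in auto)
qed

lemma dfn_disj:
  assumes "dfn ar C J P" and "dfn ar C J R"
  shows "dfn ar C J (\<lambda>E. P E \<or> R E)"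
  by (rule dfn_cong[OF dfn_not[OF dfn_conj[OF dfn_not[OF assms(1)] dfn_not[OF assms(2)]]]]) simp

lemma dfn_imp:
  assumes "dfn ar C J P" and "dfn ar C J R"
  shows "dfn ar C J (\<lambda>E. P E \<longrightarrow> R E)"
  by (rule dfn_cong[OF dfn_disj[OF dfn_not[OF assms(1)] assms(2)]]) simp

lemma dfn_iff:
  assumes "dfn ar C J P" and "dfn ar C J R"
  shows "dfn ar C J (\<lambda>E. P E \<longleftrightarrow> R E)"
  by (rule dfn_cong[OF dfn_conj[OF dfn_imp[OF assms] dfn_imp[OF assms(2,1)]]]) auto

lemma dfn_const: "dfn ar C J (\<lambda>E. b)"
proof -
  have "dfn ar C J (\<lambda>E. True)"
    by (rule dfnI[of "Ex 0 (Eq (Var 0) (Var 0))"]) (use U_nonempty in auto)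
  from this dfn_not[OF this] show ?thesis by (cases b) simp_all
qed

lemma dfn_ball_finite: "finite I \<Longrightarrow> (\<And>i. i \<in> I \<Longrightarrow> dfn ar C J (P i)) \<Longrightarrow> dfn ar C J (\<lambda>E. \<forall>i\<in>I. P i E)"
proof (induction I rule: finite_induct)
  case empty
  then show ?case by (simp add: dfn_const)
next
  case (insert i I)
  have "dfn ar C J (\<lambda>E. P i E \<and> (\<forall>i\<in>I. P i E))"
    by (rule dfn_conj) (use insert in simp_all)
  then show ?case by simp
qed

lemma dfn_bex_finite:
  assumes "finite I" and "\<And>i. i \<in> I \<Longrightarrow> dfn ar C J (P i)"
  shows "dfn ar C J (\<lambda>E. \<exists>i\<in>I. P i E)"
  by (rule dfn_cong[OF dfn_not[OF dfn_ball_finite[OF assms(1) dfn_not[OF assms(2)]]]]) simp_all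

text \<open>
  Any condition on the set of indices at which a relation holds, in particular on its
  cardinality, is a Boolean combination.
\<close>

lemma dfn_boolean:
  assumes "finite I" and "\<And>i. i \<in> I \<Longrightarrow> dfn ar C J (P i)"
  shows "dfn ar C J (\<lambda>E. \<Phi> {i\<in>I. P i E})"
proof (rule dfn_cong)
  show "dfn ar C J (\<lambda>E. \<exists>T\<in>{T\<in>Pow I. \<Phi> T}. \<forall>i\<in>I. P i E \<longleftrightarrow> i \<in> T)"
    using assms by (intro dfn_bex_finite dfn_ball_finite dfn_iff dfn_const) auto
  show "\<Phi> {i\<in>I. P i E} = (\<exists>T\<in>{T\<in>Pow I. \<Phi> T}. \<forall>i\<in>I. P i E \<longleftrightarrow> i \<in> T)" for E
  proof
    assume "\<exists>T\<in>{T\<in>Pow I. \<Phi> T}. \<forall>i\<in>I. P i E \<longleftrightarrow> i \<in> T"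
    then obtain T where T: "T \<subseteq> I" "\<Phi> T" "\<forall>i\<in>I. P i E \<longleftrightarrow> i \<in> T" by blast
    then have "{i\<in>I. P i E} = T" by blast
    then show "\<Phi> {i\<in>I. P i E}" using T by simp
  next
    assume "\<Phi> {i\<in>I. P i E}"
    then show "\<exists>T\<in>{T\<in>Pow I. \<Phi> T}. \<forall>i\<in>I. P i E \<longleftrightarrow> i \<in> T"
      by (intro bexI[of _ "{i\<in>I. P i E}"]) auto
  qed
qed

text \<open>
  The terms of this calculus are lists of atoms: the function symbols stay inside the formulas.
\<close>

definition dlist :: "('v \<Rightarrow> nat) \<Rightarrow> 'a set \<Rightarrow> 'v set \<Rightarrow> nat \<Rightarrow> (('v \<Rightarrow> 'a list) \<Rightarrow> 'a list) \<Rightarrow> bool" where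
  "dlist ar C J m F \<longleftrightarrow> (\<exists>ts. length ts = m \<and> set ts \<subseteq> atoms ar C J \<and> (\<forall>E\<in>envs ar. F E = map (val E) ts))"

lemma dlist_atoms: "set ts \<subseteq> atoms ar C J \<Longrightarrow> dlist ar C J (length ts) (\<lambda>E. map (val E) ts)"
  unfolding dlist_def by blast

lemma dlist_var: "v \<in> J \<Longrightarrow> m = ar v \<Longrightarrow> dlist ar C J m (\<lambda>E. E v)"
  unfolding dlist_def
  by (rule exI[of _ "map (\<lambda>k. Inr (v, k)) [0..<ar v]"]) (auto simp: envs_length intro!: nth_equalityI)

lemma dlist_const: "c \<in> tuples C m \<Longrightarrow> dlist ar C J m (\<lambda>E. c)"
  unfolding dlist_def by (rule exI[of _ "map Inl c"]) (auto simp: tuples_def comp_def)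

lemma dlist_Nil: "dlist ar C J 0 (\<lambda>E. [])"
  unfolding dlist_def by auto

lemma dlist_append: "dlist ar C J m F \<Longrightarrow> dlist ar C J k G \<Longrightarrow> dlist ar C J (m + k) (\<lambda>E. F E @ G E)"
  unfolding dlist_def
proof (elim exE conjE)
  fix ts us assume "length ts = m" "length us = k" "set ts \<subseteq> atoms ar C J" "set us \<subseteq> atoms ar C J"
    "\<forall>E\<in>envs ar. F E = map (val E) ts" "\<forall>E\<in>envs ar. G E = map (val E) us"
  then show "\<exists>vs. length vs = m + k \<and> set vs \<subseteq> atoms ar C J \<and> (\<forall>E\<in>envs ar. F E @ G E = map (val E) vs)"
    by (intro exI[of _ "ts @ us"]) auto
qed

lemma dlist_append': "dlist ar C J m F \<Longrightarrow> dlist ar C J k G \<Longrightarrow> l = m + k \<Longrightarrow> dlist ar C J l (\<lambda>E. F E @ G E)"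
  using dlist_append by blast

lemma dlist_concat: "(\<And>x. x \<in> set xs \<Longrightarrow> dlist ar C J m (F x)) \<Longrightarrow> k = length xs * m \<Longrightarrow>
    dlist ar C J k (\<lambda>E. concat (map (\<lambda>x. F x E) xs))"
proof (induction xs arbitrary: k)
  case Nil
  then show ?case by (simp add: dlist_Nil)
next
  case (Cons x xs)
  have "dlist ar C J (length xs * m) (\<lambda>E. concat (map (\<lambda>x. F x E) xs))" by (rule Cons.IH) (use Cons.prems in auto)
  from dlist_append[OF Cons.prems(1)[of x] this] show ?case using Cons.prems(2) by simp
qed

lemma dlist_map_nth:
  assumes "dlist ar C J m F" and "set is \<subseteq> {..<m}" and "k = length is"
  shows "dlist ar C J k (\<lambda>E. map (\<lambda>i. F E ! i) is)"
proof -
  obtain ts where ts: "length ts = m" "set ts \<subseteq> atoms ar C J" "\<forall>E\<in>envs ar. F E = map (val E) ts"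
    using assms(1) by (auto simp: dlist_def)
  show ?thesis unfolding dlist_def
    by (rule exI[of _ "map (\<lambda>i. ts ! i) is"]) (use ts assms(2,3) in \<open>auto simp: subset_iff\<close>)
qed

lemma dfn_holds:
  assumes "\<phi> \<in> fms L m" and "dlist ar C J m F"
  shows "dfn ar C J (\<lambda>E. holds M \<phi> (F E))"
proof -
  obtain ts where ts: "length ts = m" "set ts \<subseteq> atoms ar C J" "\<forall>E\<in>envs ar. F E = map (val E) ts"
    using assms(2) by (auto simp: dlist_def)
  have "holds M \<phi> (F E) \<longleftrightarrow> sat M (\<lambda>i. val E (ts ! i)) \<phi>" if "E \<in> envs ar" for E
    unfolding holds_def using ts that assms(1) by (intro sat_cong) (auto simp: fms_def)
  then show ?thesis using assms(1) ts by (intro dfnI[of \<phi> "\<lambda>i. ts ! i"]) (auto simp: fms_def subset_iff)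
qed

text \<open>
  In this normal form the tuple \<open>v\<close> comes first, so that it can be bound by \<open>exs\<close> or by an
  ultrafilter quantifier.
\<close>

lemma dfn_split:
  assumes "dfn ar C (insert v J) P"
  shows "\<exists>\<phi> ts. \<phi> \<in> fms L (ar v + length ts) \<and> set ts \<subseteq> atoms ar C (J - {v}) \<and>
    (\<forall>E\<in>envs ar. P E \<longleftrightarrow> holds M \<phi> (E v @ map (val E) ts))"
proof -
  obtain \<phi> w where w: "wf_fm L \<phi>" "\<And>i. i \<in> fv \<phi> \<Longrightarrow> w i \<in> atoms ar C (insert v J)"
    "\<And>E. E \<in> envs ar \<Longrightarrow> P E \<longleftrightarrow> sat M (\<lambda>i. val E (w i)) \<phi>" using assms unfolding dfn_def by blast
  define I where "I = {i \<in> fv \<phi>. \<not> (\<exists>k. w i = Inr (v, k))}"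
  have "finite I" by (simp add: I_def finite_fv)
  then obtain xs where xs: "set xs = I" "distinct xs" using finite_distinct_list by blast
  define ts where "ts = map w xs"
  define f where "f i = (if i \<in> I then ar v + inv_into {..<length xs} ((!) xs) i else snd (projr (w i)))" for i
  obtain \<phi>' where p: "wf_fm L \<phi>'" "fv \<phi>' \<subseteq> f ` fv \<phi>" "\<forall>e. sat M e \<phi>' = sat M (\<lambda>i. e (f i)) \<phi>"
    using rename_fm[OF w(1)] by blast
  have fI: "inv_into {..<length xs} ((!) xs) i < length xs" "xs ! inv_into {..<length xs} ((!) xs) i = i"
    if "i \<in> I" for i
  proof -
    have "i \<in> (!) xs ` {..<length xs}" using that xs(1) by (metis in_set_conv_nth image_eqI lessThan_iff)
    then show "inv_into {..<length xs} ((!) xs) i < length xs" "xs ! inv_into {..<length xs} ((!) xs) i = i"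
      using inv_into_into[of i "(!) xs" "{..<length xs}"] f_inv_into_f[of i "(!) xs" "{..<length xs}"] by auto
  qed
  have nI: "\<exists>k. w i = Inr (v, k) \<and> k < ar v \<and> f i = k" if "i \<in> fv \<phi>" "i \<notin> I" for i
    using that w(2)[OF that(1)] by (auto simp: I_def f_def)
  have "\<phi>' \<in> fms L (ar v + length ts)"
  proof -
    have "f i < ar v + length ts" if "i \<in> fv \<phi>" for i
      using fI(1)[of i] nI[of i] that by (cases "i \<in> I") (auto simp: f_def ts_def)
    then show ?thesis using p(1,2) by (auto simp: fms_def)
  qed
  moreover have "set ts \<subseteq> atoms ar C (J - {v})"
  proof -
    have "w i \<in> atoms ar C (J - {v})" if "i \<in> I" for i
      using that w(2)[of i] by (cases "w i") (auto simp: I_def)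
    then show ?thesis using xs(1) by (auto simp: ts_def)
  qed
  moreover have "P E \<longleftrightarrow> holds M \<phi>' (E v @ map (val E) ts)" if E: "E \<in> envs ar" for E
    unfolding w(3)[OF E] holds_def p(3)[rule_format]
  proof (rule sat_cong)
    fix i assume i: "i \<in> fv \<phi>"
    show "val E (w i) = (E v @ map (val E) ts) ! f i"
    proof (cases "i \<in> I")
      case True
      then show ?thesis using fI[OF True] by (simp add: f_def nth_append envs_length[OF E] ts_def)
    next
      case False
      then show ?thesis using nI[OF i False] by (auto simp: nth_append envs_length[OF E])
    qed
  qed
  ultimately show ?thesis by blast
qed

lemma dfn_ex:
  assumes "dfn ar C (insert v J) P"
  shows "dfn ar C (J - {v}) (\<lambda>E. \<exists>a\<in>tup (ar v). P (E(v := a)))"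
proof -
  obtain \<phi> ts where p: "\<phi> \<in> fms L (ar v + length ts)" "set ts \<subseteq> atoms ar C (J - {v})"
    "\<And>E. E \<in> envs ar \<Longrightarrow> P E \<longleftrightarrow> holds M \<phi> (E v @ map (val E) ts)" using dfn_split[OF assms] by blast
  have same: "val (E(v := a)) t = val E t" if "t \<in> set ts" for E a t
    by (rule val_agree[of t ar C "J - {v}"]) (use p(2) that in auto)
  show ?thesis
  proof (rule dfnI[of "exs (ar v) \<phi>" "\<lambda>i. ts ! (i - ar v)"])
    show "wf_fm L (exs (ar v) \<phi>)" using p(1) by (simp add: wf_exs fms_def)
  next
    fix i assume "i \<in> fv (exs (ar v) \<phi>)"
    then have "ar v \<le> i" "i < ar v + length ts" using p(1) by (auto simp: fv_exs fms_def)
    then have "i - ar v < length ts" by simp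
    then show "ts ! (i - ar v) \<in> atoms ar C (J - {v})" using p(2) nth_mem by blast
  next
    fix E assume E: "E \<in> envs ar"
    have "P (E(v := a)) \<longleftrightarrow> sat M (\<lambda>i. if i < ar v then a ! i else val E (ts ! (i - ar v))) \<phi>" if a: "a \<in> tup (ar v)" for a
      unfolding p(3)[OF envs_upd[OF E a]] holds_def
      by (rule sat_cong) (use a p(1) same in \<open>auto simp: nth_append tuples_def fms_def subset_iff\<close>)
    then show "(\<exists>a\<in>tup (ar v). P (E(v := a))) = sat M (\<lambda>i. val E (ts ! (i - ar v))) (exs (ar v) \<phi>)"
      by (simp add: sat_exs)
  qed
qed

text \<open>
  Quantifying over infinitely many variables is a finite quantification, since the variables that
  are not mentioned do not change the truth value.
\<close>

lemma dfn_ex_set: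
  assumes "dfn ar C J P"
  shows "dfn ar C (J - V) (\<lambda>E. \<exists>E'\<in>envs ar. (\<forall>v. v \<notin> V \<longrightarrow> E' v = E v) \<and> P E')"
proof -
  have fin: "dfn ar C (J - F) (\<lambda>E. \<exists>E'\<in>envs ar. (\<forall>v. v \<notin> F \<longrightarrow> E' v = E v) \<and> P E')" if "finite F" "dfn ar C J P" for F J
    using that
  proof (induction F rule: finite_induct)
    case empty
    have "E' = E" if "\<forall>v. E' v = E v" for E E' :: "'b \<Rightarrow> 'a list" using that by auto
    then have "(\<exists>E'\<in>envs ar. (\<forall>v. v \<notin> {} \<longrightarrow> E' v = E v) \<and> P E') = P E" if "E \<in> envs ar" for E
      using that by (metis empty_iff)
    from dfn_cong[OF empty this] show ?case by simp
  next
    case (insert v F)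
    have "dfn ar C (insert v (J - F)) (\<lambda>E. \<exists>E'\<in>envs ar. (\<forall>v. v \<notin> F \<longrightarrow> E' v = E v) \<and> P E')"
      by (rule dfn_mono[OF insert.IH[OF insert.prems]]) auto
    from dfn_ex[OF this] have "dfn ar C (J - insert v F)
      (\<lambda>E. \<exists>a\<in>tup (ar v). \<exists>E'\<in>envs ar. (\<forall>u. u \<notin> F \<longrightarrow> E' u = (E(v := a)) u) \<and> P E')"
      by (rule dfn_mono) auto
    then show ?case
    proof (rule dfn_cong)
      fix E assume "E \<in> envs ar"
      show "(\<exists>E'\<in>envs ar. (\<forall>u. u \<notin> insert v F \<longrightarrow> E' u = E u) \<and> P E') =
        (\<exists>a\<in>tup (ar v). \<exists>E'\<in>envs ar. (\<forall>u. u \<notin> F \<longrightarrow> E' u = (E(v := a)) u) \<and> P E')" (is "?l = ?r")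
      proof
        assume ?l
        then obtain E' where "E' \<in> envs ar" "\<forall>u. u \<notin> insert v F \<longrightarrow> E' u = E u" "P E'" by blast
        then show ?r by (intro bexI[of _ "E' v"] bexI[of _ E']) (auto simp: envs_tup)
      next
        assume ?r
        then show ?l using insert.hyps(2) by (metis fun_upd_other insert_iff)
      qed
    qed
  qed
  obtain J0 where J0: "finite J0" "J0 \<subseteq> J" "dfn ar C J0 P"
    using dfn_finite_support[OF assms] dfn_mono by (metis order_refl)
  have "dfn ar C (J - V) (\<lambda>E. \<exists>E'\<in>envs ar. (\<forall>v. v \<notin> J0 \<inter> V \<longrightarrow> E' v = E v) \<and> P E')"
    by (rule dfn_mono[OF fin[of "J0 \<inter> V" J0]]) (use J0 in auto)
  then show ?thesis
  proof (rule dfn_cong)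
    fix E assume E: "E \<in> envs ar"
    show "(\<exists>E'\<in>envs ar. (\<forall>v. v \<notin> V \<longrightarrow> E' v = E v) \<and> P E') =
      (\<exists>E'\<in>envs ar. (\<forall>v. v \<notin> J0 \<inter> V \<longrightarrow> E' v = E v) \<and> P E')" (is "?l = ?r")
    proof
      assume ?l
      then obtain E' where E': "E' \<in> envs ar" "\<forall>v. v \<notin> V \<longrightarrow> E' v = E v" "P E'" by blast
      define E1 where "E1 = (\<lambda>v. if v \<in> J0 then E' v else E v)"
      have E1: "E1 \<in> envs ar" using E E'(1) by (simp add: envs_def E1_def)
      have "P E1" using dfn_agree[OF J0(3) E'(1) E1] E'(3) by (simp add: E1_def)
      then show ?r using E1 E'(2) by (intro bexI[of _ E1]) (auto simp: E1_def)
    qed blast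
  qed
qed

text \<open>
  The formula does not change under a substitution; its variables are assigned to other atoms.
\<close>

lemma dfn_subst:
  assumes P: "dfn ar C J P" and s: "\<And>v. v \<in> J \<Longrightarrow> dlist ar' C' J' (ar v) (\<lambda>E. F E v)"
    and env: "\<And>E. E \<in> envs ar' \<Longrightarrow> F E \<in> envs ar" and C: "C \<subseteq> C'"
  shows "dfn ar' C' J' (\<lambda>E. P (F E))"
proof -
  obtain \<phi> w where w: "wf_fm L \<phi>" "\<And>i. i \<in> fv \<phi> \<Longrightarrow> w i \<in> atoms ar C J"
    "\<And>E. E \<in> envs ar \<Longrightarrow> P E \<longleftrightarrow> sat M (\<lambda>i. val E (w i)) \<phi>" using P unfolding dfn_def by blast
  obtain ts where ts: "\<And>v. v \<in> J \<Longrightarrow> length (ts v) = ar v" "\<And>v. v \<in> J \<Longrightarrow> set (ts v) \<subseteq> atoms ar' C' J'"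
    "\<And>v E. v \<in> J \<Longrightarrow> E \<in> envs ar' \<Longrightarrow> F E v = map (val E) (ts v)"
  proof -
    have "\<forall>v. \<exists>ts. v \<in> J \<longrightarrow> length ts = ar v \<and> set ts \<subseteq> atoms ar' C' J' \<and> (\<forall>E\<in>envs ar'. F E v = map (val E) ts)"
      using s unfolding dlist_def by blast
    from choice[OF this] show thesis using that by blast
  qed
  define x where "x i = (case w i of Inl a \<Rightarrow> Inl a | Inr (v, k) \<Rightarrow> ts v ! k)" for i
  show ?thesis
  proof (rule dfnI[of \<phi> x])
    show "x i \<in> atoms ar' C' J'" if "i \<in> fv \<phi>" for i
    proof (cases "w i")
      case (Inl a)
      then show ?thesis using w(2)[OF that] C by (auto simp: x_def)
    next
      case (Inr vk)
      obtain v k where "vk = (v, k)" by fastforce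
      then show ?thesis using Inr w(2)[OF that] ts(1,2)[of v] by (auto simp: x_def intro: nth_mem)
    qed
    show "P (F E) \<longleftrightarrow> sat M (\<lambda>i. val E (x i)) \<phi>" if E: "E \<in> envs ar'" for E
      unfolding w(3)[OF env[OF E]]
    proof (rule sat_cong)
      fix i assume i: "i \<in> fv \<phi>"
      show "val (F E) (w i) = val E (x i)"
      proof (cases "w i")
        case (Inr vk)
        obtain v k where "vk = (v, k)" by fastforce
        then show ?thesis using Inr w(2)[OF i] ts(1,3)[of v] E by (auto simp: x_def)
      qed (simp add: x_def)
    qed
  qed (rule w(1))
qed

lemma dfn_rename:
  assumes "dfn ar C J P" and "\<And>v. v \<in> J \<Longrightarrow> f v \<in> J'" and "\<And>v. ar' (f v) = ar v"
  shows "dfn ar' C J' (\<lambda>E. P (\<lambda>v. E (f v)))"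
  by (rule dfn_subst[OF assms(1)]) (use assms(2,3) in \<open>auto intro!: dlist_var simp: envs_def\<close>, metis)

section \<open>Automorphisms\<close>

lemma eval_U: "wf_tm L t \<Longrightarrow> (\<And>i. e i \<in> U) \<Longrightarrow> eval M e t \<in> U"
proof (induction t)
  case (Fun f ts)
  then have "map (eval M e) ts \<in> tup (fun_ar L f)" by (auto simp: tuples_def)
  then show ?case using Fun.prems struct by (auto simp: is_struct_def)
qed simp

lemma eval_automorphism:
  assumes \<sigma>: "automorphism L M \<sigma>"
  shows "wf_tm L t \<Longrightarrow> (\<And>i. e i \<in> U) \<Longrightarrow> eval M (\<lambda>i. \<sigma> (e i)) t = \<sigma> (eval M e t)"
proof (induction t)
  case (Fun f ts)
  have args: "map (eval M e) ts \<in> tup (fun_ar L f)" using Fun.prems eval_U by (auto simp: tuples_def)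
  have "map (eval M (\<lambda>i. \<sigma> (e i))) ts = map \<sigma> (map (eval M e) ts)" using Fun by simp
  then show ?case using \<sigma> args Fun.prems(1) by (simp add: automorphism_def del: map_map)
qed simp

lemma sat_automorphism:
  assumes \<sigma>: "automorphism L M \<sigma>"
  shows "wf_fm L \<phi> \<Longrightarrow> (\<And>i. e i \<in> U) \<Longrightarrow> sat M (\<lambda>i. \<sigma> (e i)) \<phi> = sat M e \<phi>"
proof (induction \<phi> arbitrary: e)
  case (Eq s t)
  have "inj_on \<sigma> U" using \<sigma> by (simp add: automorphism_def bij_betw_def)
  then show ?case using Eq eval_U by (simp add: eval_automorphism[OF \<sigma>] inj_on_eq_iff)
next
  case (Rel r ts)
  have args: "map (eval M e) ts \<in> tup (rel_ar L r)" using Rel.prems eval_U by (auto simp: tuples_def)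
  have "map (eval M (\<lambda>i. \<sigma> (e i))) ts = map \<sigma> (map (eval M e) ts)"
    using Rel.prems eval_automorphism[OF \<sigma>] by simp
  then show ?case using \<sigma> args Rel.prems(1) by (simp add: automorphism_def del: map_map)
next
  case (Ex x \<phi>)
  have upd: "(\<lambda>i. \<sigma> (e i))(x := \<sigma> a) = (\<lambda>i. \<sigma> ((e(x := a)) i))" for a by auto
  have "\<sigma> ` U = U" using \<sigma> by (simp add: automorphism_def bij_betw_def)
  then have "(\<exists>a\<in>U. sat M ((\<lambda>i. \<sigma> (e i))(x := a)) \<phi>) \<longleftrightarrow> (\<exists>a\<in>U. sat M ((\<lambda>i. \<sigma> (e i))(x := \<sigma> a)) \<phi>)"
    using bex_simps(7)[of \<sigma> U "\<lambda>a. sat M ((\<lambda>i. \<sigma> (e i))(x := a)) \<phi>"] by simp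
  also have "\<dots> \<longleftrightarrow> (\<exists>a\<in>U. sat M (e(x := a)) \<phi>)"
    unfolding upd
  proof (rule bex_cong)
    fix a assume "a \<in> U"
    then show "sat M (\<lambda>i. \<sigma> ((e(x := a)) i)) \<phi> = sat M (e(x := a)) \<phi>"
      using Ex.prems by (intro Ex.IH) auto
  qed simp
  finally show ?case by simp
qed simp_all

lemma automorphism_U: "automorphism L M \<sigma> \<Longrightarrow> a \<in> U \<Longrightarrow> \<sigma> a \<in> U"
  by (auto simp: automorphism_def bij_betw_def)

lemma automorphism_tup: "automorphism L M \<sigma> \<Longrightarrow> c \<in> tup m \<Longrightarrow> map \<sigma> c \<in> tup m"
  using automorphism_U by (auto simp: tuples_def)

definition ainv :: "('a \<Rightarrow> 'a) \<Rightarrow> 'a \<Rightarrow> 'a" where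
  "ainv \<sigma> = inv_into U \<sigma>"

lemma ainv_simps:
  assumes "automorphism L M \<sigma>" and "a \<in> U"
  shows "\<sigma> (ainv \<sigma> a) = a" "ainv \<sigma> (\<sigma> a) = a" "ainv \<sigma> a \<in> U"
  using assms by (auto simp: automorphism_def bij_betw_def ainv_def f_inv_into_f inv_into_f_f inv_into_into)

lemma ainv_tup:
  assumes "automorphism L M \<sigma>" and "c \<in> tup m"
  shows "map \<sigma> (map (ainv \<sigma>) c) = c" "map (ainv \<sigma>) (map \<sigma> c) = c"
  using assms by (auto simp: tuples_def ainv_simps subset_iff intro!: map_idI)

lemma automorphism_ainv:
  assumes \<sigma>: "automorphism L M \<sigma>"
  shows "automorphism L M (ainv \<sigma>)"
  unfolding automorphism_def
proof (intro conjI ballI)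
  show "bij_betw (ainv \<sigma>) U U" using \<sigma> by (simp add: automorphism_def ainv_def bij_betw_inv_into)
next
  fix f as assume f: "f \<in> funs L" and as: "as \<in> tup (fun_ar L f)"
  have b: "map (ainv \<sigma>) as \<in> tup (fun_ar L f)" using as ainv_simps(3)[OF \<sigma>] by (auto simp: tuples_def)
  have "\<sigma> (fn M f (map (ainv \<sigma>) as)) = fn M f as"
    using \<sigma> f b ainv_tup(1)[OF \<sigma> as] by (simp add: automorphism_def del: map_map)
  moreover have "fn M f (map (ainv \<sigma>) as) \<in> U" using struct f b by (auto simp: is_struct_def)
  ultimately show "ainv \<sigma> (fn M f as) = fn M f (map (ainv \<sigma>) as)" using ainv_simps(2)[OF \<sigma>] by metis
next
  fix r as assume r: "r \<in> rels L" and as: "as \<in> tup (rel_ar L r)"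
  have b: "map (ainv \<sigma>) as \<in> tup (rel_ar L r)" using as ainv_simps(3)[OF \<sigma>] by (auto simp: tuples_def)
  show "rl M r as = rl M r (map (ainv \<sigma>) as)"
    using \<sigma> r b ainv_tup(1)[OF \<sigma> as] by (metis automorphism_def)
qed

lemma automorphism_comp:
  assumes \<sigma>: "automorphism L M \<sigma>" and \<tau>: "automorphism L M \<tau>"
  shows "automorphism L M (\<sigma> \<circ> \<tau>)"
  unfolding automorphism_def
proof (intro conjI ballI)
  show "bij_betw (\<sigma> \<circ> \<tau>) U U" using assms by (auto simp: automorphism_def intro: bij_betw_trans)
next
  fix f as assume f: "f \<in> funs L" and as: "as \<in> tup (fun_ar L f)"
  have "\<tau> (fn M f as) = fn M f (map \<tau> as)" using \<tau> f as by (simp add: automorphism_def)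
  moreover have "\<sigma> (fn M f (map \<tau> as)) = fn M f (map \<sigma> (map \<tau> as))"
    using \<sigma> f automorphism_tup[OF \<tau> as] by (simp add: automorphism_def del: map_map)
  ultimately show "(\<sigma> \<circ> \<tau>) (fn M f as) = fn M f (map (\<sigma> \<circ> \<tau>) as)" by simp
next
  fix r as assume r: "r \<in> rels L" and as: "as \<in> tup (rel_ar L r)"
  have "rl M r as = rl M r (map \<tau> as)" using \<tau> r as by (simp add: automorphism_def)
  moreover have "rl M r (map \<tau> as) = rl M r (map \<sigma> (map \<tau> as))"
    using \<sigma> r automorphism_tup[OF \<tau> as] by (simp add: automorphism_def del: map_map)
  ultimately show "rl M r as = rl M r (map (\<sigma> \<circ> \<tau>) as)" by simp
qed

lemma automorphism_id: "automorphism L M id"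
  by (simp add: automorphism_def)

lemma holds_automorphism:
  assumes "automorphism L M \<sigma>" and "\<phi> \<in> fms L m" and "c \<in> tup m"
  shows "holds M \<phi> (map \<sigma> c) = holds M \<phi> c"
proof -
  obtain u where u: "u \<in> U" using U_nonempty by blast
  define e where "e = (\<lambda>i. if i < m then c ! i else u)"
  have e: "\<And>i. e i \<in> U" using assms(3) u by (auto simp: e_def tuples_def)
  have "holds M \<phi> (map \<sigma> c) = sat M (\<lambda>i. \<sigma> (e i)) \<phi>" "holds M \<phi> c = sat M e \<phi>"
    unfolding holds_def using assms(2,3) by (intro sat_cong; auto simp: e_def fms_def tuples_def)+
  then show ?thesis using sat_automorphism[OF assms(1) _ e] assms(2) by (simp add: fms_def)
qed

lemma dfn_automorphism:
  assumes P: "dfn ar C J P" and \<sigma>: "automorphism L M \<sigma>" and C: "C \<subseteq> U" "\<And>c. c \<in> C \<Longrightarrow> \<sigma> c = c"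
    and E: "E \<in> envs ar"
  shows "P (\<lambda>v. map \<sigma> (E v)) = P E"
proof -
  obtain \<phi> w where w: "wf_fm L \<phi>" "\<And>i. i \<in> fv \<phi> \<Longrightarrow> w i \<in> atoms ar C J"
    "\<And>E. E \<in> envs ar \<Longrightarrow> P E \<longleftrightarrow> sat M (\<lambda>i. val E (w i)) \<phi>" using P unfolding dfn_def by blast
  obtain u where u: "u \<in> U" using U_nonempty by blast
  define e where "e = (\<lambda>i. if i \<in> fv \<phi> then val E (w i) else u)"
  have vU: "val E (w i) \<in> U" "val (\<lambda>v. map \<sigma> (E v)) (w i) = \<sigma> (val E (w i))" if "i \<in> fv \<phi>" for i
  proof -
    have "val E (w i) \<in> U \<and> val (\<lambda>v. map \<sigma> (E v)) (w i) = \<sigma> (val E (w i))"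
    proof (cases "w i")
      case (Inl c)
      then show ?thesis using w(2)[OF that] C by auto
    next
      case (Inr vk)
      obtain v k where vk: "vk = (v, k)" by fastforce
      then have "k < length (E v)" "set (E v) \<subseteq> U"
        using w(2)[OF that] Inr envs_tup[OF E, of v] by (simp_all add: tuples_def)
      then show ?thesis using Inr vk nth_mem[of k "E v"] by (simp add: subset_iff)
    qed
    then show "val E (w i) \<in> U" "val (\<lambda>v. map \<sigma> (E v)) (w i) = \<sigma> (val E (w i))" by auto
  qed
  have e: "\<And>i. e i \<in> U" using vU u by (auto simp: e_def)
  have E': "(\<lambda>v. map \<sigma> (E v)) \<in> envs ar" using E automorphism_tup[OF \<sigma>] by (auto simp: envs_def)
  have "P (\<lambda>v. map \<sigma> (E v)) = sat M (\<lambda>i. \<sigma> (e i)) \<phi>" unfolding w(3)[OF E']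
    by (rule sat_cong) (use vU in \<open>auto simp: e_def\<close>)
  moreover have "P E = sat M e \<phi>" unfolding w(3)[OF E]
    by (rule sat_cong) (auto simp: e_def)
  ultimately show ?thesis using sat_automorphism[OF \<sigma> w(1) e] by simp
qed

end

section \<open>Relations definable over a set of parameters\<close>

lemma wf_subst_tm:
  "wf_tm L t \<Longrightarrow> (\<And>x a. x \<in> fv_tm t \<Longrightarrow> \<sigma> x = Some a \<Longrightarrow> a \<in> C) \<Longrightarrow> wf_tm (lang_over L C) (subst_tm \<sigma> t)"
proof (induction t)
  case (Fun f ts)
  then have "\<forall>t\<in>set ts. wf_tm (lang_over L C) (subst_tm \<sigma> t)" by fastforce
  then show ?case using Fun.prems(1) by (simp add: lang_over_def)
qed (auto simp: lang_over_def split: option.split)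

lemma fv_subst_tm: "fv_tm (subst_tm \<sigma> t) \<subseteq> {x \<in> fv_tm t. \<sigma> x = None}"
proof (induction t)
  case (Fun f ts)
  then show ?case by fastforce
qed (auto split: option.split)

lemma wf_subst_fm:
  "wf_fm L \<phi> \<Longrightarrow> (\<And>x a. x \<in> fv \<phi> \<Longrightarrow> \<sigma> x = Some a \<Longrightarrow> a \<in> C) \<Longrightarrow> wf_fm (lang_over L C) (subst_fm \<sigma> \<phi>)"
proof (induction \<phi> arbitrary: \<sigma>)
  case (Eq s t)
  then show ?case using wf_subst_tm[of L s \<sigma> C] wf_subst_tm[of L t \<sigma> C] by auto
next
  case (Rel r ts)
  have "wf_tm (lang_over L C) (subst_tm \<sigma> t)" if t: "t \<in> set ts" for t
  proof (rule wf_subst_tm)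
    show "wf_tm L t" using Rel.prems(1) t by simp
    show "a \<in> C" if "x \<in> fv_tm t" "\<sigma> x = Some a" for x a
      using Rel.prems(2)[of x a] that t by auto
  qed
  then show ?case using Rel.prems(1) by (simp add: lang_over_def)
next
  case (Conj \<phi> \<psi>)
  have "wf_fm (lang_over L C) (subst_fm \<sigma> \<phi>)" by (rule Conj.IH(1)) (use Conj.prems in auto)
  moreover have "wf_fm (lang_over L C) (subst_fm \<sigma> \<psi>)" by (rule Conj.IH(2)) (use Conj.prems in auto)
  ultimately show ?case by simp
next
  case (Ex x \<phi>)
  have "wf_fm (lang_over L C) (subst_fm (\<sigma>(x := None)) \<phi>)"
    by (rule Ex.IH) (use Ex.prems in \<open>auto split: if_splits\<close>)
  then show ?case by simp
next
  case (Neg \<phi>)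
  then show ?case by auto
qed

lemma fv_subst_fm: "fv (subst_fm \<sigma> \<phi>) \<subseteq> {x \<in> fv \<phi>. \<sigma> x = None}"
proof (induction \<phi> arbitrary: \<sigma>)
  case (Eq s t)
  then show ?case using fv_subst_tm[of \<sigma> s] fv_subst_tm[of \<sigma> t] by auto
next
  case (Rel r ts)
  have "(\<Union>t\<in>set ts. fv_tm (subst_tm \<sigma> t)) \<subseteq> {x \<in> (\<Union>t\<in>set ts. fv_tm t). \<sigma> x = None}"
    using fv_subst_tm[of \<sigma>] by blast
  then show ?case by simp
next
  case (Neg \<phi>)
  show ?case using Neg[of \<sigma>] by simp
next
  case (Conj \<phi> \<psi>)
  show ?case using Conj.IH(1)[of \<sigma>] Conj.IH(2)[of \<sigma>] by auto
next
  case (Ex x \<phi>)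
  have "fv (subst_fm (\<sigma>(x := None)) \<phi>) - {x} \<subseteq> {y \<in> fv \<phi> - {x}. \<sigma> y = None}"
  proof
    fix y assume "y \<in> fv (subst_fm (\<sigma>(x := None)) \<phi>) - {x}"
    then have "y \<in> {y \<in> fv \<phi>. (\<sigma>(x := None)) y = None}" "y \<noteq> x" using Ex.IH[of "\<sigma>(x := None)"] by blast+
    then show "y \<in> {y \<in> fv \<phi> - {x}. \<sigma> y = None}" by simp
  qed
  then show ?case by simp
qed

lemma inst_fms_over:
  assumes "\<phi> \<in> fms L (m + length e)" and "set e \<subseteq> C"
  shows "inst m \<phi> e \<in> fms_over L C m"
proof -
  let ?\<sigma> = "\<lambda>i. if m \<le> i \<and> i < m + length e then Some (e ! (i - m)) else None"
  have "wf_fm (lang_over L C) (subst_fm ?\<sigma> \<phi>)"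
    by (rule wf_subst_fm) (use assms in \<open>auto simp: fms_def subset_iff split: if_splits\<close>)
  moreover have "fv (subst_fm ?\<sigma> \<phi>) \<subseteq> {..<m}"
  proof
    fix x assume "x \<in> fv (subst_fm ?\<sigma> \<phi>)"
    then have "x \<in> fv \<phi>" "?\<sigma> x = None" using fv_subst_fm[of ?\<sigma> \<phi>] by auto
    then show "x \<in> {..<m}" using assms(1) by (force simp: fms_def split: if_splits)
  qed
  ultimately show ?thesis by (simp add: inst_def fms_def)
qed

text \<open>
  The constants of \<open>L(C)\<close> are turned back into variables, which are then assigned to the parameters
  that they name.  Doubling the old variables leaves room for the new ones.
\<close>

fun cs_tm :: "('f + 'a) tm \<Rightarrow> 'a set" where
  "cs_tm (Var x) = {}"
| "cs_tm (Fun (Inl f) ts) = (\<Union>t\<in>set ts. cs_tm t)"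
| "cs_tm (Fun (Inr a) ts) = {a}"

fun un_tm :: "('a \<Rightarrow> nat) \<Rightarrow> ('f + 'a) tm \<Rightarrow> 'f tm" where
  "un_tm g (Var x) = Var (2 * x)"
| "un_tm g (Fun (Inl f) ts) = Fun f (map (un_tm g) ts)"
| "un_tm g (Fun (Inr a) ts) = Var (g a)"

lemma un_tm:
  "wf_tm (lang_over L C) t \<Longrightarrow> cs_tm t \<subseteq> C \<and> finite (cs_tm t) \<and> wf_tm L (un_tm g t) \<and>
    fv_tm (un_tm g t) \<subseteq> (\<lambda>x. 2 * x) ` fv_tm t \<union> g ` cs_tm t \<and>
    ((\<forall>x\<in>fv_tm t. e' (2 * x) = e x) \<longrightarrow> (\<forall>a\<in>cs_tm t. e' (g a) = a) \<longrightarrow>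
      eval M e' (un_tm g t) = eval (named M) e t)"
proof (induction t rule: cs_tm.induct)
  case (2 f ts)
  have wf: "wf_tm (lang_over L C) t" if "t \<in> set ts" for t using 2(2) that by simp
  note ih = 2(1)[OF _ wf]
  have "map (eval M e') (map (un_tm g) ts) = map (eval (named M) e) ts"
    if "\<forall>x\<in>fv_tm (Fun (Inl f) ts). e' (2 * x) = e x" "\<forall>a\<in>cs_tm (Fun (Inl f) ts). e' (g a) = a"
    using ih that by auto
  then have ev: "eval M e' (un_tm g (Fun (Inl f) ts)) = eval (named M) e (Fun (Inl f) ts)"
    if "\<forall>x\<in>fv_tm (Fun (Inl f) ts). e' (2 * x) = e x" "\<forall>a\<in>cs_tm (Fun (Inl f) ts). e' (g a) = a"
    using that by (simp add: named_def del: map_map)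
  have "fv_tm (un_tm g (Fun (Inl f) ts)) \<subseteq> (\<lambda>x. 2 * x) ` fv_tm (Fun (Inl f) ts) \<union> g ` cs_tm (Fun (Inl f) ts)"
    using ih by (auto simp: image_iff) blast+
  moreover have "cs_tm (Fun (Inl f) ts) \<subseteq> C" "finite (cs_tm (Fun (Inl f) ts))" using ih by auto
  moreover have "wf_tm L (un_tm g (Fun (Inl f) ts))" using 2(2) ih by (auto simp: lang_over_def)
  ultimately show ?case using ev by blast
next
  case (3 a ts)
  then have "a \<in> C" "ts = []" by (auto simp: lang_over_def)
  then show ?case by (simp add: named_def)
qed auto

lemma
  assumes "wf_tm (lang_over L C) t"
  shows cs_tm: "cs_tm t \<subseteq> C" "finite (cs_tm t)" and wf_un_tm: "wf_tm L (un_tm g t)"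
    and fv_un_tm: "fv_tm (un_tm g t) \<subseteq> (\<lambda>x. 2 * x) ` fv_tm t \<union> g ` cs_tm t"
    and eval_un_tm: "(\<And>x. x \<in> fv_tm t \<Longrightarrow> e' (2 * x) = e x) \<Longrightarrow> (\<And>a. a \<in> cs_tm t \<Longrightarrow> e' (g a) = a) \<Longrightarrow>
      eval M e' (un_tm g t) = eval (named M) e t"
  using un_tm[OF assms, of g e' e M] by auto

context fo_structure
begin

lemma dfn_atomic:
  assumes wf: "\<forall>t\<in>set ts. wf_tm (lang_over L C) t"
    and \<phi>: "\<And>ts'. length ts' = length ts \<Longrightarrow> \<forall>t\<in>set ts'. wf_tm L t \<Longrightarrow>
      wf_fm L (\<phi> ts') \<and> fv (\<phi> ts') \<subseteq> (\<Union>t\<in>set ts'. fv_tm t)"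
    and sem: "\<And>e ts'. length ts' = length ts \<Longrightarrow> sat M e (\<phi> ts') \<longleftrightarrow> Q (map (eval M e) ts')"
  shows "dfn (\<lambda>_::nat. 1) C (\<Union>t\<in>set ts. fv_tm t) (\<lambda>E. Q (map (eval (named M) (\<lambda>i. E i ! 0)) ts))"
proof -
  define cs where "cs = (\<Union>t\<in>set ts. cs_tm t)"
  have cs: "finite cs" "cs \<subseteq> C"
  proof -
    have "cs_tm t \<subseteq> C \<and> finite (cs_tm t)" if "t \<in> set ts" for t
      using cs_tm[of L C t] wf that by simp
    then show "finite cs" "cs \<subseteq> C" by (auto simp: cs_def)
  qed
  obtain f :: "'a \<Rightarrow> nat" where f: "inj_on f cs" using finite_imp_inj_to_nat_seg[OF cs(1)] by blast
  define g where "g a = Suc (2 * f a)" for a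
  define w :: "nat \<Rightarrow> ('a, nat) atom" where
    "w i = (if even i then Inr (i div 2, 0) else Inl (inv_into cs f (i div 2)))" for i
  have wg: "w (g a) = Inl a" if "a \<in> cs" for a using f that by (simp add: w_def g_def)
  have w2: "w (2 * x) = Inr (x, 0)" for x by (simp add: w_def)
  let ?ts = "map (un_tm g) ts"
  have wf': "\<forall>t\<in>set ?ts. wf_tm L t" using wf by (auto intro: wf_un_tm)
  have fv': "fv (\<phi> ?ts) \<subseteq> (\<lambda>x. 2 * x) ` (\<Union>t\<in>set ts. fv_tm t) \<union> g ` cs"
  proof -
    have "fv_tm (un_tm g t) \<subseteq> (\<lambda>x. 2 * x) ` fv_tm t \<union> g ` cs_tm t" if "t \<in> set ts" for t
      by (rule fv_un_tm) (use wf that in blast)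
    then have "(\<Union>t\<in>set ts. fv_tm (un_tm g t)) \<subseteq> (\<Union>t\<in>set ts. (\<lambda>x. 2 * x) ` fv_tm t \<union> g ` cs_tm t)"
      by (intro UN_mono) auto
    then have "(\<Union>t\<in>set ?ts. fv_tm t) \<subseteq> (\<lambda>x. 2 * x) ` (\<Union>t\<in>set ts. fv_tm t) \<union> g ` cs"
      unfolding cs_def image_UN by (simp add: UN_Un_distrib)
    moreover have "fv (\<phi> ?ts) \<subseteq> (\<Union>t\<in>set ?ts. fv_tm t)" using \<phi>[of ?ts] wf' by (metis length_map)
    ultimately show ?thesis by (rule order_trans[rotated])
  qed
  show ?thesis
  proof (rule dfnI[of "\<phi> ?ts" w])
    show "wf_fm L (\<phi> ?ts)" using \<phi>[of ?ts] wf' by simp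
    fix i assume "i \<in> fv (\<phi> ?ts)"
    then have "i \<in> (\<lambda>x. 2 * x) ` (\<Union>t\<in>set ts. fv_tm t) \<union> g ` cs" using fv' by (rule subsetD[rotated])
    then consider x where "i = 2 * x" "x \<in> (\<Union>t\<in>set ts. fv_tm t)" | a where "i = g a" "a \<in> cs" by blast
    then show "w i \<in> atoms (\<lambda>_. 1) C (\<Union>t\<in>set ts. fv_tm t)"
    proof cases
      case 1
      then show ?thesis by (simp add: w2)
    next
      case 2
      then show ?thesis using cs(2) wg by auto
    qed
  next
    fix E :: "nat \<Rightarrow> 'a list"
    have "eval M (\<lambda>i. val E (w i)) (un_tm g t) = eval (named M) (\<lambda>i. E i ! 0) t" if t: "t \<in> set ts" for t
    proof -
      have "\<forall>a\<in>cs_tm t. val E (w (g a)) = a"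
      proof
        fix a assume "a \<in> cs_tm t"
        then have "a \<in> cs" using t by (auto simp: cs_def)
        then show "val E (w (g a)) = a" by (simp add: wg)
      qed
      then show ?thesis using wf t by (intro eval_un_tm[of L C t]) (auto simp: w2)
    qed
    then have "map (eval M (\<lambda>i. val E (w i))) ?ts = map (eval (named M) (\<lambda>i. E i ! 0)) ts" by simp
    then show "Q (map (eval (named M) (\<lambda>i. E i ! 0)) ts) \<longleftrightarrow> sat M (\<lambda>i. val E (w i)) (\<phi> ?ts)"
      using sem[of ?ts] by (metis length_map)
  qed
qed

lemma dfn_sat_named:
  "wf_fm (lang_over L C) \<chi> \<Longrightarrow> dfn (\<lambda>_::nat. 1) C (fv \<chi>) (\<lambda>E. sat (named M) (\<lambda>i. E i ! 0) \<chi>)"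
proof (induction \<chi>)
  case (Eq s t)
  have "dfn (\<lambda>_::nat. 1) C (\<Union>t\<in>set [s, t]. fv_tm t)
    (\<lambda>E. (\<lambda>as. as ! 0 = as ! 1) (map (eval (named M) (\<lambda>i. E i ! 0)) [s, t]))"
    by (rule dfn_atomic[where \<phi> = "\<lambda>ts. Eq (ts ! 0) (ts ! 1)"]) (use Eq in \<open>auto simp: length_Suc_conv\<close>)
  then show ?case by simp
next
  case (Rel r ts)
  have "dfn (\<lambda>_::nat. 1) C (\<Union>t\<in>set ts. fv_tm t) (\<lambda>E. rl M r (map (eval (named M) (\<lambda>i. E i ! 0)) ts))"
    by (rule dfn_atomic[where \<phi> = "\<lambda>ts. Rel r ts"]) (use Rel in \<open>auto simp: lang_over_def\<close>)
  then show ?case by (simp add: named_def)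
next
  case (Neg \<chi>)
  then show ?case by (simp add: dfn_not)
next
  case (Conj \<chi> \<psi>)
  have "dfn (\<lambda>_::nat. 1) C (fv (Conj \<chi> \<psi>)) (\<lambda>E. sat (named M) (\<lambda>i. E i ! 0) \<chi>)"
    by (rule dfn_mono[OF Conj.IH(1)]) (use Conj.prems in auto)
  moreover have "dfn (\<lambda>_::nat. 1) C (fv (Conj \<chi> \<psi>)) (\<lambda>E. sat (named M) (\<lambda>i. E i ! 0) \<psi>)"
    by (rule dfn_mono[OF Conj.IH(2)]) (use Conj.prems in auto)
  ultimately show ?case by (simp add: dfn_conj)
next
  case (Ex x \<chi>)
  have "dfn (\<lambda>_::nat. 1) C (insert x (fv \<chi>)) (\<lambda>E. sat (named M) (\<lambda>i. E i ! 0) \<chi>)"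
    by (rule dfn_mono[OF Ex.IH]) (use Ex.prems in auto)
  from dfn_ex[OF this] have "dfn (\<lambda>_::nat. 1) C (fv \<chi> - {x})
    (\<lambda>E. \<exists>a\<in>tup 1. sat (named M) (\<lambda>i. (E(x := a)) i ! 0) \<chi>)" .
  then have "dfn (\<lambda>_::nat. 1) C (fv (Ex x \<chi>))
    (\<lambda>E. \<exists>a\<in>tup 1. sat (named M) (\<lambda>i. (E(x := a)) i ! 0) \<chi>)" by simp
  then show ?case
  proof (rule dfn_cong)
    fix E :: "nat \<Rightarrow> 'a list"
    have upd: "(\<lambda>i. (E(x := [a])) i ! 0) = (\<lambda>i. E i ! 0)(x := a)" for a by auto
    have "tup 1 = (\<lambda>a. [a]) ` U" by (auto simp: tuples_def length_Suc_conv)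
    moreover have "universe (named M) = U" by (simp add: named_def)
    ultimately show "sat (named M) (\<lambda>i. E i ! 0) (Ex x \<chi>) = (\<exists>a\<in>tup 1. sat (named M) (\<lambda>i. (E(x := a)) i ! 0) \<chi>)"
      by (simp add: upd del: fun_upd_apply)
  qed
qed

text \<open>
  The relations definable over \<open>C\<close>; they take the place of \<open>L(C)\<close>-formulas, by
  \<open>rdef_fms_over\<close> and \<open>fms_over_rdef\<close>.
\<close>

definition rdef :: "nat \<Rightarrow> 'a set \<Rightarrow> ('a list \<Rightarrow> bool) \<Rightarrow> bool" where
  "rdef m C R \<longleftrightarrow> (\<exists>\<psi> e. \<psi> \<in> fms L (m + length e) \<and> set e \<subseteq> C \<and> (\<forall>a\<in>tup m. R a \<longleftrightarrow> holds M \<psi> (a @ e)))"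

lemma rdefE:
  assumes "rdef m C R"
  obtains \<psi> e where "\<psi> \<in> fms L (m + length e)" "set e \<subseteq> C" "\<And>a. a \<in> tup m \<Longrightarrow> R a \<longleftrightarrow> holds M \<psi> (a @ e)"
  using assms unfolding rdef_def by blast

lemma rdefI: "\<psi> \<in> fms L (m + length e) \<Longrightarrow> set e \<subseteq> C \<Longrightarrow> (\<And>a. a \<in> tup m \<Longrightarrow> R a \<longleftrightarrow> holds M \<psi> (a @ e)) \<Longrightarrow> rdef m C R"
  unfolding rdef_def by blast

lemma rdef_mono: "rdef m C R \<Longrightarrow> C \<subseteq> C' \<Longrightarrow> rdef m C' R"
  by (elim rdefE) (rule rdefI, auto)

lemma dlist_tup:
  assumes "dlist ar C J m F" and "C \<subseteq> U" and "E \<in> envs ar"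
  shows "F E \<in> tup m"
proof -
  obtain ts where ts: "length ts = m" "set ts \<subseteq> atoms ar C J" "F E = map (val E) ts"
    using assms(1,3) by (auto simp: dlist_def)
  have "val E t \<in> U" if "t \<in> set ts" for t
  proof (cases t)
    case (Inl a)
    then have "Inl a \<in> atoms ar C J" using that ts(2) by auto
    then show ?thesis using Inl assms(2) by auto
  next
    case (Inr vk)
    obtain v k where vk: "vk = (v, k)" by fastforce
    have "Inr (v, k) \<in> atoms ar C J" using that ts(2) Inr vk by auto
    then have "k < length (E v)" "set (E v) \<subseteq> U"
      using envs_tup[OF assms(3), of v] by (auto simp: tuples_def)
    then show ?thesis using Inr vk nth_mem[of k "E v"] by (simp add: subset_iff)
  qed
  then show ?thesis using ts(1,3) by (auto simp: tuples_def)
qed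

lemma dfn_rdef:
  assumes R: "rdef m C R" and F: "dlist ar C' J m F" and C: "C \<subseteq> C'" "C' \<subseteq> U"
  shows "dfn ar C' J (\<lambda>E. R (F E))"
proof -
  obtain \<psi> e where \<psi>: "\<psi> \<in> fms L (m + length e)" "set e \<subseteq> C" "\<And>a. a \<in> tup m \<Longrightarrow> R a \<longleftrightarrow> holds M \<psi> (a @ e)"
    using R unfolding rdef_def by blast
  have "dfn ar C' J (\<lambda>E. holds M \<psi> (F E @ e))"
    by (rule dfn_holds[OF \<psi>(1) dlist_append[OF F dlist_const]]) (use \<psi>(2) C in \<open>auto simp: tuples_def\<close>)
  then show ?thesis by (rule dfn_cong) (use dlist_tup[OF F C(2)] \<psi>(3) in auto)
qed

lemma rdef_dfn:
  assumes "dfn ar C {v} (\<lambda>E. R (E v))" and m: "m = ar v"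
  shows "rdef m C R"
proof -
  obtain \<phi> ts where p: "\<phi> \<in> fms L (ar v + length ts)" "set ts \<subseteq> atoms ar C ({} - {v})"
    "\<forall>E\<in>envs ar. R (E v) \<longleftrightarrow> holds M \<phi> (E v @ map (val E) ts)"
    using dfn_split[of ar C v "{}" "\<lambda>E. R (E v)"] assms(1) by blast
  have "\<exists>a\<in>C. t = Inl a" if "t \<in> set ts" for t using p(2) that by (auto simp: atoms_def)
  then have "\<forall>t\<in>set ts. t = Inl (projl t) \<and> projl t \<in> C" by (metis sum.sel(1))
  then have ts: "map (val E) ts = map projl ts" "set (map projl ts) \<subseteq> C" for E
    by (auto simp: val_def split: sum.splits)
  obtain E0 where E0: "E0 \<in> envs ar" using envs_nonempty by blast
  show ?thesis
  proof (rule rdefI[of \<phi> m "map projl ts"])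
    fix a assume "a \<in> tup m"
    then have "E0(v := a) \<in> envs ar" using E0 m by (simp add: envs_upd)
    then have "R ((E0(v := a)) v) \<longleftrightarrow> holds M \<phi> ((E0(v := a)) v @ map (val (E0(v := a))) ts)" using p(3) by blast
    then show "R a \<longleftrightarrow> holds M \<phi> (a @ map projl ts)" by (simp add: ts(1))
  qed (use p(1) m ts in auto)
qed

lemma rdef_fms_over:
  assumes "rdef m C R"
  shows "\<exists>\<chi>\<in>fms_over L C m. \<forall>a\<in>tup m. holds (named M) \<chi> a \<longleftrightarrow> R a"
proof -
  obtain \<psi> e where \<psi>: "\<psi> \<in> fms L (m + length e)" "set e \<subseteq> C" "\<And>a. a \<in> tup m \<Longrightarrow> R a \<longleftrightarrow> holds M \<psi> (a @ e)"
    using assms unfolding rdef_def by blast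
  then show ?thesis
    by (intro bexI[of _ "inst m \<psi> e"] inst_fms_over) (auto simp: holds_inst tuples_def)
qed

lemma fms_over_rdef:
  assumes "\<chi> \<in> fms_over L C m"
  shows "rdef m C (holds (named M) \<chi>)"
proof -
  obtain u where u: "u \<in> U" using U_nonempty by blast
  have wf: "wf_fm (lang_over L C) \<chi>" "fv \<chi> \<subseteq> {..<m}" using assms by (auto simp: fms_def)
  have "dfn (\<lambda>_::nat. 1) C {..<m} (\<lambda>E. sat (named M) (\<lambda>i. E i ! 0) \<chi>)"
    using dfn_mono[OF dfn_sat_named[OF wf(1)]] wf(2) by blast
  then have "dfn (\<lambda>_::unit. m) C {()} (\<lambda>E. sat (named M) (\<lambda>i. [if i < m then E () ! i else u] ! 0) \<chi>)"
  proof (rule dfn_subst)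
    fix v :: nat assume v: "v \<in> {..<m}"
    have "dlist (\<lambda>_::unit. m) C {()} 1 (\<lambda>E. map (\<lambda>i. E () ! i) [v])"
      by (rule dlist_map_nth[OF dlist_var]) (use v in auto)
    then show "dlist (\<lambda>_::unit. m) C {()} 1 (\<lambda>E. [if v < m then E () ! v else u])" using v by simp
  qed (use u in \<open>auto simp: envs_def tuples_def subset_iff\<close>)
  then have "dfn (\<lambda>_::unit. m) C {()} (\<lambda>E. holds (named M) \<chi> (E ()))"
  proof (rule dfn_cong)
    fix E :: "unit \<Rightarrow> 'a list"
    show "holds (named M) \<chi> (E ()) = sat (named M) (\<lambda>i. [if i < m then E () ! i else u] ! 0) \<chi>"
      unfolding holds_def by (rule sat_cong) (use wf(2) in auto)
  qed
  then show ?thesis by (rule rdef_dfn) simp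
qed

lemma rdef_const: "C \<subseteq> U \<Longrightarrow> rdef m C (\<lambda>_. b)"
  by (rule rdef_dfn[of "\<lambda>_::unit. m" C "()"]) (simp_all add: dfn_const)

lemma dfn_rdef_unit: "rdef m C R \<Longrightarrow> C \<subseteq> U \<Longrightarrow> dfn (\<lambda>_::unit. m) C {()} (\<lambda>E. R (E ()))"
  by (rule dfn_rdef) (auto intro: dlist_var)

lemma rdef_not: "rdef m C R \<Longrightarrow> C \<subseteq> U \<Longrightarrow> rdef m C (\<lambda>a. \<not> R a)"
  by (rule rdef_dfn[of "\<lambda>_::unit. m" C "()"]) (simp_all add: dfn_not dfn_rdef_unit)

lemma rdef_conj: "rdef m C R \<Longrightarrow> rdef m C R' \<Longrightarrow> C \<subseteq> U \<Longrightarrow> rdef m C (\<lambda>a. R a \<and> R' a)"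
  by (rule rdef_dfn[of "\<lambda>_::unit. m" C "()"]) (simp_all add: dfn_conj dfn_rdef_unit)

lemma rdef_ball_finite: "finite I \<Longrightarrow> (\<And>i. i \<in> I \<Longrightarrow> rdef m C (R i)) \<Longrightarrow> C \<subseteq> U \<Longrightarrow> rdef m C (\<lambda>a. \<forall>i\<in>I. R i a)"
  by (rule rdef_dfn[of "\<lambda>_::unit. m" C "()"]) (simp_all add: dfn_ball_finite dfn_rdef_unit)

end

section \<open>Saturation and homogeneity of the monster model\<close>

lemma small_subset: "small \<kappa> A \<Longrightarrow> B \<subseteq> A \<Longrightarrow> small \<kappa> B"
  unfolding small_def using card_of_mono1 ordLeq_ordLess_trans by blast

lemma small_image: "small \<kappa> A \<Longrightarrow> small \<kappa> (f ` A)"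
  unfolding small_def using card_of_image ordLeq_ordLess_trans by blast

locale monster = fo_structure L M
  for L :: "('f, 'r) language" and M :: "('f, 'r, 'a) struct" +
  fixes \<kappa> :: "'k rel"
  assumes Card: "Card_order \<kappa>" and small_L: "small \<kappa> {\<phi>. wf_fm L \<phi>}"
    and sat: "saturated L \<kappa> M" and hom: "strongly_homogeneous L \<kappa> M"
begin

lemma infinite_fms: "infinite {\<phi>. wf_fm L \<phi>}"
proof
  assume "finite {\<phi>. wf_fm L \<phi>}"
  moreover have "(\<lambda>i. Eq (Var i) (Var i)) ` UNIV \<subseteq> {\<phi>. wf_fm L \<phi>}" by auto
  ultimately have "finite ((\<lambda>i. Eq (Var i) (Var i) :: ('f, 'r) fm) ` UNIV)" using finite_subset by blast
  moreover have "inj (\<lambda>i. Eq (Var i) (Var i) :: ('f, 'r) fm)" by (auto simp: inj_on_def)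
  ultimately show False using finite_imageD infinite_UNIV_nat by blast
qed

lemma infinite_kappa: "infinite (Field \<kappa>)"
proof -
  have "(card_of {\<phi>. wf_fm L \<phi>}, card_of (Field \<kappa>)) \<in> ordLeq"
    using small_L Card unfolding small_def
    by (meson card_of_Field_ordIso ordIso_symmetric ordLeq_ordIso_trans ordLess_imp_ordLeq)
  then show ?thesis using infinite_fms card_of_ordLeq_infinite by blast
qed

lemma small_finite: "finite A \<Longrightarrow> small \<kappa> A"
  unfolding small_def using infinite_kappa Card
    finite_ordLess_infinite[of "card_of A" \<kappa>] card_of_Well_order[of A] card_order_on_well_order_on[of _ \<kappa>]
  by (simp add: Field_card_of)

lemma small_Un: "small \<kappa> A \<Longrightarrow> small \<kappa> B \<Longrightarrow> small \<kappa> (A \<union> B)"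
  unfolding small_def using infinite_kappa Card card_of_Un_ordLess_infinite_Field by blast

lemma small_insert: "small \<kappa> A \<Longrightarrow> small \<kappa> (insert a A)"
  using small_Un[OF small_finite[of "{a}"]] by simp

lemma small_UN_finite:
  assumes "small \<kappa> I" and "\<And>i. i \<in> I \<Longrightarrow> finite (A i)"
  shows "small \<kappa> (\<Union>i\<in>I. A i)"
proof (cases "finite I")
  case True
  then show ?thesis using assms(2) by (intro small_finite) auto
next
  case False
  have "(card_of (\<Union>i\<in>I. A i), card_of I) \<in> ordLeq"
  proof (rule card_of_UNION_ordLeq_infinite[OF False])
    show "\<forall>i\<in>I. (card_of (A i), card_of I) \<in> ordLeq"
      using assms(2) False by (metis card_of_ordLeq_infinite card_of_ordLeq ordLeq_total card_of_Well_order)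
  qed (rule card_of_mono1, rule order_refl)
  then show ?thesis using assms(1) ordLeq_ordLess_trans unfolding small_def by blast
qed

lemma small_countable: "small \<kappa> (A :: nat set)"
proof -
  have "(\<lambda>i. Eq (Var i) (Var i) :: ('f, 'r) fm) ` UNIV \<subseteq> {\<phi>. wf_fm L \<phi>}" by auto
  then have "small \<kappa> ((\<lambda>i. Eq (Var i) (Var i) :: ('f, 'r) fm) ` UNIV)" using small_L small_subset by blast
  from small_image[OF this, of "\<lambda>\<phi>. case \<phi> of Eq s t \<Rightarrow> (case s of Var i \<Rightarrow> i | _ \<Rightarrow> 0) | _ \<Rightarrow> 0"]
  have "small \<kappa> (UNIV :: nat set)" by (simp add: image_image)
  then show ?thesis using small_subset by blast
qed

lemma small_nat_image: "small \<kappa> (f ` (A :: nat set))"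
  using small_countable small_image by blast

text \<open>The partial type given by \<open>\<D>\<close> is completed by an ultrafilter.\<close>

lemma saturation_1:
  assumes C: "C \<subseteq> U" "small \<kappa> C" and D: "\<And>R. R \<in> \<D> \<Longrightarrow> rdef 1 C R"
    and fip: "\<And>F. finite F \<Longrightarrow> F \<subseteq> \<D> \<Longrightarrow> \<exists>a\<in>tup 1. \<forall>R\<in>F. R a"
  shows "\<exists>a\<in>tup 1. \<forall>R\<in>\<D>. R a"
proof -
  have "\<exists>a. \<forall>R\<in>F. R a" if "finite F" "F \<subseteq> insert (\<lambda>a. a \<in> tup 1) \<D>" for F
    using fip[of "F - {\<lambda>a. a \<in> tup 1}"] that by blast
  then obtain W where W: "uq W" "\<forall>R\<in>insert (\<lambda>a. a \<in> tup 1) \<D>. W R" using uq_exists by blast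
  have Wt: "W (\<lambda>a. a \<in> tup 1)" using W(2) by blast
  define p where "p = {\<chi> \<in> fms_over L C 1. W (\<lambda>a. holds (named M) \<chi> a)}"
  have "p \<in> S L M 1 C"
    unfolding S_def partial_type_def
  proof (intro CollectI conjI allI impI ballI)
    show "p \<subseteq> fms_over L C 1" by (auto simp: p_def)
  next
    fix p0 assume "p0 \<subseteq> p" "finite p0"
    then have "W (\<lambda>a. \<forall>\<chi>\<in>p0. holds (named M) \<chi> a)" by (auto simp: p_def uq_ball[OF _ W(1)])
    with Wt have "W (\<lambda>a. a \<in> tup 1 \<and> (\<forall>\<chi>\<in>p0. holds (named M) \<chi> a))" by (rule uq_conjI[OF W(1)])
    from uq_ex[OF W(1), OF this] show "\<exists>a\<in>tup 1. \<forall>\<chi>\<in>p0. holds (named M) \<chi> a" by blast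
  next
    fix \<chi> assume c: "\<chi> \<in> fms_over L C 1"
    then have "Neg \<chi> \<in> fms_over L C 1" by (simp add: fms_def)
    moreover have "holds (named M) (Neg \<chi>) a \<longleftrightarrow> \<not> holds (named M) \<chi> a" for a by (simp add: holds_def)
    then have "holds (named M) (Neg \<chi>) = (\<lambda>a. \<not> holds (named M) \<chi> a)" by (rule ext)
    then have "W (holds (named M) (Neg \<chi>)) \<longleftrightarrow> \<not> W (holds (named M) \<chi>)"
      using uq_not[OF W(1), of "holds (named M) \<chi>"] by simp
    ultimately show "\<chi> \<in> p \<or> Neg \<chi> \<in> p" using c by (auto simp: p_def)
  qed
  then obtain a where a: "realizes M 1 a p" using sat C unfolding saturated_def by blast
  have "R a" if R: "R \<in> \<D>" for R
  proof -
    obtain \<chi> where x: "\<chi> \<in> fms_over L C 1" "\<forall>a\<in>tup 1. holds (named M) \<chi> a \<longleftrightarrow> R a"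
      using rdef_fms_over[OF D[OF R]] by blast
    have "W (\<lambda>a. holds (named M) \<chi> a) = W R" by (rule uq_cong[OF W(1), OF Wt]) (use x(2) in blast)
    moreover have "W R" using W(2) R by blast
    ultimately have "\<chi> \<in> p" using x(1) by (simp add: p_def)
    then show "R a" using a x(2) by (auto simp: realizes_def)
  qed
  then show ?thesis using a by (auto simp: realizes_def)
qed

text \<open>
  The last entry of a tuple is realized first, from the projections of the relations; it is then a
  parameter for the remaining entries.
\<close>

lemma saturation:
  "C \<subseteq> U \<Longrightarrow> small \<kappa> C \<Longrightarrow> (\<And>R. R \<in> \<D> \<Longrightarrow> rdef m C R) \<Longrightarrow>
    (\<And>F. finite F \<Longrightarrow> F \<subseteq> \<D> \<Longrightarrow> \<exists>a\<in>tup m. \<forall>R\<in>F. R a) \<Longrightarrow> \<exists>a\<in>tup m. \<forall>R\<in>\<D>. R a"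
proof (induction m arbitrary: C \<D>)
  case 0
  have "tup 0 = {[]}" by (auto simp: tuples_def)
  moreover have "R []" if "R \<in> \<D>" for R using "0.prems"(4)[of "{R}"] that calculation by auto
  ultimately show ?case by auto
next
  case (Suc m)
  define \<D>1 where "\<D>1 = (\<lambda>F xs. \<exists>a\<in>tup m. \<forall>R\<in>F. R (a @ xs)) ` {F. finite F \<and> F \<subseteq> \<D>}"
  have "\<exists>xs\<in>tup 1. \<forall>R\<in>\<D>1. R xs"
  proof (rule saturation_1[OF Suc.prems(1,2)])
    fix R assume "R \<in> \<D>1"
    then obtain F where F: "finite F" "F \<subseteq> \<D>" "R = (\<lambda>xs. \<exists>a\<in>tup m. \<forall>R\<in>F. R (a @ xs))" by (auto simp: \<D>1_def)
    define ar where "ar = (\<lambda>b. if b then m else 1)"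
    have "dfn ar C (insert True {False}) (\<lambda>E. \<forall>R\<in>F. R (E True @ E False))"
    proof (rule dfn_ball_finite[OF F(1)])
      fix R assume "R \<in> F"
      then have "rdef (Suc m) C R" using F(2) Suc.prems(3) by blast
      then show "dfn ar C (insert True {False}) (\<lambda>E. R (E True @ E False))"
        by (rule dfn_rdef) (auto simp: ar_def Suc.prems(1) intro!: dlist_append'[where m = m and k = 1] dlist_var)
    qed
    from dfn_ex[OF this] have "dfn ar C {False} (\<lambda>E. \<exists>a\<in>tup m. \<forall>R\<in>F. R (a @ E False))"
      by (simp add: ar_def insert_Diff_if)
    then show "rdef 1 C R" unfolding F(3) by (rule rdef_dfn) (simp add: ar_def)
  next
    fix \<F> assume "finite \<F>" "\<F> \<subseteq> \<D>1"
    then obtain G where G: "G \<subseteq> {F. finite F \<and> F \<subseteq> \<D>}" "finite G" "\<F> = (\<lambda>F xs. \<exists>a\<in>tup m. \<forall>R\<in>F. R (a @ xs)) ` G"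
      unfolding \<D>1_def by (meson finite_subset_image)
    have "finite (\<Union>G)" "\<Union>G \<subseteq> \<D>" using G by auto
    then obtain c where c: "c \<in> tup (Suc m)" "\<forall>R\<in>\<Union>G. R c" using Suc.prems(4) by blast
    then obtain a x where ax: "a \<in> tup m" "x \<in> U" "c = a @ [x]" using tuples_Suc_snoc by metis
    have "[x] \<in> tup 1" using ax by (simp add: tuples_def)
    moreover have "\<forall>R\<in>\<F>. R [x]" using G(3) c(2) ax by auto
    ultimately show "\<exists>a\<in>tup 1. \<forall>R\<in>\<F>. R a" by blast
  qed
  then obtain x where x: "x \<in> U" "\<forall>R\<in>\<D>1. R [x]" by (auto simp: tuples_def length_Suc_conv)
  define \<D>2 where "\<D>2 = (\<lambda>R a. R (a @ [x])) ` \<D>"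
  have "\<exists>a\<in>tup m. \<forall>R\<in>\<D>2. R a"
  proof (rule Suc.IH)
    show C': "insert x C \<subseteq> U" using x Suc.prems(1) by simp
    show "small \<kappa> (insert x C)" using Suc.prems(2) by (rule small_insert)
    fix R assume "R \<in> \<D>2"
    then obtain R0 where R0: "R0 \<in> \<D>" "R = (\<lambda>a. R0 (a @ [x]))" by (auto simp: \<D>2_def)
    have "dfn (\<lambda>_::unit. m) (insert x C) {()} (\<lambda>E. R0 (E () @ [x]))"
      by (rule dfn_rdef[OF Suc.prems(3)[OF R0(1)]])
        (use C' in \<open>auto simp: tuples_def intro!: dlist_append'[where m = m and k = 1] dlist_var dlist_const\<close>)
    then show "rdef m (insert x C) R" unfolding R0(2) by (rule rdef_dfn) simp
  next
    fix \<F> assume "finite \<F>" "\<F> \<subseteq> \<D>2"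
    then obtain G where G: "G \<subseteq> \<D>" "finite G" "\<F> = (\<lambda>R a. R (a @ [x])) ` G"
      unfolding \<D>2_def by (meson finite_subset_image)
    then have "(\<lambda>xs. \<exists>a\<in>tup m. \<forall>R\<in>G. R (a @ xs)) \<in> \<D>1" by (auto simp: \<D>1_def)
    from bspec[OF x(2) this] obtain a where "a \<in> tup m" "\<forall>R\<in>G. R (a @ [x])" by blast
    then show "\<exists>a\<in>tup m. \<forall>R\<in>\<F>. R a" using G(3) by auto
  qed
  then obtain a where "a \<in> tup m" "\<forall>R\<in>\<D>. R (a @ [x])" by (auto simp: \<D>2_def)
  then show ?case using x(1) by (intro bexI[of _ "a @ [x]"]) (auto simp: tuples_def)
qed

text \<open>
  Compactness for a small number of variables: by Zorn's lemma there is a maximal partial solution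
  that is consistent with every finite set of constraints.  It is total, because a
  value for one more variable has to realize the projections of the constraints, which form a
  type over a small set.
\<close>

lemma compactness:
  fixes ar :: "'v \<Rightarrow> nat"
  assumes C: "C \<subseteq> U" "small \<kappa> C" and J: "small \<kappa> J" and \<Gamma>: "\<And>P. P \<in> \<Gamma> \<Longrightarrow> dfn ar C J P"
    and fip: "\<And>F. finite F \<Longrightarrow> F \<subseteq> \<Gamma> \<Longrightarrow> \<exists>E\<in>envs ar. \<forall>P\<in>F. P E"
  shows "\<exists>E\<in>envs ar. \<forall>P\<in>\<Gamma>. P E"
proof -
  define ok where "ok h F \<longleftrightarrow> (\<exists>E\<in>envs ar. (\<forall>(v, a)\<in>h. E v = a) \<and> (\<forall>P\<in>F. P E))" for h F
  have ok_env: "\<exists>E\<in>envs ar. (\<forall>v a. (v, a) \<in> h \<longrightarrow> E v = a) \<and> (\<forall>P\<in>F. P E)" if "ok h F" for h F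
    using that unfolding ok_def by fast
  define \<A> where "\<A> = {h. fst ` h \<subseteq> J \<and> (\<forall>F. finite F \<longrightarrow> F \<subseteq> \<Gamma> \<longrightarrow> ok h F)}"
  have "{} \<in> \<A>" using fip by (auto simp: \<A>_def ok_def)
  moreover have "\<Union>\<C> \<in> \<A>" if ne: "\<C> \<noteq> {}" and ch: "subset.chain \<A> \<C>" for \<C>
  proof -
    have sub: "\<C> \<subseteq> \<A>" using ch by (simp add: subset_chain_def)
    have uniq: "a = b \<and> a \<in> tup (ar v)" if "(v, a) \<in> \<Union>\<C>" "(v, b) \<in> \<Union>\<C>" for v a b
    proof -
      have "finite {(v, a), (v, b)}" "{(v, a), (v, b)} \<subseteq> \<Union>\<C>" using that by auto
      from finite_subset_Union_chain[OF this ne ch] obtain g where g: "g \<in> \<C>" "{(v, a), (v, b)} \<subseteq> g" by blast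
      then have "ok g {}" using sub by (auto simp: \<A>_def)
      from ok_env[OF this] obtain E where E: "E \<in> envs ar" "\<forall>v a. (v, a) \<in> g \<longrightarrow> E v = a" by blast
      then have "E v = a" "E v = b" using g(2) by auto
      then show ?thesis using envs_tup[OF E(1), of v] by simp
    qed
    have "ok (\<Union>\<C>) F" if F: "finite F" "F \<subseteq> \<Gamma>" for F
    proof -
      have "dfn ar C J (\<lambda>E. \<forall>P\<in>F. P E)" using F \<Gamma> by (intro dfn_ball_finite) auto
      from dfn_finite_support[OF this] obtain C0 J0 where J0: "finite J0" "dfn ar C0 J0 (\<lambda>E. \<forall>P\<in>F. P E)" by blast
      define h0 where "h0 = {(v, a). (v, a) \<in> \<Union>\<C> \<and> v \<in> J0}"
      have "inj_on fst h0" using uniq unfolding h0_def inj_on_def by (metis (no_types, lifting) mem_Collect_eq case_prodE fst_conv)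
      moreover have "finite (fst ` h0)" using J0(1) by (rule finite_subset[rotated]) (auto simp: h0_def)
      ultimately have "finite h0" by (rule finite_imageD[rotated])
      moreover have "h0 \<subseteq> \<Union>\<C>" by (auto simp: h0_def)
      ultimately obtain g where g: "g \<in> \<C>" "h0 \<subseteq> g" using finite_subset_Union_chain[OF _ _ ne ch] by blast
      then have "ok g F" using sub F by (auto simp: \<A>_def)
      from ok_env[OF this] obtain E where E: "E \<in> envs ar" "\<forall>v a. (v, a) \<in> g \<longrightarrow> E v = a" "\<forall>P\<in>F. P E" by blast
      define E1 where "E1 v = (if v \<notin> J0 \<and> (\<exists>a. (v, a) \<in> \<Union>\<C>) then SOME a. (v, a) \<in> \<Union>\<C> else E v)" for v
      have some: "(v, SOME a. (v, a) \<in> \<Union>\<C>) \<in> \<Union>\<C>" if "(v, a) \<in> \<Union>\<C>" for v a using that by (rule someI)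
      have "E1 v \<in> tup (ar v)" for v using some uniq envs_tup[OF E(1)] unfolding E1_def by (metis (no_types, lifting))
      then have E1: "E1 \<in> envs ar" by (simp add: envs_def)
      have "E1 v = a" if va: "(v, a) \<in> \<Union>\<C>" for v a
      proof (cases "v \<in> J0")
        case True
        then have "(v, a) \<in> h0" using va by (simp add: h0_def)
        then show ?thesis using E(2) g(2) True by (auto simp: E1_def)
      next
        case False
        then show ?thesis using va uniq[OF some[OF va] va] unfolding E1_def by auto
      qed
      moreover have "\<forall>P\<in>F. P E1" using dfn_agree[OF J0(2) E(1) E1] E(3) by (simp add: E1_def)
      ultimately show ?thesis using E1 unfolding ok_def by (intro bexI[of _ E1]) auto
    qed
    moreover have "fst ` \<Union>\<C> \<subseteq> J" using sub by (auto simp: \<A>_def)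
    ultimately show ?thesis by (simp add: \<A>_def)
  qed
  ultimately obtain h where h: "h \<in> \<A>" and max: "\<And>h'. h' \<in> \<A> \<Longrightarrow> h \<subseteq> h' \<Longrightarrow> h' = h"
    using subset_Zorn_nonempty[of \<A>] by blast
  have okh: "ok h F" if "finite F" "F \<subseteq> \<Gamma>" for F using h that by (simp add: \<A>_def)
  obtain E0 where E0: "E0 \<in> envs ar" "\<forall>v a. (v, a) \<in> h \<longrightarrow> E0 v = a" using ok_env[OF okh[of "{}"]] by auto
  define D where "D = fst ` h"
  have DJ: "D \<subseteq> J" using h by (simp add: \<A>_def D_def)
  have hD: "(v, a) \<in> h \<longleftrightarrow> v \<in> D \<and> a = E0 v" for v a
  proof
    show "(v, a) \<in> h" if "v \<in> D \<and> a = E0 v" using that E0(2) by (auto simp: D_def)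
  qed (use E0(2) in \<open>force simp: D_def\<close>)
  have "J \<subseteq> D"
  proof (rule ccontr)
    assume "\<not> J \<subseteq> D"
    then obtain v where v: "v \<in> J" "v \<notin> D" by blast
    define C' where "C' = C \<union> (\<Union>u\<in>D. set (E0 u))"
    have C': "C' \<subseteq> U" using C(1) envs_tup[OF E0(1)] by (auto simp: C'_def tuples_def)
    have sC': "small \<kappa> C'" unfolding C'_def
      by (rule small_Un[OF C(2) small_UN_finite[OF small_subset[OF J DJ]]]) simp
    define R where "R F a \<longleftrightarrow> (\<exists>E\<in>envs ar. (\<forall>u\<in>D. E u = E0 u) \<and> E v = a \<and> (\<forall>P\<in>F. P E))" for F a
    have Rdef: "rdef (ar v) C' (R F)" if F: "finite F" "F \<subseteq> \<Gamma>" for F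
    proof -
      define G where "G E = (\<lambda>u. if u \<in> D then E0 u else E u)" for E
      have GE: "G E \<in> envs ar" if "E \<in> envs ar" for E using that E0(1) by (simp add: envs_def G_def)
      have "dfn ar C J (\<lambda>E. \<forall>P\<in>F. P E)" using F \<Gamma> by (intro dfn_ball_finite) auto
      then have "dfn ar C' UNIV (\<lambda>E. \<forall>P\<in>F. P (G E))"
      proof (rule dfn_subst)
        fix u
        show "dlist ar C' UNIV (ar u) (\<lambda>E. G E u)"
        proof (cases "u \<in> D")
          case True
          have "E0 u \<in> tuples C' (ar u)" using envs_tup[OF E0(1), of u] True by (auto simp: tuples_def C'_def)
          then show ?thesis using True by (simp add: G_def dlist_const)
        qed (simp add: G_def dlist_var)
      qed (use GE in \<open>auto simp: C'_def\<close>)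
      from dfn_ex_set[OF this, of "- {v}"]
      have "dfn ar C' {v} (\<lambda>E. \<exists>E'\<in>envs ar. (\<forall>u. u \<notin> - {v} \<longrightarrow> E' u = E u) \<and> (\<forall>P\<in>F. P (G E')))"
        by (simp add: Diff_eq)
      then have "dfn ar C' {v} (\<lambda>E. R F (E v))"
      proof (rule dfn_cong)
        fix E :: "'v \<Rightarrow> 'a list"
        show "R F (E v) = (\<exists>E'\<in>envs ar. (\<forall>u. u \<notin> - {v} \<longrightarrow> E' u = E u) \<and> (\<forall>P\<in>F. P (G E')))" (is "_ = ?r")
        proof
          assume "R F (E v)"
          then obtain E' where E': "E' \<in> envs ar" "\<forall>u\<in>D. E' u = E0 u" "E' v = E v" "\<forall>P\<in>F. P E'"
            unfolding R_def by blast
          have "G E' = E'" using E'(2) by (auto simp: G_def)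
          then show ?r using E' by (intro bexI[of _ E']) auto
        next
          assume ?r
          then obtain E' where "E' \<in> envs ar" "E' v = E v" "\<forall>P\<in>F. P (G E')" by auto
          then show "R F (E v)" unfolding R_def using GE v(2) by (intro bexI[of _ "G E'"]) (auto simp: G_def)
        qed
      qed
      then show ?thesis by (rule rdef_dfn) simp
    qed
    have "\<exists>a\<in>tup (ar v). \<forall>R'\<in>R ` {F. finite F \<and> F \<subseteq> \<Gamma>}. R' a"
    proof (rule saturation[OF C' sC'])
      fix \<F> assume "finite \<F>" "\<F> \<subseteq> R ` {F. finite F \<and> F \<subseteq> \<Gamma>}"
      then obtain G where G: "G \<subseteq> {F. finite F \<and> F \<subseteq> \<Gamma>}" "finite G" "\<F> = R ` G" by (meson finite_subset_image)
      then have "finite (\<Union>G)" "\<Union>G \<subseteq> \<Gamma>" by auto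
      from ok_env[OF okh[OF this]] obtain E
        where E: "E \<in> envs ar" "\<forall>u a. (u, a) \<in> h \<longrightarrow> E u = a" "\<forall>P\<in>\<Union>G. P E" by blast
      have "R F (E v)" if "F \<in> G" for F
        unfolding R_def using E that by (intro bexI[of _ E]) (auto simp: hD)
      then show "\<exists>a\<in>tup (ar v). \<forall>R'\<in>\<F>. R' a" using G(3) envs_tup[OF E(1), of v] by auto
    qed (use Rdef in auto)
    then obtain a where a: "\<And>F. finite F \<Longrightarrow> F \<subseteq> \<Gamma> \<Longrightarrow> R F a" by auto
    have "ok (insert (v, a) h) F" if F: "finite F" "F \<subseteq> \<Gamma>" for F
      using a[OF F] unfolding R_def ok_def by (auto simp: hD)
    then have "insert (v, a) h \<in> \<A>" using h v(1) by (auto simp: \<A>_def)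
    then have "(v, a) \<in> h" using max[of "insert (v, a) h"] by auto
    then show False using v(2) hD by blast
  qed
  have "P E0" if P: "P \<in> \<Gamma>" for P
  proof -
    obtain E where E: "E \<in> envs ar" "\<forall>u a. (u, a) \<in> h \<longrightarrow> E u = a" "P E"
      using ok_env[OF okh[of "{P}"]] P by auto
    have "P E = P E0" by (rule dfn_agree[OF \<Gamma>[OF P] E(1) E0(1)]) (use E(2) hD \<open>J \<subseteq> D\<close> in auto)
    then show ?thesis using E(3) by simp
  qed
  then show ?thesis using E0(1) by blast
qed

text \<open>
  Two environments with the same type over \<open>C\<close> are conjugate: sending the atoms of the first to those
  of the second is well defined, since equality is a formula, and elementary.
\<close>

lemma homogeneity:
  fixes ar :: "'v \<Rightarrow> nat"
  assumes C: "C \<subseteq> U" "small \<kappa> C" and J: "small \<kappa> J" and E: "E1 \<in> envs ar" "E2 \<in> envs ar"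
    and eq: "\<And>P. dfn ar C J P \<Longrightarrow> P E1 \<Longrightarrow> P E2"
  shows "\<exists>\<sigma>. automorphism L M \<sigma> \<and> (\<forall>c\<in>C. \<sigma> c = c) \<and> (\<forall>v\<in>J. map \<sigma> (E1 v) = E2 v)"
proof -
  define I where "I = atoms ar C J"
  define D where "D = val E1 ` I"
  have IU: "val E' t \<in> U" if "t \<in> I" "E' \<in> envs ar" for t E'
  proof -
    have "dlist ar C J 1 (\<lambda>E. map (val E) [t])" using dlist_atoms[of "[t]" ar C J] that(1) by (simp add: I_def)
    from dlist_tup[OF this C(1) that(2)] show ?thesis by (simp add: tuples_def)
  qed
  have smI: "small \<kappa> I"
  proof -
    have "I = Inl ` C \<union> (\<Union>v\<in>J. (\<lambda>k. Inr (v, k)) ` {..<ar v})" by (auto simp: I_def atoms_def)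
    moreover have "small \<kappa> (\<Union>v\<in>J. (\<lambda>k. (Inr (v, k) :: ('a, 'v) atom)) ` {..<ar v})"
      by (rule small_UN_finite[OF J]) simp
    ultimately show ?thesis using small_Un[OF small_image[OF C(2)]] by simp
  qed
  have eq': "holds M \<phi> (map (val E1) ts) \<longleftrightarrow> holds M \<phi> (map (val E2) ts)"
    if "\<phi> \<in> fms L (length ts)" "set ts \<subseteq> I" for \<phi> ts
  proof -
    have "dfn ar C J (\<lambda>E. holds M \<phi> (map (val E) ts))"
      by (rule dfn_holds[OF that(1) dlist_atoms]) (use that(2) in \<open>simp add: I_def\<close>)
    from eq[OF this] eq[OF dfn_not[OF this]] show ?thesis by blast
  qed
  define g where "g a = inv_into I (val E1) a" for a
  have g: "g a \<in> I" "val E1 (g a) = a" if "a \<in> D" for a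
    using that unfolding D_def g_def by (auto simp: inv_into_into f_inv_into_f)
  define h where "h a = val E2 (g a)" for a
  have h: "h (val E1 t) = val E2 t" if t: "t \<in> I" for t
  proof -
    have D: "val E1 t \<in> D" using t by (simp add: D_def)
    have "Eq (Var 0) (Var 1) \<in> fms L (length [g (val E1 t), t])" by (auto simp: fms_def)
    from eq'[OF this] g[OF D] t show ?thesis by (simp add: holds_def h_def)
  qed
  have "elementary_map L M D h"
    unfolding elementary_map_def
  proof (intro conjI allI ballI)
    show "h ` D \<subseteq> U" using h IU[OF _ E(2)] by (auto simp: D_def)
  next
    fix m \<phi> a assume p: "\<phi> \<in> fms L m" and a: "a \<in> tuples D m"
    have "map (val E1) (map g a) = a" "map (val E2) (map g a) = map h a"
      using a g by (auto simp: tuples_def h_def intro!: map_idI)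
    moreover have "\<phi> \<in> fms L (length (map g a))" "set (map g a) \<subseteq> I" using p a g by (auto simp: tuples_def)
    ultimately show "holds M \<phi> a = holds M \<phi> (map h a)" using eq' by metis
  qed
  moreover have "D \<subseteq> U" "small \<kappa> D" using IU[OF _ E(1)] small_image[OF smI] by (auto simp: D_def)
  ultimately obtain \<sigma> where \<sigma>: "automorphism L M \<sigma>" "\<forall>a\<in>D. \<sigma> a = h a"
    using hom unfolding strongly_homogeneous_def by blast
  have \<sigma>I: "\<sigma> (val E1 t) = val E2 t" if "t \<in> I" for t using \<sigma>(2) h that by (simp add: D_def)
  have "\<sigma> c = c" if "c \<in> C" for c using \<sigma>I[of "Inl c"] that by (simp add: I_def)
  moreover have "map \<sigma> (E1 v) = E2 v" if "v \<in> J" for v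
  proof (rule nth_equalityI)
    fix k assume "k < length (map \<sigma> (E1 v))"
    then show "map \<sigma> (E1 v) ! k = E2 v ! k"
      using \<sigma>I[of "Inr (v, k)"] that envs_length[OF E(1), of v] by (simp add: I_def)
  qed (use envs_length[OF E(1), of v] envs_length[OF E(2), of v] in simp)
  ultimately show ?thesis using \<sigma>(1) by blast
qed

lemma homogeneity_tup:
  assumes C: "C \<subseteq> U" "small \<kappa> C" and ab: "a \<in> tup m" "b \<in> tup m"
    and eq: "\<And>R. rdef m C R \<Longrightarrow> R a \<Longrightarrow> R b"
  shows "\<exists>\<sigma>. automorphism L M \<sigma> \<and> (\<forall>c\<in>C. \<sigma> c = c) \<and> map \<sigma> a = b"
proof -
  have "\<exists>\<sigma>. automorphism L M \<sigma> \<and> (\<forall>c\<in>C. \<sigma> c = c) \<and> (\<forall>v\<in>{()}. map \<sigma> ((\<lambda>_. a) v) = (\<lambda>_. b) v)"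
  proof (rule homogeneity[OF C, where ar = "\<lambda>_. m"])
    show "small \<kappa> {()}" by (rule small_finite) simp
    fix P assume P: "dfn (\<lambda>_::unit. m) C {()} P"
    have "(\<lambda>_. E ()) = E" for E :: "unit \<Rightarrow> 'a list" by auto
    then have "dfn (\<lambda>_::unit. m) C {()} (\<lambda>E. (\<lambda>a. P (\<lambda>_. a)) (E ()))" using P by simp
    from rdef_dfn[OF this refl] have "rdef m C (\<lambda>a. P (\<lambda>_. a))" .
    from eq[OF this] show "P (\<lambda>_. a) \<Longrightarrow> P (\<lambda>_. b)" .
  qed (use ab in \<open>auto simp: envs_def\<close>)
  then show ?thesis by auto
qed

end

section \<open>Definability from bounded rank\<close>

context monster
begin

text \<open>
  That the rank is at least \<open>r\<close> is a first-order condition on the parameters of the set.  The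
  variable \<open>0\<close> stands for the elements of the set, the variables from \<open>1\<close> on for its parameters; in
  the recursion, the instance at the root of the tree becomes a further parameter \<open>k\<close>.
\<close>

lemma tree_dfn:
  fixes n m :: nat
  defines "ar \<equiv> \<lambda>v::nat. if v = 0 then n else m"
  assumes \<phi>: "\<phi> \<in> fms L (n + m)" and C: "C \<subseteq> U"
  shows "1 \<le> k \<Longrightarrow> dfn ar C {..<k} P \<Longrightarrow>
    dfn ar C {1..<k} (\<lambda>E. tree (\<lambda>x c. holds M \<phi> (x @ c)) (tup m) r (\<lambda>x. x \<in> tup n \<and> P (E(0 := x))))"
proof (induction r arbitrary: k P)
  case 0
  have "{..<k} = insert 0 {..<k}" "{..<k} - {0} = {1..<k}" using 0 by auto
  then have "dfn ar C {1..<k} (\<lambda>E. \<exists>x\<in>tup (ar 0). P (E(0 := x)))" using dfn_ex[of ar C 0 "{..<k}" P] 0 by simp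
  moreover have "ar 0 = n" by (simp add: ar_def)
  ultimately show ?case by (simp add: Bex_def del: fun_upd_apply)
next
  case (Suc r)
  have ark: "ar k = m" using Suc.prems(1) by (simp add: ar_def)
  have Pk: "dfn ar C {..<Suc k} P" using Suc.prems(2) by (rule dfn_mono) auto
  have ph: "dfn ar C {..<Suc k} (\<lambda>E. holds M \<phi> (E 0 @ E k))"
    by (rule dfn_holds[OF \<phi> dlist_append[OF dlist_var dlist_var]]) (use ark in \<open>auto simp: ar_def\<close>)
  let ?T = "tree (\<lambda>x c. holds M \<phi> (x @ c)) (tup m) r"
  have "dfn ar C {1..<Suc k} (\<lambda>E. ?T (\<lambda>x. x \<in> tup n \<and> P (E(0 := x)) \<and> holds M \<phi> ((E(0 := x)) 0 @ (E(0 := x)) k)) \<and>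
      ?T (\<lambda>x. x \<in> tup n \<and> P (E(0 := x)) \<and> \<not> holds M \<phi> ((E(0 := x)) 0 @ (E(0 := x)) k)))"
    by (intro dfn_conj Suc.IH Pk ph dfn_not) auto
  then have "dfn ar C (insert k {1..<k}) (\<lambda>E. ?T (\<lambda>x. x \<in> tup n \<and> P (E(0 := x)) \<and> holds M \<phi> ((E(0 := x)) 0 @ (E(0 := x)) k)) \<and>
      ?T (\<lambda>x. x \<in> tup n \<and> P (E(0 := x)) \<and> \<not> holds M \<phi> ((E(0 := x)) 0 @ (E(0 := x)) k)))"
    by (rule dfn_mono) auto
  from dfn_ex[OF this] have "dfn ar C {1..<k} (\<lambda>E. \<exists>c\<in>tup m.
      ?T (\<lambda>x. x \<in> tup n \<and> P (E(k := c, 0 := x)) \<and> holds M \<phi> (x @ c)) \<and>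
      ?T (\<lambda>x. x \<in> tup n \<and> P (E(k := c, 0 := x)) \<and> \<not> holds M \<phi> (x @ c)))"
    using Suc.prems(1) by (simp add: ark)
  then show ?case
  proof (rule dfn_cong)
    fix E assume E: "E \<in> envs ar"
    have "P (E(k := c, 0 := x)) = P (E(0 := x))" if cx: "c \<in> tup m" "x \<in> tup n" for c x
    proof (rule dfn_agree[OF Suc.prems(2)])
      have "c \<in> tup (ar k)" "x \<in> tup (ar 0)" using cx ark by (simp_all add: ar_def)
      then show "E(k := c, 0 := x) \<in> envs ar" "E(0 := x) \<in> envs ar" using E by (simp_all add: envs_upd)
    qed auto
    then have "(\<lambda>x. x \<in> tup n \<and> P (E(k := c, 0 := x)) \<and> H x) = (\<lambda>x. (x \<in> tup n \<and> P (E(0 := x))) \<and> H x)"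
      if "c \<in> tup m" for c and H :: "'a list \<Rightarrow> bool" using that by auto
    then show "tree (\<lambda>x c. holds M \<phi> (x @ c)) (tup m) (Suc r) (\<lambda>x. x \<in> tup n \<and> P (E(0 := x))) =
      (\<exists>c\<in>tup m. ?T (\<lambda>x. x \<in> tup n \<and> P (E(k := c, 0 := x)) \<and> holds M \<phi> (x @ c)) \<and>
        ?T (\<lambda>x. x \<in> tup n \<and> P (E(k := c, 0 := x)) \<and> \<not> holds M \<phi> (x @ c)))"
      by simp
  qed
qed

lemma rdef_instance:
  assumes "\<phi> \<in> fms L (n + m)" and "c \<in> tuples C m"
  shows "rdef n C (\<lambda>x. holds M \<phi> (x @ c))"
  using assms by (intro rdefI[of \<phi> n c]) (auto simp: tuples_def)

text \<open>
  A set \<open>X\<close> of minimal rank \<open>r\<close> in the type determines its \<open>\<phi>\<close>-part: an instance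
  of \<open>\<phi>\<close> belongs to the type exactly when it cuts \<open>X\<close> in a set of rank \<open>r\<close>, since
  two complementary parts of rank \<open>r\<close> would raise the rank of \<open>X\<close>.
\<close>

lemma definable_of_noladder:
  assumes W: "uq W" "W (\<lambda>x. x \<in> tup n)" and C: "C \<subseteq> U" and X0: "rdef n C X0" "W X0"
    and nl: "noladder (\<lambda>x c. holds M \<phi> (x @ c)) N (\<lambda>x. x \<in> tup n \<and> X0 x) (tup m)"
    and \<phi>: "\<phi> \<in> fms L (n + m)"
  shows "\<exists>R. rdef m C R \<and> (\<forall>c\<in>tuples C m. W (\<lambda>x. holds M \<phi> (x @ c)) \<longleftrightarrow> R c)"
proof -
  let ?T = "tree (\<lambda>x c. holds M \<phi> (x @ c)) (tup m)"
  define good where "good r \<longleftrightarrow> (\<exists>X. rdef n C X \<and> W X \<and> \<not> ?T r (\<lambda>x. x \<in> tup n \<and> X x))" for r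
  have "good (4 ^ (N + N))" using noladder_no_tree[OF nl] X0 by (auto simp: good_def)
  then have "good (LEAST r. good r)" and least: "\<And>r. r < (LEAST r. good r) \<Longrightarrow> \<not> good r"
    by (auto intro: LeastI dest: not_less_Least)
  moreover have "\<not> good 0"
  proof
    assume "good 0"
    then obtain X where X: "W X" "\<not> (\<exists>x. x \<in> tup n \<and> X x)" by (auto simp: good_def)
    have "W (\<lambda>x. x \<in> tup n \<and> X x)" using W(2) X(1) by (rule uq_conjI[OF W(1)])
    from uq_ex[OF W(1), OF this] show False using X(2) by blast
  qed
  ultimately obtain r where r: "(LEAST r. good r) = Suc r" by (metis not0_implies_Suc)
  then obtain X where X: "rdef n C X" "W X" "\<not> ?T (Suc r) (\<lambda>x. x \<in> tup n \<and> X x)"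
    using \<open>good (LEAST r. good r)\<close> by (auto simp: good_def simp del: tree.simps)
  have min: "?T r (\<lambda>x. x \<in> tup n \<and> X' x)" if "rdef n C X'" "W X'" for X'
    using least[of r] r that by (auto simp: good_def)
  define R where "R c = ?T r (\<lambda>x. x \<in> tup n \<and> X x \<and> holds M \<phi> (x @ c))" for c
  have "rdef m C R"
  proof -
    let ?ar = "\<lambda>v::nat. if v = 0 then n else m"
    have "dfn ?ar C {..<2} (\<lambda>E. X (E 0) \<and> holds M \<phi> (E 0 @ E 1))"
      by (intro dfn_conj dfn_rdef[OF X(1)] dfn_holds[OF \<phi>] dlist_append dlist_var order_refl C) auto
    from tree_dfn[OF \<phi> C _ this, of r]
    have "dfn ?ar C {1} (\<lambda>E. R (E 1))" unfolding R_def by (simp add: numeral_2_eq_2)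
    then show ?thesis by (rule rdef_dfn) simp
  qed
  moreover have "W (\<lambda>x. holds M \<phi> (x @ c)) \<longleftrightarrow> R c" if c: "c \<in> tuples C m" for c
  proof
    assume "W (\<lambda>x. holds M \<phi> (x @ c))"
    with X(2) have "W (\<lambda>x. X x \<and> holds M \<phi> (x @ c))" by (rule uq_conjI[OF W(1)])
    then show "R c" unfolding R_def by (intro min rdef_conj X(1) rdef_instance[OF \<phi> c] C)
  next
    assume Rc: "R c"
    show "W (\<lambda>x. holds M \<phi> (x @ c))"
    proof (rule ccontr)
      assume "\<not> W (\<lambda>x. holds M \<phi> (x @ c))"
      then have "W (\<lambda>x. \<not> holds M \<phi> (x @ c))" using uq_not[OF W(1)] by blast
      with X(2) have "W (\<lambda>x. X x \<and> \<not> holds M \<phi> (x @ c))" by (rule uq_conjI[OF W(1)])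
      then have "?T r (\<lambda>x. x \<in> tup n \<and> X x \<and> \<not> holds M \<phi> (x @ c))"
        by (intro min rdef_conj rdef_not X(1) rdef_instance[OF \<phi> c] C)
      moreover have "c \<in> tup m" using c C by (auto simp: tuples_def)
      ultimately have "?T (Suc r) (\<lambda>x. x \<in> tup n \<and> X x)" using Rc by (auto simp: R_def conj_assoc)
      then show False using X(3) by simp
    qed
  qed
  ultimately show ?thesis by blast
qed

section \<open>Tuples of realizations of a stable type\<close>

definition eqtp :: "nat \<Rightarrow> 'a set \<Rightarrow> 'a list \<Rightarrow> 'a list \<Rightarrow> bool" where
  "eqtp m C a b \<longleftrightarrow> (\<forall>R. rdef m C R \<longrightarrow> (R a \<longleftrightarrow> R b))"

lemma eqtpI: "C \<subseteq> U \<Longrightarrow> (\<And>R. rdef m C R \<Longrightarrow> R a \<Longrightarrow> R b) \<Longrightarrow> eqtp m C a b"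
  unfolding eqtp_def using rdef_not by blast

text \<open>
  Stability of the type of \<open>a0\<close> over \<open>B\<close>, expressed by its realizations \<open>a\<close> in place of the extensions
  of the type.
\<close>

definition stable_at :: "nat \<Rightarrow> 'a set \<Rightarrow> 'a list \<Rightarrow> bool" where
  "stable_at n B a0 \<longleftrightarrow> (\<forall>C a m \<phi>. B \<subseteq> C \<longrightarrow> C \<subseteq> U \<longrightarrow> small \<kappa> C \<longrightarrow> a \<in> tup n \<longrightarrow> eqtp n B a0 a \<longrightarrow>
     \<phi> \<in> fms L (n + m) \<longrightarrow> (\<exists>R. rdef m C R \<and> (\<forall>c\<in>tuples C m. holds M \<phi> (a @ c) \<longleftrightarrow> R c)))"

text \<open>The parameters outside \<open>C\<close> are entries of \<open>d\<close>, and become variables.\<close>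

lemma rdef_extract:
  assumes R: "rdef k (C \<union> set d) R" and d: "d \<in> tup l" and C: "C \<subseteq> U"
  shows "\<exists>R'. rdef (k + l) C R' \<and> (\<forall>z\<in>tup k. R z \<longleftrightarrow> R' (z @ d))"
proof -
  obtain \<psi> e where \<psi>: "\<psi> \<in> fms L (k + length e)" "set e \<subseteq> C \<union> set d" "\<And>z. z \<in> tup k \<Longrightarrow> R z \<longleftrightarrow> holds M \<psi> (z @ e)"
    using R unfolding rdef_def by blast
  have "\<forall>x. \<exists>t. x \<in> set e \<longrightarrow> t \<in> atoms (\<lambda>_::unit. k + l) C {()} \<and> (\<forall>z\<in>tup k. val (\<lambda>_. z @ d) t = x)"
  proof
    fix x
    show "\<exists>t. x \<in> set e \<longrightarrow> t \<in> atoms (\<lambda>_::unit. k + l) C {()} \<and> (\<forall>z\<in>tup k. val (\<lambda>_. z @ d) t = x)"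
    proof (cases "x \<in> C")
      case True
      then show ?thesis by (intro exI[of _ "Inl x"]) simp
    next
      case False
      show ?thesis
      proof (cases "x \<in> set e")
        case True
        then have "x \<in> set d" using \<psi>(2) False by blast
        then obtain i where i: "i < l" "d ! i = x" using d by (auto simp: tuples_def in_set_conv_nth)
        then show ?thesis by (intro exI[of _ "Inr ((), k + i)"]) (auto simp: tuples_def nth_append)
      qed simp
    qed
  qed
  from choice[OF this] obtain t where
    t: "\<And>x. x \<in> set e \<Longrightarrow> t x \<in> atoms (\<lambda>_::unit. k + l) C {()}"
       "\<And>x z. x \<in> set e \<Longrightarrow> z \<in> tup k \<Longrightarrow> val (\<lambda>_. z @ d) (t x) = x" by blast
  define R' where "R' y = holds M \<psi> (map (\<lambda>i. y ! i) [0..<k] @ map (val (\<lambda>_. y)) (map t e))" for y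
  have eta: "(\<lambda>_. E ()) = E" for E :: "unit \<Rightarrow> 'a list" by auto
  have "dlist (\<lambda>_::unit. k + l) C {()} (length (map t e)) (\<lambda>E. map (val E) (map t e))"
    by (rule dlist_atoms) (use t(1) in auto)
  moreover have "dlist (\<lambda>_::unit. k + l) C {()} k (\<lambda>E. map (\<lambda>i. E () ! i) [0..<k])"
    by (rule dlist_map_nth[OF dlist_var]) auto
  ultimately have "dfn (\<lambda>_::unit. k + l) C {()} (\<lambda>E. R' (E ()))"
    unfolding R'_def eta by (intro dfn_holds[OF \<psi>(1)] dlist_append) simp_all
  then have "rdef (k + l) C R'" by (rule rdef_dfn) simp
  moreover have "R z \<longleftrightarrow> R' (z @ d)" if z: "z \<in> tup k" for z
  proof -
    have "map (\<lambda>i. (z @ d) ! i) [0..<k] = z" using z by (intro nth_equalityI) (auto simp: tuples_def nth_append)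
    moreover have "map (val (\<lambda>_. z @ d)) (map t e) = e" using t(2)[OF _ z] by (auto intro: map_idI)
    ultimately show ?thesis using \<psi>(3)[OF z] by (simp add: R'_def del: map_map)
  qed
  ultimately show ?thesis by blast
qed

lemma concat_tup: "length bs = j \<Longrightarrow> \<forall>b\<in>set bs. b \<in> tup n \<Longrightarrow> concat bs \<in> tup (j * n)"
  by (induction bs arbitrary: j) (auto simp: tuples_def)

text \<open>
  The product of stable types is stable: the definition of the type of the first entry
  over the remaining ones is evaluated at the remaining entries.
\<close>

lemma stable_block:
  assumes st: "stable_at n B a0" and C: "B \<subseteq> C" "C \<subseteq> U" "small \<kappa> C"
  shows "\<forall>a\<in>set bs. a \<in> tup n \<and> eqtp n B a0 a \<Longrightarrow> \<phi> \<in> fms L (length bs * n + m) \<Longrightarrow>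
    \<exists>R. rdef m C R \<and> (\<forall>c\<in>tuples C m. holds M \<phi> (concat bs @ c) \<longleftrightarrow> R c)"
proof (induction bs arbitrary: m \<phi>)
  case Nil
  then show ?case by (intro exI[of _ "holds M \<phi>"]) (auto intro!: rdefI[of \<phi> m "[]"])
next
  case (Cons a bs)
  define k where "k = length bs * n"
  define d where "d = concat bs"
  have d: "d \<in> tup k" unfolding d_def k_def by (rule concat_tup) (use Cons.prems in auto)
  define C' where "C' = C \<union> set d"
  have C': "B \<subseteq> C'" "C' \<subseteq> U" "small \<kappa> C'"
    using C d small_Un[OF C(3) small_finite] by (auto simp: C'_def tuples_def)
  have "\<phi> \<in> fms L (n + (k + m))" using Cons.prems(2) by (simp add: k_def algebra_simps)
  with C' Cons.prems(1) st obtain R1 where R1: "rdef (k + m) C' R1" "\<forall>z\<in>tuples C' (k + m). holds M \<phi> (a @ z) \<longleftrightarrow> R1 z"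
    unfolding stable_at_def by (metis list.set_intros(1))
  obtain R2 where R2: "rdef (k + m + k) C R2" "\<forall>z\<in>tup (k + m). R1 z \<longleftrightarrow> R2 (z @ d)"
    using rdef_extract[OF R1(1)[unfolded C'_def] d C(2)] by blast
  define R3 where "R3 y = R2 (y @ map (\<lambda>i. y ! i) [0..<k])" for y
  have "dfn (\<lambda>_::unit. k + m) C {()} (\<lambda>E. R3 (E ()))"
    unfolding R3_def
    by (rule dfn_rdef[OF R2(1)], rule dlist_append, rule dlist_var)
      (use C in \<open>auto intro!: dlist_map_nth[where m = "k + m"] dlist_var\<close>)
  then have "rdef (k + m) C R3" by (rule rdef_dfn) simp
  then obtain \<psi> e where \<psi>: "\<psi> \<in> fms L (k + m + length e)" "set e \<subseteq> C" "\<And>y. y \<in> tup (k + m) \<Longrightarrow> R3 y \<longleftrightarrow> holds M \<psi> (y @ e)"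
    unfolding rdef_def by blast
  have "\<exists>R. rdef (m + length e) C R \<and> (\<forall>c\<in>tuples C (m + length e). holds M \<psi> (concat bs @ c) \<longleftrightarrow> R c)"
    by (rule Cons.IH) (use Cons.prems(1) \<psi>(1) in \<open>auto simp: k_def add.assoc\<close>)
  then obtain R4 where R4: "rdef (m + length e) C R4" "\<forall>c\<in>tuples C (m + length e). holds M \<psi> (d @ c) \<longleftrightarrow> R4 c"
    unfolding d_def by blast
  have "dfn (\<lambda>_::unit. m) C {()} (\<lambda>E. R4 (E () @ e))"
    by (rule dfn_rdef[OF R4(1)], rule dlist_append, rule dlist_var)
      (use C \<psi>(2) in \<open>auto intro!: dlist_const simp: tuples_def\<close>)
  then have "rdef m C (\<lambda>c. R4 (c @ e))" by (rule rdef_dfn) simp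
  moreover have "holds M \<phi> (concat (a # bs) @ c) \<longleftrightarrow> R4 (c @ e)" if c: "c \<in> tuples C m" for c
  proof -
    have dc: "d @ c \<in> tuples C' (k + m)" "d @ c \<in> tup (k + m)" "c @ e \<in> tuples C (m + length e)"
      using c d \<psi>(2) C(2) by (auto simp: tuples_def C'_def)
    have "map (\<lambda>i. (d @ c) ! i) [0..<k] = d" using d by (intro nth_equalityI) (auto simp: tuples_def nth_append)
    then have "R2 ((d @ c) @ d) \<longleftrightarrow> R3 (d @ c)" by (simp add: R3_def)
    then show ?thesis using R1(2) R2(2) \<psi>(3) R4(2) dc by (simp add: d_def[symmetric])
  qed
  ultimately show ?case by blast
qed

lemma small_countable_type: "small \<kappa> (A :: 'b::countable set)"
proof -
  have "small \<kappa> ((from_nat :: nat \<Rightarrow> 'b) ` UNIV)" by (rule small_nat_image)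
  then show ?thesis by (rule small_subset) (simp add: surj_from_nat)
qed

text \<open>
  Arbitrarily long ladders in every neighbourhood of the type of \<open>a\<close> give, by compactness, an infinite
  ladder in the type itself.
\<close>

lemma infinite_ladder:
  assumes C: "C \<subseteq> U" "small \<kappa> C" and \<phi>: "\<phi> \<in> fms L (j * n + m)"
    and long: "\<And>N X. rdef n C X \<Longrightarrow> X a \<Longrightarrow>
      \<not> noladder (\<lambda>b c. holds M \<phi> (concat b @ c)) N (\<lambda>b. length b = j \<and> (\<forall>x\<in>set b. x \<in> tup n \<and> X x)) (tup m)"
  shows "\<exists>b c. (\<forall>i::nat. length (b i) = j \<and> (\<forall>x\<in>set (b i). x \<in> tup n \<and> eqtp n C a x)) \<and> (\<forall>i. c i \<in> tup m) \<and>
    (\<forall>i l. (i < l \<longrightarrow> holds M \<phi> (concat (b i) @ c l)) \<and> (l < i \<longrightarrow> \<not> holds M \<phi> (concat (b i) @ c l)))"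
proof -
  define ar :: "nat \<times> nat + nat \<Rightarrow> nat" where "ar = case_sum (\<lambda>_. n) (\<lambda>_. m)"
  define bl :: "(nat \<times> nat + nat \<Rightarrow> 'a list) \<Rightarrow> nat \<Rightarrow> 'a list list"
    where "bl E i = map (\<lambda>t. E (Inl (i, t))) [0..<j]" for E i
  define K where "K = {(X, i::nat, l::nat). rdef n C X \<and> X a}"
  define g where "g = (\<lambda>(X, i, l) E. (\<forall>t\<in>{..<j}. X (E (Inl (i, t)))) \<and>
     (i < l \<longrightarrow> holds M \<phi> (concat (bl E i) @ E (Inr l))) \<and> (l < i \<longrightarrow> \<not> holds M \<phi> (concat (bl E i) @ E (Inr l))))"
  have "\<exists>E\<in>envs ar. \<forall>P\<in>g ` K. P E"
  proof (rule compactness[OF C, where J = UNIV])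
    show "small \<kappa> (UNIV :: (nat \<times> nat + nat) set)" by (rule small_countable_type)
  next
    fix P assume "P \<in> g ` K"
    then obtain X i l where X: "rdef n C X" "P = g (X, i, l)" by (auto simp: K_def)
    have "dlist ar C UNIV (j * n) (\<lambda>E. concat (bl E i))"
      unfolding bl_def by (rule dlist_concat[where m = n]) (auto intro!: dlist_var simp: ar_def)
    then have "dfn ar C UNIV (\<lambda>E. holds M \<phi> (concat (bl E i) @ E (Inr l)))"
      by (intro dfn_holds[OF \<phi>] dlist_append dlist_var) (auto simp: ar_def)
    moreover have "dfn ar C UNIV (\<lambda>E. \<forall>t\<in>{..<j}. X (E (Inl (i, t))))"
      by (intro dfn_ball_finite dfn_rdef[OF X(1)] dlist_var order_refl C) (auto simp: ar_def)
    ultimately show "dfn ar C UNIV P" unfolding X(2) g_def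
      by (simp only: prod.case) (intro dfn_conj dfn_imp dfn_const dfn_not)
  next
    fix F assume "finite F" "F \<subseteq> g ` K"
    then obtain K0 where K0: "K0 \<subseteq> K" "finite K0" "F = g ` K0" by (meson finite_subset_image)
    define N where "N = Suc (Max ({0} \<union> (\<lambda>(X, i, l). i + l) ` K0))"
    define X where "X x \<longleftrightarrow> (\<forall>X'\<in>fst ` K0. X' x)" for x
    have "rdef n C X" unfolding X_def using K0 by (intro rdef_ball_finite C) (auto simp: K_def)
    moreover have "X a" using K0 by (auto simp: X_def K_def)
    ultimately obtain b c where bc: "\<forall>i<N. length (b i) = j \<and> (\<forall>x\<in>set (b i). x \<in> tup n \<and> X x)" "\<forall>i<N. c i \<in> tup m"
      "ladder (\<lambda>b c. holds M \<phi> (concat b @ c)) N b c"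
      using long[of X N] unfolding noladder_def by blast
    obtain E0 where E0: "E0 \<in> envs ar" using envs_nonempty by blast
    define E where "E v = (case v of Inl (i, t) \<Rightarrow> if i < N \<and> t < j then b i ! t else E0 v
       | Inr l \<Rightarrow> if l < N then c l else E0 v)" for v
    have "E v \<in> tup (ar v)" for v
      using bc(1,2) envs_tup[OF E0, of v] by (auto simp: E_def ar_def split: sum.split)
    then have E: "E \<in> envs ar" by (simp add: envs_def)
    have blE: "bl E i = b i" if "i < N" for i
      using bc(1) that by (auto simp: bl_def E_def intro!: nth_equalityI)
    have "g k E" if k: "k \<in> K0" for k
    proof -
      obtain X' i l where k': "k = (X', i, l)" by (metis prod_cases3)
      have "i + l \<le> Max ({0} \<union> (\<lambda>(X, i, l). i + l) ` K0)" using k k' K0(2) by (intro Max_ge) force+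
      then have il: "i < N" "l < N" by (auto simp: N_def)
      have "X' (E (Inl (i, t)))" if "t < j" for t
      proof -
        have "b i ! t \<in> set (b i)" using bc(1) il that by auto
        then have "X (b i ! t)" using bc(1) il by blast
        then have "X' (b i ! t)" using k k' by (force simp: X_def)
        then show ?thesis using il that by (simp add: E_def)
      qed
      moreover have "E (Inr l) = c l" using il by (simp add: E_def)
      ultimately show ?thesis using bc(3) il unfolding k' g_def by (auto simp: blE ladder_def)
    qed
    then have "\<forall>P\<in>F. P E" unfolding K0(3) by blast
    then show "\<exists>E\<in>envs ar. \<forall>P\<in>F. P E" using E by blast
  qed
  then obtain E where E: "E \<in> envs ar" "\<And>k. k \<in> K \<Longrightarrow> g k E" by auto
  have K: "(X, i, l) \<in> K \<longleftrightarrow> rdef n C X \<and> X a" for X i l by (simp add: K_def)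
  have "length (bl E i) = j \<and> (\<forall>x\<in>set (bl E i). x \<in> tup n \<and> eqtp n C a x)" for i
  proof (intro conjI ballI)
    fix x assume "x \<in> set (bl E i)"
    then obtain t where t: "t < j" "x = E (Inl (i, t))" by (auto simp: bl_def)
    then show "x \<in> tup n" using envs_tup[OF E(1), of "Inl (i, t)"] by (simp add: ar_def)
    show "eqtp n C a x"
    proof (rule eqtpI[OF C(1)])
      fix R assume "rdef n C R" "R a"
      then have "g (R, i, 0) E" using E(2) K by blast
      then show "R x" using t by (auto simp: g_def)
    qed
  qed (simp add: bl_def)
  moreover have "E (Inr i) \<in> tup m" for i using envs_tup[OF E(1), of "Inr i"] by (simp add: ar_def)
  moreover have "(i < l \<longrightarrow> holds M \<phi> (concat (bl E i) @ E (Inr l))) \<and> (l < i \<longrightarrow> \<not> holds M \<phi> (concat (bl E i) @ E (Inr l)))" for i l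
  proof -
    have "(\<lambda>_. True, i, l) \<in> K" using rdef_const[OF C(1)] by (simp add: K)
    from E(2)[OF this] show ?thesis by (simp add: g_def)
  qed
  ultimately show ?thesis by (intro exI[of _ "bl E"] exI[of _ "\<lambda>i. E (Inr i)"]) simp
qed

end

text \<open>Ramsey's theorem for finitely many relations on increasing tuples.\<close>

lemma homogeneous_subset:
  fixes c :: "nat \<Rightarrow> 'z" and \<P> :: "(nat \<times> ((nat \<Rightarrow> 'z) \<Rightarrow> bool)) set"
  assumes "finite \<P>" and "\<forall>(r, P)\<in>\<P>. \<forall>u v. (\<forall>i<r. u i = v i) \<longrightarrow> P u = P v" and "infinite Z"
  shows "\<exists>Y\<subseteq>Z. infinite Y \<and> (\<forall>(r, P)\<in>\<P>. \<forall>u v. strict_mono_on {..<r} u \<longrightarrow> u ` {..<r} \<subseteq> Y \<longrightarrow>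
    strict_mono_on {..<r} v \<longrightarrow> v ` {..<r} \<subseteq> Y \<longrightarrow> P (\<lambda>i. c (u i)) = P (\<lambda>i. c (v i)))"
  using assms
proof (induction \<P> arbitrary: Z rule: finite_induct)
  case empty
  then show ?case by auto
next
  case (insert p \<P>)
  obtain r P where p: "p = (r, P)" by fastforce
  obtain Z' where Z': "Z' \<subseteq> Z" "infinite Z'" "\<forall>(r, P)\<in>\<P>. \<forall>u v. strict_mono_on {..<r} u \<longrightarrow> u ` {..<r} \<subseteq> Z' \<longrightarrow>
    strict_mono_on {..<r} v \<longrightarrow> v ` {..<r} \<subseteq> Z' \<longrightarrow> P (\<lambda>i. c (u i)) = P (\<lambda>i. c (v i))"
  proof -
    have "\<forall>(r, P)\<in>\<P>. \<forall>u v. (\<forall>i<r. u i = v i) \<longrightarrow> P u = P v" using insert.prems(1) by simp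
    from insert.IH[OF this insert.prems(2)] show thesis using that by (elim exE conjE) simp
  qed
  define f where "f X = (if P (\<lambda>i. c (sorted_list_of_set X ! i)) then 0 else 1 :: nat)" for X
  obtain Y t where Y: "Y \<subseteq> Z'" "infinite Y" "\<And>X. X \<subseteq> Y \<Longrightarrow> finite X \<Longrightarrow> card X = r \<Longrightarrow> f X = t"
  proof -
    have "\<forall>X. X \<subseteq> Z' \<and> finite X \<and> card X = r \<longrightarrow> f X < 2" by (simp add: f_def)
    from Ramsey[OF Z'(2) this] show thesis using that by (elim exE conjE) simp
  qed
  have eq: "P (\<lambda>i. c (u i)) \<longleftrightarrow> t = 0" if u: "strict_mono_on {..<r} u" "u ` {..<r} \<subseteq> Y" for u
  proof -
    have inj: "inj_on u {..<r}" using u(1) by (rule strict_mono_on_imp_inj_on)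
    have "sorted_list_of_set (u ` {..<r}) = map u [0..<r]"
    proof (rule sorted_distinct_set_unique)
      show "sorted (map u [0..<r])"
        using strict_mono_on_leD[OF u(1)] by (simp add: sorted_iff_nth_mono)
      show "distinct (map u [0..<r])" using inj by (simp add: distinct_map atLeast0LessThan)
    qed (auto simp: atLeast0LessThan)
    then have "\<forall>i<r. c (u i) = c (sorted_list_of_set (u ` {..<r}) ! i)" by simp
    moreover have "\<forall>u v. (\<forall>i<r. u i = v i) \<longrightarrow> P u = P v" using insert.prems(1) by (simp add: p)
    ultimately have "P (\<lambda>i. c (u i)) = P (\<lambda>i. c (sorted_list_of_set (u ` {..<r}) ! i))" by simp
    then show ?thesis using Y(3)[OF u(2)] card_image[OF inj] by (auto simp: f_def split: if_splits)
  qed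
  have "\<forall>(r', P')\<in>insert p \<P>. \<forall>u v. strict_mono_on {..<r'} u \<longrightarrow> u ` {..<r'} \<subseteq> Y \<longrightarrow>
    strict_mono_on {..<r'} v \<longrightarrow> v ` {..<r'} \<subseteq> Y \<longrightarrow> P' (\<lambda>i. c (u i)) = P' (\<lambda>i. c (v i))"
  proof (intro ballI, clarify)
    fix r' P' and u v :: "nat \<Rightarrow> nat"
    assume *: "(r', P') \<in> insert p \<P>" "strict_mono_on {..<r'} u" "u ` {..<r'} \<subseteq> Y"
      "strict_mono_on {..<r'} v" "v ` {..<r'} \<subseteq> Y"
    show "P' (\<lambda>i. c (u i)) = P' (\<lambda>i. c (v i))"
    proof (cases "(r', P') \<in> \<P>")
      case True
      have "u ` {..<r'} \<subseteq> Z'" "v ` {..<r'} \<subseteq> Z'" using *(3,5) Y(1) by (blast, blast)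
      then show ?thesis by (rule bspec[OF Z'(3) True, unfolded prod.case, rule_format, OF *(2) _ *(4)])
    next
      case False
      then have rP: "r' = r" "P' = P" using *(1) p by auto
      show ?thesis using eq[OF *(2,3)[unfolded rP]] eq[OF *(4,5)[unfolded rP]] unfolding rP by simp
    qed
  qed
  then show ?case using Y(1,2) Z'(1) by (intro exI[of _ Y]) auto
qed

context monster
begin

text \<open>
  A stable type has no infinite ladder: otherwise there are indiscernible parameters \<open>z\<close>, indexed
  by the nonzero rationals, and a block \<open>b\<close> of realizations of the type with \<open>\<phi>(b, z_q)\<close> exactly
  for positive \<open>q\<close>.  A definition of the type of \<open>b\<close> over these parameters mentions finitely
  many of them and cannot separate a small positive from a small negative index.
\<close>

lemma stable_noladder:
  assumes st: "stable_at n B a0" and B: "B \<subseteq> U" "small \<kappa> B" and \<phi>: "\<phi> \<in> fms L (j * n + m)"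
  shows "\<exists>N X. rdef n B X \<and> X a0 \<and>
    noladder (\<lambda>b c. holds M \<phi> (concat b @ c)) N (\<lambda>b. length b = j \<and> (\<forall>x\<in>set b. x \<in> tup n \<and> X x)) (tup m)"
proof (rule ccontr)
  assume "\<not> ?thesis"
  then have long: "\<not> noladder (\<lambda>b c. holds M \<phi> (concat b @ c)) N (\<lambda>b. length b = j \<and> (\<forall>x\<in>set b. x \<in> tup n \<and> X x)) (tup m)"
    if "rdef n B X" "X a0" for N X using that by blast
  have "\<exists>b c. (\<forall>i::nat. length (b i) = j \<and> (\<forall>x\<in>set (b i). x \<in> tup n \<and> eqtp n B a0 x)) \<and> (\<forall>i. c i \<in> tup m) \<and>
    (\<forall>i l. (i < l \<longrightarrow> holds M \<phi> (concat (b i) @ c l)) \<and> (l < i \<longrightarrow> \<not> holds M \<phi> (concat (b i) @ c l)))"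
    by (rule infinite_ladder[OF B \<phi>]) (rule long)
  then obtain b c where bc:
    "\<forall>i::nat. length (b i) = j \<and> (\<forall>x\<in>set (b i). x \<in> tup n \<and> eqtp n B a0 x)" "\<forall>i. c i \<in> tup m"
    "\<forall>i l. (i < l \<longrightarrow> holds M \<phi> (concat (b i) @ c l)) \<and> (l < i \<longrightarrow> \<not> holds M \<phi> (concat (b i) @ c l))"
    by blast
  then have b: "\<And>i::nat. length (b i) = j" "\<And>i x. x \<in> set (b i) \<Longrightarrow> x \<in> tup n" "\<And>i x. x \<in> set (b i) \<Longrightarrow> eqtp n B a0 x"
    and c: "\<And>i. c i \<in> tup m" and lad: "\<And>i l. i < l \<Longrightarrow> holds M \<phi> (concat (b i) @ c l)"
      "\<And>i l. l < i \<Longrightarrow> \<not> holds M \<phi> (concat (b i) @ c l)"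
    by simp_all
  \<comment> \<open>Variables: \<open>Inl t\<close> is the entry \<open>t\<close> of the block, \<open>Inr q\<close> the parameter \<open>z_q\<close>.  The constraints
     say that the block realizes the type, that the formula is true at positive and false at
     negative \<open>q\<close>, and that \<open>P\<close> does not distinguish the increasing sequences \<open>f\<close> and \<open>g\<close>.\<close>
  define ar :: "nat + rat \<Rightarrow> nat" where "ar = case_sum (\<lambda>_. n) (\<lambda>_. m)"
  define bl :: "(nat + rat \<Rightarrow> 'a list) \<Rightarrow> 'a list list" where "bl E = map (\<lambda>t. E (Inl t)) [0..<j]" for E
  define K where "K = {(X, q::rat, r::nat, P, f::nat \<Rightarrow> rat, g::nat \<Rightarrow> rat). rdef n B X \<and> X a0 \<and>
    dfn (\<lambda>_::nat. m) B {..<r} P \<and> strict_mono_on {..<r} f \<and> strict_mono_on {..<r} g}"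
  define G where "G = (\<lambda>(X, q::rat, r::nat, P, f::nat \<Rightarrow> rat, g::nat \<Rightarrow> rat) E. (\<forall>t\<in>{..<j}. X (E (Inl t))) \<and>
     (0 < q \<longrightarrow> holds M \<phi> (concat (bl E) @ E (Inr q))) \<and> (q < 0 \<longrightarrow> \<not> holds M \<phi> (concat (bl E) @ E (Inr q))) \<and>
     (P (\<lambda>i. E (Inr (f i))) \<longleftrightarrow> P (\<lambda>i. E (Inr (g i)))))"
  have "\<exists>E\<in>envs ar. \<forall>P\<in>G ` K. P E"
  proof (rule compactness[OF B, where J = UNIV])
    show "small \<kappa> (UNIV :: (nat + rat) set)" by (rule small_countable_type)
  next
    fix P' assume "P' \<in> G ` K"
    then obtain X q r P f g where k: "rdef n B X" "dfn (\<lambda>_::nat. m) B {..<r} P" "P' = G (X, q, r, P, f, g)"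
      by (auto simp: K_def)
    have "dlist ar B UNIV (j * n) (\<lambda>E. concat (bl E))"
      unfolding bl_def by (rule dlist_concat[where m = n]) (auto intro!: dlist_var simp: ar_def)
    then have "dfn ar B UNIV (\<lambda>E. holds M \<phi> (concat (bl E) @ E (Inr q)))"
      by (intro dfn_holds[OF \<phi>] dlist_append dlist_var) (auto simp: ar_def)
    moreover have "dfn ar B UNIV (\<lambda>E. \<forall>t\<in>{..<j}. X (E (Inl t)))"
      by (intro dfn_ball_finite dfn_rdef[OF k(1)] dlist_var order_refl B) (auto simp: ar_def)
    moreover have "dfn ar B UNIV (\<lambda>E. P (\<lambda>i. E (Inr (h i))))" for h
      by (rule dfn_rename[OF k(2)]) (auto simp: ar_def)
    ultimately show "dfn ar B UNIV P'" unfolding k(3) G_def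
      by (simp only: prod.case) (intro dfn_conj dfn_imp dfn_const dfn_not dfn_iff)
  next
    fix F assume "finite F" "F \<subseteq> G ` K"
    then obtain K0 where K0: "K0 \<subseteq> K" "finite K0" "F = G ` K0" by (meson finite_subset_image)
    define \<P> where "\<P> = (\<lambda>(X, q, r, P, f, g). (r, P)) ` K0"
    define P' where "P' P = (\<lambda>z :: nat \<Rightarrow> 'a list. P (\<lambda>i. if z i \<in> tup m then z i else c 0))" for P :: "(nat \<Rightarrow> 'a list) \<Rightarrow> bool"
    define \<P>' where "\<P>' = (\<lambda>(r, P). (r, P' P)) ` \<P>"
    have dep: "\<forall>(r, P)\<in>\<P>'. \<forall>u v. (\<forall>i<r. u i = v i) \<longrightarrow> P u = P v"
    proof (clarsimp simp: \<P>'_def)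
      fix r P and u v :: "nat \<Rightarrow> 'a list"
      assume "(r, P) \<in> \<P>" and uv: "\<forall>i<r. u i = v i"
      then have "dfn (\<lambda>_::nat. m) B {..<r} P" using K0(1) by (auto simp: \<P>_def K_def)
      then show "P' P u = P' P v" unfolding P'_def
        by (rule dfn_agree) (use uv c in \<open>auto simp: envs_def\<close>)
    qed
    have "finite \<P>'" using K0(2) by (simp add: \<P>'_def \<P>_def)
    then have "\<exists>Y\<subseteq>UNIV. infinite Y \<and> (\<forall>(r, P)\<in>\<P>'. \<forall>u v. strict_mono_on {..<r} u \<longrightarrow> u ` {..<r} \<subseteq> Y \<longrightarrow>
      strict_mono_on {..<r} v \<longrightarrow> v ` {..<r} \<subseteq> Y \<longrightarrow> P (\<lambda>i. c (u i)) = P (\<lambda>i. c (v i)))"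
      by (rule homogeneous_subset[OF _ dep infinite_UNIV_nat])
    then obtain Y where "infinite Y \<and> (\<forall>(r, P)\<in>\<P>'. \<forall>u v. strict_mono_on {..<r} u \<longrightarrow> u ` {..<r} \<subseteq> Y \<longrightarrow>
      strict_mono_on {..<r} v \<longrightarrow> v ` {..<r} \<subseteq> Y \<longrightarrow> P (\<lambda>i. c (u i)) = P (\<lambda>i. c (v i)))" by (elim exE conjE) (rule that, rule conjI)
    then have Y: "infinite Y" "\<forall>(r, P)\<in>\<P>'. \<forall>u v. strict_mono_on {..<r} u \<longrightarrow> u ` {..<r} \<subseteq> Y \<longrightarrow>
      strict_mono_on {..<r} v \<longrightarrow> v ` {..<r} \<subseteq> Y \<longrightarrow> P (\<lambda>i. c (u i)) = P (\<lambda>i. c (v i))" by (rule conjunct1, rule conjunct2)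
    define I where "I = insert 0 (\<Union>(X, q, r, P, f, g)\<in>K0. insert q (f ` {..<r} \<union> g ` {..<r}))"
    have finI: "finite I" using K0(2) by (auto simp: I_def)
    \<comment> \<open>The finitely many indices in \<open>I\<close> are mapped increasingly into the homogeneous set, and \<open>h 0\<close>
       is the position of the block in the ladder.\<close>
    define h where "h q = enumerate Y (card {y \<in> I. y < q})" for q
    have hY: "h q \<in> Y" for q unfolding h_def by (rule enumerate_in_set[OF Y(1)])
    have hmono: "h p < h q" if "p \<in> I" "p < q" for p q
    proof -
      have "{y \<in> I. y < p} \<subset> {y \<in> I. y < q}" using that by auto
      then have "card {y \<in> I. y < p} < card {y \<in> I. y < q}" using finI by (intro psubset_card_mono) auto
      then show ?thesis unfolding h_def by (rule enumerate_mono[OF _ Y(1)])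
    qed
    obtain E0 where E0: "E0 \<in> envs ar" using envs_nonempty by blast
    define E where "E v = (case v of Inl t \<Rightarrow> if t < j then b (h 0) ! t else E0 v | Inr q \<Rightarrow> c (h q))" for v
    have mem: "b (h 0) ! t \<in> set (b (h 0))" if "t < j" for t using that b(1) by simp
    have "E v \<in> tup (ar v)" for v
      using b(2)[OF mem] c envs_tup[OF E0, of v] by (auto simp: E_def ar_def split: sum.split)
    then have E: "E \<in> envs ar" by (simp add: envs_def)
    have blE: "bl E = b (h 0)"
      using b(1) by (auto simp: bl_def E_def intro!: nth_equalityI)
    have "G k E" if k: "k \<in> K0" for k
    proof -
      obtain X q r P f g where k': "k = (X, q, r, P, f, g)" by (metis prod_cases6)
      have kK: "rdef n B X" "X a0" "strict_mono_on {..<r} f" "strict_mono_on {..<r} g"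
        using k k' K0(1) by (auto simp: K_def)
      have I: "0 \<in> I" "q \<in> I" "\<And>i. i < r \<Longrightarrow> f i \<in> I" "\<And>i. i < r \<Longrightarrow> g i \<in> I"
        using k k' unfolding I_def by force+
      have "X (E (Inl t))" if "t < j" for t
      proof -
        have "X a0 = X (b (h 0) ! t)" using b(3)[OF mem[OF that]] kK(1) unfolding eqtp_def by blast
        then show ?thesis using kK(2) that by (simp add: E_def)
      qed
      moreover have "0 < q \<longrightarrow> holds M \<phi> (concat (bl E) @ E (Inr q))"
        using lad(1) hmono[OF I(1), of q] by (auto simp: blE E_def)
      moreover have "q < 0 \<longrightarrow> \<not> holds M \<phi> (concat (bl E) @ E (Inr q))"
        using lad(2) hmono[OF I(2), of 0] by (auto simp: blE E_def)
      moreover have "P (\<lambda>i. E (Inr (f i))) \<longleftrightarrow> P (\<lambda>i. E (Inr (g i)))"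
      proof -
        have "(r, P) \<in> \<P>" unfolding \<P>_def using k k' by force
        then have rP: "(r, P' P) \<in> \<P>'" unfolding \<P>'_def by force
        have sm: "strict_mono_on {..<r} (\<lambda>i. h (f i))" "strict_mono_on {..<r} (\<lambda>i. h (g i))"
          using kK(3,4) I(3,4) hmono unfolding strict_mono_on_def by auto
        have im: "(\<lambda>i. h (f i)) ` {..<r} \<subseteq> Y" "(\<lambda>i. h (g i)) ` {..<r} \<subseteq> Y" using hY by auto
        have "P' P (\<lambda>i. c (h (f i))) = P' P (\<lambda>i. c (h (g i)))"
          by (rule bspec[OF Y(2) rP, unfolded prod.case, rule_format, OF sm(1) im(1) sm(2) im(2)])
        then show ?thesis using c by (simp add: P'_def E_def)
      qed
      ultimately show ?thesis unfolding k' G_def by simp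
    qed
    then have "\<forall>P\<in>F. P E" unfolding K0(3) by blast
    then show "\<exists>E\<in>envs ar. \<forall>P\<in>F. P E" using E by blast
  qed
  then obtain E where E: "E \<in> envs ar" "\<And>k. k \<in> K \<Longrightarrow> G k E" by auto
  have z: "E (Inr q) \<in> tup m" for q using envs_tup[OF E(1), of "Inr q"] by (simp add: ar_def)
  have K1: "(X, q, 0, \<lambda>_. True, \<lambda>_. 0, \<lambda>_. 0) \<in> K" if "rdef n B X" "X a0" for X q
    using that by (auto simp: K_def dfn_const strict_mono_on_def)
  have K2: "(\<lambda>_. True, q, r, P, f, g) \<in> K"
    if "dfn (\<lambda>_::nat. m) B {..<r} P" "strict_mono_on {..<r} f" "strict_mono_on {..<r} g" for q r P f g
    using that rdef_const[OF B(1)] by (simp add: K_def)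
  have \<phi>E: "0 < q \<Longrightarrow> holds M \<phi> (concat (bl E) @ E (Inr q))" "q < 0 \<Longrightarrow> \<not> holds M \<phi> (concat (bl E) @ E (Inr q))" for q
    using E(2)[OF K1[of "\<lambda>_. True" q]] rdef_const[OF B(1)] by (auto simp: G_def)
  have blE: "\<forall>a\<in>set (bl E). a \<in> tup n \<and> eqtp n B a0 a"
  proof
    fix a assume "a \<in> set (bl E)"
    then obtain t where t: "t < j" "a = E (Inl t)" by (auto simp: bl_def)
    have "eqtp n B a0 a"
    proof (rule eqtpI[OF B(1)])
      fix R assume "rdef n B R" "R a0"
      from E(2)[OF K1[OF this, of 0]] show "R a" using t by (auto simp: G_def)
    qed
    then show "a \<in> tup n \<and> eqtp n B a0 a" using t envs_tup[OF E(1), of "Inl t"] by (simp add: ar_def)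
  qed
  define C where "C = B \<union> (\<Union>q\<in>-{0}. set (E (Inr q)))"
  have C: "B \<subseteq> C" "C \<subseteq> U" using B(1) z by (auto simp: C_def tuples_def)
  have sC: "small \<kappa> C" unfolding C_def
    by (rule small_Un[OF B(2) small_UN_finite[OF small_countable_type]]) simp
  have "\<phi> \<in> fms L (length (bl E) * n + m)" using \<phi> by (simp add: bl_def)
  from stable_block[OF st C sC blE this] obtain R
    where R: "rdef m C R" "\<And>c. c \<in> tuples C m \<Longrightarrow> holds M \<phi> (concat (bl E) @ c) \<longleftrightarrow> R c" by blast
  obtain \<psi> e where \<psi>: "\<psi> \<in> fms L (m + length e)" "set e \<subseteq> C" "\<And>c. c \<in> tup m \<Longrightarrow> R c \<longleftrightarrow> holds M \<psi> (c @ e)"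
    using R(1) unfolding rdef_def by blast
  \<comment> \<open>The parameters of the definition, as elements of \<open>B\<close> or entries of some \<open>z_q\<close>.\<close>
  have "\<forall>x. \<exists>t. x \<in> set e \<longrightarrow> t \<in> atoms (\<lambda>_::rat. m) B (-{0}) \<and> val (\<lambda>q. E (Inr q)) t = x"
  proof
    fix x
    show "\<exists>t. x \<in> set e \<longrightarrow> t \<in> atoms (\<lambda>_::rat. m) B (-{0}) \<and> val (\<lambda>q. E (Inr q)) t = x"
    proof (cases "x \<in> set e \<and> x \<notin> B")
      case True
      then obtain q where q: "q \<noteq> 0" "x \<in> set (E (Inr q))" using \<psi>(2) by (auto simp: C_def)
      then obtain i where "i < m" "E (Inr q) ! i = x" using z[of q] by (auto simp: in_set_conv_nth tuples_def)
      then show ?thesis using q(1) by (intro exI[of _ "Inr (q, i)"]) simp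
    next
      case False
      then show ?thesis by (intro exI[of _ "Inl x"]) auto
    qed
  qed
  from choice[OF this] obtain t where
    t: "\<And>x. x \<in> set e \<Longrightarrow> t x \<in> atoms (\<lambda>_::rat. m) B (-{0})"
       "\<And>x. x \<in> set e \<Longrightarrow> val (\<lambda>q. E (Inr q)) (t x) = x" by blast
  define F where "F = {q. \<exists>k. Inr (q, k) \<in> t ` set e}"
  have "finite F"
  proof (rule finite_subset)
    show "F \<subseteq> (\<lambda>t. fst (projr t)) ` t ` set e"
    proof
      fix q assume "q \<in> F"
      then obtain k where "Inr (q, k) \<in> t ` set e" by (auto simp: F_def)
      then show "q \<in> (\<lambda>t. fst (projr t)) ` t ` set e" by (rule rev_image_eqI) simp
    qed
  qed simp
  have "q \<noteq> 0" if q: "q \<in> F" for q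
  proof -
    obtain k x where "x \<in> set e" "t x = Inr (q, k)" using q unfolding F_def by (auto simp: image_iff) metis
    then show ?thesis using t(1)[of x] by simp
  qed
  have tF: "t x \<in> atoms (\<lambda>_::rat. m) B F" if "x \<in> set e" for x
  proof (cases "t x")
    case (Inl a)
    then show ?thesis using t(1)[OF that] by simp
  next
    case (Inr qk)
    obtain q k where "qk = (q, k)" by fastforce
    then show ?thesis using t(1)[OF that] Inr that by (force simp: F_def)
  qed
  \<comment> \<open>No parameter of the definition has an index in \<open>[-\<epsilon>, \<epsilon>]\<close>, so that \<open>\<epsilon>\<close> and \<open>-\<epsilon>\<close> have the same
     position among the indices of the parameters.\<close>
  define \<epsilon> where "\<epsilon> = Min (insert 1 (abs ` F)) / 2"
  have Min: "0 < Min (insert 1 (abs ` F))" using \<open>finite F\<close> \<open>\<And>q. q \<in> F \<Longrightarrow> q \<noteq> 0\<close> by simp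
  then have \<epsilon>: "0 < \<epsilon>" by (simp add: \<epsilon>_def)
  have \<epsilon>F: "\<epsilon> < \<bar>q\<bar>" if "q \<in> F" for q
  proof -
    have "Min (insert 1 (abs ` F)) \<le> \<bar>q\<bar>" using \<open>finite F\<close> that by simp
    then show ?thesis using Min by (simp add: \<epsilon>_def)
  qed
  define xs where "xs = sorted_list_of_set (insert \<epsilon> F)"
  have "finite (insert \<epsilon> F)" using \<open>finite F\<close> by simp
  then have xs: "set xs = insert \<epsilon> F" "sorted xs" "distinct xs" unfolding xs_def
    by (rule set_sorted_list_of_set, intro sorted_sorted_list_of_set, intro distinct_sorted_list_of_set)
  define r where "r = length xs"
  have "\<forall>q. \<exists>i. q \<in> insert \<epsilon> F \<longrightarrow> i < r \<and> xs ! i = q" using xs(1) by (metis in_set_conv_nth r_def)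
  from choice[OF this] obtain idx where idx: "\<And>q. q \<in> insert \<epsilon> F \<Longrightarrow> idx q < r \<and> xs ! idx q = q" by blast
  define f where "f i = xs ! i" for i
  define g where "g i = (if f i = \<epsilon> then - \<epsilon> else f i)" for i
  have fF: "f i \<in> insert \<epsilon> F" if "i < r" for i using that xs(1) nth_mem[of i xs] by (simp add: f_def r_def)
  have f: "strict_mono_on {..<r} f"
  proof (rule strict_mono_onI)
    fix i l assume "i \<in> {..<r}" "l \<in> {..<r}" "i < l"
    then have "xs ! i \<le> xs ! l" "xs ! i \<noteq> xs ! l"
      using xs(2,3) by (auto simp: sorted_iff_nth_mono nth_eq_iff_index_eq r_def)
    then show "f i < f l" by (simp add: f_def)
  qed
  have g: "strict_mono_on {..<r} g"
  proof (rule strict_mono_onI)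
    fix i l assume il: "i \<in> {..<r}" "l \<in> {..<r}" "i < l"
    then have lt: "f i < f l" using f by (auto simp: strict_mono_on_def)
    have "f i < - \<epsilon>" if "f l = \<epsilon>"
    proof -
      have "f i \<in> F" using fF[of i] il lt that by auto
      then show ?thesis using \<epsilon>F[of "f i"] lt that by (auto simp: abs_if split: if_splits)
    qed
    then show "g i < g l" using lt \<epsilon> by (auto simp: g_def)
  qed
  define P0 where "P0 E' = holds M \<psi> (E' \<epsilon> @ map (val E') (map t e))" for E' :: "rat \<Rightarrow> 'a list"
  have "dlist (\<lambda>_::rat. m) B (insert \<epsilon> F) (length (map t e)) (\<lambda>E'. map (val E') (map t e))"
  proof (rule dlist_atoms)
    show "set (map t e) \<subseteq> atoms (\<lambda>_. m) B (insert \<epsilon> F)"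
      using tF atoms_mono[OF order_refl, of F "insert \<epsilon> F" "\<lambda>_. m" B] by auto
  qed
  then have P0: "dfn (\<lambda>_::rat. m) B (insert \<epsilon> F) P0" unfolding P0_def
    by (intro dfn_holds[OF \<psi>(1)] dlist_append dlist_var) simp_all
  then have P: "dfn (\<lambda>_::nat. m) B {..<r} (\<lambda>z. P0 (\<lambda>q. z (idx q)))"
    by (rule dfn_rename) (use idx in auto)
  from E(2)[OF K2[OF P f g, of 0]]
  have same: "P0 (\<lambda>q. E (Inr (f (idx q)))) \<longleftrightarrow> P0 (\<lambda>q. E (Inr (g (idx q))))" by (simp add: G_def)
  have "P0 (\<lambda>q. E (Inr (f (idx q)))) \<longleftrightarrow> R (E (Inr \<epsilon>))"
  proof -
    have "P0 (\<lambda>q. E (Inr (f (idx q)))) \<longleftrightarrow> P0 (\<lambda>q. E (Inr q))"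
      by (rule dfn_agree[OF P0]) (use z idx in \<open>auto simp: envs_def f_def\<close>)
    moreover have "map (val (\<lambda>q. E (Inr q))) (map t e) = e" using t(2) by (auto intro: map_idI)
    ultimately show ?thesis using \<psi>(3)[OF z] by (simp add: P0_def del: map_map)
  qed
  moreover have "P0 (\<lambda>q. E (Inr (g (idx q)))) \<longleftrightarrow> R (E (Inr (- \<epsilon>)))"
  proof -
    have "\<epsilon> \<notin> F" using \<epsilon>F[of \<epsilon>] \<epsilon> by auto
    have "P0 (\<lambda>q. E (Inr (g (idx q)))) \<longleftrightarrow> P0 (\<lambda>q. E (Inr (if q = \<epsilon> then - \<epsilon> else q)))"
      by (rule dfn_agree[OF P0]) (use z idx in \<open>auto simp: envs_def f_def g_def\<close>)
    moreover have "val (\<lambda>q. E (Inr (if q = \<epsilon> then - \<epsilon> else q))) (t x) = x" if x: "x \<in> set e" for x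
    proof -
      have "val (\<lambda>q. E (Inr (if q = \<epsilon> then - \<epsilon> else q))) (t x) = val (\<lambda>q. E (Inr q)) (t x)"
        by (rule val_agree[OF tF[OF x]]) (use \<open>\<epsilon> \<notin> F\<close> in auto)
      then show ?thesis using t(2)[OF x] by simp
    qed
    then have "map (val (\<lambda>q. E (Inr (if q = \<epsilon> then - \<epsilon> else q)))) (map t e) = e" by (auto intro: map_idI)
    ultimately show ?thesis using \<psi>(3)[OF z] by (simp add: P0_def del: map_map)
  qed
  moreover have zC: "E (Inr q) \<in> tuples C m" if "q \<noteq> 0" for q using z[of q] that by (auto simp: tuples_def C_def)
  have "R (E (Inr \<epsilon>))" "\<not> R (E (Inr (- \<epsilon>)))"
    using \<phi>E(1)[OF \<epsilon>] \<phi>E(2)[of "- \<epsilon>"] \<epsilon> R(2)[OF zC[of \<epsilon>]] R(2)[OF zC[of "- \<epsilon>"]] by auto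
  ultimately show False using same by simp
qed

end

lemma noladder_neg: "noladder \<mu> N Y Z \<Longrightarrow> noladder (\<lambda>y z. \<not> \<mu> y z) N Y Z"
proof -
  assume nl: "noladder \<mu> N Y Z"
  show ?thesis unfolding noladder_def
  proof (intro notI, elim exE conjE)
    fix b c assume "\<forall>i<N. Y (b i)" "\<forall>i<N. c i \<in> Z" "ladder (\<lambda>y z. \<not> \<mu> y z) N b c"
    then show False using noladder_rev[OF nl] by simp
  qed
qed

lemma noladder_map:
  assumes "noladder \<mu> N Y Z" and "\<And>y. Y' y \<Longrightarrow> Y (f y)" and "\<And>z. z \<in> Z' \<Longrightarrow> g z \<in> Z"
    and "\<And>y z. Y' y \<Longrightarrow> z \<in> Z' \<Longrightarrow> \<mu>' y z = \<mu> (f y) (g z)"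
  shows "noladder \<mu>' N Y' Z'"
  unfolding noladder_def
proof (intro notI, elim exE conjE)
  fix b c assume *: "\<forall>i<N. Y' (b i)" "\<forall>i<N. c i \<in> Z'" "ladder \<mu>' N b c"
  then have "ladder \<mu> N (\<lambda>i. f (b i)) (\<lambda>i. g (c i))" using assms(4) by (auto simp: ladder_def)
  moreover have "\<forall>i<N. Y (f (b i))" "\<forall>i<N. g (c i) \<in> Z" using * assms(2,3) by auto
  ultimately have "\<exists>b c. (\<forall>i<N. Y (b i)) \<and> (\<forall>i<N. c i \<in> Z) \<and> ladder \<mu> N b c" by (intro exI conjI)
  then show False using assms(1) unfolding noladder_def by simp
qed

lemma nth_concat_uniform:
  "\<forall>x\<in>set bs. length x = n \<Longrightarrow> i < length bs \<Longrightarrow> k < n \<Longrightarrow> concat bs ! (i * n + k) = bs ! i ! k"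
proof (induction bs arbitrary: i)
  case (Cons x bs)
  then show ?case by (cases i) (auto simp: nth_append)
qed simp

definition chunk :: "nat \<Rightarrow> nat \<Rightarrow> 'x list \<Rightarrow> 'x list" where
  "chunk n i xs = map (\<lambda>k. xs ! k) [i * n..<i * n + n]"

lemma chunk_concat:
  assumes "\<forall>x\<in>set bs. length x = n" and "i < length bs"
  shows "chunk n i (concat bs) = bs ! i"
proof (rule nth_equalityI)
  show "length (chunk n i (concat bs)) = length (bs ! i)" using assms by (simp add: chunk_def)
  fix k assume "k < length (chunk n i (concat bs))"
  then have "k < n" by (simp add: chunk_def)
  then show "chunk n i (concat bs) ! k = bs ! i ! k"
    using nth_concat_uniform[OF assms] by (simp add: chunk_def)
qed

lemma chunk_concat_append:
  assumes "\<forall>x\<in>set bs. length x = n" and "i < length bs"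
  shows "chunk n i (concat bs @ z) = bs ! i"
proof -
  have len: "length (concat bs) = length bs * n" using assms(1) by (induction bs) auto
  have "Suc i * n \<le> length bs * n" using assms(2) by (intro mult_le_mono1) simp
  then have "chunk n i (concat bs @ z) = chunk n i (concat bs)"
    using len by (auto simp: chunk_def nth_append)
  then show ?thesis using chunk_concat[OF assms] by simp
qed

section \<open>A global nonforking extension of a stable type\<close>

context monster
begin

lemma dlist_cong: "dlist ar C J m F \<Longrightarrow> (\<And>E. E \<in> envs ar \<Longrightarrow> G E = F E) \<Longrightarrow> dlist ar C J m G"
  unfolding dlist_def by (elim exE) (rule exI, auto)

text \<open>
  A block of \<open>n\<close>-tuples is kept as a list of tuples, not concatenated, so that the iterated quantifier
  \<open>qpow\<close> applies to relations between blocks.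
\<close>

definition lrel :: "nat \<Rightarrow> nat \<Rightarrow> 'a set \<Rightarrow> ('a list list \<Rightarrow> bool) \<Rightarrow> bool" where
  "lrel n j C R \<longleftrightarrow> dfn (\<lambda>_::nat. n) C {..<j} (\<lambda>E. R (map E [0..<j]))"

definition ltup :: "nat \<Rightarrow> nat \<Rightarrow> 'a list list set" where
  "ltup n j = {b. length b = j \<and> set b \<subseteq> tup n}"

lemma ltup_env: "E \<in> envs (\<lambda>_::nat. n) \<Longrightarrow> map E [0..<j] \<in> ltup n j"
  by (auto simp: ltup_def envs_def)

lemma tup_nonempty: "tup m \<noteq> {}"
proof -
  obtain u where "u \<in> U" using U_nonempty by blast
  then have "replicate m u \<in> tup m" by (auto simp: tuples_def)
  then show ?thesis by blast
qed

lemma dfn_lrel: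
  assumes R: "lrel n j C R" and C: "C \<subseteq> C'"  "C' \<subseteq> U"
    and F: "\<And>i. i < j \<Longrightarrow> dlist ar C' J n (\<lambda>E. F E ! i)" "\<And>E. E \<in> envs ar \<Longrightarrow> length (F E) = j"
  shows "dfn ar C' J (\<lambda>E. R (F E))"
proof -
  obtain u where u: "u \<in> tup n" using tup_nonempty by blast
  have "dfn ar C' J (\<lambda>E. R (map (\<lambda>i. if i < j then F E ! i else u) [0..<j]))"
    by (rule dfn_subst[OF R[unfolded lrel_def], of ar C' J "\<lambda>E i. if i < j then F E ! i else u"])
      (use F C u dlist_tup[OF F(1) C(2)] in \<open>auto simp: envs_def\<close>)
  then show ?thesis
  proof (rule dfn_cong)
    fix E assume "E \<in> envs ar"
    then have "map (\<lambda>i. if i < j then F E ! i else u) [0..<j] = F E" using F(2) by (intro nth_equalityI) auto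
    then show "R (F E) = R (map (\<lambda>i. if i < j then F E ! i else u) [0..<j])" by simp
  qed
qed

lemma lrelI:
  assumes "dfn (\<lambda>_::nat. n) C {..<j} P" and "\<And>E. E \<in> envs (\<lambda>_::nat. n) \<Longrightarrow> R (map E [0..<j]) = P E"
  shows "lrel n j C R"
  unfolding lrel_def by (rule dfn_cong[OF assms(1)]) (use assms(2) in auto)

lemma lrel_not: "lrel n j C R \<Longrightarrow> lrel n j C (\<lambda>b. \<not> R b)"
  unfolding lrel_def by (rule dfn_not)

lemma lrel_conj: "lrel n j C R \<Longrightarrow> lrel n j C R' \<Longrightarrow> lrel n j C (\<lambda>b. R b \<and> R' b)"
  unfolding lrel_def by (rule dfn_conj)

lemma lrel_ball_finite: "finite I \<Longrightarrow> (\<And>i. i \<in> I \<Longrightarrow> lrel n j C (R i)) \<Longrightarrow> lrel n j C (\<lambda>b. \<forall>i\<in>I. R i b)"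
  unfolding lrel_def by (rule dfn_ball_finite)

lemma lrel_mono: "lrel n j C R \<Longrightarrow> C \<subseteq> C' \<Longrightarrow> lrel n j C' R"
  unfolding lrel_def by (rule dfn_mono) auto

lemma lrel_cong: "lrel n j C R \<Longrightarrow> (\<And>b. b \<in> ltup n j \<Longrightarrow> R' b = R b) \<Longrightarrow> lrel n j C R'"
  unfolding lrel_def by (erule dfn_cong) (simp add: ltup_env)

lemma lrel_subst:
  assumes R: "lrel n k C R" and C: "C \<subseteq> C'" "C' \<subseteq> U"
    and F: "\<And>i. i < k \<Longrightarrow> (\<exists>l<j. \<forall>b\<in>ltup n j. F b ! i = b ! l) \<or> (\<exists>u\<in>tuples C' n. \<forall>b\<in>ltup n j. F b ! i = u)"
    and len: "\<And>b. b \<in> ltup n j \<Longrightarrow> length (F b) = k"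
  shows "lrel n j C' (\<lambda>b. R (F b))"
  unfolding lrel_def
proof (rule dfn_lrel[OF R C])
  fix i assume i: "i < k"
  from F[OF i] show "dlist (\<lambda>_::nat. n) C' {..<j} n (\<lambda>E. F (map E [0..<j]) ! i)"
  proof
    assume "\<exists>l<j. \<forall>b\<in>ltup n j. F b ! i = b ! l"
    then obtain l where l: "l < j" "\<forall>b\<in>ltup n j. F b ! i = b ! l" by blast
    have "dlist (\<lambda>_::nat. n) C' {..<j} n (\<lambda>E. E l)" using l(1) by (intro dlist_var) auto
    then show ?thesis by (rule dlist_cong) (use l ltup_env[where j = j] in simp)
  next
    assume "\<exists>u\<in>tuples C' n. \<forall>b\<in>ltup n j. F b ! i = u"
    then obtain u where u: "u \<in> tuples C' n" "\<forall>b\<in>ltup n j. F b ! i = u" by blast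
    have "dlist (\<lambda>_::nat. n) C' {..<j} n (\<lambda>E. u)" using u(1) by (rule dlist_const)
    then show ?thesis by (rule dlist_cong) (use u(2) ltup_env in blast)
  qed
qed (use len ltup_env in auto)

lemma lrel_take: "lrel n i C R \<Longrightarrow> i \<le> j \<Longrightarrow> C \<subseteq> U \<Longrightarrow> lrel n j C (\<lambda>b. R (take i b))"
proof (rule lrel_subst)
  fix l assume "i \<le> j" "l < i"
  then show "(\<exists>l'<j. \<forall>b\<in>ltup n j. take i b ! l = b ! l') \<or> (\<exists>u\<in>tuples C n. \<forall>b\<in>ltup n j. take i b ! l = u)"
    by (intro disjI1 exI[of _ l]) simp
qed (auto simp: ltup_def)

lemma lrel_rdef:
  assumes "lrel n j C R" and C: "C \<subseteq> U"
  shows "rdef (j * n) C (\<lambda>y. R (map (\<lambda>i. chunk n i y) [0..<j]))"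
proof -
  have "dfn (\<lambda>_::unit. j * n) C {()} (\<lambda>E. R (map (\<lambda>i. chunk n i (E ())) [0..<j]))"
  proof (rule dfn_lrel[OF assms(1) order_refl C])
    fix i assume i: "i < j"
    then have "Suc i * n \<le> j * n" by (intro mult_le_mono1) simp
    then have "dlist (\<lambda>_::unit. j * n) C {()} n (\<lambda>E. chunk n i (E ()))"
      unfolding chunk_def by (intro dlist_map_nth[OF dlist_var]) auto
    then show "dlist (\<lambda>_::unit. j * n) C {()} n (\<lambda>E. map (\<lambda>i. chunk n i (E ())) [0..<j] ! i)" using i by simp
  qed simp
  then show ?thesis by (rule rdef_dfn) simp
qed

lemma chunks_concat: "b \<in> ltup n j \<Longrightarrow> map (\<lambda>i. chunk n i (concat b @ z)) [0..<j] = b"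
  by (rule nth_equalityI) (auto simp: ltup_def chunk_concat_append tuples_def subset_iff)

lemma chunks_concat': "b \<in> ltup n j \<Longrightarrow> map (\<lambda>i. chunk n i (concat b)) [0..<j] = b"
  using chunks_concat[of b n j "[]"] by simp

lemma concat_ltup: "b \<in> ltup n j \<Longrightarrow> concat b \<in> tup (j * n)"
  by (rule concat_tup) (auto simp: ltup_def)

lemma lrel_fm:
  assumes "lrel n j C R" and "C \<subseteq> U"
  shows "\<exists>\<phi> e. \<phi> \<in> fms L (j * n + length e) \<and> set e \<subseteq> C \<and> (\<forall>b\<in>ltup n j. R b \<longleftrightarrow> holds M \<phi> (concat b @ e))"
proof -
  obtain \<phi> e where p: "\<phi> \<in> fms L (j * n + length e)" "set e \<subseteq> C"
    "\<And>y. y \<in> tup (j * n) \<Longrightarrow> R (map (\<lambda>i. chunk n i y) [0..<j]) \<longleftrightarrow> holds M \<phi> (y @ e)"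
    using lrel_rdef[OF assms] unfolding rdef_def by blast
  have "R b \<longleftrightarrow> holds M \<phi> (concat b @ e)" if "b \<in> ltup n j" for b
    using p(3)[OF concat_ltup[OF that]] chunks_concat'[OF that] by simp
  then show ?thesis using p(1,2) by blast
qed

lemma lrel_of_rdef:
  assumes R: "rdef (j * n + l) C R" and d: "d \<in> tuples C' l" and C: "C \<subseteq> C'" "C' \<subseteq> U"
  shows "lrel n j C' (\<lambda>b. R (concat b @ d))"
  unfolding lrel_def
proof (rule dfn_rdef[OF R _ C], rule dlist_append)
  show "dlist (\<lambda>_::nat. n) C' {..<j} (j * n) (\<lambda>E. concat (map E [0..<j]))"
    using dlist_concat[of "[0..<j]" "\<lambda>_::nat. n" C' "{..<j}" n "\<lambda>i E. E i" "j * n"] by (simp add: dlist_var)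
qed (rule dlist_const[OF d])

end

text \<open>
  The type of \<open>a0\<close> over \<open>B\<close> is stable, and the ultrafilter \<open>Q\<close> is a global extension of it in which no
  formula divides over \<open>A\<close>.
\<close>

locale stable_nonforking = monster L M \<kappa>
  for L :: "('f, 'r) language" and M :: "('f, 'r, 'a) struct" and \<kappa> :: "'k rel" +
  fixes n :: nat and A B :: "'a set" and a0 :: "'a list" and Q :: "('a list \<Rightarrow> bool) \<Rightarrow> bool"
  assumes AB: "A \<subseteq> B" and BU: "B \<subseteq> U" and smallB: "small \<kappa> B" and a0: "a0 \<in> tup n"
    and stable: "stable_at n B a0"
    and Q: "uq Q" and Qtup: "Q (\<lambda>x. x \<in> tup n)" and QB: "\<And>X. rdef n B X \<Longrightarrow> X a0 \<Longrightarrow> Q X"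
    and nondividing: "\<And>\<phi> b. \<phi> \<in> fms L (n + length b) \<Longrightarrow> set b \<subseteq> U \<Longrightarrow> divides L M n A \<phi> b \<Longrightarrow>
      \<not> Q (\<lambda>x. holds M \<phi> (x @ b))"
begin

lemma noladder_1:
  assumes "\<phi> \<in> fms L (n + m)"
  shows "\<exists>N X. rdef n B X \<and> X a0 \<and> noladder (\<lambda>x c. holds M \<phi> (x @ c)) N (\<lambda>x. x \<in> tup n \<and> X x) (tup m)"
proof -
  obtain N X where "rdef n B X" "X a0"
    and nl: "noladder (\<lambda>b c. holds M \<phi> (concat b @ c)) N (\<lambda>b. length b = 1 \<and> (\<forall>x\<in>set b. x \<in> tup n \<and> X x)) (tup m)"
    using stable_noladder[OF stable BU smallB, of \<phi> 1 m] assms by auto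
  moreover have "noladder (\<lambda>x c. holds M \<phi> (x @ c)) N (\<lambda>x. x \<in> tup n \<and> X x) (tup m)"
    by (rule noladder_map[OF nl, of _ "\<lambda>x. [x]" _ "\<lambda>c. c"]) auto
  ultimately show ?thesis by blast
qed

lemma Q_definable:
  assumes "\<phi> \<in> fms L (n + m)"
  shows "\<exists>\<psi> d. \<psi> \<in> fms L (m + length d) \<and> set d \<subseteq> U \<and> (\<forall>c\<in>tup m. Q (\<lambda>x. holds M \<phi> (x @ c)) \<longleftrightarrow> holds M \<psi> (c @ d))"
proof -
  obtain N X where X: "rdef n B X" "X a0" "noladder (\<lambda>x c. holds M \<phi> (x @ c)) N (\<lambda>x. x \<in> tup n \<and> X x) (tup m)"
    using noladder_1[OF assms] by blast
  obtain R where R: "rdef m U R" "\<forall>c\<in>tup m. Q (\<lambda>x. holds M \<phi> (x @ c)) \<longleftrightarrow> R c"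
    using definable_of_noladder[OF Q Qtup order_refl rdef_mono[OF X(1) BU] QB[OF X(1,2)] X(3) assms] by blast
  obtain \<psi> d where p: "\<psi> \<in> fms L (m + length d)" "set d \<subseteq> U" "\<And>c. c \<in> tup m \<Longrightarrow> R c \<longleftrightarrow> holds M \<psi> (c @ d)"
    using R(1) unfolding rdef_def by blast
  then have "\<forall>c\<in>tup m. Q (\<lambda>x. holds M \<phi> (x @ c)) \<longleftrightarrow> holds M \<psi> (c @ d)" using R(2) by simp
  then show ?thesis using p(1,2) by blast
qed

text \<open>
  The formula \<open>psi m \<phi>\<close> with the parameters \<open>dd m \<phi>\<close> is a chosen definition of the \<open>\<phi>\<close>-part of \<open>Q\<close>.
\<close>

definition defn :: "nat \<Rightarrow> ('f, 'r) fm \<Rightarrow> ('f, 'r) fm \<times> 'a list" where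
  "defn m \<phi> = (SOME \<psi>d. fst \<psi>d \<in> fms L (m + length (snd \<psi>d)) \<and> set (snd \<psi>d) \<subseteq> U \<and>
     (\<forall>c\<in>tup m. Q (\<lambda>x. holds M \<phi> (x @ c)) \<longleftrightarrow> holds M (fst \<psi>d) (c @ snd \<psi>d)))"

definition psi :: "nat \<Rightarrow> ('f, 'r) fm \<Rightarrow> ('f, 'r) fm" where "psi m \<phi> = fst (defn m \<phi>)"
definition dd :: "nat \<Rightarrow> ('f, 'r) fm \<Rightarrow> 'a list" where "dd m \<phi> = snd (defn m \<phi>)"

lemma psi:
  assumes "\<phi> \<in> fms L (n + m)"
  shows "psi m \<phi> \<in> fms L (m + length (dd m \<phi>))" "set (dd m \<phi>) \<subseteq> U"
    "c \<in> tup m \<Longrightarrow> Q (\<lambda>x. holds M \<phi> (x @ c)) \<longleftrightarrow> holds M (psi m \<phi>) (c @ dd m \<phi>)"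
proof -
  let ?P = "\<lambda>\<psi>d. fst \<psi>d \<in> fms L (m + length (snd \<psi>d)) \<and> set (snd \<psi>d) \<subseteq> U \<and>
     (\<forall>c\<in>tup m. Q (\<lambda>x. holds M \<phi> (x @ c)) \<longleftrightarrow> holds M (fst \<psi>d) (c @ snd \<psi>d))"
  obtain \<psi> d where "?P (\<psi>, d)" using Q_definable[OF assms] by auto
  then have "?P (defn m \<phi>)" unfolding defn_def by (rule someI)
  then show "psi m \<phi> \<in> fms L (m + length (dd m \<phi>))" "set (dd m \<phi>) \<subseteq> U"
    "c \<in> tup m \<Longrightarrow> Q (\<lambda>x. holds M \<phi> (x @ c)) \<longleftrightarrow> holds M (psi m \<phi>) (c @ dd m \<phi>)"
    unfolding psi_def dd_def by blast+
qed

text \<open>A small set over which the global type is definable, as there are few formulas.\<close>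

definition B0 :: "'a set" where
  "B0 = B \<union> (\<Union>(m, \<phi>)\<in>{(m, \<phi>). \<phi> \<in> fms L (n + m)}. set (dd m \<phi>))"

lemma B0: "A \<subseteq> B0" "B \<subseteq> B0" "B0 \<subseteq> U" "small \<kappa> B0" "\<phi> \<in> fms L (n + m) \<Longrightarrow> set (dd m \<phi>) \<subseteq> B0"
proof -
  show "A \<subseteq> B0" "B \<subseteq> B0" "\<phi> \<in> fms L (n + m) \<Longrightarrow> set (dd m \<phi>) \<subseteq> B0" using AB by (auto simp: B0_def)
  show "B0 \<subseteq> U" using BU psi(2) by (auto simp: B0_def)
  \<comment> \<open>The pair \<open>(m, \<phi>)\<close> is coded by the formula \<open>x\<^sub>m = x\<^sub>m \<and> \<phi>\<close>, and \<open>?f\<close> decodes it.\<close>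
  let ?f = "\<lambda>\<chi>. case \<chi> of Conj \<alpha> \<phi> \<Rightarrow> (case \<alpha> of Eq s t \<Rightarrow> (case s of Var m \<Rightarrow> (m, \<phi>) | _ \<Rightarrow> (0, \<phi>)) | _ \<Rightarrow> (0, \<phi>)) | _ \<Rightarrow> (0, \<chi>)"
  have "{(m, \<phi>). \<phi> \<in> fms L (n + m)} \<subseteq> ?f ` {\<phi>. wf_fm L \<phi>}"
  proof clarify
    fix m \<phi> assume "\<phi> \<in> fms L (n + m)"
    then show "(m, \<phi>) \<in> ?f ` {\<phi>. wf_fm L \<phi>}"
      by (intro image_eqI[of _ _ "Conj (Eq (Var m) (Var m)) \<phi>"]) (auto simp: fms_def)
  qed
  then have "small \<kappa> {(m, \<phi>). \<phi> \<in> fms L (n + m)}" using small_subset[OF small_image[OF small_L]] by blast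
  then show "small \<kappa> B0" unfolding B0_def
    by (intro small_Un[OF smallB] small_UN_finite) auto
qed

lemma dfn_Q:
  assumes P: "dfn ar C (insert v J) P" and ar: "ar v = n" and C: "B0 \<subseteq> C" "C \<subseteq> U"
  shows "dfn ar C (J - {v}) (\<lambda>E. Q (\<lambda>x. P (E(v := x))))"
proof -
  obtain \<phi> ts where p: "\<phi> \<in> fms L (ar v + length ts)" "set ts \<subseteq> atoms ar C (J - {v})"
    "\<forall>E\<in>envs ar. P E \<longleftrightarrow> holds M \<phi> (E v @ map (val E) ts)" using dfn_split[OF P] by blast
  have \<phi>: "\<phi> \<in> fms L (n + length ts)" using p(1) ar by simp
  have ts: "dlist ar C (J - {v}) (length ts) (\<lambda>E. map (val E) ts)" by (rule dlist_atoms[OF p(2)])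
  have "dfn ar C (J - {v}) (\<lambda>E. holds M (psi (length ts) \<phi>) (map (val E) ts @ dd (length ts) \<phi>))"
    by (rule dfn_holds[OF psi(1)[OF \<phi>] dlist_append[OF ts dlist_const]])
      (use B0(5)[OF \<phi>] C in \<open>auto simp: tuples_def\<close>)
  then show ?thesis
  proof (rule dfn_cong)
    fix E assume E: "E \<in> envs ar"
    have "Q (\<lambda>x. P (E(v := x))) \<longleftrightarrow> Q (\<lambda>x. holds M \<phi> (x @ map (val E) ts))"
    proof (rule uq_cong[OF Q, OF Qtup])
      fix x assume x: "x \<in> tup n"
      then have "E(v := x) \<in> envs ar" using E ar by (simp add: envs_upd)
      then have "P (E(v := x)) \<longleftrightarrow> holds M \<phi> (x @ map (val (E(v := x))) ts)" using p(3) by fastforce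
      moreover have "val (E(v := x)) t = val E t" if "t \<in> set ts" for t
        by (rule val_agree[of t ar C "J - {v}"]) (use p(2) that in auto)
      then have "map (val (E(v := x))) ts = map (val E) ts" by simp
      ultimately show "P (E(v := x)) = holds M \<phi> (x @ map (val E) ts)" by simp
    qed
    also have "\<dots> \<longleftrightarrow> holds M (psi (length ts) \<phi>) (map (val E) ts @ dd (length ts) \<phi>)"
      by (rule psi(3)[OF \<phi> dlist_tup[OF ts C(2) E]])
    finally show "Q (\<lambda>x. P (E(v := x))) = holds M (psi (length ts) \<phi>) (map (val E) ts @ dd (length ts) \<phi>)" .
  qed
qed

lemma lrel_Q:
  assumes "lrel n (Suc j) C R" and C: "B0 \<subseteq> C" "C \<subseteq> U"
  shows "lrel n j C (\<lambda>b. Q (\<lambda>x. R (b @ [x])))"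
proof (rule lrelI)
  have "dfn (\<lambda>_::nat. n) C (insert j {..<j}) (\<lambda>E. R (map E [0..<Suc j]))"
    using assms(1) unfolding lrel_def by (rule dfn_mono) auto
  from dfn_Q[OF this refl C] show "dfn (\<lambda>_::nat. n) C {..<j} (\<lambda>E. Q (\<lambda>x. R (map (E(j := x)) [0..<Suc j])))"
    by (rule dfn_mono) auto
  show "Q (\<lambda>x. R (map E [0..<j] @ [x])) = Q (\<lambda>x. R (map (E(j := x)) [0..<Suc j]))" for E by simp
qed

lemma lrel_qpow:
  "lrel n (j + k) C R \<Longrightarrow> B0 \<subseteq> C \<Longrightarrow> C \<subseteq> U \<Longrightarrow> lrel n j C (\<lambda>b. qpow Q k (\<lambda>y. R (b @ y)))"
proof (induction k arbitrary: R)
  case (Suc k)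
  have "lrel n (j + k) C (\<lambda>c. Q (\<lambda>x. R (c @ [x])))" using Suc.prems by (intro lrel_Q) simp_all
  from Suc.IH[OF this Suc.prems(2,3)] show ?case by (simp add: qpow_Suc_end[OF Q] del: qpow.simps)
qed simp

abbreviation Qp where "Qp j \<equiv> qpow Q j"

lemma uqp: "uq (Qp j)" by (rule uq_qpow[OF Q])

lemma Qp_ltup: "Qp j (\<lambda>b. b \<in> ltup n j)"
  using qpow_members[OF Q Qtup, of j] by (rule uq_mono[OF uqp]) (auto simp: ltup_def)

lemma Qp_cong: "(\<And>b. b \<in> ltup n j \<Longrightarrow> P b = R b) \<Longrightarrow> Qp j P = Qp j R"
  using uq_cong[OF uqp, OF Qp_ltup, of j P R] by blast

text \<open>The generic tuples over \<open>C\<close>: the realizations of the \<open>j\<close>-th power of the global type.\<close>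

definition gen :: "nat \<Rightarrow> 'a set \<Rightarrow> 'a list list \<Rightarrow> bool" where
  "gen j C b \<longleftrightarrow> b \<in> ltup n j \<and> (\<forall>R. lrel n j C R \<longrightarrow> Qp j R \<longrightarrow> R b)"

lemma gen_iff: "gen j C b \<Longrightarrow> lrel n j C R \<Longrightarrow> R b \<longleftrightarrow> Qp j R"
  using uq_not[OF uqp, of j R] lrel_not[of n j C R] unfolding gen_def by blast

lemma gen_exists:
  assumes C: "C \<subseteq> U" "small \<kappa> C"
  shows "\<exists>b. gen j C b"
proof -
  define \<Gamma> where "\<Gamma> = (\<lambda>R E. R (map E [0..<j])) ` {R. lrel n j C R \<and> Qp j R}"
  have "\<exists>E\<in>envs (\<lambda>_::nat. n). \<forall>P\<in>\<Gamma>. P E"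
  proof (rule compactness[OF C small_countable])
    show "dfn (\<lambda>_. n) C {..<j} P" if "P \<in> \<Gamma>" for P using that by (auto simp: \<Gamma>_def lrel_def)
  next
    fix F assume "finite F" "F \<subseteq> \<Gamma>"
    then obtain G where G: "G \<subseteq> {R. lrel n j C R \<and> Qp j R}" "finite G" "F = (\<lambda>R E. R (map E [0..<j])) ` G"
      unfolding \<Gamma>_def by (meson finite_subset_image)
    then have "Qp j (\<lambda>b. \<forall>R\<in>G. R b)" by (auto simp: uq_ball[OF _ uqp])
    with Qp_ltup have "Qp j (\<lambda>b. b \<in> ltup n j \<and> (\<forall>R\<in>G. R b))" by (rule uq_conjI[OF uqp])
    from uq_ex[OF uqp, OF this] obtain b where b: "b \<in> ltup n j" "\<forall>R\<in>G. R b" by blast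
    obtain u where u: "u \<in> tup n" using tup_nonempty by blast
    define E where "E i = (if i < j then b ! i else u)" for i
    have "E \<in> envs (\<lambda>_. n)" using b u by (auto simp: envs_def E_def ltup_def)
    moreover have "map E [0..<j] = b" using b by (intro nth_equalityI) (auto simp: E_def ltup_def)
    ultimately show "\<exists>E\<in>envs (\<lambda>_::nat. n). \<forall>P\<in>F. P E" using G(3) b(2) by (intro bexI[of _ E]) auto
  qed
  then obtain E where "E \<in> envs (\<lambda>_::nat. n)" "\<forall>P\<in>\<Gamma>. P E" by blast
  then have "gen j C (map E [0..<j])" unfolding gen_def by (auto simp: \<Gamma>_def ltup_env)
  then show ?thesis by blast
qed

lemma gen_mono: "gen j C b \<Longrightarrow> C' \<subseteq> C \<Longrightarrow> gen j C' b"
  unfolding gen_def using lrel_mono by blast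

lemma gen_take:
  assumes "gen j C b" and "i \<le> j" and C: "C \<subseteq> U"
  shows "gen i C (take i b)"
  unfolding gen_def
proof (intro conjI allI impI)
  have b: "b \<in> ltup n j" using assms(1) by (simp add: gen_def)
  then show "take i b \<in> ltup n i" using assms(2) set_take_subset[of i b] by (auto simp: ltup_def)
  fix R assume R: "lrel n i C R" "Qp i R"
  have "Qp (i + (j - i)) (\<lambda>b. R (take i b)) = Qp i (\<lambda>u. Qp (j - i) (\<lambda>v. R (take i (u @ v))))"
    by (rule qpow_add[OF Q])
  also have "\<dots> = Qp i R"
    by (rule Qp_cong) (simp add: ltup_def uq_const[OF uqp])
  finally have "Qp j (\<lambda>b. R (take i b))" using R(2) assms(2) by simp
  then show "R (take i b)" using assms(1) lrel_take[OF R(1) assms(2) C] unfolding gen_def by blast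
qed

text \<open>
  For a relation between two blocks the second block is part of the parameters, so blocks of
  realizations of the stable type have no long ladders for it.
\<close>

lemma noladder_lrel:
  assumes \<mu>: "lrel n (a + k) C \<mu>" and C: "C \<subseteq> U"
  shows "\<exists>N X. rdef n B X \<and> X a0 \<and> noladder (\<lambda>b y. \<mu> (b @ y)) N (\<lambda>b. length b = a \<and> (\<forall>x\<in>set b. x \<in> tup n \<and> X x)) (ltup n k)"
proof -
  obtain \<phi> e where p: "\<phi> \<in> fms L ((a + k) * n + length e)" "set e \<subseteq> C"
    "\<And>b. b \<in> ltup n (a + k) \<Longrightarrow> \<mu> b \<longleftrightarrow> holds M \<phi> (concat b @ e)" using lrel_fm[OF \<mu> C] by blast
  have \<phi>: "\<phi> \<in> fms L (a * n + (k * n + length e))" using p(1) by (simp add: algebra_simps)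
  obtain N X where X: "rdef n B X" "X a0"
    and nl: "noladder (\<lambda>b c. holds M \<phi> (concat b @ c)) N (\<lambda>b. length b = a \<and> (\<forall>x\<in>set b. x \<in> tup n \<and> X x)) (tup (k * n + length e))"
    using stable_noladder[OF stable BU smallB \<phi>] by blast
  have "noladder (\<lambda>b y. \<mu> (b @ y)) N (\<lambda>b. length b = a \<and> (\<forall>x\<in>set b. x \<in> tup n \<and> X x)) (ltup n k)"
  proof (rule noladder_map[OF nl, of _ "\<lambda>b. b" _ "\<lambda>y. concat y @ e"])
    fix y assume "y \<in> ltup n k"
    from concat_ltup[OF this] show "concat y @ e \<in> tup (k * n + length e)" using p(2) C by (auto simp: tuples_def)
  next
    fix b y assume "length b = a \<and> (\<forall>x\<in>set b. x \<in> tup n \<and> X x)" "y \<in> ltup n k"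
    then have "b @ y \<in> ltup n (a + k)" by (auto simp: ltup_def)
    then show "\<mu> (b @ y) = holds M \<phi> (concat b @ concat y @ e)" using p(3) by simp
  qed
  then show ?thesis using X by blast
qed

lemma Qp_block:
  assumes "rdef n B X" and "X a0"
  shows "Qp a (\<lambda>b. length b = a \<and> (\<forall>x\<in>set b. x \<in> tup n \<and> X x))"
proof -
  have "Q (\<lambda>x. x \<in> tup n \<and> X x)" by (rule uq_conjI[OF Q, OF Qtup, OF QB[OF assms]])
  then show ?thesis by (rule qpow_members[OF Q])
qed

lemma majority_lrel:
  assumes \<mu>: "lrel n (a + k) C \<mu>" and C: "C \<subseteq> U"
  shows "\<exists>N. \<forall>L. Qp (a * L) (\<lambda>s. \<forall>y\<in>ltup n k. Qp a (\<lambda>b. \<mu> (b @ y)) \<longrightarrow>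
    card {l. l < L \<and> \<not> \<mu> (chunk a l s @ y)} < N)"
proof -
  obtain N X where X: "rdef n B X" "X a0"
    and nl: "noladder (\<lambda>b y. \<mu> (b @ y)) N (\<lambda>b. length b = a \<and> (\<forall>x\<in>set b. x \<in> tup n \<and> X x)) (ltup n k)"
    using noladder_lrel[OF assms] by blast
  have "Qp (a * L) (\<lambda>s. \<forall>y\<in>ltup n k. Qp a (\<lambda>b. \<mu> (b @ y)) \<longrightarrow> card {l. l < L \<and> \<not> \<mu> (chunk a l s @ y)} < N)" for L
  proof -
    have "qpow (Qp a) L (\<lambda>bs. \<forall>y\<in>ltup n k. Qp a (\<lambda>b. \<mu> (b @ y)) \<longrightarrow> card {l. l < L \<and> \<not> \<mu> (bs ! l @ y)} < N)"
      by (rule majority[OF uqp, OF Qp_block[OF X], OF nl])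
    moreover have "qpow (Qp a) L (\<lambda>bs. \<forall>y\<in>ltup n k. Qp a (\<lambda>b. \<mu> (b @ y)) \<longrightarrow> card {l. l < L \<and> \<not> \<mu> (bs ! l @ y)} < N) =
      qpow (Qp a) L (\<lambda>bs. \<forall>y\<in>ltup n k. Qp a (\<lambda>b. \<mu> (b @ y)) \<longrightarrow> card {l. l < L \<and> \<not> \<mu> (chunk a l (concat bs) @ y)} < N)"
    proof (rule qpow_cong[OF uqp, OF qpow_length[OF Q]])
      fix bs :: "'a list list list" assume "length bs = L" "\<forall>x\<in>set bs. length x = a"
      then have "chunk a l (concat bs) = bs ! l" if "l < L" for l using chunk_concat that by blast
      then have "{l. l < L \<and> \<not> \<mu> (chunk a l (concat bs) @ y)} = {l. l < L \<and> \<not> \<mu> (bs ! l @ y)}" for y by auto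
      then show "(\<forall>y\<in>ltup n k. Qp a (\<lambda>b. \<mu> (b @ y)) \<longrightarrow> card {l. l < L \<and> \<not> \<mu> (bs ! l @ y)} < N) =
        (\<forall>y\<in>ltup n k. Qp a (\<lambda>b. \<mu> (b @ y)) \<longrightarrow> card {l. l < L \<and> \<not> \<mu> (chunk a l (concat bs) @ y)} < N)" by simp
    qed
    ultimately show ?thesis by (simp add: qpow_concat[OF Q])
  qed
  then show ?thesis by blast
qed

lemma Qp_commute:
  assumes \<mu>: "lrel n (a + k) C \<mu>" and C: "C \<subseteq> U" and "Qp a (\<lambda>b. Qp k (\<lambda>y. \<mu> (b @ y)))"
  shows "Qp k (\<lambda>y. Qp a (\<lambda>b. \<mu> (b @ y)))"
proof -
  obtain N X where X: "rdef n B X" "X a0"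
    and nl: "noladder (\<lambda>b y. \<mu> (b @ y)) N (\<lambda>b. length b = a \<and> (\<forall>x\<in>set b. x \<in> tup n \<and> X x)) (ltup n k)"
    using noladder_lrel[OF \<mu> C] by blast
  show ?thesis by (rule uq_commute[OF uqp, OF Qp_block[OF X], OF uqp, OF Qp_ltup, OF nl _ assms(3)])
qed

text \<open>
  The second part combines the bounds for \<open>\<phi>\<close> and for its negation: a generic tuple of length \<open>2 * N\<close>
  decides by majority which instances of \<open>\<phi>\<close> belong to \<open>Q\<close>.
\<close>

lemma majority_fm:
  assumes "\<phi> \<in> fms L (n + m)"
  shows "\<exists>N. \<forall>L. Qp L (\<lambda>b. \<forall>c\<in>tup m. Q (\<lambda>x. holds M \<phi> (x @ c)) \<longrightarrow> card {l. l < L \<and> \<not> holds M \<phi> (b ! l @ c)} < N)"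
    and "\<exists>N. Qp (2 * N) (\<lambda>b. \<forall>c\<in>tup m. Q (\<lambda>x. holds M \<phi> (x @ c)) \<longleftrightarrow> N < card {l. l < 2 * N \<and> holds M \<phi> (b ! l @ c)})"
proof -
  obtain N X where X: "rdef n B X" "X a0"
    and nl: "noladder (\<lambda>x c. holds M \<phi> (x @ c)) N (\<lambda>x. x \<in> tup n \<and> X x) (tup m)"
    using noladder_1[OF assms] by blast
  have QX: "Q (\<lambda>x. x \<in> tup n \<and> X x)" by (rule uq_conjI[OF Q, OF Qtup, OF QB[OF X]])
  note maj = majority[OF Q, OF QX, OF nl]
  note maj' = majority[OF Q, OF QX, OF noladder_neg[OF nl]]
  show "\<exists>N. \<forall>L. Qp L (\<lambda>b. \<forall>c\<in>tup m. Q (\<lambda>x. holds M \<phi> (x @ c)) \<longrightarrow> card {l. l < L \<and> \<not> holds M \<phi> (b ! l @ c)} < N)"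
    using maj by blast
  have "Qp (2 * N) (\<lambda>b. (\<forall>c\<in>tup m. Q (\<lambda>x. holds M \<phi> (x @ c)) \<longrightarrow> card {l. l < 2 * N \<and> \<not> holds M \<phi> (b ! l @ c)} < N) \<and>
    (\<forall>c\<in>tup m. Q (\<lambda>x. \<not> holds M \<phi> (x @ c)) \<longrightarrow> card {l. l < 2 * N \<and> \<not> \<not> holds M \<phi> (b ! l @ c)} < N))"
    by (rule uq_conjI[OF uqp, OF maj, OF maj'])
  then have "Qp (2 * N) (\<lambda>b. \<forall>c\<in>tup m. Q (\<lambda>x. holds M \<phi> (x @ c)) \<longleftrightarrow> N < card {l. l < 2 * N \<and> holds M \<phi> (b ! l @ c)})"
  proof (rule uq_mono[OF uqp], elim conjE, intro ballI)
    fix b c assume *: "\<forall>c\<in>tup m. Q (\<lambda>x. holds M \<phi> (x @ c)) \<longrightarrow> card {l. l < 2 * N \<and> \<not> holds M \<phi> (b ! l @ c)} < N"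
      "\<forall>c\<in>tup m. Q (\<lambda>x. \<not> holds M \<phi> (x @ c)) \<longrightarrow> card {l. l < 2 * N \<and> \<not> \<not> holds M \<phi> (b ! l @ c)} < N" "c \<in> tup m"
    have "{..<2 * N} = {l. l < 2 * N \<and> holds M \<phi> (b ! l @ c)} \<union> {l. l < 2 * N \<and> \<not> holds M \<phi> (b ! l @ c)}" by auto
    then have "2 * N = card ({l. l < 2 * N \<and> holds M \<phi> (b ! l @ c)} \<union> {l. l < 2 * N \<and> \<not> holds M \<phi> (b ! l @ c)})"
      by (metis card_lessThan)
    also have "\<dots> = card {l. l < 2 * N \<and> holds M \<phi> (b ! l @ c)} + card {l. l < 2 * N \<and> \<not> holds M \<phi> (b ! l @ c)}"
      by (rule card_Un_disjoint) auto
    finally have sum: "2 * N = card {l. l < 2 * N \<and> holds M \<phi> (b ! l @ c)} + card {l. l < 2 * N \<and> \<not> holds M \<phi> (b ! l @ c)}" .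
    show "Q (\<lambda>x. holds M \<phi> (x @ c)) = (N < card {l. l < 2 * N \<and> holds M \<phi> (b ! l @ c)})"
    proof (cases "Q (\<lambda>x. holds M \<phi> (x @ c))")
      case True
      then have "card {l. l < 2 * N \<and> \<not> holds M \<phi> (b ! l @ c)} < N" using *(1,3) by blast
      then show ?thesis using sum True by linarith
    next
      case False
      then have "Q (\<lambda>x. \<not> holds M \<phi> (x @ c))" using uq_not[OF Q] by blast
      then have "card {l. l < 2 * N \<and> holds M \<phi> (b ! l @ c)} < N" using *(2,3) by simp
      then show ?thesis using False by simp
    qed
  qed
  then show "\<exists>N. Qp (2 * N) (\<lambda>b. \<forall>c\<in>tup m. Q (\<lambda>x. holds M \<phi> (x @ c)) \<longleftrightarrow> N < card {l. l < 2 * N \<and> holds M \<phi> (b ! l @ c)})"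
    by blast
qed

end

section \<open>Few conjugates of the definitions\<close>

text \<open>
  For an equivalence relation \<open>eq\<close> this says that \<open>P\<close> meets at most \<open>s\<close> classes.  In this form it is
  first-order whenever \<open>eq\<close> and \<open>P\<close> are.
\<close>

definition few :: "nat \<Rightarrow> ('z \<Rightarrow> 'z \<Rightarrow> bool) \<Rightarrow> ('z \<Rightarrow> bool) \<Rightarrow> bool" where
  "few s eq P \<longleftrightarrow> \<not> (\<exists>z. (\<forall>i\<le>s. P (z i)) \<and> (\<forall>i j. i < j \<and> j \<le> s \<longrightarrow> \<not> eq (z i) (z j)))"

context monster
begin

lemma dfn_all:
  assumes "dfn ar C (insert v J) P"
  shows "dfn ar C (J - {v}) (\<lambda>E. \<forall>a\<in>tup (ar v). P (E(v := a)))"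
  by (rule dfn_cong[OF dfn_not[OF dfn_ex[OF dfn_not[OF assms]]]]) simp

lemma few_rdef:
  assumes H: "rdef (k + l) C H" and eq: "rdef (l + l) C eqR" "\<And>z z'. z \<in> tup l \<Longrightarrow> z' \<in> tup l \<Longrightarrow> eqR (z @ z') = eq z z'"
    and C: "C \<subseteq> U"
  shows "rdef k C (\<lambda>y. few s eq (\<lambda>z. z \<in> tup l \<and> H (y @ z)))"
proof -
  define ar where "ar = case_nat k (\<lambda>_::nat. l)"
  define I where "I = {(i, j). i < j \<and> j \<le> s}"
  have finI: "finite I" by (rule finite_subset[of _ "{..s} \<times> {..s}"]) (auto simp: I_def)
  define P where "P E \<longleftrightarrow> (\<forall>i\<in>{..s}. H (E 0 @ E (Suc i))) \<and> (\<forall>p\<in>I. \<not> eqR (E (Suc (fst p)) @ E (Suc (snd p))))"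
    for E :: "nat \<Rightarrow> 'a list"
  have "dfn ar C UNIV P" unfolding P_def
    by (intro dfn_conj dfn_ball_finite dfn_not finI dfn_rdef[OF H] dfn_rdef[OF eq(1)] dlist_append dlist_var order_refl C)
      (auto simp: ar_def)
  from dfn_ex_set[OF this, of "range Suc"]
  have "dfn ar C (UNIV - range Suc) (\<lambda>E. \<exists>E'\<in>envs ar. (\<forall>v. v \<notin> range Suc \<longrightarrow> E' v = E v) \<and> P E')" .
  moreover have "UNIV - range Suc = {0}" by (auto simp: image_iff) (metis not0_implies_Suc)
  ultimately have "dfn ar C {0} (\<lambda>E. \<exists>E'\<in>envs ar. (\<forall>v. v \<notin> range Suc \<longrightarrow> E' v = E v) \<and> P E')" by (simp only:)
  from dfn_not[OF this] have "dfn ar C {0} (\<lambda>E. few s eq (\<lambda>z. z \<in> tup l \<and> H (E 0 @ z)))"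
  proof (rule dfn_cong)
    fix E assume E: "E \<in> envs ar"
    have "(\<exists>z. (\<forall>i\<le>s. z i \<in> tup l \<and> H (E 0 @ z i)) \<and> (\<forall>i j. i < j \<and> j \<le> s \<longrightarrow> \<not> eq (z i) (z j))) \<longleftrightarrow>
      (\<exists>E'\<in>envs ar. (\<forall>v. v \<notin> range Suc \<longrightarrow> E' v = E v) \<and> P E')" (is "?l \<longleftrightarrow> ?r")
    proof
      assume ?l
      then obtain z where z: "\<forall>i\<le>s. z i \<in> tup l \<and> H (E 0 @ z i)" "\<forall>i j. i < j \<and> j \<le> s \<longrightarrow> \<not> eq (z i) (z j)" by blast
      define E' where "E' = case_nat (E 0) (\<lambda>i. if i \<le> s then z i else E (Suc i))"
      have "E' v \<in> tup (ar v)" for v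
        using z(1) envs_tup[OF E, of v] by (cases v) (auto simp: E'_def ar_def)
      then have E': "E' \<in> envs ar" by (simp add: envs_def)
      have "P E'" unfolding P_def using z eq(2) by (auto simp: E'_def I_def)
      moreover have "E' v = E v" if "v \<notin> range Suc" for v using that by (cases v) (auto simp: E'_def)
      ultimately show ?r using E' by blast
    next
      assume ?r
      then obtain E' where E': "E' \<in> envs ar" "E' 0 = E 0" "P E'" by force
      have t: "E' (Suc i) \<in> tup l" for i using envs_tup[OF E'(1), of "Suc i"] by (simp add: ar_def)
      show ?l
      proof (intro exI[of _ "\<lambda>i. E' (Suc i)"] conjI allI impI)
        fix i j assume "i < j \<and> j \<le> s"
        then have "(i, j) \<in> I" by (simp add: I_def)
        then show "\<not> eq (E' (Suc i)) (E' (Suc j))" using E'(3) eq(2)[OF t t] by (force simp: P_def)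
      qed (use t E' in \<open>auto simp: P_def\<close>)
    qed
    then show "few s eq (\<lambda>z. z \<in> tup l \<and> H (E 0 @ z)) = (\<not> (\<exists>E'\<in>envs ar. (\<forall>v. v \<notin> range Suc \<longrightarrow> E' v = E v) \<and> P E'))"
      by (simp add: few_def)
  qed
  then show ?thesis by (rule rdef_dfn) (simp add: ar_def)
qed

lemma slice_append: "x \<in> tup a \<Longrightarrow> map (\<lambda>i. (x @ y) ! i) [0..<a] = x"
  "x \<in> tup a \<Longrightarrow> y \<in> tup b \<Longrightarrow> map (\<lambda>i. (x @ y @ z) ! i) [a..<a + b] = y"
  "x \<in> tup a \<Longrightarrow> y \<in> tup b \<Longrightarrow> z \<in> tup c \<Longrightarrow> map (\<lambda>i. (x @ y @ z) ! i) [a + b..<a + b + c] = z"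
  by (auto simp: tuples_def nth_append intro!: nth_equalityI)

lemma dlist_slice: "dlist ar C J m F \<Longrightarrow> b \<le> m \<Longrightarrow> k = b - a \<Longrightarrow> dlist ar C J k (\<lambda>E. map (\<lambda>i. F E ! i) [a..<b])"
  by (rule dlist_map_nth) auto

end

context stable_nonforking
begin

text \<open>Equality of canonical parameters, without imaginary elements.\<close>

definition eqv :: "nat \<Rightarrow> ('f, 'r) fm \<Rightarrow> 'a list \<Rightarrow> 'a list \<Rightarrow> bool" where
  "eqv m \<phi> z z' \<longleftrightarrow> (\<forall>c\<in>tup m. holds M (psi m \<phi>) (c @ z) \<longleftrightarrow> holds M (psi m \<phi>) (c @ z'))"

lemma eqv_rdef:
  assumes \<phi>: "\<phi> \<in> fms L (n + m)" and l: "l = length (dd m \<phi>)"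
  shows "\<exists>R. rdef (l + l) {} R \<and> (\<forall>z\<in>tup l. \<forall>z'\<in>tup l. R (z @ z') = eqv m \<phi> z z')"
proof -
  define R where "R w = eqv m \<phi> (map (\<lambda>i. w ! i) [0..<l]) (map (\<lambda>i. w ! i) [l..<l + l])" for w :: "'a list"
  define ar where "ar = (\<lambda>b. if b then m else l + l)"
  have psi': "psi m \<phi> \<in> fms L (m + l)" using psi(1)[OF \<phi>] l by simp
  have "dfn ar {} (insert True {False}) (\<lambda>E. holds M (psi m \<phi>) (E True @ map (\<lambda>i. E False ! i) [0..<l]) \<longleftrightarrow>
      holds M (psi m \<phi>) (E True @ map (\<lambda>i. E False ! i) [l..<l + l]))"
    by (intro dfn_iff dfn_holds[OF psi'] dlist_append dlist_var dlist_slice) (auto simp: ar_def)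
  from dfn_all[OF this] have "dfn ar {} {False} (\<lambda>E. R (E False))"
    by (simp add: R_def eqv_def ar_def insert_Diff_if)
  then have "rdef (l + l) {} R" by (rule rdef_dfn) (simp add: ar_def)
  moreover have "R (z @ z') = eqv m \<phi> z z'" if "z \<in> tup l" "z' \<in> tup l" for z z'
    using slice_append(1)[OF that(1), of z'] slice_append(2)[OF that, of "[]"] by (simp add: R_def)
  ultimately show ?thesis by blast
qed

lemma A: "A \<subseteq> U" "small \<kappa> A"
  using AB BU small_subset[OF smallB] by auto

text \<open>
  Nondividing removes one generic entry: if a generic \<open>x\<close> bounds the number of conjugates of
  \<open>d\<close> up to equivalence over \<open>A\<close>, \<open>x\<close> and \<open>y\<close>, then the number of conjugates over \<open>A\<close> and \<open>y\<close>
  is bounded.  Otherwise there is an infinite sequence of inequivalent conjugates, and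
  along it the formula expressing the bound is inconsistent.
\<close>

lemma few_conjugates_step:
  assumes \<phi>: "\<phi> \<in> fms L (n + m)" and l: "l = length (dd m \<phi>)"
    and H: "rdef (k + n + l) A H" and y: "y \<in> tup k" and d: "d \<in> tup l"
    and QH: "Q (\<lambda>x. H (y @ x @ d) \<and> few s (eqv m \<phi>) (\<lambda>z. z \<in> tup l \<and> H (y @ x @ z)))"
  shows "\<exists>H' s'. rdef (k + l) A H' \<and> H' (y @ d) \<and> few s' (eqv m \<phi>) (\<lambda>z. z \<in> tup l \<and> H' (y @ z))"
proof (rule ccontr)
  assume neg: "\<not> ?thesis"
  obtain eqR where eqR: "rdef (l + l) {} eqR" "\<And>z z'. z \<in> tup l \<Longrightarrow> z' \<in> tup l \<Longrightarrow> eqR (z @ z') = eqv m \<phi> z z'"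
    using eqv_rdef[OF \<phi> l] by blast
  define C where "C = A \<union> set y"
  have C: "C \<subseteq> U" "small \<kappa> C" using A y small_Un[OF A(2) small_finite] by (auto simp: C_def tuples_def)
  \<comment> \<open>By compactness there are pairwise inequivalent tuples \<open>E i\<close> such that \<open>y @ E i\<close> has the type of
     \<open>y @ d\<close> over \<open>A\<close>.\<close>
  define K where "K = {(H', i::nat, j::nat). rdef (k + l) A H' \<and> H' (y @ d)}"
  define g where "g = (\<lambda>(H', i::nat, j::nat) E. H' (y @ E i) \<and> (i < j \<longrightarrow> \<not> eqR (E i @ E j)))"
  have "\<exists>E\<in>envs (\<lambda>_::nat. l). \<forall>P\<in>g ` K. P E"
  proof (rule compactness[OF C small_countable])
    fix P assume "P \<in> g ` K"
    then obtain H' i j where P: "rdef (k + l) A H'" "P = g (H', i, j)" by (auto simp: K_def)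
    have "dfn (\<lambda>_::nat. l) C UNIV (\<lambda>E. H' (y @ E i))"
      by (rule dfn_rdef[OF P(1)], rule dlist_append, rule dlist_const)
        (use y C in \<open>auto simp: C_def tuples_def intro: dlist_var\<close>)
    moreover have "dfn (\<lambda>_::nat. l) C UNIV (\<lambda>E. eqR (E i @ E j))"
      by (rule dfn_rdef[OF eqR(1)], rule dlist_append) (use C in \<open>auto intro: dlist_var\<close>)
    ultimately show "dfn (\<lambda>_::nat. l) C UNIV P" unfolding P(2) g_def
      by (simp only: prod.case) (intro dfn_conj dfn_imp dfn_const dfn_not)
  next
    fix F assume "finite F" "F \<subseteq> g ` K"
    then obtain K0 where K0: "K0 \<subseteq> K" "finite K0" "F = g ` K0" by (meson finite_subset_image)
    define s' where "s' = Max ({0} \<union> (\<lambda>(H', i, j). i + j) ` K0)"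
    define H' where "H' w \<longleftrightarrow> (\<forall>h\<in>fst ` K0. h w)" for w
    have "rdef (k + l) A H'" unfolding H'_def using K0 A by (intro rdef_ball_finite) (auto simp: K_def)
    moreover have "H' (y @ d)" using K0 by (auto simp: H'_def K_def)
    ultimately have "\<not> few s' (eqv m \<phi>) (\<lambda>z. z \<in> tup l \<and> H' (y @ z))" using neg by blast
    then obtain z where z: "\<forall>i\<le>s'. z i \<in> tup l \<and> H' (y @ z i)" "\<forall>i j. i < j \<and> j \<le> s' \<longrightarrow> \<not> eqv m \<phi> (z i) (z j)"
      unfolding few_def by blast
    define E where "E i = (if i \<le> s' then z i else d)" for i
    have E: "E \<in> envs (\<lambda>_. l)" using z(1) d by (auto simp: envs_def E_def)
    have "g p E" if p: "p \<in> K0" for p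
    proof -
      obtain h i j where p': "p = (h, i, j)" by (metis prod_cases3)
      have "i + j \<le> s'" unfolding s'_def using p p' K0(2) by (intro Max_ge) force+
      then have ij: "i \<le> s'" "j \<le> s'" by auto
      have "h (y @ z i)" using z(1) ij p p' by (force simp: H'_def)
      then show ?thesis using z ij eqR(2) by (auto simp: p' g_def E_def)
    qed
    then have "\<forall>P\<in>F. P E" unfolding K0(3) by blast
    then show "\<exists>E\<in>envs (\<lambda>_::nat. l). \<forall>P\<in>F. P E" using E by blast
  qed
  then obtain E where E: "E \<in> envs (\<lambda>_::nat. l)" "\<And>p. p \<in> K \<Longrightarrow> g p E" by auto
  have z: "E i \<in> tup l" for i using envs_tup[OF E(1), of i] .
  have ineq: "\<not> eqv m \<phi> (E i) (E j)" if "i < j" for i j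
  proof -
    have "(\<lambda>_. True, i, j) \<in> K" using rdef_const[OF A(1)] by (simp add: K_def)
    from E(2)[OF this] show ?thesis using that eqR(2)[OF z z] by (simp add: g_def)
  qed
  have conj: "H' (y @ E i)" if "rdef (k + l) A H'" "H' (y @ d)" for H' i
  proof -
    have "(H', i, i) \<in> K" using that by (simp add: K_def)
    from E(2)[OF this] show ?thesis by (simp add: g_def)
  qed
  define \<chi> where "\<chi> x w \<longleftrightarrow> H (map (\<lambda>i. w ! i) [0..<k] @ x @ map (\<lambda>i. w ! i) [k..<k + l]) \<and>
    few s (eqv m \<phi>) (\<lambda>z. z \<in> tup l \<and> H ((map (\<lambda>i. w ! i) [0..<k] @ x) @ z))" for x w
  define fs where "fs = (\<lambda>y. few s (eqv m \<phi>) (\<lambda>z. z \<in> tup l \<and> H (y @ z)))"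
  have "rdef (k + n) A fs" unfolding fs_def
    using few_rdef[OF H rdef_mono[OF eqR(1)] eqR(2) A(1)] by simp
  let ?ar = "\<lambda>b. if b then n else k + l"
  have sl: "dlist ?ar A UNIV k (\<lambda>E. map (\<lambda>i. E False ! i) [0..<k])"
    and sr: "dlist ?ar A UNIV l (\<lambda>E. map (\<lambda>i. E False ! i) [k..<k + l])"
    and xt: "dlist ?ar A UNIV n (\<lambda>E. E True)"
    by (auto intro!: dlist_slice[where m = "k + l"] dlist_var)
  have "dfn ?ar A UNIV (\<lambda>E. H (map (\<lambda>i. E False ! i) [0..<k] @ E True @ map (\<lambda>i. E False ! i) [k..<k + l]))"
    by (rule dfn_rdef[OF H dlist_append'[OF sl dlist_append[OF xt sr]] order_refl A(1)]) simp
  moreover have "dfn ?ar A UNIV (\<lambda>E. fs (map (\<lambda>i. E False ! i) [0..<k] @ E True))"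
    by (rule dfn_rdef[OF \<open>rdef (k + n) A fs\<close> dlist_append[OF sl xt] order_refl A(1)])
  ultimately have "dfn ?ar A UNIV (\<lambda>E. \<chi> (E True) (E False))"
    unfolding \<chi>_def fs_def by (rule dfn_conj)
  from dfn_split[of _ A True UNIV, simplified, OF this] obtain \<phi>' ts where
    p: "\<phi>' \<in> fms L (n + length ts)" "set ts \<subseteq> atoms (\<lambda>b. if b then n else k + l) A (- {True})"
    "\<forall>E\<in>envs (\<lambda>b. if b then n else k + l). \<chi> (E True) (E False) \<longleftrightarrow> holds M \<phi>' (E True @ map (val E) ts)"
    by (auto simp: Compl_eq_Diff_UNIV)
  \<comment> \<open>the parameters of the dividing formula, with \<open>w\<close> in place of \<open>y @ d\<close>\<close>
  define pr where "pr w = map (val (\<lambda>b::bool. w)) ts" for w :: "'a list"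
  have \<chi>\<phi>: "\<chi> x w \<longleftrightarrow> holds M \<phi>' (x @ pr w)" if "x \<in> tup n" "w \<in> tup (k + l)" for x w
  proof -
    have "(\<lambda>b. if b then x else w) \<in> envs (\<lambda>b. if b then n else k + l)" using that by (simp add: envs_def)
    then have "\<chi> x w \<longleftrightarrow> holds M \<phi>' (x @ map (val (\<lambda>b. if b then x else w)) ts)" using p(3) by fastforce
    moreover have "val (\<lambda>b. if b then x else w) t = val (\<lambda>b. w) t" if "t \<in> set ts" for t
      by (rule val_agree[of t "\<lambda>b. if b then n else k + l" A "- {True}"]) (use p(2) that in auto)
    then have "map (val (\<lambda>b. if b then x else w)) ts = pr w" by (simp add: pr_def)
    ultimately show ?thesis by simp
  qed
  have dpr: "dlist (\<lambda>_::unit. k + l) A {()} (length ts) (\<lambda>E. pr (E ()))"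
  proof -
    let ?h = "\<lambda>t. case t of Inl a \<Rightarrow> Inl a | Inr (b, k) \<Rightarrow> Inr ((), k)"
    have v: "val E (?h t) = val (\<lambda>b::bool. E ()) t" for E :: "unit \<Rightarrow> 'a list" and t
      by (auto split: sum.split)
    have "set (map ?h ts) \<subseteq> atoms (\<lambda>_::unit. k + l) A {()}"
    proof -
      have "?h t \<in> atoms (\<lambda>_::unit. k + l) A {()}" if t: "t \<in> atoms (\<lambda>b. if b then n else k + l) A (- {True})" for t
        using t by (auto simp: atoms_def)
      then show ?thesis using p(2) by auto
    qed
    from dlist_atoms[OF this] show ?thesis by (simp add: pr_def comp_def v)
  qed
  have prU: "pr w \<in> tup (length ts)" if "w \<in> tup (k + l)" for w
    using dlist_tup[OF dpr A(1), of "\<lambda>_. w"] that by (simp add: envs_def)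
  have yd: "y @ d \<in> tup (k + l)" and yE: "\<And>i. y @ E i \<in> tup (k + l)" using y d z by (auto simp: tuples_def)
  have \<chi>eq: "\<chi> x (y @ v) \<longleftrightarrow> H (y @ x @ v) \<and> few s (eqv m \<phi>) (\<lambda>z. z \<in> tup l \<and> H (y @ x @ z))" if "v \<in> tup l" for x v
    using slice_append(1)[OF y, of v] slice_append(2)[OF y that, of "[]"] by (simp add: \<chi>_def)
  have "divides L M n A \<phi>' (pr (y @ d))"
    unfolding divides_def
  proof (intro exI[of _ "Suc s"] exI[of _ "\<lambda>i. pr (y @ E i)"] conjI allI impI)
    fix i
    show "pr (y @ E i) \<in> tup (length (pr (y @ d)))" using prU[OF yE[of i]] by (simp add: pr_def)
    have tr: "holds (named M) \<chi>' (pr (y @ E i)) = holds (named M) \<chi>' (pr (y @ d))" if "\<chi>' \<in> fms_over L A (length ts)" for \<chi>'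
    proof -
      have "dfn (\<lambda>_::unit. k + l) A {()} (\<lambda>E. holds (named M) \<chi>' (pr (E ())))"
        by (rule dfn_rdef[OF fms_over_rdef[OF that] dpr order_refl A(1)])
      then have r: "rdef (k + l) A (\<lambda>w. holds (named M) \<chi>' (pr w))" by (rule rdef_dfn) simp
      from conj[OF this] conj[OF rdef_not[OF this A(1)]] show ?thesis by blast
    qed
    have "length (pr w) = length ts" for w by (simp add: pr_def)
    then show "tp L M (pr (y @ E i)) A = tp L M (pr (y @ d)) A" using tr by (auto simp: tp_def)
  next
    fix I :: "nat set" assume I: "finite I \<and> card I = Suc s"
    show "\<not> (\<exists>a\<in>tup n. \<forall>i\<in>I. holds (named M) (inst n \<phi>' (pr (y @ E i))) a)"
    proof (rule notI, elim bexE)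
      fix a assume a: "a \<in> tup n" "\<forall>i\<in>I. holds (named M) (inst n \<phi>' (pr (y @ E i))) a"
      have len: "length (pr w) = length ts" for w by (simp add: pr_def)
      have "\<chi> a (y @ E i)" if "i \<in> I" for i
        using a that p(1) \<chi>\<phi>[OF a(1) yE[of i]] by (simp add: holds_inst len tuples_def)
      then have aH: "H (y @ a @ E i)" "few s (eqv m \<phi>) (\<lambda>z. z \<in> tup l \<and> H (y @ a @ z))" if "i \<in> I" for i
        using that \<chi>eq[OF z] by blast+
      define xs where "xs = sorted_list_of_set I"
      have xs: "length xs = Suc s" "set xs = I" "sorted xs" "distinct xs" using I by (auto simp: xs_def)
      have ltx: "xs ! i < xs ! j" if "i < j" "j \<le> s" for i j
      proof -
        have "xs ! i \<le> xs ! j" "xs ! i \<noteq> xs ! j" using that xs by (auto simp: sorted_iff_nth_mono nth_eq_iff_index_eq)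
        then show ?thesis by simp
      qed
      have xI: "xs ! i \<in> I" if "i \<le> s" for i using that xs(1,2) nth_mem[of i xs] by simp
      have "\<not> few s (eqv m \<phi>) (\<lambda>z. z \<in> tup l \<and> H (y @ a @ z))"
        unfolding few_def not_not
        by (rule exI[of _ "\<lambda>i. E (xs ! i)"]) (use z aH(1)[OF xI] ineq ltx in auto)
      moreover have "xs ! 0 \<in> I" by (rule xI) simp
      ultimately show False using aH(2) by blast
    qed
  qed
  then have "\<not> Q (\<lambda>x. holds M \<phi>' (x @ pr (y @ d)))"
    using p(1) prU[OF yd] by (intro nondividing) (auto simp: pr_def tuples_def)
  moreover have "Q (\<lambda>x. holds M \<phi>' (x @ pr (y @ d))) = Q (\<lambda>x. \<chi> x (y @ d))"
    by (rule uq_cong[OF Q, OF Qtup]) (use \<chi>\<phi>[OF _ yd] in simp)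
  ultimately show False using QH \<chi>eq[OF d] by simp
qed

text \<open>
  Up to equivalence the parameter of a definition has boundedly many conjugates over \<open>A\<close>: a long
  generic tuple determines the defined set by majority, and its entries are removed
  one by one.
\<close>

lemma few_conjugates:
  assumes \<phi>: "\<phi> \<in> fms L (n + m)" and l: "l = length (dd m \<phi>)"
  shows "\<exists>H s. rdef l A H \<and> H (dd m \<phi>) \<and> few s (eqv m \<phi>) (\<lambda>z. z \<in> tup l \<and> H z)"
proof -
  define d where "d = dd m \<phi>"
  have d: "d \<in> tup l" "d \<in> tuples B0 l" using psi(2)[OF \<phi>] B0(5)[OF \<phi>] l by (auto simp: d_def tuples_def)
  have psi': "psi m \<phi> \<in> fms L (m + l)" using psi(1)[OF \<phi>] l by simp
  obtain N where N: "Qp (2 * N) (\<lambda>b. \<forall>c\<in>tup m. Q (\<lambda>x. holds M \<phi> (x @ c)) \<longleftrightarrow> N < card {i. i < 2 * N \<and> holds M \<phi> (b ! i @ c)})"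
    using majority_fm(2)[OF \<phi>] by blast
  obtain b where b: "gen (2 * N) B0 b" using gen_exists[OF B0(3,4)] by blast
  have bt: "b \<in> ltup n (2 * N)" using b by (simp add: gen_def)
  obtain eqR where eqR: "rdef (l + l) {} eqR" "\<And>z z'. z \<in> tup l \<Longrightarrow> z' \<in> tup l \<Longrightarrow> eqR (z @ z') = eqv m \<phi> z z'"
    using eqv_rdef[OF \<phi> l] by blast
  have "\<exists>H s. rdef (r * n + l) A H \<and> H (concat (take r b) @ d) \<and>
      few s (eqv m \<phi>) (\<lambda>z. z \<in> tup l \<and> H (concat (take r b) @ z))" if "r \<le> 2 * N" for r
    using that
  proof (induction r rule: inc_induct)
    case base
    define k where "k = 2 * N * n"
    \<comment> \<open>\<open>H (concat b @ z)\<close> says that \<open>z\<close> defines the set of those \<open>c\<close> for which \<open>\<phi>(x, c)\<close> holds at the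
       majority of the entries \<open>x\<close> of \<open>b\<close>.\<close>
    define H where "H w \<longleftrightarrow> (\<forall>c\<in>tup m. holds M (psi m \<phi>) (c @ map (\<lambda>i. w ! i) [k..<k + l]) \<longleftrightarrow>
      N < card {i\<in>{..<2 * N}. holds M \<phi> (chunk n i w @ c)})" for w
    define ar where "ar = (\<lambda>b. if b then m else k + l)"
    have ch: "i * n + n \<le> k + l" if "i \<in> {..<2 * N}" for i
    proof -
      have "Suc i * n \<le> 2 * N * n" using that by (intro mult_le_mono1) simp
      then show ?thesis by (simp add: k_def)
    qed
    have "dfn ar A (insert True {False}) (\<lambda>E. holds M (psi m \<phi>) (E True @ map (\<lambda>i. E False ! i) [k..<k + l]) \<longleftrightarrow>
        N < card {i\<in>{..<2 * N}. holds M \<phi> (chunk n i (E False) @ E True)})"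
      unfolding chunk_def
      by (intro dfn_iff dfn_boolean[where \<Phi> = "\<lambda>T. N < card T"] dfn_holds[OF psi'] dfn_holds[OF \<phi>]
          dlist_append dlist_slice[where m = "k + l"] dlist_var) (use ch in \<open>auto simp: ar_def\<close>)
    from dfn_all[OF this] have "dfn ar A {False} (\<lambda>E. H (E False))" by (simp add: H_def ar_def insert_Diff_if)
    then have "rdef (k + l) A H" by (rule rdef_dfn) (simp add: ar_def)
    then have HA: "rdef (2 * N * n + l) A H" by (simp add: k_def)
    have Heq: "H (concat b' @ z) \<longleftrightarrow> (\<forall>c\<in>tup m. holds M (psi m \<phi>) (c @ z) \<longleftrightarrow>
        N < card {i\<in>{..<2 * N}. holds M \<phi> (b' ! i @ c)})" if "b' \<in> ltup n (2 * N)" "z \<in> tup l" for b' z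
    proof -
      have "map (\<lambda>i. (concat b' @ z) ! i) [k..<k + l] = z"
        using slice_append(2)[OF concat_ltup[OF that(1)] that(2), of "[]"] by (simp add: k_def)
      moreover have "chunk n i (concat b' @ z) = b' ! i" if "i < 2 * N" for i
        using \<open>b' \<in> ltup n (2 * N)\<close> that by (intro chunk_concat_append) (auto simp: ltup_def tuples_def)
      then have "{i\<in>{..<2 * N}. holds M \<phi> (chunk n i (concat b' @ z) @ c)} = {i\<in>{..<2 * N}. holds M \<phi> (b' ! i @ c)}" for c by auto
      ultimately show ?thesis by (simp add: H_def)
    qed
    have "lrel n (2 * N) B0 (\<lambda>b. H (concat b @ d))" by (rule lrel_of_rdef[OF HA d(2) B0(1,3)])
    moreover have "Qp (2 * N) (\<lambda>b. H (concat b @ d))"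
    proof -
      have "Qp (2 * N) (\<lambda>b. H (concat b @ d)) = Qp (2 * N) (\<lambda>b. \<forall>c\<in>tup m. Q (\<lambda>x. holds M \<phi> (x @ c)) \<longleftrightarrow> N < card {i. i < 2 * N \<and> holds M \<phi> (b ! i @ c)})"
        by (rule Qp_cong) (simp add: Heq d psi(3)[OF \<phi>] d_def[symmetric])
      then show ?thesis using N by simp
    qed
    ultimately have Hb: "H (concat b @ d)" using b unfolding gen_def by blast
    have "few 1 (eqv m \<phi>) (\<lambda>z. z \<in> tup l \<and> H (concat b @ z))"
      unfolding few_def
    proof (intro notI, elim exE conjE)
      fix z :: "nat \<Rightarrow> 'a list" assume z: "\<forall>i\<le>1. z i \<in> tup l \<and> H (concat b @ z i)" "\<forall>i j. i < j \<and> j \<le> 1 \<longrightarrow> \<not> eqv m \<phi> (z i) (z j)"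
      have "H (concat b @ z 0)" "H (concat b @ z 1)" "z 0 \<in> tup l" "z 1 \<in> tup l" using z(1) by auto
      then have "eqv m \<phi> (z 0) (z 1)" by (simp add: Heq[OF bt] eqv_def)
      then show False using z(2) by simp
    qed
    moreover have "take (2 * N) b = b" using bt by (simp add: ltup_def)
    ultimately show ?case using HA Hb by (intro exI[of _ H] exI[of _ 1]) simp
  next
    case (step r)
    then obtain H s where H: "rdef (Suc r * n + l) A H" "H (concat (take (Suc r) b) @ d)"
      "few s (eqv m \<phi>) (\<lambda>z. z \<in> tup l \<and> H (concat (take (Suc r) b) @ z))" by blast
    have r: "r < 2 * N" using step by simp
    have tk: "take (Suc r) b = take r b @ [b ! r]" using r bt by (simp add: take_Suc_conv_app_nth ltup_def)
    have gr: "gen r B0 (take r b)" "gen (Suc r) B0 (take (Suc r) b)" using gen_take[OF b _ B0(3)] r by auto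
    have H': "rdef (r * n + n + l) A H" using H(1) by (simp add: algebra_simps)
    define R where "R b' \<longleftrightarrow> H (concat b' @ d) \<and> few s (eqv m \<phi>) (\<lambda>z. z \<in> tup l \<and> H (concat b' @ z))" for b'
    have "rdef (Suc r * n) A (\<lambda>y. few s (eqv m \<phi>) (\<lambda>z. z \<in> tup l \<and> H (y @ z)))"
      by (rule few_rdef[OF H(1) rdef_mono[OF eqR(1)] eqR(2) A(1)]) auto
    then have "rdef (Suc r * n + 0) A (\<lambda>y. few s (eqv m \<phi>) (\<lambda>z. z \<in> tup l \<and> H (y @ z)))" by simp
    from lrel_of_rdef[OF this _ B0(1,3), of "[]"]
    have "lrel n (Suc r) B0 (\<lambda>b'. few s (eqv m \<phi>) (\<lambda>z. z \<in> tup l \<and> H (concat b' @ z)))" by (simp add: tuples_def)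
    then have R: "lrel n (Suc r) B0 R" unfolding R_def
      by (intro lrel_conj lrel_of_rdef[OF H(1) d(2) B0(1,3)])
    have "lrel n r B0 (\<lambda>b'. Q (\<lambda>x. R (b' @ [x])))" by (rule lrel_Q[OF R order_refl B0(3)])
    then have "Q (\<lambda>x. R (take r b @ [x])) \<longleftrightarrow> Qp r (\<lambda>b'. Q (\<lambda>x. R (b' @ [x])))" by (rule gen_iff[OF gr(1)])
    also have "\<dots> \<longleftrightarrow> Qp (Suc r) R" by (simp add: qpow_Suc_end[OF Q] del: qpow.simps)
    also have "\<dots> \<longleftrightarrow> R (take (Suc r) b)" using gen_iff[OF gr(2) R] by simp
    finally have "Q (\<lambda>x. R (take r b @ [x]))" using H by (simp add: R_def)
    then have QH: "Q (\<lambda>x. H (concat (take r b) @ x @ d) \<and> few s (eqv m \<phi>) (\<lambda>z. z \<in> tup l \<and> H (concat (take r b) @ x @ z)))"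
      by (simp add: R_def)
    have "concat (take r b) \<in> tup (r * n)" using gr(1) by (intro concat_ltup) (simp add: gen_def)
    from few_conjugates_step[OF \<phi> l H' this d(1) QH] show ?case by blast
  qed
  from this[of 0] show ?thesis by (simp add: d_def)
qed

section \<open>The stabilizer of the global type\<close>

text \<open>
  The automorphisms over \<open>A\<close> that fix the canonical base of the global type.  By \<open>few_conjugates\<close> this
  base is algebraic over \<open>A\<close>.
\<close>

definition G0 :: "('a \<Rightarrow> 'a) set" where
  "G0 = {\<sigma>. automorphism L M \<sigma> \<and> (\<forall>a\<in>A. \<sigma> a = a) \<and> (\<forall>m. \<forall>\<phi>\<in>fms L (n + m). \<forall>c\<in>tup m.
     Q (\<lambda>x. holds M \<phi> (x @ map \<sigma> c)) \<longleftrightarrow> Q (\<lambda>x. holds M \<phi> (x @ c)))}"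

lemma G0_D:
  assumes "\<sigma> \<in> G0"
  shows "automorphism L M \<sigma>" "a \<in> A \<Longrightarrow> \<sigma> a = a"
    "\<phi> \<in> fms L (n + m) \<Longrightarrow> c \<in> tup m \<Longrightarrow> Q (\<lambda>x. holds M \<phi> (x @ map \<sigma> c)) \<longleftrightarrow> Q (\<lambda>x. holds M \<phi> (x @ c))"
  using assms unfolding G0_def by blast+

lemma G0_id: "id \<in> G0"
  by (simp add: G0_def automorphism_id)

lemma G0_comp:
  assumes "\<sigma> \<in> G0" "\<tau> \<in> G0"
  shows "\<sigma> \<circ> \<tau> \<in> G0"
proof -
  have "Q (\<lambda>x. holds M \<phi> (x @ map (\<sigma> \<circ> \<tau>) c)) \<longleftrightarrow> Q (\<lambda>x. holds M \<phi> (x @ c))"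
    if "\<phi> \<in> fms L (n + m)" "c \<in> tup m" for m \<phi> c
    using G0_D(3)[OF assms(1) that(1) automorphism_tup[OF G0_D(1)[OF assms(2)] that(2)]] G0_D(3)[OF assms(2) that]
    by simp
  then show ?thesis using automorphism_comp[OF G0_D(1)[OF assms(1)] G0_D(1)[OF assms(2)]] G0_D(2) assms
    by (simp add: G0_def)
qed

lemma G0_ainv:
  assumes "\<sigma> \<in> G0"
  shows "ainv \<sigma> \<in> G0"
proof -
  note \<sigma> = G0_D(1)[OF assms]
  have "Q (\<lambda>x. holds M \<phi> (x @ map (ainv \<sigma>) c)) \<longleftrightarrow> Q (\<lambda>x. holds M \<phi> (x @ c))"
    if "\<phi> \<in> fms L (n + m)" "c \<in> tup m" for m \<phi> c
    using G0_D(3)[OF assms that(1) automorphism_tup[OF automorphism_ainv[OF \<sigma>] that(2)]]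
      ainv_tup(1)[OF \<sigma> that(2)] by (simp del: map_map)
  moreover have "ainv \<sigma> a = a" if "a \<in> A" for a using ainv_simps(2)[OF \<sigma>, of a] G0_D(2)[OF assms that] A(1) that by auto
  ultimately show ?thesis using automorphism_ainv[OF \<sigma>] by (simp add: G0_def)
qed

abbreviation act :: "('a \<Rightarrow> 'a) \<Rightarrow> 'a list list \<Rightarrow> 'a list list" where "act \<sigma> \<equiv> map (map \<sigma>)"

lemma act_ltup: "automorphism L M \<sigma> \<Longrightarrow> b \<in> ltup n j \<Longrightarrow> act \<sigma> b \<in> ltup n j"
  using automorphism_tup by (auto simp: ltup_def)

lemma act_ainv:
  assumes "automorphism L M \<sigma>" "b \<in> ltup n j"
  shows "act \<sigma> (act (ainv \<sigma>) b) = b" "act (ainv \<sigma>) (act \<sigma> b) = b"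
proof -
  have b: "x \<in> tup n" if "x \<in> set b" for x using assms(2) that by (auto simp: ltup_def)
  have "map (\<lambda>x. map \<sigma> (map (ainv \<sigma>) x)) b = b" "map (\<lambda>x. map (ainv \<sigma>) (map \<sigma> x)) b = b"
    by (rule map_idI, rule ainv_tup[OF assms(1) b], assumption)+
  then show "act \<sigma> (act (ainv \<sigma>) b) = b" "act (ainv \<sigma>) (act \<sigma> b) = b" by (simp_all add: comp_def)
qed

text \<open>
  Invariance under \<open>G0\<close> stands for definability over \<open>A\<close> and the canonical base of the global type.
\<close>

definition invr :: "nat \<Rightarrow> ('a list list \<Rightarrow> bool) \<Rightarrow> bool" where
  "invr j R \<longleftrightarrow> (\<forall>\<sigma>\<in>G0. \<forall>b\<in>ltup n j. R (act \<sigma> b) = R b)"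

lemma invr_Q:
  assumes R: "lrel n (Suc j) C R" and C: "C \<subseteq> U" and inv: "invr (Suc j) R"
  shows "invr j (\<lambda>b. Q (\<lambda>x. R (b @ [x])))"
  unfolding invr_def
proof (intro ballI)
  fix \<sigma> b assume \<sigma>: "\<sigma> \<in> G0" and b: "b \<in> ltup n j"
  note au = G0_D(1)[OF \<sigma>]
  define F where "F b = map (\<lambda>i. b ! (if i < j then Suc i else 0)) [0..<Suc j]" for b :: "'a list list"
  have F: "F (x # b) = b @ [x]" if "length b = j" for x b
    using that by (intro nth_equalityI) (auto simp: F_def nth_append less_Suc_eq simp del: upt_Suc)
  have "lrel n (Suc j) C (\<lambda>b. R (F b))"
  proof (rule lrel_subst[OF R order_refl C])
    fix i assume i: "i < Suc j"
    show "(\<exists>l<Suc j. \<forall>b\<in>ltup n (Suc j). F b ! i = b ! l) \<or> (\<exists>u\<in>tuples C n. \<forall>b\<in>ltup n (Suc j). F b ! i = u)"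
      by (intro disjI1 exI[of _ "if i < j then Suc i else 0"]) (use i in \<open>simp add: F_def del: upt_Suc\<close>)
  qed (simp add: F_def)
  from lrel_fm[OF this C] obtain \<phi> e where p: "\<phi> \<in> fms L (Suc j * n + length e)" "set e \<subseteq> C"
    "\<forall>b\<in>ltup n (Suc j). R (F b) \<longleftrightarrow> holds M \<phi> (concat b @ e)" by blast
  have \<phi>: "\<phi> \<in> fms L (n + (j * n + length e))" using p(1) by (simp add: algebra_simps)
  have Req: "R (b @ [x]) \<longleftrightarrow> holds M \<phi> (x @ concat b @ e)" if "x \<in> tup n" "b \<in> ltup n j" for x b
  proof -
    have "x # b \<in> ltup n (Suc j)" "length b = j" using that by (auto simp: ltup_def)
    then show ?thesis using p(3) F by fastforce
  qed
  have e: "e \<in> tup (length e)" using p(2) C by (auto simp: tuples_def)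
  define e' where "e' = map (ainv \<sigma>) e"
  have e': "map \<sigma> e' = e" "e' \<in> tup (length e)"
    using ainv_tup(1)[OF au e] automorphism_tup[OF automorphism_ainv[OF au] e] by (simp_all add: e'_def)
  have be: "concat b @ e' \<in> tup (j * n + length e)" using concat_ltup[OF b] e'(2) by (auto simp: tuples_def)
  have "Q (\<lambda>x. R (act \<sigma> b @ [x])) \<longleftrightarrow> Q (\<lambda>x. holds M \<phi> (x @ map \<sigma> (concat b @ e')))"
    by (rule uq_cong[OF Q, OF Qtup]) (simp add: Req act_ltup[OF au b] map_concat e'(1))
  also have "\<dots> \<longleftrightarrow> Q (\<lambda>x. holds M \<phi> (x @ concat b @ e'))" by (rule G0_D(3)[OF \<sigma> \<phi> be])
  also have "\<dots> \<longleftrightarrow> Q (\<lambda>x. R (b @ [x]))"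
  proof (rule uq_cong[OF Q, OF Qtup])
    fix x assume x: "x \<in> tup n"
    have "x @ concat b @ e' \<in> tup (n + (j * n + length e))" using x be by (auto simp: tuples_def)
    then have "holds M \<phi> (x @ concat b @ e') = holds M \<phi> (map \<sigma> (x @ concat b @ e'))"
      using holds_automorphism[OF au \<phi>] by blast
    also have "\<dots> = R (act \<sigma> b @ [map \<sigma> x])"
      using Req[OF automorphism_tup[OF au x] act_ltup[OF au b]] by (simp add: map_concat e'(1))
    also have "\<dots> = R (act \<sigma> (b @ [x]))" by simp
    also have "\<dots> = R (b @ [x])"
    proof -
      have "b @ [x] \<in> ltup n (Suc j)" using b x by (auto simp: ltup_def)
      then show ?thesis using inv \<sigma> unfolding invr_def by blast
    qed
    finally show "holds M \<phi> (x @ concat b @ e') = R (b @ [x])" .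
  qed
  finally show "Q (\<lambda>x. R (act \<sigma> b @ [x])) = Q (\<lambda>x. R (b @ [x]))" .
qed

lemma invr_Qp:
  "lrel n (j + k) C R \<Longrightarrow> B0 \<subseteq> C \<Longrightarrow> C \<subseteq> U \<Longrightarrow> invr (j + k) R \<Longrightarrow> invr j (\<lambda>b. Qp k (\<lambda>y. R (b @ y)))"
proof (induction k arbitrary: R)
  case (Suc k)
  have "lrel n (j + k) C (\<lambda>c. Q (\<lambda>x. R (c @ [x])))" using Suc.prems by (intro lrel_Q) simp_all
  moreover have "invr (j + k) (\<lambda>c. Q (\<lambda>x. R (c @ [x])))" using Suc.prems by (intro invr_Q) simp_all
  ultimately have "invr j (\<lambda>b. Qp k (\<lambda>y. Q (\<lambda>x. R ((b @ y) @ [x]))))" by (rule Suc.IH[OF _ Suc.prems(2,3)])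
  then show ?case by (simp add: qpow_Suc_end[OF Q] del: qpow.simps)
qed simp

end

section \<open>Orbits of generic tuples\<close>

text \<open>The pigeonhole principle for a sequence that meets boundedly many classes.\<close>

lemma few_infinite:
  fixes z :: "nat \<Rightarrow> 'z"
  assumes few: "few s eq P" and z: "\<And>i. P (z i)" and refl: "\<And>x. eq x x"
    and sym: "\<And>x y. eq x y \<Longrightarrow> eq y x" and trans: "\<And>x y w. eq x y \<Longrightarrow> eq y w \<Longrightarrow> eq x w" and Z: "infinite Z"
  shows "\<exists>I\<subseteq>Z. infinite I \<and> (\<forall>i\<in>I. \<forall>j\<in>I. eq (z i) (z j))"
proof -
  define f where "f i = {x. eq (z i) x}" for i
  have f: "f i = f j \<longleftrightarrow> eq (z i) (z j)" for i j
    unfolding f_def using refl sym trans by blast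
  have "finite (f ` Z)"
  proof (rule ccontr)
    assume "infinite (f ` Z)"
    then obtain F where F: "F \<subseteq> f ` Z" "card F = Suc s" "finite F"
      by (meson infinite_arbitrarily_large)
    obtain h where h: "bij_betw h {..<Suc s} F"
      using ex_bij_betw_nat_finite[OF F(3)] F(2) by (auto simp: atLeast0LessThan)
    have "\<forall>i. \<exists>k. i < Suc s \<longrightarrow> f k = h i"
    proof
      fix i show "\<exists>k. i < Suc s \<longrightarrow> f k = h i"
        using F(1) bij_betwE[OF h] by (cases "i < Suc s") fastforce+
    qed
    from choice[OF this] obtain k where k: "\<And>i. i < Suc s \<Longrightarrow> f (k i) = h i" by blast
    have "\<not> eq (z (k i)) (z (k j))" if "i < j" "j \<le> s" for i j
    proof -
      have "h i \<noteq> h j" using h that inj_on_eq_iff[of h "{..<Suc s}" i j] by (simp add: bij_betw_def)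
      then show ?thesis using k[of i] k[of j] f[of "k i" "k j"] that by simp
    qed
    then show False using few z unfolding few_def by (elim notE) (intro exI[of _ "\<lambda>i. z (k i)"], simp)
  qed
  from pigeonhole_infinite[OF Z this] obtain i0 where i0: "i0 \<in> Z" "infinite {a \<in> Z. f a = f i0}" by blast
  have "eq (z i) (z j)" if "i \<in> {a \<in> Z. f a = f i0}" "j \<in> {a \<in> Z. f a = f i0}" for i j
    using that f[of i j] by simp
  then show ?thesis using i0(2) by (intro exI[of _ "{a \<in> Z. f a = f i0}"]) blast
qed

context stable_nonforking
begin

definition u1 :: 'a where "u1 = (SOME u. u \<in> U)"

lemma u1: "u1 \<in> U"
  unfolding u1_def using U_nonempty by (simp add: some_in_eq)

text \<open>
  An automorphism is described by the images of a block \<open>b\<close> and of the set \<open>B0\<close>.  The variable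
  \<open>Inl i\<close> stands for the image of the \<open>i\<close>-th entry of \<open>b\<close>, the variable \<open>Inr a\<close> for the image of
  \<open>a \<in> B0\<close>.  The environment of the identity is \<open>Est b\<close>; the element \<open>u1\<close> fills the positions that
  have no meaning.
\<close>

definition arB :: "nat + 'a \<Rightarrow> nat" where "arB = case_sum (\<lambda>_. n) (\<lambda>_. 1)"
definition JB :: "nat \<Rightarrow> (nat + 'a) set" where "JB r = Inl ` {..<r} \<union> Inr ` B0"
definition Est :: "'a list list \<Rightarrow> nat + 'a \<Rightarrow> 'a list" where
  "Est b = case_sum (\<lambda>i. if i < length b then b ! i else replicate n u1) (\<lambda>a. [if a \<in> U then a else u1])"
definition par :: "(nat + 'a \<Rightarrow> 'a list) \<Rightarrow> 'a list \<Rightarrow> 'a list" where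
  "par E d = concat (map (\<lambda>a. E (Inr a)) d)"
definition blk :: "nat \<Rightarrow> (nat + 'a \<Rightarrow> 'a list) \<Rightarrow> 'a list list" where
  "blk r E = map (\<lambda>i. E (Inl i)) [0..<r]"
definition params :: "(nat \<times> ('f, 'r) fm) set" where "params = {(m, \<phi>). \<phi> \<in> fms L (n + m)}"

definition sameQ :: "(nat \<times> ('f, 'r) fm) set \<Rightarrow> (nat + 'a \<Rightarrow> 'a list) \<Rightarrow> bool" where
  "sameQ \<Phi> E \<longleftrightarrow> (\<forall>(m, \<phi>)\<in>\<Phi>. eqv m \<phi> (dd m \<phi>) (par E (dd m \<phi>)))"

lemma Est_envs: "b \<in> ltup n r \<Longrightarrow> Est b \<in> envs arB"
  unfolding envs_def
proof (intro CollectI allI)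
  fix v assume b: "b \<in> ltup n r"
  show "Est b v \<in> tup (arB v)"
  proof (cases v)
    case (Inl i)
    have "b ! i \<in> tup n" if "i < length b" using b nth_mem[OF that] by (auto simp: ltup_def)
    then show ?thesis using Inl u1 by (auto simp: Est_def arB_def tuples_def)
  next
    case (Inr a)
    then show ?thesis using u1 by (simp add: Est_def arB_def tuples_def)
  qed
qed

lemma small_JB: "small \<kappa> (JB r)"
  unfolding JB_def by (intro small_Un small_image[OF B0(4)] small_nat_image)

lemma par_tup: "E \<in> envs arB \<Longrightarrow> par E d \<in> tup (length d)"
proof -
  assume E: "E \<in> envs arB"
  have "concat (map (\<lambda>a. E (Inr a)) d) \<in> tup (length d * 1)"
    by (rule concat_tup) (use envs_tup[OF E, of "Inr a" for a] in \<open>auto simp: arB_def\<close>)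
  then show ?thesis by (simp add: par_def)
qed

lemma blk_Est: "b \<in> ltup n r \<Longrightarrow> blk r (\<lambda>v. map \<sigma> (Est b v)) = act \<sigma> b"
  by (rule nth_equalityI) (auto simp: blk_def Est_def ltup_def)

lemma par_Est: "set d \<subseteq> U \<Longrightarrow> par (\<lambda>v. map \<sigma> (Est b v)) d = map \<sigma> d"
  by (induction d) (auto simp: par_def Est_def)

lemma eqv_refl: "eqv m \<phi> z z"
  by (simp add: eqv_def)

lemma eqv_sym: "eqv m \<phi> z z' \<Longrightarrow> eqv m \<phi> z' z"
  by (simp add: eqv_def)

lemma eqv_trans: "eqv m \<phi> z z' \<Longrightarrow> eqv m \<phi> z' w \<Longrightarrow> eqv m \<phi> z w"
  by (simp add: eqv_def)

lemma eqv_automorphism: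
  assumes \<phi>: "\<phi> \<in> fms L (n + m)" and \<sigma>: "automorphism L M \<sigma>" and z: "z \<in> tup (length (dd m \<phi>))" "z' \<in> tup (length (dd m \<phi>))"
    and e: "eqv m \<phi> z z'"
  shows "eqv m \<phi> (map \<sigma> z) (map \<sigma> z')"
  unfolding eqv_def
proof
  fix c assume c: "c \<in> tup m"
  define c' where "c' = map (ainv \<sigma>) c"
  have c': "c' \<in> tup m" "map \<sigma> c' = c"
    using automorphism_tup[OF automorphism_ainv[OF \<sigma>] c] ainv_tup(1)[OF \<sigma> c] by (simp_all add: c'_def)
  have "c' @ z \<in> tup (m + length (dd m \<phi>))" "c' @ z' \<in> tup (m + length (dd m \<phi>))" using c' z by (auto simp: tuples_def)
  from holds_automorphism[OF \<sigma> psi(1)[OF \<phi>] this(1)] holds_automorphism[OF \<sigma> psi(1)[OF \<phi>] this(2)]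
  show "holds M (psi m \<phi>) (c @ map \<sigma> z) = holds M (psi m \<phi>) (c @ map \<sigma> z')"
    using e c' by (simp add: eqv_def)
qed

lemma dd_tup: "\<phi> \<in> fms L (n + m) \<Longrightarrow> dd m \<phi> \<in> tup (length (dd m \<phi>))"
  using psi(2) by (simp add: tuples_def)

lemma G0_iff_eqv:
  assumes \<sigma>: "automorphism L M \<sigma>" and \<phi>: "\<phi> \<in> fms L (n + m)"
  shows "eqv m \<phi> (dd m \<phi>) (map \<sigma> (dd m \<phi>)) \<longleftrightarrow>
    (\<forall>c\<in>tup m. Q (\<lambda>x. holds M \<phi> (x @ map \<sigma> c)) \<longleftrightarrow> Q (\<lambda>x. holds M \<phi> (x @ c)))"
proof -
  have a: "Q (\<lambda>x. holds M \<phi> (x @ c)) \<longleftrightarrow> holds M (psi m \<phi>) (map \<sigma> c @ map \<sigma> (dd m \<phi>))" if c: "c \<in> tup m" for c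
  proof -
    have "c @ dd m \<phi> \<in> tup (m + length (dd m \<phi>))" using c dd_tup[OF \<phi>] by (auto simp: tuples_def)
    from holds_automorphism[OF \<sigma> psi(1)[OF \<phi>] this] psi(3)[OF \<phi> c] show ?thesis by simp
  qed
  have b: "Q (\<lambda>x. holds M \<phi> (x @ map \<sigma> c)) \<longleftrightarrow> holds M (psi m \<phi>) (map \<sigma> c @ dd m \<phi>)" if "c \<in> tup m" for c
    by (rule psi(3)[OF \<phi> automorphism_tup[OF \<sigma> that]])
  have "eqv m \<phi> (dd m \<phi>) (map \<sigma> (dd m \<phi>)) \<longleftrightarrow>
      (\<forall>c\<in>tup m. holds M (psi m \<phi>) (map \<sigma> c @ dd m \<phi>) \<longleftrightarrow> holds M (psi m \<phi>) (map \<sigma> c @ map \<sigma> (dd m \<phi>)))"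
    unfolding eqv_def
    using automorphism_tup[OF \<sigma>, of _ m] ainv_tup(1)[OF \<sigma>, of _ m] automorphism_tup[OF automorphism_ainv[OF \<sigma>], of _ m] by metis
  then show ?thesis using a b by simp
qed

lemma eqv_G0:
  assumes "\<sigma> \<in> G0" and \<phi>: "\<phi> \<in> fms L (n + m)"
  shows "eqv m \<phi> (dd m \<phi>) (map \<sigma> (dd m \<phi>))"
  using G0_iff_eqv[OF G0_D(1)[OF assms(1)] \<phi>] G0_D(3)[OF assms] by simp

lemma dfn_eqv:
  assumes \<phi>: "\<phi> \<in> fms L (n + m)" and B: "B0 \<subseteq> C" "C \<subseteq> U"
  shows "dfn arB C (JB r) (\<lambda>E. eqv m \<phi> (dd m \<phi>) (par E (dd m \<phi>)))"
proof -
  define l where "l = length (dd m \<phi>)"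
  obtain eqR where eqR: "rdef (l + l) {} eqR" "\<And>z z'. z \<in> tup l \<Longrightarrow> z' \<in> tup l \<Longrightarrow> eqR (z @ z') = eqv m \<phi> z z'"
    using eqv_rdef[OF \<phi> l_def] by blast
  have "dlist arB C (JB r) l (\<lambda>E. par E (dd m \<phi>))"
    unfolding par_def by (rule dlist_concat[where m = 1])
      (use B0(5)[OF \<phi>] in \<open>auto simp: l_def JB_def arB_def intro!: dlist_var\<close>)
  moreover have "dlist arB C (JB r) l (\<lambda>E. dd m \<phi>)"
    by (rule dlist_const) (use B0(5)[OF \<phi>] B in \<open>auto simp: tuples_def l_def\<close>)
  ultimately have "dfn arB C (JB r) (\<lambda>E. eqR (dd m \<phi> @ par E (dd m \<phi>)))"
    by (intro dfn_rdef[OF eqR(1)] dlist_append B) auto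
  then show ?thesis
    by (rule dfn_cong) (use eqR(2) dd_tup[OF \<phi>] par_tup in \<open>auto simp: l_def\<close>)
qed

lemma dfn_sameQ: "finite \<Phi> \<Longrightarrow> \<Phi> \<subseteq> params \<Longrightarrow> B0 \<subseteq> C \<Longrightarrow> C \<subseteq> U \<Longrightarrow> dfn arB C (JB r) (sameQ \<Phi>)"
  unfolding sameQ_def by (rule dfn_ball_finite) (auto simp: params_def intro!: dfn_eqv)

text \<open>
  An automorphism over \<open>A\<close> belongs to \<open>G0\<close> if it sends the parameters of every definition to
  equivalent ones (\<open>G0_iff_eqv\<close>).  This is a set of first-order conditions on the image of \<open>B0\<close>, so
  by compactness and homogeneity any finitely satisfiable set of conditions on the image of
  \<open>b\<close> is satisfied by some element of \<open>G0\<close>.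
\<close>

lemma orbit_compactness:
  assumes b: "b \<in> ltup n r" and C: "C \<subseteq> U" "small \<kappa> C" and N: "\<And>\<nu>. \<nu> \<in> \<N> \<Longrightarrow> lrel n r C \<nu>"
    and fip: "\<And>P \<Phi> \<N>0. dfn arB A (JB r) P \<Longrightarrow> P (Est b) \<Longrightarrow> finite \<Phi> \<Longrightarrow> \<Phi> \<subseteq> params \<Longrightarrow> finite \<N>0 \<Longrightarrow> \<N>0 \<subseteq> \<N> \<Longrightarrow>
      \<exists>E\<in>envs arB. P E \<and> sameQ \<Phi> E \<and> (\<forall>\<nu>\<in>\<N>0. \<nu> (blk r E))"
  shows "\<exists>\<sigma>\<in>G0. \<forall>\<nu>\<in>\<N>. \<nu> (act \<sigma> b)"
proof -
  define \<Gamma>1 where "\<Gamma>1 = {P. dfn arB A (JB r) P \<and> P (Est b)}"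
  define g2 where "g2 = (\<lambda>p. sameQ {p})"
  define g3 where "g3 = (\<lambda>\<nu> E. \<nu> (blk r E) :: bool)"
  define C' where "C' = C \<union> B0"
  have C': "C \<subseteq> C'" "B0 \<subseteq> C'" "A \<subseteq> C'" "C' \<subseteq> U" "small \<kappa> C'"
    using C B0 small_Un[OF C(2) B0(4)] by (auto simp: C'_def)
  have "\<exists>E\<in>envs arB. \<forall>P\<in>\<Gamma>1 \<union> (g2 ` params \<union> g3 ` \<N>). P E"
  proof (rule compactness[OF C'(4,5) small_JB])
    fix P assume "P \<in> \<Gamma>1 \<union> (g2 ` params \<union> g3 ` \<N>)"
    then consider "P \<in> \<Gamma>1" | p where "p \<in> params" "P = g2 p" | \<nu> where "\<nu> \<in> \<N>" "P = g3 \<nu>" by blast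
    then show "dfn arB C' (JB r) P"
    proof cases
      case 1
      then show ?thesis using dfn_mono[OF _ C'(3) order_refl] by (auto simp: \<Gamma>1_def)
    next
      case 2
      then show ?thesis unfolding 2(2) g2_def by (intro dfn_sameQ C') auto
    next
      case 3
      show ?thesis unfolding 3(2) g3_def
        by (rule dfn_lrel[OF N[OF 3(1)] C'(1,4)]) (auto simp: blk_def JB_def arB_def intro!: dlist_var)
    qed
  next
    fix F assume F: "finite F" "F \<subseteq> \<Gamma>1 \<union> (g2 ` params \<union> g3 ` \<N>)"
    have "finite (F \<inter> g2 ` params)" "F \<inter> g2 ` params \<subseteq> g2 ` params" using F by auto
    then obtain \<Phi> where \<Phi>: "\<Phi> \<subseteq> params" "finite \<Phi>" "F \<inter> g2 ` params = g2 ` \<Phi>" by (meson finite_subset_image)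
    have "finite (F \<inter> g3 ` \<N>)" "F \<inter> g3 ` \<N> \<subseteq> g3 ` \<N>" using F by auto
    then obtain \<N>0 where N0: "\<N>0 \<subseteq> \<N>" "finite \<N>0" "F \<inter> g3 ` \<N> = g3 ` \<N>0" by (meson finite_subset_image)
    have "dfn arB A (JB r) (\<lambda>E. \<forall>P\<in>F \<inter> \<Gamma>1. P E)" using F(1) by (intro dfn_ball_finite) (auto simp: \<Gamma>1_def)
    moreover have "\<forall>P\<in>F \<inter> \<Gamma>1. P (Est b)" by (auto simp: \<Gamma>1_def)
    ultimately obtain E where E: "E \<in> envs arB" "\<forall>P\<in>F \<inter> \<Gamma>1. P E" "sameQ \<Phi> E" "\<forall>\<nu>\<in>\<N>0. \<nu> (blk r E)"
      using fip[OF _ _ \<Phi>(2,1) N0(2,1)] by blast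
    have "P E" if P: "P \<in> F" for P
    proof -
      have "P \<in> F \<inter> \<Gamma>1 \<or> P \<in> F \<inter> g2 ` params \<or> P \<in> F \<inter> g3 ` \<N>" using P F(2) by blast
      then consider "P \<in> F \<inter> \<Gamma>1" | "P \<in> g2 ` \<Phi>" | "P \<in> g3 ` \<N>0" unfolding \<Phi>(3) N0(3) by (elim disjE)
      then show ?thesis
      proof cases
        case 2
        then obtain p where "p \<in> \<Phi>" "P = g2 p" by blast
        then show ?thesis using E(3) by (auto simp: g2_def sameQ_def)
      qed (use E in \<open>auto simp: g3_def\<close>)
    qed
    then show "\<exists>E\<in>envs arB. \<forall>P\<in>F. P E" using E(1) by blast
  qed
  then obtain E where E0: "E \<in> envs arB" "\<forall>P\<in>\<Gamma>1 \<union> (g2 ` params \<union> g3 ` \<N>). P E" by (elim bexE)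
  have E: "E \<in> envs arB" "\<And>P. P \<in> \<Gamma>1 \<Longrightarrow> P E" "\<And>p. p \<in> params \<Longrightarrow> sameQ {p} E" "\<And>\<nu>. \<nu> \<in> \<N> \<Longrightarrow> \<nu> (blk r E)"
  proof -
    show "E \<in> envs arB" by (rule E0(1))
    show "P E" if "P \<in> \<Gamma>1" for P using bspec[OF E0(2), of P] that by simp
    show "sameQ {p} E" if "p \<in> params" for p using bspec[OF E0(2), of "g2 p"] that by (simp add: g2_def)
    show "\<nu> (blk r E)" if "\<nu> \<in> \<N>" for \<nu> using bspec[OF E0(2), of "g3 \<nu>"] that by (simp add: g3_def)
  qed
  have "\<exists>\<sigma>. automorphism L M \<sigma> \<and> (\<forall>c\<in>A. \<sigma> c = c) \<and> (\<forall>v\<in>JB r. map \<sigma> (Est b v) = E v)"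
    by (rule homogeneity[OF A small_JB Est_envs[OF b] E(1)]) (use E(2) in \<open>auto simp: \<Gamma>1_def\<close>)
  then obtain \<sigma> where \<sigma>: "automorphism L M \<sigma>" "\<forall>c\<in>A. \<sigma> c = c" "\<forall>v\<in>JB r. map \<sigma> (Est b v) = E v" by blast
  have "par E d = map \<sigma> d" if "set d \<subseteq> B0" for d
  proof -
    have "E (Inr a) = map \<sigma> (Est b (Inr a))" if "a \<in> set d" for a
    proof -
      have "Inr a \<in> JB r" using that \<open>set d \<subseteq> B0\<close> by (auto simp: JB_def)
      then show ?thesis using \<sigma>(3) by simp
    qed
    then have "par E d = par (\<lambda>v. map \<sigma> (Est b v)) d" unfolding par_def by (intro arg_cong[where f = concat] map_cong) auto
    also have "\<dots> = map \<sigma> d" by (rule par_Est) (use that B0(3) in blast)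
    finally show ?thesis .
  qed
  then have "eqv m \<phi> (dd m \<phi>) (map \<sigma> (dd m \<phi>))" if "\<phi> \<in> fms L (n + m)" for m \<phi>
    using E(3)[of "(m, \<phi>)"] B0(5)[OF that] that by (simp add: sameQ_def params_def)
  then have "\<forall>m. \<forall>\<phi>\<in>fms L (n + m). \<forall>c\<in>tup m. Q (\<lambda>x. holds M \<phi> (x @ map \<sigma> c)) \<longleftrightarrow> Q (\<lambda>x. holds M \<phi> (x @ c))"
    using G0_iff_eqv[OF \<sigma>(1)] by simp
  then have "\<sigma> \<in> G0" using \<sigma>(1,2) unfolding G0_def by (intro CollectI conjI)
  moreover have "blk r E = blk r (\<lambda>v. map \<sigma> (Est b v))"
    unfolding blk_def by (rule map_cong) (use \<sigma>(3) in \<open>auto simp: JB_def\<close>)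
  then have "blk r E = act \<sigma> b" using blk_Est[OF b, of \<sigma>] by simp
  ultimately show ?thesis using E(4) by (intro bexI[of _ \<sigma>] ballI) simp
qed

lemma Est_id: "b \<in> ltup n r \<Longrightarrow> blk r (Est b) = b" "set d \<subseteq> U \<Longrightarrow> par (Est b) d = d"
  using blk_Est[of b r id] par_Est[of d id b] by simp_all

lemma sameQ_act:
  assumes \<Phi>: "\<Phi> \<subseteq> params" and \<sigma>: "automorphism L M \<sigma>"
    and e: "\<And>m \<phi>. (m, \<phi>) \<in> \<Phi> \<Longrightarrow> eqv m \<phi> (dd m \<phi>) (map \<sigma> (dd m \<phi>))"
  shows "sameQ \<Phi> (\<lambda>v. map \<sigma> (Est b v))"
  unfolding sameQ_def using e \<Phi> psi(2) by (auto simp: params_def par_Est)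

lemma orbit_compactness_G0:
  assumes b: "b \<in> ltup n r" and C: "C \<subseteq> U" "small \<kappa> C" and N: "\<And>\<nu>. \<nu> \<in> \<N> \<Longrightarrow> lrel n r C \<nu>"
    and fip: "\<And>\<N>0. finite \<N>0 \<Longrightarrow> \<N>0 \<subseteq> \<N> \<Longrightarrow> \<exists>\<sigma>\<in>G0. \<forall>\<nu>\<in>\<N>0. \<nu> (act \<sigma> b)"
  shows "\<exists>\<sigma>\<in>G0. \<forall>\<nu>\<in>\<N>. \<nu> (act \<sigma> b)"
proof (rule orbit_compactness[OF b C N])
  fix P \<Phi> \<N>0 assume P: "dfn arB A (JB r) P" "P (Est b)" and \<Phi>: "\<Phi> \<subseteq> params" and N0: "finite \<N>0" "\<N>0 \<subseteq> \<N>"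
  obtain \<sigma> where \<sigma>: "\<sigma> \<in> G0" "\<forall>\<nu>\<in>\<N>0. \<nu> (act \<sigma> b)" using fip[OF N0] by blast
  let ?E = "\<lambda>v. map \<sigma> (Est b v)"
  have "?E \<in> envs arB" using Est_envs[OF b] automorphism_tup[OF G0_D(1)[OF \<sigma>(1)]] by (auto simp: envs_def)
  moreover have "P ?E" using dfn_automorphism[OF P(1) G0_D(1)[OF \<sigma>(1)] A(1) G0_D(2)[OF \<sigma>(1)] Est_envs[OF b]] P(2) by blast
  moreover have "sameQ \<Phi> ?E"
    by (rule sameQ_act[OF \<Phi> G0_D(1)[OF \<sigma>(1)]]) (use eqv_G0[OF \<sigma>(1)] \<Phi> in \<open>auto simp: params_def\<close>)
  ultimately show "\<exists>E\<in>envs arB. P E \<and> sameQ \<Phi> E \<and> (\<forall>\<nu>\<in>\<N>0. \<nu> (blk r E))"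
    using \<sigma>(2) blk_Est[OF b] by (intro bexI[of _ ?E]) auto
qed

lemma lrel_eq:
  assumes b: "b \<in> ltup n r" and C: "set (concat b) \<subseteq> C" "C \<subseteq> U"
  shows "lrel n r C (\<lambda>b'. b' = b)"
proof (rule lrelI)
  show "dfn (\<lambda>_::nat. n) C {..<r} (\<lambda>E. \<forall>i\<in>{..<r}. \<forall>k\<in>{..<n}. holds M (Eq (Var k) (Var n)) (E i @ [b ! i ! k]))"
  proof (intro dfn_ball_finite)
    fix i k assume ik: "i \<in> {..<r}" "k \<in> {..<n}"
    then have "b ! i ! k \<in> set (concat b)" using b by (auto simp: ltup_def tuples_def subset_iff) (metis nth_mem)
    then have "[b ! i ! k] \<in> tuples C 1" using C(1) by (auto simp: tuples_def)
    moreover have "Eq (Var k) (Var n) \<in> fms L (n + 1)" using ik by (auto simp: fms_def)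
    ultimately show "dfn (\<lambda>_::nat. n) C {..<r} (\<lambda>E. holds M (Eq (Var k) (Var n)) (E i @ [b ! i ! k]))"
      using ik by (intro dfn_holds[of _ "n + 1"] dlist_append dlist_var dlist_const) auto
  qed auto
next
  fix E :: "nat \<Rightarrow> 'a list" assume E: "E \<in> envs (\<lambda>_. n)"
  have len: "length (E i) = n" "i < r \<Longrightarrow> length (b ! i) = n" "length b = r" for i
    using envs_length[OF E] b by (auto simp: ltup_def tuples_def subset_iff)
  have "map E [0..<r] = b \<longleftrightarrow> (\<forall>i<r. E i = b ! i)" using len by (auto simp: list_eq_iff_nth_eq)
  also have "\<dots> \<longleftrightarrow> (\<forall>i<r. \<forall>k<n. E i ! k = b ! i ! k)" using len by (auto simp: list_eq_iff_nth_eq)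
  finally show "(map E [0..<r] = b) = (\<forall>i\<in>{..<r}. \<forall>k\<in>{..<n}. holds M (Eq (Var k) (Var n)) (E i @ [b ! i ! k]))"
    using len by (auto simp: holds_def nth_append)
qed

text \<open>
  For \<open>P\<close> true at \<open>Est g\<close> these are the finite approximations of the orbit of \<open>g\<close> under \<open>G0\<close>.  They
  are definable over \<open>B0\<close> and invariant.
\<close>

definition sp :: "nat \<Rightarrow> ((nat + 'a \<Rightarrow> 'a list) \<Rightarrow> bool) \<Rightarrow> (nat \<times> ('f, 'r) fm) set \<Rightarrow> 'a list list \<Rightarrow> bool" where
  "sp r P \<Phi> b \<longleftrightarrow> (\<exists>E\<in>envs arB. blk r E = b \<and> P E \<and> sameQ \<Phi> E)"

lemma orbit_of_sp:
  assumes g: "g \<in> ltup n r" and b: "b \<in> ltup n r"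
    and sp: "\<And>P \<Phi>. dfn arB A (JB r) P \<Longrightarrow> P (Est g) \<Longrightarrow> finite \<Phi> \<Longrightarrow> \<Phi> \<subseteq> params \<Longrightarrow> sp r P \<Phi> b"
  shows "\<exists>\<sigma>\<in>G0. act \<sigma> g = b"
proof -
  have C: "set (concat b) \<subseteq> U" using concat_ltup[OF b] by (simp add: tuples_def)
  have "\<exists>\<sigma>\<in>G0. \<forall>\<nu>\<in>{\<lambda>b'. b' = b}. \<nu> (act \<sigma> g)"
  proof (rule orbit_compactness[OF g C small_finite])
    show "lrel n r (set (concat b)) \<nu>" if "\<nu> \<in> {\<lambda>b'. b' = b}" for \<nu>
      using that lrel_eq[OF b order_refl C] by simp
    fix P \<Phi> \<N>0 assume *: "dfn arB A (JB r) P" "P (Est g)" "finite \<Phi>" "\<Phi> \<subseteq> params" "\<N>0 \<subseteq> {\<lambda>b'. b' = b}"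
    obtain E where "E \<in> envs arB" "blk r E = b" "P E" "sameQ \<Phi> E" using sp[OF *(1-4)] unfolding sp_def by blast
    then show "\<exists>E\<in>envs arB. P E \<and> sameQ \<Phi> E \<and> (\<forall>\<nu>\<in>\<N>0. \<nu> (blk r E))" using *(5) by (intro bexI[of _ E]) auto
  qed simp
  then show ?thesis by simp
qed

lemma sp_lrel:
  assumes P: "dfn arB A (JB r) P" and \<Phi>: "finite \<Phi>" "\<Phi> \<subseteq> params"
  shows "lrel n r B0 (sp r P \<Phi>)"
proof -
  have PQ: "dfn arB B0 (JB r) (\<lambda>E. P E \<and> sameQ \<Phi> E)"
    by (intro dfn_conj dfn_mono[OF P B0(1)] dfn_sameQ \<Phi> B0(3)) auto
  from dfn_ex_set[OF this, of "range Inr"]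
  have "dfn arB B0 (Inl ` {..<r}) (\<lambda>E. \<exists>E'\<in>envs arB. (\<forall>v. v \<notin> range Inr \<longrightarrow> E' v = E v) \<and> P E' \<and> sameQ \<Phi> E')"
    by (rule dfn_mono) (auto simp: JB_def)
  then have "dfn (\<lambda>_::nat. n) B0 {..<r} (\<lambda>E. \<exists>E'\<in>envs arB. (\<forall>v. v \<notin> range Inr \<longrightarrow> E' v = case_sum E (\<lambda>_. [u1]) v) \<and> P E' \<and> sameQ \<Phi> E')"
    by (rule dfn_subst[of arB B0 "Inl ` {..<r}" _ "\<lambda>_. n" B0 "{..<r}" "\<lambda>E. case_sum E (\<lambda>_. [u1])"])
      (use u1 in \<open>auto simp: arB_def envs_def tuples_def split: sum.split intro!: dlist_var\<close>)
  then show ?thesis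
  proof (rule lrelI)
    fix E :: "nat \<Rightarrow> 'a list" assume E: "E \<in> envs (\<lambda>_. n)"
    show "sp r P \<Phi> (map E [0..<r]) = (\<exists>E'\<in>envs arB. (\<forall>v. v \<notin> range Inr \<longrightarrow> E' v = case_sum E (\<lambda>_. [u1]) v) \<and> P E' \<and> sameQ \<Phi> E')" (is "_ = ?r")
    proof
      assume "sp r P \<Phi> (map E [0..<r])"
      then obtain E' where E': "E' \<in> envs arB" "blk r E' = map E [0..<r]" "P E' \<and> sameQ \<Phi> E'" unfolding sp_def by blast
      define E1 where "E1 v = (case v of Inl i \<Rightarrow> E i | Inr a \<Rightarrow> E' (Inr a))" for v
      have "E1 v \<in> tup (arB v)" for v
        using envs_tup[OF E] envs_tup[OF E'(1), of v] by (auto simp: E1_def arB_def split: sum.split)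
      then have E1: "E1 \<in> envs arB" by (simp add: envs_def)
      have "\<forall>i<r. E' (Inl i) = E i" using E'(2) by (simp add: blk_def)
      then have "(P E' \<and> sameQ \<Phi> E') = (P E1 \<and> sameQ \<Phi> E1)"
        by (intro dfn_agree[OF PQ E'(1) E1]) (auto simp: JB_def E1_def)
      then show ?r using E'(3) E1 by (intro bexI[of _ E1]) (auto simp: E1_def split: sum.split)
    next
      assume ?r
      then obtain E' where E': "E' \<in> envs arB" "\<forall>v. v \<notin> range Inr \<longrightarrow> E' v = case_sum E (\<lambda>_. [u1]) v" "P E'" "sameQ \<Phi> E'" by blast
      have "E' (Inl i) = E i" for i using E'(2)[rule_format, of "Inl i"] by auto
      then have "blk r E' = map E [0..<r]" by (simp add: blk_def)
      then show "sp r P \<Phi> (map E [0..<r])" unfolding sp_def using E' by blast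
    qed
  qed
qed

lemma invrI:
  assumes "\<And>\<sigma> b. \<sigma> \<in> G0 \<Longrightarrow> b \<in> ltup n j \<Longrightarrow> R b \<Longrightarrow> R (act \<sigma> b)"
  shows "invr j R"
  unfolding invr_def
proof (intro ballI iffI)
  fix \<sigma> b assume \<sigma>: "\<sigma> \<in> G0" and b: "b \<in> ltup n j"
  show "R b \<Longrightarrow> R (act \<sigma> b)" by (rule assms[OF \<sigma> b])
  assume "R (act \<sigma> b)"
  from assms[OF G0_ainv[OF \<sigma>] act_ltup[OF G0_D(1)[OF \<sigma>] b] this]
  show "R b" using act_ainv(2)[OF G0_D(1)[OF \<sigma>] b] by simp
qed

lemma sp_invr:
  assumes P: "dfn arB A (JB r) P" and \<Phi>: "\<Phi> \<subseteq> params"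
  shows "invr r (sp r P \<Phi>)"
proof (rule invrI)
  fix \<sigma> b assume \<sigma>: "\<sigma> \<in> G0" and "sp r P \<Phi> b"
  then obtain E where E: "E \<in> envs arB" "blk r E = b" "P E" "sameQ \<Phi> E" unfolding sp_def by blast
  note au = G0_D(1)[OF \<sigma>]
  let ?E = "\<lambda>v. map \<sigma> (E v)"
  have "?E \<in> envs arB" using E(1) automorphism_tup[OF au] by (auto simp: envs_def)
  moreover have "blk r ?E = act \<sigma> b" using E(2) by (auto simp: blk_def)
  moreover have "P ?E" using dfn_automorphism[OF P au A(1) G0_D(2)[OF \<sigma>] E(1)] E(3) by blast
  moreover have "sameQ \<Phi> ?E"
    unfolding sameQ_def
  proof clarify
    fix m \<phi> assume p: "(m, \<phi>) \<in> \<Phi>"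
    then have \<phi>: "\<phi> \<in> fms L (n + m)" using \<Phi> by (auto simp: params_def)
    have "eqv m \<phi> (dd m \<phi>) (par E (dd m \<phi>))" using E(4) p by (auto simp: sameQ_def)
    from eqv_automorphism[OF \<phi> au dd_tup[OF \<phi>] par_tup[OF E(1)] this] eqv_G0[OF \<sigma> \<phi>]
    have "eqv m \<phi> (dd m \<phi>) (map \<sigma> (par E (dd m \<phi>)))" by (rule eqv_trans[rotated])
    then show "eqv m \<phi> (dd m \<phi>) (par ?E (dd m \<phi>))" by (simp add: par_def map_concat comp_def)
  qed
  ultimately show "sp r P \<Phi> (act \<sigma> b)" unfolding sp_def by blast
qed

text \<open>
  The realizations of the \<open>j\<close>-th power of the global type over \<open>A\<close> and its canonical base.
\<close>

definition RR :: "nat \<Rightarrow> 'a list list set" where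
  "RR j = {b. \<exists>\<sigma>\<in>G0. \<exists>g. gen j B0 g \<and> act \<sigma> g = b}"

lemma RR_ltup: "b \<in> RR j \<Longrightarrow> b \<in> ltup n j"
  unfolding RR_def gen_def using act_ltup G0_D(1) by blast

lemma gen_RR: "gen j B0 g \<Longrightarrow> g \<in> RR j"
  unfolding RR_def using G0_id by (auto intro!: bexI[of _ id])

lemma act_comp: "act (\<sigma> \<circ> \<tau>) b = act \<sigma> (act \<tau> b)"
  by simp

lemma RR_act:
  assumes \<sigma>: "\<sigma> \<in> G0" and b: "b \<in> RR j"
  shows "act \<sigma> b \<in> RR j"
proof -
  obtain \<tau> g where \<tau>: "\<tau> \<in> G0" "gen j B0 g" "b = act \<tau> g" using b unfolding RR_def by blast
  then have "act (\<sigma> \<circ> \<tau>) g = act \<sigma> b" by simp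
  then show ?thesis unfolding RR_def using G0_comp[OF \<sigma> \<tau>(1)] \<tau>(2) by blast
qed

lemma RR_inv:
  assumes b: "b \<in> RR j" and R: "lrel n j B0 R" "invr j R" "Qp j R"
  shows "R b"
proof -
  obtain \<tau> g where \<tau>: "\<tau> \<in> G0" "gen j B0 g" "b = act \<tau> g" using b unfolding RR_def by blast
  then have "R g" "g \<in> ltup n j" using R unfolding gen_def by blast+
  then show ?thesis using R(2) \<tau> unfolding invr_def by blast
qed

lemma gen_conj:
  assumes g: "gen j B0 g" "gen j B0 g'"
  shows "\<exists>\<sigma>\<in>G0. act \<sigma> g = g'"
proof (rule orbit_of_sp)
  show gl: "g \<in> ltup n j" "g' \<in> ltup n j" using g by (auto simp: gen_def)
  fix P \<Phi> assume P: "dfn arB A (JB j) P" "P (Est g)" and \<Phi>: "finite \<Phi>" "\<Phi> \<subseteq> params"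
  have "sameQ \<Phi> (Est g)" using sameQ_act[OF \<Phi>(2) automorphism_id, of g] by (simp add: eqv_refl)
  then have "sp j P \<Phi> g" unfolding sp_def using P(2) Est_envs[OF gl(1)] Est_id(1)[OF gl(1)] by blast
  then show "sp j P \<Phi> g'" using gen_iff[OF g(1) sp_lrel[OF P(1) \<Phi>]] gen_iff[OF g(2) sp_lrel[OF P(1) \<Phi>]] by simp
qed

lemma RR_conj:
  assumes "b \<in> RR j" "b' \<in> RR j"
  shows "\<exists>\<sigma>\<in>G0. act \<sigma> b = b'"
proof -
  obtain \<sigma> g where s: "\<sigma> \<in> G0" "gen j B0 g" "act \<sigma> g = b" using assms(1) unfolding RR_def by blast
  obtain \<sigma>' g' where s': "\<sigma>' \<in> G0" "gen j B0 g'" "act \<sigma>' g' = b'" using assms(2) unfolding RR_def by blast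
  obtain \<tau> where t: "\<tau> \<in> G0" "act \<tau> g = g'" using gen_conj[OF s(2) s'(2)] by blast
  have "g \<in> ltup n j" using s(2) by (simp add: gen_def)
  then have "act (ainv \<sigma>) b = g" using act_ainv(2)[OF G0_D(1)[OF s(1)]] s(3) by blast
  then have "act (\<sigma>' \<circ> (\<tau> \<circ> ainv \<sigma>)) b = b'" unfolding act_comp using t(2) s'(3) by simp
  then show ?thesis using G0_comp[OF s'(1) G0_comp[OF t(1) G0_ainv[OF s(1)]]] by blast
qed

lemma RR_of_sp:
  assumes b: "b \<in> ltup n j" and g: "gen j B0 g"
    and sp: "\<And>P \<Phi>. dfn arB A (JB j) P \<Longrightarrow> P (Est g) \<Longrightarrow> finite \<Phi> \<Longrightarrow> \<Phi> \<subseteq> params \<Longrightarrow> sp j P \<Phi> b"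
  shows "b \<in> RR j"
proof -
  have "g \<in> ltup n j" using g by (simp add: gen_def)
  from orbit_of_sp[OF this b sp] show ?thesis unfolding RR_def using g by blast
qed

lemma RR_of_invariant:
  assumes b: "b \<in> ltup n j" and inv: "\<And>R. lrel n j B0 R \<Longrightarrow> invr j R \<Longrightarrow> Qp j R \<Longrightarrow> R b"
  shows "b \<in> RR j"
proof -
  obtain g where g: "gen j B0 g" using gen_exists[OF B0(3,4)] by blast
  then have gl: "g \<in> ltup n j" by (simp add: gen_def)
  show ?thesis
  proof (rule RR_of_sp[OF b g])
    fix P \<Phi> assume P: "dfn arB A (JB j) P" "P (Est g)" and \<Phi>: "finite \<Phi>" "\<Phi> \<subseteq> params"
    have "sameQ \<Phi> (Est g)" using sameQ_act[OF \<Phi>(2) automorphism_id, of g] by (simp add: eqv_refl)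
    then have "sp j P \<Phi> g" unfolding sp_def using P(2) Est_envs[OF gl] Est_id(1)[OF gl] by blast
    then have "Qp j (sp j P \<Phi>)" using gen_iff[OF g sp_lrel[OF P(1) \<Phi>]] by simp
    then show "sp j P \<Phi> b" using inv[OF sp_lrel[OF P(1) \<Phi>] sp_invr[OF P(1) \<Phi>(2)]] by blast
  qed
qed

end

section \<open>Spreading finitely many realizations\<close>

context stable_nonforking
begin

lemma lrel_ex1:
  assumes "lrel n (Suc p) C R"
  shows "lrel n p C (\<lambda>s. \<exists>x\<in>tup n. R (s @ [x]))"
proof (rule lrelI)
  have "dfn (\<lambda>_::nat. n) C (insert p {..<p}) (\<lambda>E. R (map E [0..<Suc p]))"
    using assms unfolding lrel_def by (rule dfn_mono) auto
  from dfn_ex[OF this] show "dfn (\<lambda>_::nat. n) C {..<p} (\<lambda>E. \<exists>x\<in>tup n. R (map (E(p := x)) [0..<Suc p]))"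
    by (rule dfn_mono) auto
  show "(\<exists>x\<in>tup n. R (map E [0..<p] @ [x])) = (\<exists>x\<in>tup n. R (map (E(p := x)) [0..<Suc p]))" for E by simp
qed

lemma ltup_Suc: "(\<exists>y\<in>ltup n (Suc j). P y) \<longleftrightarrow> (\<exists>y\<in>ltup n j. \<exists>x\<in>tup n. P (y @ [x]))"
proof
  assume "\<exists>y\<in>ltup n (Suc j). P y"
  then obtain y where y: "length y = Suc j" "set y \<subseteq> tup n" "P y" by (auto simp: ltup_def)
  then obtain y' x where "y = y' @ [x]" by (metis append_butlast_last_id list.size(3) nat.distinct(1))
  then show "\<exists>y\<in>ltup n j. \<exists>x\<in>tup n. P (y @ [x])" using y by (intro bexI[of _ y'] bexI[of _ x]) (auto simp: ltup_def)
next
  assume "\<exists>y\<in>ltup n j. \<exists>x\<in>tup n. P (y @ [x])"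
  then obtain y x where "y \<in> ltup n j" "x \<in> tup n" "P (y @ [x])" by blast
  then show "\<exists>y\<in>ltup n (Suc j). P y" by (intro bexI[of _ "y @ [x]"]) (auto simp: ltup_def)
qed

lemma lrel_ex: "lrel n (p + j) C R \<Longrightarrow> lrel n p C (\<lambda>s. \<exists>y\<in>ltup n j. R (s @ y))"
proof (induction j arbitrary: R)
  case 0
  have "ltup n 0 = {[]}" by (auto simp: ltup_def)
  then show ?case using 0 by simp
next
  case (Suc j)
  have "lrel n (p + j) C (\<lambda>s. \<exists>x\<in>tup n. R (s @ [x]))" using Suc.prems by (intro lrel_ex1) simp
  from Suc.IH[OF this] show ?case by (simp add: ltup_Suc)
qed

lemma lrel_all:
  assumes "lrel n (p + j) C R"
  shows "lrel n p C (\<lambda>s. \<forall>y\<in>ltup n j. R (s @ y))"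
  using lrel_not[OF lrel_ex[OF lrel_not[OF assms]]] by (rule lrel_cong) simp

lemma act_append_ltup: "b \<in> ltup n a \<Longrightarrow> y \<in> ltup n k \<Longrightarrow> b @ y \<in> ltup n (a + k)"
  by (auto simp: ltup_def)

lemma invrD: "invr j R \<Longrightarrow> \<sigma> \<in> G0 \<Longrightarrow> b \<in> ltup n j \<Longrightarrow> R (act \<sigma> b) = R b"
  by (simp add: invr_def)

text \<open>The first block is moved to the end, where it can be quantified by \<open>qpow\<close>.\<close>

lemma first_block:
  assumes \<mu>: "lrel n (a + k) B0 \<mu>" "invr (a + k) \<mu>"
  shows "lrel n k B0 (\<lambda>y. Qp a (\<lambda>c. \<mu> (c @ y)))" "invr k (\<lambda>y. Qp a (\<lambda>c. \<mu> (c @ y)))"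
proof -
  define \<mu>' where "\<mu>' d = \<mu> (drop k d @ take k d)" for d
  have R: "lrel n (k + a) B0 \<mu>'"
    unfolding \<mu>'_def
  proof (rule lrel_subst[OF \<mu>(1) order_refl B0(3)])
    fix i assume i: "i < a + k"
    show "(\<exists>l<k + a. \<forall>b\<in>ltup n (k + a). (drop k b @ take k b) ! i = b ! l) \<or>
      (\<exists>u\<in>tuples B0 n. \<forall>b\<in>ltup n (k + a). (drop k b @ take k b) ! i = u)"
      by (rule disjI1, rule exI[of _ "if i < a then k + i else i - a"])
        (use i in \<open>auto simp: ltup_def nth_append\<close>)
  qed (simp add: ltup_def)
  have inv: "invr (k + a) \<mu>'"
  proof (rule invrI)
    fix \<sigma> b assume \<sigma>: "\<sigma> \<in> G0" and b: "b \<in> ltup n (k + a)" and h: "\<mu>' b"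
    have "drop k b @ take k b \<in> ltup n (a + k)"
      using b set_take_subset[of k b] set_drop_subset[of k b] by (auto simp: ltup_def)
    from invrD[OF \<mu>(2) \<sigma> this] h show "\<mu>' (act \<sigma> b)" by (simp add: \<mu>'_def take_map drop_map)
  qed
  have eq: "Qp a (\<lambda>c. \<mu>' (y @ c)) = Qp a (\<lambda>c. \<mu> (c @ y))" if "y \<in> ltup n k" for y
    using that by (simp add: \<mu>'_def ltup_def)
  show "lrel n k B0 (\<lambda>y. Qp a (\<lambda>c. \<mu> (c @ y)))"
    using lrel_qpow[OF R order_refl B0(3)] by (rule lrel_cong) (simp add: eq)
  show "invr k (\<lambda>y. Qp a (\<lambda>c. \<mu> (c @ y)))"
    using invr_Qp[OF R order_refl B0(3) inv] eq act_ltup[OF G0_D(1)] unfolding invr_def by simp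
qed

text \<open>
  The conclusion of the majority lemma is an invariant definable relation of \<open>s\<close>, hence it
  passes from generic tuples to all elements of \<open>RR (a * L)\<close>.  It quantifies over all \<open>y\<close>, so \<open>s\<close> and
  \<open>y\<close> may depend on each other.
\<close>

lemma majority_RR:
  assumes \<mu>: "lrel n (a + k) B0 \<mu>" "invr (a + k) \<mu>" "Qp (a + k) \<mu>"
  shows "\<exists>N. \<forall>L. \<forall>s\<in>RR (a * L). \<forall>y\<in>RR k. card {l. l < L \<and> \<not> \<mu> (chunk a l s @ y)} < N"
proof -
  obtain N where N: "\<And>L. Qp (a * L) (\<lambda>s. \<forall>y\<in>ltup n k. Qp a (\<lambda>b. \<mu> (b @ y)) \<longrightarrow>
    card {l. l < L \<and> \<not> \<mu> (chunk a l s @ y)} < N)" using majority_lrel[OF \<mu>(1) B0(3)] by blast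
  note fb = first_block[OF \<mu>(1,2)]
  have gy: "Qp a (\<lambda>c. \<mu> (c @ y))" if "y \<in> RR k" for y
  proof (rule RR_inv[OF that fb])
    have "Qp a (\<lambda>b. Qp k (\<lambda>y. \<mu> (b @ y)))" using \<mu>(3) by (simp add: qpow_add[OF Q])
    then show "Qp k (\<lambda>y. Qp a (\<lambda>c. \<mu> (c @ y)))" by (rule Qp_commute[OF \<mu>(1) B0(3)])
  qed
  have "card {l. l < L \<and> \<not> \<mu> (chunk a l s @ y)} < N" if s: "s \<in> RR (a * L)" and y: "y \<in> RR k" for L s y
  proof -
    define p where "p = a * L"
    have chl: "Suc l * a \<le> p" if "l < L" for l
    proof -
      have "Suc l * a \<le> L * a" using that by (intro mult_le_mono1) simp
      then show ?thesis by (simp add: p_def mult.commute)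
    qed
    define W where "W d \<longleftrightarrow> (Qp a (\<lambda>b. \<mu> (b @ drop p d)) \<longrightarrow> card {l\<in>{..<L}. \<not> \<mu> (chunk a l d @ drop p d)} < N)" for d
    have Wst: "W (s @ y) \<longleftrightarrow> (Qp a (\<lambda>b. \<mu> (b @ y)) \<longrightarrow> card {l. l < L \<and> \<not> \<mu> (chunk a l s @ y)} < N)"
      if "s \<in> ltup n p" for s y
    proof -
      have "chunk a l (s @ y) = chunk a l s" if "l < L" for l
        using chl[OF that] \<open>s \<in> ltup n p\<close> by (auto simp: chunk_def nth_append ltup_def)
      then have "{l\<in>{..<L}. \<not> \<mu> (chunk a l (s @ y) @ y)} = {l. l < L \<and> \<not> \<mu> (chunk a l s @ y)}" by auto
      then show ?thesis using that by (simp add: W_def ltup_def)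
    qed
    have "lrel n (p + k) B0 (\<lambda>d. Qp a (\<lambda>b. \<mu> (b @ drop p d)))"
    proof (rule lrel_subst[OF fb(1) order_refl B0(3)])
      fix i assume "i < k"
      then show "(\<exists>l<p + k. \<forall>b\<in>ltup n (p + k). drop p b ! i = b ! l) \<or> (\<exists>u\<in>tuples B0 n. \<forall>b\<in>ltup n (p + k). drop p b ! i = u)"
        by (intro disjI1 exI[of _ "p + i"]) (auto simp: ltup_def)
    qed (simp add: ltup_def)
    moreover have "lrel n (p + k) B0 (\<lambda>d. \<not> \<mu> (chunk a l d @ drop p d))" if l: "l \<in> {..<L}" for l
    proof (rule lrel_not, rule lrel_subst[OF \<mu>(1) order_refl B0(3)])
      fix i assume i: "i < a + k"
      show "(\<exists>l'<p + k. \<forall>b\<in>ltup n (p + k). (chunk a l b @ drop p b) ! i = b ! l') \<or>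
        (\<exists>u\<in>tuples B0 n. \<forall>b\<in>ltup n (p + k). (chunk a l b @ drop p b) ! i = u)"
        by (rule disjI1, rule exI[of _ "if i < a then l * a + i else p + (i - a)"])
          (use i chl[of l] l in \<open>auto simp: ltup_def nth_append chunk_def\<close>)
    qed (auto simp: ltup_def chunk_def)
    ultimately have Wl: "lrel n (p + k) B0 W"
      unfolding W_def lrel_def
      by (intro dfn_imp dfn_boolean[where \<Phi> = "\<lambda>T. card T < N"] finite_lessThan) simp_all
    have Winv: "invr (p + k) W"
    proof (rule invrI)
      fix \<sigma> d assume \<sigma>: "\<sigma> \<in> G0" and d: "d \<in> ltup n (p + k)" and h: "W d"
      have dp: "drop p d \<in> ltup n k" using d set_drop_subset[of p d] by (auto simp: ltup_def)
      have ch: "chunk a l d \<in> ltup n a" "chunk a l (act \<sigma> d) = act \<sigma> (chunk a l d)" if "l < L" for l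
        using chl[OF that] d by (auto simp: ltup_def chunk_def subset_iff)
      have "\<mu> (chunk a l (act \<sigma> d) @ drop p (act \<sigma> d)) = \<mu> (chunk a l d @ drop p d)" if "l < L" for l
        using invrD[OF \<mu>(2) \<sigma> act_append_ltup[OF ch(1)[OF that] dp]] ch(2)[OF that] by (simp add: drop_map)
      then have "{l\<in>{..<L}. \<not> \<mu> (chunk a l (act \<sigma> d) @ drop p (act \<sigma> d))} = {l\<in>{..<L}. \<not> \<mu> (chunk a l d @ drop p d)}" by auto
      moreover have "Qp a (\<lambda>b. \<mu> (b @ drop p (act \<sigma> d))) = Qp a (\<lambda>b. \<mu> (b @ drop p d))"
        using invrD[OF fb(2) \<sigma> dp] by (simp add: drop_map)
      ultimately show "W (act \<sigma> d)" using h by (simp add: W_def)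
    qed
    define V where "V s \<longleftrightarrow> (\<forall>y\<in>ltup n k. W (s @ y))" for s
    have "lrel n p B0 V" unfolding V_def by (rule lrel_all[OF Wl])
    moreover have "invr p V"
    proof (rule invrI)
      fix \<sigma> s assume \<sigma>: "\<sigma> \<in> G0" and s: "s \<in> ltup n p" and h: "V s"
      show "V (act \<sigma> s)" unfolding V_def
      proof
        fix y assume y: "y \<in> ltup n k"
        define y' where "y' = act (ainv \<sigma>) y"
        have y': "y' \<in> ltup n k" "act \<sigma> y' = y"
          using act_ltup[OF G0_D(1)[OF G0_ainv[OF \<sigma>]] y] act_ainv(1)[OF G0_D(1)[OF \<sigma>] y] by (simp_all add: y'_def del: map_map)
        have "W (s @ y')" using h y'(1) by (simp add: V_def)
        then show "W (act \<sigma> s @ y)" using invrD[OF Winv \<sigma> act_append_ltup[OF s y'(1)]] y'(2) by simp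
      qed
    qed
    moreover have "Qp p V"
      using N[of L] unfolding p_def[symmetric]
      by (rule iffD1[OF Qp_cong, rotated]) (simp add: V_def Wst)
    moreover have "s \<in> RR p" using s by (simp add: p_def)
    ultimately have "V s" by (intro RR_inv)
    then have "W (s @ y)" using RR_ltup[OF y] by (simp add: V_def)
    then show ?thesis using Wst[OF RR_ltup[OF \<open>s \<in> RR p\<close>]] gy[OF y] by simp
  qed
  then show ?thesis by blast
qed

text \<open>
  One more entry \<open>act \<tau> b\<close> for the columns \<open>c b\<close>, with respect to one relation \<open>\<mu>\<close>.  By the hypothesis
  the columns other than \<open>c b0\<close> have simultaneous conjugates, their copies, that form an independent
  sequence for each column.  A tuple \<open>g\<close> that is generic over the copies of \<open>c b0\<close> is a good new
  entry for all of these, and the realizations \<open>b\<close> are moved so that \<open>b0\<close> becomes \<open>g\<close>.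
  For each of the other columns only a few copies are bad, so some copy is good for all.
\<close>

lemma spread_step:
  assumes bs: "\<And>b. b \<in> set (b0 # bs) \<Longrightarrow> b \<in> RR j \<and> c b \<in> RR i"
    and spread: "\<And>L. \<exists>\<sigma>. (\<forall>l. \<sigma> l \<in> G0) \<and> (\<forall>b\<in>set (map c bs). concat (map (\<lambda>l. act (\<sigma> l) b) [0..<L]) \<in> RR (i * L))"
    and \<mu>: "lrel n (i + j) B0 \<mu>" "invr (i + j) \<mu>" "Qp (i + j) \<mu>"
  shows "\<exists>\<tau>\<in>G0. \<forall>b\<in>set (b0 # bs). \<mu> (c b @ act \<tau> b)"
proof -
  obtain N where N: "\<And>L s y. s \<in> RR (i * L) \<Longrightarrow> y \<in> RR j \<Longrightarrow> card {l. l < L \<and> \<not> \<mu> (chunk i l s @ y)} < N"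
    using majority_RR[OF \<mu>] by blast
  define L' where "L' = Suc (length bs * N)"
  obtain \<sigma> where \<sigma>: "\<And>l. \<sigma> l \<in> G0" "\<And>b. b \<in> set bs \<Longrightarrow> concat (map (\<lambda>l. act (\<sigma> l) (c b)) [0..<L']) \<in> RR (i * L')"
    using spread[of L'] by auto
  note au = G0_D(1)[OF \<sigma>(1)]
  have c0: "act (\<sigma> l) (c b0) \<in> RR i" for l using RR_act[OF \<sigma>(1)] bs by simp
  define C where "C = B0 \<union> (\<Union>l\<in>{..<L'}. set (concat (act (\<sigma> l) (c b0))))"
  have C: "B0 \<subseteq> C" "C \<subseteq> U" "small \<kappa> C"
  proof -
    have "set (concat (act (\<sigma> l) (c b0))) \<subseteq> U" for l
      using concat_ltup[OF RR_ltup[OF c0[of l]]] by (simp only: tuples_def mem_Collect_eq)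
    then show "C \<subseteq> U" unfolding C_def using B0(3) by blast
    show "small \<kappa> C" unfolding C_def by (intro small_Un[OF B0(4)] small_finite) auto
  qed (auto simp: C_def)
  obtain g where g: "gen j C g" using gen_exists[OF C(2,3)] by blast
  have "gen j B0 g" by (rule gen_mono[OF g C(1)])
  then have gR: "g \<in> RR j" by (rule gen_RR)
  obtain \<tau> where \<tau>: "\<tau> \<in> G0" "act \<tau> b0 = g" using RR_conj[OF _ gR] bs[of b0] by auto
  have good0: "\<mu> (act (\<sigma> l) (c b0) @ g)" if l: "l < L'" for l
  proof -
    define e where "e = act (\<sigma> l) (c b0)"
    have eR: "e \<in> RR i" using c0 by (simp add: e_def)
    have el: "e \<in> ltup n i" by (rule RR_ltup[OF eR])
    have "Qp j (\<lambda>y. \<mu> (e @ y))"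
    proof (rule RR_inv[OF eR])
      show "lrel n i B0 (\<lambda>c. Qp j (\<lambda>y. \<mu> (c @ y)))" by (rule lrel_qpow[OF \<mu>(1) order_refl B0(3)])
      show "invr i (\<lambda>c. Qp j (\<lambda>y. \<mu> (c @ y)))" by (rule invr_Qp[OF \<mu>(1) order_refl B0(3) \<mu>(2)])
      show "Qp i (\<lambda>c. Qp j (\<lambda>y. \<mu> (c @ y)))" using \<mu>(3) by (simp add: qpow_add[OF Q])
    qed
    moreover have "lrel n j C (\<lambda>y. \<mu> (e @ y))"
    proof (rule lrel_subst[OF \<mu>(1) C(1,2)])
      fix k assume k: "k < i + j"
      show "(\<exists>l<j. \<forall>b\<in>ltup n j. (e @ b) ! k = b ! l) \<or> (\<exists>u\<in>tuples C n. \<forall>b\<in>ltup n j. (e @ b) ! k = u)"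
      proof (cases "k < i")
        case True
        then have "e ! k \<in> set e" using el by (simp add: ltup_def)
        moreover have "set (concat e) \<subseteq> C" using l by (auto simp: C_def e_def)
        ultimately have "e ! k \<in> tuples C n" using el by (fastforce simp: ltup_def tuples_def)
        then show ?thesis using True el by (intro disjI2 bexI[of _ "e ! k"]) (auto simp: nth_append ltup_def)
      next
        case False
        then show ?thesis using k el by (intro disjI1 exI[of _ "k - i"]) (auto simp: nth_append ltup_def)
      qed
    qed (use el in \<open>simp add: ltup_def\<close>)
    ultimately show ?thesis using g unfolding gen_def e_def by blast
  qed
  define bad where "bad b = {l. l < L' \<and> \<not> \<mu> (act (\<sigma> l) (c b) @ act \<tau> b)}" for b
  have badN: "card (bad b) \<le> N" if b: "b \<in> set bs" for b
  proof -
    have cb: "c b \<in> ltup n i" using bs[of b] b RR_ltup by simp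
    have "chunk i l (concat (map (\<lambda>l. act (\<sigma> l) (c b)) [0..<L'])) = act (\<sigma> l) (c b)" if "l < L'" for l
      using that cb by (subst chunk_concat) (auto simp: ltup_def)
    then have "bad b = {l. l < L' \<and> \<not> \<mu> (chunk i l (concat (map (\<lambda>l. act (\<sigma> l) (c b)) [0..<L'])) @ act \<tau> b)}"
      by (auto simp: bad_def)
    moreover have "act \<tau> b \<in> RR j" using RR_act[OF \<tau>(1)] bs[of b] b by simp
    ultimately show ?thesis using N[OF \<sigma>(2)[OF b], of "act \<tau> b"] by simp
  qed
  have "card (\<Union>b\<in>set bs. bad b) \<le> (\<Sum>b\<in>set bs. card (bad b))" by (rule card_UN_le) simp
  also have "\<dots> \<le> (\<Sum>b\<in>set bs. N)" using badN by (rule sum_mono)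
  also have "\<dots> = card (set bs) * N" by simp
  also have "\<dots> \<le> length bs * N" by (intro mult_le_mono1 card_length)
  finally have "card (\<Union>b\<in>set bs. bad b) < card {..<L'}" by (simp add: L'_def)
  moreover have "finite (\<Union>b\<in>set bs. bad b)" by (auto simp: bad_def)
  ultimately have "\<not> {..<L'} \<subseteq> (\<Union>b\<in>set bs. bad b)" by (metis card_mono not_less)
  then obtain l where l: "l < L'" "\<And>b. b \<in> set bs \<Longrightarrow> \<mu> (act (\<sigma> l) (c b) @ act \<tau> b)" by (auto simp: bad_def)
  define \<rho> where "\<rho> = ainv (\<sigma> l) \<circ> \<tau>"
  have \<rho>: "\<rho> \<in> G0" unfolding \<rho>_def by (rule G0_comp[OF G0_ainv[OF \<sigma>(1)] \<tau>(1)])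
  have "\<mu> (c b @ act \<rho> b)" if b: "b \<in> set (b0 # bs)" for b
  proof -
    have bl: "b \<in> ltup n j" "c b \<in> ltup n i" using bs[OF b] RR_ltup by blast+
    have "act (\<sigma> l) (act \<rho> b) = act \<tau> b"
      unfolding \<rho>_def act_comp by (rule act_ainv(1)[OF au act_ltup[OF G0_D(1)[OF \<tau>(1)] bl(1)]])
    then have "\<mu> (act (\<sigma> l) (c b @ act \<rho> b)) = \<mu> (act (\<sigma> l) (c b) @ act \<tau> b)" by (simp del: map_map)
    moreover have "\<mu> (act (\<sigma> l) (c b @ act \<rho> b)) = \<mu> (c b @ act \<rho> b)"
      by (rule invrD[OF \<mu>(2) \<sigma>(1) act_append_ltup[OF bl(2) act_ltup[OF G0_D(1)[OF \<rho>] bl(1)]]])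
    moreover have "\<mu> (act (\<sigma> l) (c b) @ act \<tau> b)" using b l good0[OF l(1)] \<tau>(2) by auto
    ultimately show ?thesis by simp
  qed
  then show ?thesis using \<rho> by blast
qed

text \<open>
  Finitely many realizations, however they depend on each other, have simultaneous conjugates
  such that the conjugates of each single one are independent.  The induction is on the
  number of realizations, for all \<open>j\<close> and \<open>h\<close>, and then on \<open>h\<close>: the columns for \<open>h\<close> are themselves
  realizations of a power, to which the hypothesis for fewer realizations applies.  By
  compactness of the orbits, one relation at a time has to be considered.
\<close>

lemma spread:
  "\<forall>b\<in>set bs. b \<in> RR j \<Longrightarrow>
    \<exists>\<sigma>. (\<forall>l. \<sigma> l \<in> G0) \<and> (\<forall>b\<in>set bs. concat (map (\<lambda>l. act (\<sigma> l) b) [0..<h]) \<in> RR (j * h))"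
proof (induction "length bs" arbitrary: bs j h)
  case 0
  then have "bs = []" by simp
  then show ?case by (intro exI[of _ "\<lambda>_. id"] conjI allI G0_id) simp
next
  case (Suc k)
  then obtain b0 bs' where bs: "bs = b0 # bs'" "k = length bs'" by (metis length_Suc_conv)
  note prems = Suc.prems and IH = Suc.hyps(1)
  have "\<exists>\<sigma>. (\<forall>l. \<sigma> l \<in> G0) \<and> (\<forall>b\<in>set (b0 # bs'). concat (map (\<lambda>l. act (\<sigma> l) b) [0..<h]) \<in> RR (j * h))"
  proof (induction h)
    case 0
    obtain g where "gen 0 B0 g" using gen_exists[OF B0(3,4)] by blast
    then have "[] \<in> RR 0" using gen_RR[of 0 g] by (auto simp: gen_def ltup_def)
    then show ?case by (intro exI[of _ "\<lambda>_. id"] conjI allI G0_id) simp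
  next
    case (Suc h)
    then obtain \<sigma> where \<sigma>: "\<And>l. \<sigma> l \<in> G0"
      "\<And>b. b \<in> set (b0 # bs') \<Longrightarrow> concat (map (\<lambda>l. act (\<sigma> l) b) [0..<h]) \<in> RR (j * h)" by blast
    define c where "c b = concat (map (\<lambda>l. act (\<sigma> l) b) [0..<h])" for b
    define bl where "bl = b0 # bs'"
    have bR: "b \<in> RR j" "c b \<in> RR (j * h)" if "b \<in> set bl" for b
      using prems bs \<sigma>(2) that by (auto simp: c_def bl_def)
    have blt: "b \<in> ltup n j" "c b \<in> ltup n (j * h)" if "b \<in> set bl" for b using bR[OF that] RR_ltup by blast+
    define \<M> where "\<M> = {\<mu>. lrel n (j * h + j) B0 \<mu> \<and> invr (j * h + j) \<mu> \<and> Qp (j * h + j) \<mu>}"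
    have step: "\<exists>\<tau>\<in>G0. \<forall>b\<in>set bl. \<mu> (c b @ act \<tau> b)" if "\<mu> \<in> \<M>" for \<mu>
      unfolding bl_def
    proof (rule spread_step)
      show "\<exists>\<sigma>. (\<forall>l. \<sigma> l \<in> G0) \<and> (\<forall>b\<in>set (map c bs'). concat (map (\<lambda>l. act (\<sigma> l) b) [0..<h']) \<in> RR (j * h * h'))" for h'
        by (rule IH) (use bR bs(2) in \<open>auto simp: bl_def\<close>)
    qed (use that bR in \<open>auto simp: \<M>_def bl_def\<close>)
    define r where "r = length bl * j"
    have cbl: "concat bl \<in> ltup n r"
    proof -
      have "length (concat bl) = length bl * j" using blt(1) by (induction bl) (auto simp: ltup_def)
      moreover have "set (concat bl) \<subseteq> tup n" using blt(1) by (auto simp: ltup_def)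
      ultimately show ?thesis by (simp add: ltup_def r_def)
    qed
    define C where "C = B0 \<union> (\<Union>b\<in>set bl. set (concat (c b)))"
    have C: "B0 \<subseteq> C" "C \<subseteq> U" "small \<kappa> C"
    proof -
      have "set (concat (c b)) \<subseteq> U" if "b \<in> set bl" for b
        using concat_ltup[OF blt(2)[OF that]] by (simp only: tuples_def mem_Collect_eq)
      then show "C \<subseteq> U" unfolding C_def using B0(3) by blast
      show "small \<kappa> C" unfolding C_def by (intro small_Un[OF B0(4)] small_finite) auto
    qed (auto simp: C_def)
    define \<N> where "\<N> = (\<lambda>(\<mu>, i) d. \<mu> (c (bl ! i) @ chunk j i d)) ` (\<M> \<times> {..<length bl})"
    have chact: "chunk j i (act \<tau> (concat bl)) = act \<tau> (bl ! i)" if "i < length bl" for i \<tau>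
    proof -
      have "chunk j i (concat (map (act \<tau>) bl)) = map (act \<tau>) bl ! i"
        by (rule chunk_concat) (use blt(1) that in \<open>auto simp: ltup_def\<close>)
      then show ?thesis using that by (simp add: map_concat)
    qed
    have "\<exists>\<tau>\<in>G0. \<forall>\<nu>\<in>\<N>. \<nu> (act \<tau> (concat bl))"
    proof (rule orbit_compactness_G0[OF cbl C(2,3)])
      fix \<nu> assume "\<nu> \<in> \<N>"
      then obtain \<mu> i where \<nu>: "\<mu> \<in> \<M>" "i < length bl" "\<nu> = (\<lambda>d. \<mu> (c (bl ! i) @ chunk j i d))" by (auto simp: \<N>_def)
      define e where "e = c (bl ! i)"
      have bi: "bl ! i \<in> set bl" using \<nu>(2) by simp
      have el: "e \<in> ltup n (j * h)" unfolding e_def by (rule blt(2)[OF bi])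
      have eC: "set (concat e) \<subseteq> C" unfolding e_def C_def using bi by blast
      have ch: "i * j + k < r" if "k < j" for k
      proof -
        have "Suc i * j \<le> length bl * j" using \<nu>(2) by (intro mult_le_mono1) simp
        then show ?thesis using that by (simp add: r_def)
      qed
      show "lrel n r C \<nu>" unfolding \<nu>(3) e_def[symmetric]
      proof (rule lrel_subst[of n "j * h + j" B0 \<mu>, OF _ C(1,2)])
        fix k assume k: "k < j * h + j"
        show "(\<exists>l<r. \<forall>b\<in>ltup n r. (e @ chunk j i b) ! k = b ! l) \<or> (\<exists>u\<in>tuples C n. \<forall>b\<in>ltup n r. (e @ chunk j i b) ! k = u)"
        proof (cases "k < j * h")
          case True
          then have "e ! k \<in> set e" using el by (simp add: ltup_def)
          then have "e ! k \<in> tuples C n" using el eC by (fastforce simp: ltup_def tuples_def)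
          then show ?thesis using True el by (intro disjI2 bexI[of _ "e ! k"]) (auto simp: nth_append ltup_def)
        next
          case False
          then show ?thesis using k el ch[of "k - j * h"]
            by (intro disjI1 exI[of _ "i * j + (k - j * h)"]) (auto simp: nth_append ltup_def chunk_def)
        qed
      qed (use \<nu>(1) el in \<open>auto simp: \<M>_def ltup_def chunk_def\<close>)
    next
      fix \<N>0 assume "finite \<N>0" "\<N>0 \<subseteq> \<N>"
      then obtain K where K: "K \<subseteq> \<M> \<times> {..<length bl}" "finite K" "\<N>0 = (\<lambda>(\<mu>, i) d. \<mu> (c (bl ! i) @ chunk j i d)) ` K"
        unfolding \<N>_def by (meson finite_subset_image)
      define \<mu> where "\<mu> d \<longleftrightarrow> (\<forall>\<mu>'\<in>fst ` K. \<mu>' d)" for d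
      have KM: "\<mu>' \<in> \<M>" if "\<mu>' \<in> fst ` K" for \<mu>' using that K(1) by auto
      have "\<mu> \<in> \<M>" unfolding \<M>_def
      proof (intro CollectI conjI)
        show "lrel n (j * h + j) B0 \<mu>" unfolding \<mu>_def using K(2) KM by (intro lrel_ball_finite) (auto simp: \<M>_def)
        show "invr (j * h + j) \<mu>" unfolding \<mu>_def invr_def using KM by (auto simp: \<M>_def invr_def)
        show "Qp (j * h + j) \<mu>" unfolding \<mu>_def using K(2) KM by (simp add: uq_ball[OF _ uqp] \<M>_def)
      qed
      from step[OF this] obtain \<tau> where \<tau>: "\<tau> \<in> G0" "\<forall>b\<in>set bl. \<mu> (c b @ act \<tau> b)" by blast
      have "\<nu> (act \<tau> (concat bl))" if "\<nu> \<in> \<N>0" for \<nu>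
      proof -
        from that[unfolded K(3)] obtain k0 where k0: "\<nu> = (\<lambda>(\<mu>, i) d. \<mu> (c (bl ! i) @ chunk j i d)) k0" "k0 \<in> K"
          by (rule imageE)
        obtain \<mu>' i where mi: "k0 = (\<mu>', i)" by (cases k0)
        have k: "(\<mu>', i) \<in> K" "\<nu> = (\<lambda>d. \<mu>' (c (bl ! i) @ chunk j i d))" using k0 mi by simp_all
        then have i: "i < length bl" "\<mu>' \<in> fst ` K" using K(1) by force+
        then have "\<mu> (c (bl ! i) @ act \<tau> (bl ! i))" using \<tau>(2) by simp
        then have "\<mu>' (c (bl ! i) @ act \<tau> (bl ! i))" unfolding \<mu>_def by (rule bspec) (rule i(2))
        then show ?thesis using k chact[OF i(1)] by simp
      qed
      then show "\<exists>\<tau>\<in>G0. \<forall>\<nu>\<in>\<N>0. \<nu> (act \<tau> (concat bl))" using \<tau>(1) by blast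
    qed
    then obtain \<tau> where \<tau>: "\<tau> \<in> G0" "\<And>\<nu>. \<nu> \<in> \<N> \<Longrightarrow> \<nu> (act \<tau> (concat bl))" by blast
    have col: "c b @ act \<tau> b \<in> RR (j * h + j)" if b: "b \<in> set bl" for b
    proof (rule RR_of_invariant)
      show "c b @ act \<tau> b \<in> ltup n (j * h + j)"
        by (intro act_append_ltup blt[OF b] act_ltup[OF G0_D(1)[OF \<tau>(1)]])
      fix R assume "lrel n (j * h + j) B0 R" "invr (j * h + j) R" "Qp (j * h + j) R"
      then have "R \<in> \<M>" by (simp add: \<M>_def)
      moreover obtain i where i: "i < length bl" "b = bl ! i" using b by (metis in_set_conv_nth)
      ultimately have "(\<lambda>d. R (c (bl ! i) @ chunk j i d)) \<in> \<N>" by (force simp: \<N>_def)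
      from \<tau>(2)[OF this] show "R (c b @ act \<tau> b)" using chact[OF i(1)] i(2) by simp
    qed
    show ?case
    proof (intro exI[of _ "\<lambda>l. if l < h then \<sigma> l else \<tau>"] conjI ballI allI)
      fix b assume "b \<in> set (b0 # bs')"
      then have "c b @ act \<tau> b \<in> RR (j * Suc h)" using col[of b] by (simp add: bl_def add.commute)
      moreover have "concat (map (\<lambda>l. act (if l < h then \<sigma> l else \<tau>) b) [0..<Suc h]) = c b @ act \<tau> b"
      proof -
        have "map (\<lambda>l. act (if l < h then \<sigma> l else \<tau>) b) [0..<h] = map (\<lambda>l. act (\<sigma> l) b) [0..<h]" by simp
        from arg_cong[OF this, of concat] show ?thesis by (simp only: c_def upt_Suc map_append concat_append) simp
      qed
      ultimately show "concat (map (\<lambda>l. act (if l < h then \<sigma> l else \<tau>) b) [0..<Suc h]) \<in> RR (j * Suc h)" by simp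
    qed (use \<sigma>(1) \<tau>(1) in auto)
  qed
  then show ?case unfolding bs(1) .
qed

text \<open>
  On the independent sequence of conjugates of a realization \<open>a\<close> the formula fails fewer than \<open>N\<close> times.
  The common length of these sequences exceeds \<open>N\<close> times the number of realizations, so for some
  index the formula holds at the conjugates of all of them.
\<close>

lemma common_conjugate:
  assumes as: "\<And>a. a \<in> set as \<Longrightarrow> [a] \<in> RR 1" and \<theta>: "\<theta> \<in> fms L (n + m)" and c: "c \<in> tup m"
    and Q\<theta>: "Q (\<lambda>x. holds M \<theta> (x @ c))"
  shows "\<exists>\<sigma>\<in>G0. \<forall>a\<in>set as. holds M \<theta> (a @ map \<sigma> c)"
proof -
  obtain N where N: "\<And>L. Qp L (\<lambda>b. \<forall>c\<in>tup m. Q (\<lambda>x. holds M \<theta> (x @ c)) \<longrightarrow> card {l. l < L \<and> \<not> holds M \<theta> (b ! l @ c)} < N)"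
    using majority_fm(1)[OF \<theta>] by blast
  define L' where "L' = Suc (length as * N)"
  define V where "V b \<longleftrightarrow> (\<forall>c\<in>tup m. Q (\<lambda>x. holds M \<theta> (x @ c)) \<longrightarrow> card {l\<in>{..<L'}. \<not> holds M \<theta> (b ! l @ c)} < N)" for b
  have "lrel n L' B0 V"
  proof -
    define ar where "ar = case_sum (\<lambda>_::nat. n) (\<lambda>_::unit. m)"
    have "dfn ar B0 (insert (Inr ()) (Inl ` {..<L'})) (\<lambda>E. holds M (psi m \<theta>) (E (Inr ()) @ dd m \<theta>) \<longrightarrow>
        card {l\<in>{..<L'}. \<not> holds M \<theta> (E (Inl l) @ E (Inr ()))} < N)"
      by (intro dfn_imp dfn_boolean[where \<Phi> = "\<lambda>T. card T < N"] dfn_holds[OF psi(1)[OF \<theta>]] dfn_not dfn_holds[OF \<theta>]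
          dlist_append dlist_var dlist_const finite_lessThan) (use B0(5)[OF \<theta>] in \<open>auto simp: ar_def tuples_def\<close>)
    define PV where "PV E \<longleftrightarrow> (\<forall>c\<in>tup m. holds M (psi m \<theta>) (c @ dd m \<theta>) \<longrightarrow>
        card {l\<in>{..<L'}. \<not> holds M \<theta> (E (Inl l) @ c)} < N)" for E :: "nat + unit \<Rightarrow> 'a list"
    from dfn_all[OF \<open>dfn ar B0 _ _\<close>] have "dfn ar B0 (Inl ` {..<L'}) PV"
      by (rule dfn_cong[OF dfn_mono]) (auto simp: ar_def PV_def)
    then have "dfn (\<lambda>_::nat. n) B0 {..<L'} (\<lambda>E. PV (case_sum E (\<lambda>_. replicate m u1)))"
      by (rule dfn_subst)
        (use u1 in \<open>auto simp: ar_def envs_def tuples_def split: sum.split intro!: dlist_var\<close>)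
    then show ?thesis
    proof (rule lrelI)
      fix E :: "nat \<Rightarrow> 'a list"
      have "{l\<in>{..<L'}. \<not> holds M \<theta> (map E [0..<L'] ! l @ c)} = {l\<in>{..<L'}. \<not> holds M \<theta> (E l @ c)}" for c by auto
      then show "V (map E [0..<L']) = PV (case_sum E (\<lambda>_. replicate m u1))"
        by (simp add: V_def PV_def psi(3)[OF \<theta>])
    qed
  qed
  moreover have "invr L' V"
  proof (rule invrI)
    fix \<sigma> b assume \<sigma>: "\<sigma> \<in> G0" and b: "b \<in> ltup n L'" and h: "V b"
    note au = G0_D(1)[OF \<sigma>]
    show "V (act \<sigma> b)" unfolding V_def
    proof (intro ballI impI)
      fix c assume c: "c \<in> tup m" and qc: "Q (\<lambda>x. holds M \<theta> (x @ c))"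
      define c' where "c' = map (ainv \<sigma>) c"
      have c': "c' \<in> tup m" "map \<sigma> c' = c"
        using automorphism_tup[OF automorphism_ainv[OF au] c] ainv_tup(1)[OF au c] by (simp_all add: c'_def del: map_map)
      have "Q (\<lambda>x. holds M \<theta> (x @ c'))" using G0_D(3)[OF \<sigma> \<theta> c'(1)] qc c'(2) by simp
      then have "card {l\<in>{..<L'}. \<not> holds M \<theta> (b ! l @ c')} < N" using h c'(1) by (simp add: V_def)
      moreover have "holds M \<theta> (act \<sigma> b ! l @ c) = holds M \<theta> (b ! l @ c')" if "l < L'" for l
      proof -
        have "b ! l \<in> tup n" using b that nth_mem by (fastforce simp: ltup_def)
        then have "b ! l @ c' \<in> tup (n + m)" using c'(1) by (auto simp: tuples_def)
        from holds_automorphism[OF au \<theta> this] show ?thesis using c'(2) b that by (simp add: ltup_def)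
      qed
      then have "{l\<in>{..<L'}. \<not> holds M \<theta> (act \<sigma> b ! l @ c)} = {l\<in>{..<L'}. \<not> holds M \<theta> (b ! l @ c')}" by auto
      ultimately show "card {l\<in>{..<L'}. \<not> holds M \<theta> (act \<sigma> b ! l @ c)} < N" by simp
    qed
  qed
  moreover have "V = (\<lambda>b. \<forall>c\<in>tup m. Q (\<lambda>x. holds M \<theta> (x @ c)) \<longrightarrow> card {l. l < L' \<and> \<not> holds M \<theta> (b ! l @ c)} < N)"
    by (rule ext) (simp add: V_def)
  then have "Qp L' V" using N[of L'] by simp
  ultimately have V: "V b" if "b \<in> RR L'" for b using that by (rule RR_inv[rotated])
  obtain \<sigma> where \<sigma>: "\<And>l. \<sigma> l \<in> G0" "\<And>a. a \<in> set as \<Longrightarrow> concat (map (\<lambda>l. act (\<sigma> l) [a]) [0..<L']) \<in> RR L'"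
    using spread[of "map (\<lambda>a. [a]) as" 1 L'] as by auto
  define bad where "bad a = {l\<in>{..<L'}. \<not> holds M \<theta> (map (\<sigma> l) a @ c)}" for a
  have badN: "card (bad a) \<le> N" if a: "a \<in> set as" for a
  proof -
    have "concat (map (\<lambda>l. act (\<sigma> l) [a]) [0..<L']) = map (\<lambda>l. map (\<sigma> l) a) [0..<L']"
      by (induction L') auto
    then have "V (map (\<lambda>l. map (\<sigma> l) a) [0..<L'])" using V[OF \<sigma>(2)[OF a]] by simp
    then have "card {l\<in>{..<L'}. \<not> holds M \<theta> (map (\<lambda>l. map (\<sigma> l) a) [0..<L'] ! l @ c)} < N"
      using c Q\<theta> by (simp add: V_def)
    moreover have "{l\<in>{..<L'}. \<not> holds M \<theta> (map (\<lambda>l. map (\<sigma> l) a) [0..<L'] ! l @ c)} = bad a" by (auto simp: bad_def)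
    ultimately show ?thesis by simp
  qed
  have "card (\<Union>a\<in>set as. bad a) \<le> (\<Sum>a\<in>set as. card (bad a))" by (rule card_UN_le) simp
  also have "\<dots> \<le> (\<Sum>a\<in>set as. N)" using badN by (rule sum_mono)
  also have "\<dots> = card (set as) * N" by simp
  also have "\<dots> \<le> length as * N" by (intro mult_le_mono1 card_length)
  finally have "card (\<Union>a\<in>set as. bad a) < card {..<L'}" by (simp add: L'_def)
  moreover have "finite (\<Union>a\<in>set as. bad a)" by (auto simp: bad_def)
  ultimately have "\<not> {..<L'} \<subseteq> (\<Union>a\<in>set as. bad a)" by (metis card_mono not_less)
  then obtain l where l: "\<And>a. a \<in> set as \<Longrightarrow> holds M \<theta> (map (\<sigma> l) a @ c)" by (auto simp: bad_def)
  note au = G0_D(1)[OF \<sigma>(1)[of l]]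
  have "holds M \<theta> (a @ map (ainv (\<sigma> l)) c)" if a: "a \<in> set as" for a
  proof -
    have "a \<in> tup n" using RR_ltup[OF as[OF a]] by (simp add: ltup_def)
    then have "a @ map (ainv (\<sigma> l)) c \<in> tup (n + m)"
      using automorphism_tup[OF automorphism_ainv[OF au] c] by (auto simp: tuples_def)
    from holds_automorphism[OF au \<theta> this] show ?thesis
      using l[OF a] ainv_tup(1)[OF au c] by (simp del: map_map)
  qed
  then show ?thesis using G0_ainv[OF \<sigma>(1)] by blast
qed

end

section \<open>No ladders over the smaller set\<close>

context stable_nonforking
begin

text \<open>
  Among infinitely many conjugates of finitely many definitions, infinitely many coincide.
\<close>

lemma few_Phi:
  assumes \<sigma>: "\<And>i::nat. automorphism L M (\<sigma> i)" "\<And>i x. x \<in> A \<Longrightarrow> \<sigma> i x = x"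
  shows "finite \<Phi> \<Longrightarrow> \<Phi> \<subseteq> params \<Longrightarrow> infinite Z \<Longrightarrow>
    \<exists>I\<subseteq>Z. infinite I \<and> (\<forall>i\<in>I. \<forall>j\<in>I. \<forall>(m, \<phi>)\<in>\<Phi>. eqv m \<phi> (map (\<sigma> i) (dd m \<phi>)) (map (\<sigma> j) (dd m \<phi>)))"
proof (induction \<Phi> arbitrary: Z rule: finite_induct)
  case empty
  then show ?case by auto
next
  case (insert p \<Phi>)
  obtain m \<phi> where p: "p = (m, \<phi>)" by fastforce
  have \<phi>: "\<phi> \<in> fms L (n + m)" using insert.prems(1) p by (simp add: params_def)
  have "\<Phi> \<subseteq> params" using insert.prems(1) by simp
  from insert.IH[OF this insert.prems(2)] obtain I where I: "I \<subseteq> Z" "infinite I"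
    "\<forall>i\<in>I. \<forall>j\<in>I. \<forall>(m, \<phi>)\<in>\<Phi>. eqv m \<phi> (map (\<sigma> i) (dd m \<phi>)) (map (\<sigma> j) (dd m \<phi>))" by blast
  define l where "l = length (dd m \<phi>)"
  have d: "dd m \<phi> \<in> tup l" using dd_tup[OF \<phi>] by (simp add: l_def)
  obtain H s where H: "rdef l A H" "H (dd m \<phi>)" "few s (eqv m \<phi>) (\<lambda>z. z \<in> tup l \<and> H z)"
    using few_conjugates[OF \<phi> l_def] by blast
  have z: "map (\<sigma> i) (dd m \<phi>) \<in> tup l \<and> H (map (\<sigma> i) (dd m \<phi>))" for i
  proof -
    have "(\<lambda>_::unit. dd m \<phi>) \<in> envs (\<lambda>_. l)" using d by (simp add: envs_def)
    from dfn_automorphism[OF dfn_rdef_unit[OF H(1) A(1)] \<sigma>(1) A(1) \<sigma>(2) this, of i]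
    show ?thesis using H(2) automorphism_tup[OF \<sigma>(1) d] by simp
  qed
  have "\<exists>I'\<subseteq>I. infinite I' \<and> (\<forall>i\<in>I'. \<forall>j\<in>I'. eqv m \<phi> (map (\<sigma> i) (dd m \<phi>)) (map (\<sigma> j) (dd m \<phi>)))"
    by (rule few_infinite[where z = "\<lambda>i. map (\<sigma> i) (dd m \<phi>)", OF H(3) z _ _ _ I(2)])
      (rule eqv_refl, erule eqv_sym, erule eqv_trans, assumption)
  then obtain I' where I': "I' \<subseteq> I" "infinite I'" "\<forall>i\<in>I'. \<forall>j\<in>I'. eqv m \<phi> (map (\<sigma> i) (dd m \<phi>)) (map (\<sigma> j) (dd m \<phi>))"
    by (elim exE conjE)
  have "\<forall>(m, \<phi>)\<in>insert p \<Phi>. eqv m \<phi> (map (\<sigma> i) (dd m \<phi>)) (map (\<sigma> j) (dd m \<phi>))" if ij: "i \<in> I'" "j \<in> I'" for i j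
  proof -
    have "i \<in> I" "j \<in> I" using ij I'(1) by auto
    then have "\<forall>(m, \<phi>)\<in>\<Phi>. eqv m \<phi> (map (\<sigma> i) (dd m \<phi>)) (map (\<sigma> j) (dd m \<phi>))" using I(3) by blast
    moreover have "eqv m \<phi> (map (\<sigma> i) (dd m \<phi>)) (map (\<sigma> j) (dd m \<phi>))" using I'(3) ij by blast
    ultimately show ?thesis by (simp add: p)
  qed
  then show ?case using I'(1,2) I(1) by (intro exI[of _ I']) auto
qed

text \<open>
  Long ladders in the type of \<open>a0\<close> over \<open>A\<close> yield one in \<open>RR 1\<close>.  The left entries of an infinite
  ladder are conjugates \<open>\<sigma> i x\<close> of one generic \<open>x\<close>.  As the definitions of \<open>Q\<close> have few conjugates,
  infinitely many of the \<open>\<sigma> i\<close> have the same effect on finitely many given definitions.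
\<close>

lemma ladder_RR:
  assumes \<phi>: "\<phi> \<in> fms L (n + m)"
    and long: "\<And>N X. rdef n A X \<Longrightarrow> X a0 \<Longrightarrow> \<not> noladder (\<lambda>x c. holds M \<phi> (x @ c)) N (\<lambda>x. x \<in> tup n \<and> X x) (tup m)"
  shows "\<exists>a c. (\<forall>i::nat. [a i] \<in> RR 1) \<and> (\<forall>l::nat. c l \<in> tup m) \<and>
    (\<forall>i l. (i < l \<longrightarrow> holds M \<phi> (a i @ c l)) \<and> (l < i \<longrightarrow> \<not> holds M \<phi> (a i @ c l)))"
proof -
  have "\<exists>b c. (\<forall>i::nat. length (b i) = 1 \<and> (\<forall>x\<in>set (b i). x \<in> tup n \<and> eqtp n A a0 x)) \<and> (\<forall>i. c i \<in> tup m) \<and>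
    (\<forall>i l. (i < l \<longrightarrow> holds M \<phi> (concat (b i) @ c l)) \<and> (l < i \<longrightarrow> \<not> holds M \<phi> (concat (b i) @ c l)))"
  proof (rule infinite_ladder[OF A])
    show "\<phi> \<in> fms L (1 * n + m)" using \<phi> by simp
    fix N X assume X: "rdef n A X" "X a0"
    show "\<not> noladder (\<lambda>b c. holds M \<phi> (concat b @ c)) N (\<lambda>b. length b = 1 \<and> (\<forall>x\<in>set b. x \<in> tup n \<and> X x)) (tup m)"
    proof
      assume nl: "noladder (\<lambda>b c. holds M \<phi> (concat b @ c)) N (\<lambda>b. length b = 1 \<and> (\<forall>x\<in>set b. x \<in> tup n \<and> X x)) (tup m)"
      have "noladder (\<lambda>x c. holds M \<phi> (x @ c)) N (\<lambda>x. x \<in> tup n \<and> X x) (tup m)"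
        by (rule noladder_map[OF nl, of _ "\<lambda>x. [x]" _ "\<lambda>c. c"]) auto
      then show False using long[OF X] by blast
    qed
  qed
  then obtain b c where bc: "\<forall>i::nat. length (b i) = 1 \<and> (\<forall>x\<in>set (b i). x \<in> tup n \<and> eqtp n A a0 x)" "\<forall>i. c i \<in> tup m"
    "\<forall>i l. (i < l \<longrightarrow> holds M \<phi> (concat (b i) @ c l)) \<and> (l < i \<longrightarrow> \<not> holds M \<phi> (concat (b i) @ c l))" by blast
  define a where "a i = hd (b i)" for i
  have bi: "b i = [a i]" for i using bc(1)[rule_format, of i] by (cases "b i") (auto simp: a_def)
  have a: "a i \<in> tup n" "eqtp n A a0 (a i)" for i using bc(1)[rule_format, of i] bi[of i] by auto
  have c: "c i \<in> tup m" for i using bc(2) by blast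
  have lad: "i < l \<Longrightarrow> holds M \<phi> (a i @ c l)" "l < i \<Longrightarrow> \<not> holds M \<phi> (a i @ c l)" for i l
    using bc(3)[rule_format, of i l] by (simp_all add: bi)
  obtain g where g: "gen 1 B0 g" using gen_exists[OF B0(3,4)] by blast
  then have gl: "g \<in> ltup n 1" by (simp add: gen_def)
  then obtain x where x: "g = [x]" "x \<in> tup n" by (auto simp: ltup_def length_Suc_conv)
  have ax: "eqtp n A a0 x"
  proof (rule eqtpI[OF A(1)])
    fix R assume R: "rdef n A R" "R a0"
    have "Q R" using QB[OF rdef_mono[OF R(1) AB] R(2)] .
    then have "Qp 1 (\<lambda>b. R (concat b @ []))" by simp
    moreover have "lrel n 1 B0 (\<lambda>b. R (concat b @ []))"
      by (rule lrel_of_rdef[of 1 n 0 A R "[]"]) (use R(1) B0 in \<open>auto simp: tuples_def\<close>)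
    ultimately have "R (concat g @ [])" using g unfolding gen_def by blast
    then show "R x" by (simp add: x)
  qed
  have "\<exists>\<sigma>. automorphism L M \<sigma> \<and> (\<forall>c\<in>A. \<sigma> c = c) \<and> map \<sigma> x = a i" for i
  proof (rule homogeneity_tup[OF A x(2) a(1)])
    fix R assume R: "rdef n A R" "R x"
    have "R a0 = R x" "R a0 = R (a i)" using ax a(2)[of i] R(1) by (simp_all only: eqtp_def)
    then show "R (a i)" using R(2) by (simp only:)
  qed
  then obtain \<sigma> where \<sigma>: "\<And>i. automorphism L M (\<sigma> i)" "\<And>i y. y \<in> A \<Longrightarrow> \<sigma> i y = y" "\<And>i. map (\<sigma> i) x = a i"
    by metis
  define ar where "ar = case_sum (\<lambda>_::nat. n) (\<lambda>_::nat. m)"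
  define K where "K = {(P, \<Phi>, i::nat, l::nat). dfn arB A (JB 1) P \<and> P (Est g) \<and> finite \<Phi> \<and> \<Phi> \<subseteq> params}"
  define G where "G = (\<lambda>(P, \<Phi>, i::nat, l::nat) E. sp 1 P \<Phi> [E (Inl i)] \<and>
    (i < l \<longrightarrow> holds M \<phi> (E (Inl i) @ E (Inr l))) \<and> (l < i \<longrightarrow> \<not> holds M \<phi> (E (Inl i) @ E (Inr l))))"
  have "\<exists>E\<in>envs ar. \<forall>P\<in>G ` K. P E"
  proof (rule compactness[OF B0(3,4), where J = UNIV])
    show "small \<kappa> (UNIV :: (nat + nat) set)" by (rule small_countable_type)
  next
    fix P' assume "P' \<in> G ` K"
    then obtain P \<Phi> i l where k: "dfn arB A (JB 1) P" "finite \<Phi>" "\<Phi> \<subseteq> params" "P' = G (P, \<Phi>, i, l)" by (auto simp: K_def)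
    have "dfn ar B0 UNIV (\<lambda>E. sp 1 P \<Phi> [E (Inl i)])"
      by (rule dfn_lrel[OF sp_lrel[OF k(1-3)] order_refl B0(3)]) (auto simp: ar_def intro!: dlist_var)
    moreover have "dfn ar B0 UNIV (\<lambda>E. holds M \<phi> (E (Inl i) @ E (Inr l)))"
      by (intro dfn_holds[OF \<phi>] dlist_append dlist_var) (auto simp: ar_def)
    ultimately show "dfn ar B0 UNIV P'" unfolding k(4) G_def
      by (simp only: prod.case) (intro dfn_conj dfn_imp dfn_const dfn_not)
  next
    fix F assume "finite F" "F \<subseteq> G ` K"
    then obtain K0 where K0: "K0 \<subseteq> K" "finite K0" "F = G ` K0" by (meson finite_subset_image)
    define \<Phi>' where "\<Phi>' = (\<Union>k\<in>K0. fst (snd k))"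
    have "finite (fst (snd k)) \<and> fst (snd k) \<subseteq> params" if "k \<in> K0" for k
      using subsetD[OF K0(1) that] by (auto simp: K_def)
    then have \<Phi>': "finite \<Phi>'" "\<Phi>' \<subseteq> params" using K0(2) unfolding \<Phi>'_def by (simp, blast)
    have "\<exists>I\<subseteq>UNIV. infinite I \<and> (\<forall>i\<in>I. \<forall>j\<in>I. \<forall>(m, \<phi>)\<in>\<Phi>'. eqv m \<phi> (map (\<sigma> i) (dd m \<phi>)) (map (\<sigma> j) (dd m \<phi>)))"
      by (rule few_Phi[where \<sigma> = \<sigma>, OF \<sigma>(1) _ \<Phi>' infinite_UNIV_nat]) (rule \<sigma>(2))
    then obtain I where I: "infinite I"
      "\<forall>i\<in>I. \<forall>j\<in>I. \<forall>(m, \<phi>)\<in>\<Phi>'. eqv m \<phi> (map (\<sigma> i) (dd m \<phi>)) (map (\<sigma> j) (dd m \<phi>))"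
      by (elim exE conjE)
    define e where "e = enumerate I"
    have eI: "e i \<in> I" and emono: "i < l \<Longrightarrow> e i < e l" for i l
      using enumerate_in_set[OF I(1)] enumerate_mono[OF _ I(1)] by (auto simp: e_def)
    \<comment> \<open>The automorphisms \<open>\<sigma> (e i)\<close> agree on \<open>\<Phi>'\<close> up to equivalence, so that \<open>\<rho> \<circ> \<sigma> (e i)\<close> fixes \<open>\<Phi>'\<close>.\<close>
    define \<rho> where "\<rho> = ainv (\<sigma> (e 0))"
    have \<rho>: "automorphism L M \<rho>" unfolding \<rho>_def by (rule automorphism_ainv[OF \<sigma>(1)])
    have \<rho>A: "\<rho> y = y" if "y \<in> A" for y
      using ainv_simps(2)[OF \<sigma>(1), of y "e 0"] \<sigma>(2)[OF that, of "e 0"] A(1) that by (auto simp: \<rho>_def)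
    define E where "E = case_sum (\<lambda>i. map \<rho> (a (e i))) (\<lambda>l. map \<rho> (c (e l)))"
    have "E v \<in> tup (ar v)" for v
      using automorphism_tup[OF \<rho> a(1)] automorphism_tup[OF \<rho> c] by (cases v) (simp_all add: E_def ar_def)
    then have E: "E \<in> envs ar" by (simp add: envs_def)
    have "G k E" if k: "k \<in> K0" for k
    proof -
      obtain P \<Phi> i l where k': "k = (P, \<Phi>, i, l)" by (metis prod_cases4)
      have kK: "dfn arB A (JB 1) P" "P (Est g)" "\<Phi> \<subseteq> params" using k k' K0(1) by (auto simp: K_def)
      have \<Phi>sub: "\<Phi> \<subseteq> \<Phi>'" using k k' by (force simp: \<Phi>'_def)
      define \<tau> where "\<tau> = \<rho> \<circ> \<sigma> (e i)"
      have \<tau>: "automorphism L M \<tau>" "\<And>y. y \<in> A \<Longrightarrow> \<tau> y = y"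
        using automorphism_comp[OF \<rho> \<sigma>(1)] \<rho>A \<sigma>(2) by (auto simp: \<tau>_def)
      let ?E = "\<lambda>v. map \<tau> (Est g v)"
      have "?E \<in> envs arB" using Est_envs[OF gl] automorphism_tup[OF \<tau>(1)] by (auto simp: envs_def)
      moreover have "P ?E" using dfn_automorphism[OF kK(1) \<tau>(1) A(1) \<tau>(2) Est_envs[OF gl]] kK(2) by blast
      moreover have "sameQ \<Phi> ?E"
      proof (rule sameQ_act[OF kK(3) \<tau>(1)])
        fix m' \<phi>' assume p: "(m', \<phi>') \<in> \<Phi>"
        then have \<phi>': "\<phi>' \<in> fms L (n + m')" using kK(3) by (auto simp: params_def)
        have "eqv m' \<phi>' (map (\<sigma> (e 0)) (dd m' \<phi>')) (map (\<sigma> (e i)) (dd m' \<phi>'))"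
          using I(2) eI \<Phi>sub p by blast
        from eqv_automorphism[OF \<phi>' \<rho> automorphism_tup[OF \<sigma>(1) dd_tup[OF \<phi>']] automorphism_tup[OF \<sigma>(1) dd_tup[OF \<phi>']] this]
        show "eqv m' \<phi>' (dd m' \<phi>') (map \<tau> (dd m' \<phi>'))"
          using ainv_tup(2)[OF \<sigma>(1) dd_tup[OF \<phi>']] by (simp add: \<tau>_def \<rho>_def)
      qed
      moreover have "blk 1 ?E = [E (Inl i)]"
        using blk_Est[OF gl, of \<tau>] \<sigma>(3)[of "e i"] by (simp add: x \<tau>_def E_def flip: map_map)
      ultimately have "sp 1 P \<Phi> [E (Inl i)]" unfolding sp_def by blast
      moreover have "holds M \<phi> (E (Inl i) @ E (Inr l)) = holds M \<phi> (a (e i) @ c (e l))"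
      proof -
        have "a (e i) @ c (e l) \<in> tup (n + m)" using a(1)[of "e i"] c[of "e l"] by (auto simp: tuples_def)
        from holds_automorphism[OF \<rho> \<phi> this] show ?thesis by (simp add: E_def)
      qed
      ultimately show ?thesis unfolding k' G_def using lad emono by simp
    qed
    then have "\<forall>P\<in>F. P E" unfolding K0(3) by blast
    then show "\<exists>E\<in>envs ar. \<forall>P\<in>F. P E" using E by blast
  qed
  then obtain E where E: "E \<in> envs ar" "\<And>k. k \<in> K \<Longrightarrow> G k E" by auto
  have "[E (Inl i)] \<in> RR 1" for i
  proof (rule RR_of_sp[OF _ g])
    show "[E (Inl i)] \<in> ltup n 1" using envs_tup[OF E(1), of "Inl i"] by (simp add: ltup_def ar_def)
    fix P \<Phi> assume "dfn arB A (JB 1) P" "P (Est g)" "finite \<Phi>" "\<Phi> \<subseteq> params"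
    then have "(P, \<Phi>, i, i) \<in> K" by (simp add: K_def)
    from E(2)[OF this] show "sp 1 P \<Phi> [E (Inl i)]" by (simp add: G_def)
  qed
  moreover have "E (Inr l) \<in> tup m" for l using envs_tup[OF E(1), of "Inr l"] by (simp add: ar_def)
  moreover have "(i < l \<longrightarrow> holds M \<phi> (E (Inl i) @ E (Inr l))) \<and> (l < i \<longrightarrow> \<not> holds M \<phi> (E (Inl i) @ E (Inr l)))" for i l
  proof -
    have "(\<lambda>_. True, {}, i, l) \<in> K" by (simp add: K_def dfn_const)
    from E(2)[OF this] show ?thesis by (simp add: G_def)
  qed
  ultimately show ?thesis by (intro exI[of _ "\<lambda>i. E (Inl i)"] exI[of _ "\<lambda>l. E (Inr l)"]) simp
qed

text \<open>
  A formula \<open>X\<close> of the stable type bounds the length of ladders.  By \<open>common_conjugate\<close> every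
  finite part of a ladder in \<open>RR 1\<close> lies in some conjugate of \<open>X\<close>.
\<close>

lemma noladder_A:
  assumes \<phi>: "\<phi> \<in> fms L (n + m)"
  shows "\<exists>N X. rdef n A X \<and> X a0 \<and> noladder (\<lambda>x c. holds M \<phi> (x @ c)) N (\<lambda>x. x \<in> tup n \<and> X x) (tup m)"
proof (rule ccontr)
  assume "\<not> ?thesis"
  then have long: "\<not> noladder (\<lambda>x c. holds M \<phi> (x @ c)) N (\<lambda>x. x \<in> tup n \<and> X x) (tup m)"
    if "rdef n A X" "X a0" for N X using that by blast
  have "\<exists>a c. (\<forall>i::nat. [a i] \<in> RR 1) \<and> (\<forall>l::nat. c l \<in> tup m) \<and>
    (\<forall>i l. (i < l \<longrightarrow> holds M \<phi> (a i @ c l)) \<and> (l < i \<longrightarrow> \<not> holds M \<phi> (a i @ c l)))"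
    by (rule ladder_RR[OF \<phi>]) (rule long)
  then obtain a c where ac: "\<forall>i::nat. [a i] \<in> RR 1" "\<forall>l::nat. c l \<in> tup m"
    "\<forall>i l. (i < l \<longrightarrow> holds M \<phi> (a i @ c l)) \<and> (l < i \<longrightarrow> \<not> holds M \<phi> (a i @ c l))" by blast
  have at: "a i \<in> tup n" for i using RR_ltup[OF ac(1)[rule_format, of i]] by (simp add: ltup_def)
  obtain N X where X: "rdef n B X" "X a0"
    and nl: "noladder (\<lambda>x c. holds M \<phi> (x @ c)) N (\<lambda>x. x \<in> tup n \<and> X x) (tup m)"
    using noladder_1[OF \<phi>] by blast
  obtain \<theta> e where \<theta>: "\<theta> \<in> fms L (n + length e)" "set e \<subseteq> B" "\<And>y. y \<in> tup n \<Longrightarrow> X y \<longleftrightarrow> holds M \<theta> (y @ e)"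
    using X(1) unfolding rdef_def by blast
  have e: "e \<in> tup (length e)" using \<theta>(2) BU by (auto simp: tuples_def)
  have "Q (\<lambda>y. holds M \<theta> (y @ e)) = Q X" by (rule uq_cong[OF Q, OF Qtup]) (simp add: \<theta>(3))
  then have "Q (\<lambda>y. holds M \<theta> (y @ e))" using QB[OF X] by simp
  from common_conjugate[OF _ \<theta>(1) e this, of "map a [0..<N]"]
  have "\<exists>\<sigma>\<in>G0. \<forall>x\<in>set (map a [0..<N]). holds M \<theta> (x @ map \<sigma> e)" using ac(1) by fastforce
  then obtain \<sigma> where \<sigma>: "\<sigma> \<in> G0" "\<forall>i<N. holds M \<theta> (a i @ map \<sigma> e)" by auto
  note au = G0_D(1)[OF \<sigma>(1)]
  define a' where "a' i = map (ainv \<sigma>) (a i)" for i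
  define c' where "c' i = map (ainv \<sigma>) (c i)" for i
  have a': "a' i \<in> tup n" "map \<sigma> (a' i) = a i" for i
    using automorphism_tup[OF automorphism_ainv[OF au] at] ainv_tup(1)[OF au at] by (simp_all add: a'_def del: map_map)
  have c': "c' i \<in> tup m" for i
    using automorphism_tup[OF automorphism_ainv[OF au]] ac(2) by (simp add: c'_def)
  have "X (a' i)" if i: "i < N" for i
  proof -
    have "a' i @ e \<in> tup (n + length e)" using a'(1)[of i] e by (auto simp: tuples_def)
    from holds_automorphism[OF au \<theta>(1) this] show ?thesis using \<sigma>(2) i a' \<theta>(3) by simp
  qed
  moreover have "holds M \<phi> (a' i @ c' l) = holds M \<phi> (a i @ c l)" for i l
  proof -
    have "a i @ c l \<in> tup (n + m)" using at[of i] ac(2) by (auto simp: tuples_def)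
    from holds_automorphism[OF automorphism_ainv[OF au] \<phi> this] show ?thesis by (simp add: a'_def c'_def)
  qed
  then have "ladder (\<lambda>x c. holds M \<phi> (x @ c)) N a' c'" using ac(3) by (simp add: ladder_def)
  ultimately have "\<exists>b c. (\<forall>i<N. b i \<in> tup n \<and> X (b i)) \<and> (\<forall>i<N. c i \<in> tup m) \<and> ladder (\<lambda>x c. holds M \<phi> (x @ c)) N b c"
    using a'(1) c' by (intro exI[of _ a'] exI[of _ c']) simp
  then show False using nl unfolding noladder_def by simp
qed

end

section \<open>Restrictions of stable nonforking types\<close>

lemma wf_tm_lang_mono: "wf_tm (lang_over L A) t \<Longrightarrow> A \<subseteq> C \<Longrightarrow> wf_tm (lang_over L C) t"
  by (induction t) (auto simp: lang_over_def)

lemma wf_fm_lang_mono: "wf_fm (lang_over L A) \<phi> \<Longrightarrow> A \<subseteq> C \<Longrightarrow> wf_fm (lang_over L C) \<phi>"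
proof (induction \<phi>)
  case (Rel r ts)
  then show ?case using wf_tm_lang_mono[of L A _ C] by (auto simp: lang_over_def)
qed (auto intro: wf_tm_lang_mono)

lemma fms_over_mono: "A \<subseteq> C \<Longrightarrow> fms_over L A n \<subseteq> fms_over L C n"
  using wf_fm_lang_mono[of L A _ C] by (auto simp: fms_def)

context monster
begin

lemma S_realized:
  assumes q: "q \<in> S L M n C" and C: "C \<subseteq> U" "small \<kappa> C"
  shows "\<exists>a\<in>tup n. \<forall>\<chi>. \<chi> \<in> q \<longleftrightarrow> \<chi> \<in> fms_over L C n \<and> holds (named M) \<chi> a"
proof -
  have qf: "q \<subseteq> fms_over L C n" and qfin: "\<And>q0. q0 \<subseteq> q \<Longrightarrow> finite q0 \<Longrightarrow> \<exists>a\<in>tup n. \<forall>\<chi>\<in>q0. holds (named M) \<chi> a"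
    and qc: "\<And>\<chi>. \<chi> \<in> fms_over L C n \<Longrightarrow> \<chi> \<in> q \<or> Neg \<chi> \<in> q"
    using q unfolding S_def partial_type_def by blast+
  have "\<exists>a\<in>tup n. \<forall>R\<in>(\<lambda>\<chi>. holds (named M) \<chi>) ` q. R a"
  proof (rule saturation[OF C])
    show "rdef n C R" if "R \<in> (\<lambda>\<chi>. holds (named M) \<chi>) ` q" for R
      using that qf fms_over_rdef by blast
    fix F assume "finite F" "F \<subseteq> (\<lambda>\<chi>. holds (named M) \<chi>) ` q"
    then obtain q0 where q0: "q0 \<subseteq> q" "finite q0" "F = (\<lambda>\<chi>. holds (named M) \<chi>) ` q0" by (meson finite_subset_image)
    from qfin[OF q0(1,2)] show "\<exists>a\<in>tup n. \<forall>R\<in>F. R a" using q0(3) by simp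
  qed
  then obtain a where a: "a \<in> tup n" "\<forall>\<chi>\<in>q. holds (named M) \<chi> a" by auto
  have "\<chi> \<in> q" if "\<chi> \<in> fms_over L C n" "holds (named M) \<chi> a" for \<chi>
    using qc[OF that(1)] a(2) that(2) by (auto simp: holds_def)
  then show ?thesis using a qf by blast
qed

lemma stable_type_stable_at:
  assumes st: "stable_type L \<kappa> M n B p" and a0: "a0 \<in> tup n"
    and p: "\<And>\<chi>. \<chi> \<in> p \<longleftrightarrow> \<chi> \<in> fms_over L B n \<and> holds (named M) \<chi> a0"
  shows "stable_at n B a0"
  unfolding stable_at_def
proof (intro allI impI)
  fix C a m \<phi>
  assume C: "B \<subseteq> C" "C \<subseteq> U" "small \<kappa> C" and a: "a \<in> tup n" "eqtp n B a0 a" and \<phi>: "\<phi> \<in> fms L (n + m)"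
  define q where "q = tp L M a C"
  have q: "\<chi> \<in> q \<longleftrightarrow> \<chi> \<in> fms_over L C n \<and> holds (named M) \<chi> a" for \<chi>
    using a(1) by (auto simp: q_def tp_def tuples_def)
  have "q \<in> S L M n C"
    unfolding S_def partial_type_def
  proof (intro CollectI conjI allI impI ballI)
    show "q \<subseteq> fms_over L C n" using q by blast
    show "\<exists>a\<in>tup n. \<forall>\<chi>\<in>q0. holds (named M) \<chi> a" if "q0 \<subseteq> q" for q0
      using q a(1) that by (intro bexI[of _ a]) auto
    fix \<chi> assume "\<chi> \<in> fms_over L C n"
    then show "\<chi> \<in> q \<or> Neg \<chi> \<in> q" using q by (auto simp: fms_def holds_def)
  qed
  moreover have "p \<subseteq> q"
  proof
    fix \<chi> assume "\<chi> \<in> p"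
    then have x: "\<chi> \<in> fms_over L B n" "holds (named M) \<chi> a0" using p by auto
    then have "holds (named M) \<chi> a" using a(2) fms_over_rdef[OF x(1)] unfolding eqtp_def by blast
    then show "\<chi> \<in> q" using q x(1) fms_over_mono[OF C(1)] by blast
  qed
  ultimately have "definable_type L M n C q" using st C unfolding stable_type_def by blast
  then obtain \<psi> where \<psi>: "\<psi> \<in> fms_over L C m" "\<And>c. c \<in> tuples C m \<Longrightarrow> inst n \<phi> c \<in> q \<longleftrightarrow> holds (named M) \<psi> c"
    using \<phi> unfolding definable_type_def by blast
  have "holds M \<phi> (a @ c) \<longleftrightarrow> holds (named M) \<psi> c" if c: "c \<in> tuples C m" for c
  proof -
    have "\<phi> \<in> fms L (n + length c)" "set c \<subseteq> C" using \<phi> c by (auto simp: tuples_def)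
    then have "inst n \<phi> c \<in> q \<longleftrightarrow> holds M \<phi> (a @ c)"
      using q inst_fms_over[of \<phi> L n c C] holds_inst[of \<phi> L n c a M] a(1) by (auto simp: tuples_def)
    then show ?thesis using \<psi>(2)[OF c] by simp
  qed
  then show "\<exists>R. rdef m C R \<and> (\<forall>c\<in>tuples C m. holds M \<phi> (a @ c) \<longleftrightarrow> R c)"
    using fms_over_rdef[OF \<psi>(1)] by blast
qed

text \<open>
  No finite number of dividing formulas covers the type, because their disjunction would witness
  forking; hence the type and the negations of all dividing formulas have the finite
  intersection property.
\<close>

lemma nonforking_uq:
  assumes nf: "\<not> forks L M n A p"
    and p: "\<And>\<chi>. \<chi> \<in> p \<longleftrightarrow> \<chi> \<in> fms_over L B n \<and> holds (named M) \<chi> a0" and a0: "a0 \<in> tup n"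
  shows "\<exists>Q. uq Q \<and> Q (\<lambda>x. x \<in> tup n) \<and> (\<forall>X. rdef n B X \<longrightarrow> X a0 \<longrightarrow> Q X) \<and>
    (\<forall>\<phi> b. \<phi> \<in> fms L (n + length b) \<longrightarrow> set b \<subseteq> U \<longrightarrow> divides L M n A \<phi> b \<longrightarrow> \<not> Q (\<lambda>x. holds M \<phi> (x @ b)))"
proof -
  define K where "K = {(\<phi>, b). \<phi> \<in> fms L (n + length b) \<and> set b \<subseteq> U \<and> divides L M n A \<phi> b}"
  define g where "g = (\<lambda>(\<phi>, b) x. \<not> holds M \<phi> (x @ b))"
  define \<F>1 where "\<F>1 = insert (\<lambda>x. x \<in> tup n) {X. rdef n B X \<and> X a0}"
  have "\<exists>x. \<forall>P\<in>F. P x" if F: "finite F" "F \<subseteq> \<F>1 \<union> g ` K" for F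
  proof -
    have "finite (F \<inter> g ` K)" "F \<inter> g ` K \<subseteq> g ` K" using F by auto
    then obtain D where D: "D \<subseteq> K" "finite D" "F \<inter> g ` K = g ` D" by (meson finite_subset_image)
    have "\<exists>a. realizes M n a p \<and> \<not> (\<exists>(\<phi>, b)\<in>D. holds (named M) (inst n \<phi> b) a)"
    proof (rule ccontr)
      assume "\<not> ?thesis"
      then have "\<forall>a. realizes M n a p \<longrightarrow> (\<exists>(\<phi>, b)\<in>D. holds (named M) (inst n \<phi> b) a)" by blast
      moreover have "\<forall>(\<phi>, b)\<in>D. set b \<subseteq> U \<and> \<phi> \<in> fms L (n + length b) \<and> divides L M n A \<phi> b"
        using D(1) by (auto simp: K_def)
      ultimately have "forks L M n A p" using D(2) unfolding forks_def by (intro exI[of _ D] conjI)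
      then show False using nf by simp
    qed
    then obtain a where a: "a \<in> tup n" "\<And>\<chi>. \<chi> \<in> p \<Longrightarrow> holds (named M) \<chi> a"
      "\<And>\<phi> b. (\<phi>, b) \<in> D \<Longrightarrow> \<not> holds (named M) (inst n \<phi> b) a" unfolding realizes_def by blast
    have "P a" if P: "P \<in> F" for P
    proof -
      have "P \<in> \<F>1 \<or> P \<in> F \<inter> g ` K" using P F(2) by blast
      then consider "P = (\<lambda>x. x \<in> tup n)" | "rdef n B P" "P a0" | "P \<in> g ` D" unfolding D(3) \<F>1_def by blast
      then show ?thesis
      proof cases
        case 1
        then show ?thesis using a(1) by simp
      next
        case 2
        obtain \<chi> where x: "\<chi> \<in> fms_over L B n" "\<forall>a\<in>tup n. holds (named M) \<chi> a \<longleftrightarrow> P a"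
          using rdef_fms_over[OF 2(1)] by blast
        then have "\<chi> \<in> p" using p 2(2) a0 by simp
        then show ?thesis using a(1,2) x(2) by blast
      next
        case 3
        then obtain \<phi> b where b: "(\<phi>, b) \<in> D" "P = g (\<phi>, b)" by auto
        then have "\<phi> \<in> fms L (n + length b)" using D(1) by (auto simp: K_def)
        then show ?thesis using a(3)[OF b(1)] a(1) b(2) by (simp add: g_def holds_inst tuples_def)
      qed
    qed
    then show ?thesis by blast
  qed
  from uq_exists[of "\<F>1 \<union> g ` K", OF this] obtain Q where Q: "uq Q" "\<forall>P\<in>\<F>1 \<union> g ` K. Q P" by blast
  have "\<not> Q (\<lambda>x. holds M \<phi> (x @ b))" if "\<phi> \<in> fms L (n + length b)" "set b \<subseteq> U" "divides L M n A \<phi> b" for \<phi> b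
  proof -
    have "g (\<phi>, b) \<in> \<F>1 \<union> g ` K" using that by (auto simp: K_def)
    then have "Q (g (\<phi>, b))" using Q(2) by (rule bspec[rotated])
    then have "Q (\<lambda>x. \<not> holds M \<phi> (x @ b))" by (simp add: g_def)
    then show ?thesis using uq_not[OF Q(1)] by blast
  qed
  moreover have "Q (\<lambda>x. x \<in> tup n)" by (rule bspec[OF Q(2)]) (simp add: \<F>1_def)
  moreover have "Q X" if "rdef n B X" "X a0" for X by (rule bspec[OF Q(2)]) (use that in \<open>simp add: \<F>1_def\<close>)
  ultimately show ?thesis using Q(1) by (intro exI[of _ Q]) simp
qed

end

theorem corollary3p20:
  fixes L :: "('f, 'r) language"
    and T :: "('f, 'r) fm set"
    and \<kappa> :: "'k rel"
    and M :: "('f, 'r, 'a) struct"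
    and n :: nat
    and A B :: "'a set"
    and p :: "('f + 'a, 'r) fm set"
  assumes "complete_theory L T"
    and "monster_model L T \<kappa> M"
    and "A \<subseteq> B" and "B \<subseteq> universe M" and "small \<kappa> B"
    and "p \<in> S L M n B"
    and "stable_type L \<kappa> M n B p"
    and "\<not> forks L M n A p"
  shows "stable_type L \<kappa> M n A (restrict_type L n p A)"
proof -
  interpret monster L M \<kappa>
    using assms(2) by unfold_locales (auto simp: monster_model_def models_def)
  obtain a0 where a0: "a0 \<in> tup n" and p: "\<And>\<chi>. \<chi> \<in> p \<longleftrightarrow> \<chi> \<in> fms_over L B n \<and> holds (named M) \<chi> a0"
    using S_realized[OF assms(6,4,5)] by blast
  obtain Q where Q: "uq Q" "Q (\<lambda>x. x \<in> tup n)" "\<forall>X. rdef n B X \<longrightarrow> X a0 \<longrightarrow> Q X"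
    "\<forall>\<phi> b. \<phi> \<in> fms L (n + length b) \<longrightarrow> set b \<subseteq> U \<longrightarrow> divides L M n A \<phi> b \<longrightarrow> \<not> Q (\<lambda>x. holds M \<phi> (x @ b))"
    using nonforking_uq[OF assms(8) p a0] by blast
  interpret stable_nonforking L M \<kappa> n A B a0 Q
    by unfold_locales (use assms(3-5) a0 Q stable_type_stable_at[OF assms(7) a0 p] in simp_all)
  let ?\<pi> = "restrict_type L n p A"
  have \<pi>: "\<chi> \<in> ?\<pi> \<longleftrightarrow> \<chi> \<in> fms_over L A n \<and> holds (named M) \<chi> a0" for \<chi>
    using p fms_over_mono[OF assms(3)] by (auto simp: restrict_type_def)
  show ?thesis
    unfolding stable_type_def
  proof (intro conjI allI impI ballI)
    show "partial_type L M A n ?\<pi>"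
      unfolding partial_type_def using \<pi> a0 by (auto intro!: bexI[of _ a0])
  next
    fix C q assume C: "A \<subseteq> C" "C \<subseteq> U" "small \<kappa> C" and q: "q \<in> S L M n C" "?\<pi> \<subseteq> q"
    obtain a where a: "a \<in> tup n" and qa: "\<And>\<chi>. \<chi> \<in> q \<longleftrightarrow> \<chi> \<in> fms_over L C n \<and> holds (named M) \<chi> a"
      using S_realized[OF q(1) C(2,3)] by blast
    show "definable_type L M n C q"
      unfolding definable_type_def
    proof (intro allI ballI)
      fix m \<phi> assume \<phi>: "\<phi> \<in> fms L (n + m)"
      obtain N X where X: "rdef n A X" "X a0"
        and nl: "noladder (\<lambda>x c. holds M \<phi> (x @ c)) N (\<lambda>x. x \<in> tup n \<and> X x) (tup m)"
        using noladder_A[OF \<phi>] by blast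
      obtain \<chi> where x: "\<chi> \<in> fms_over L A n" "\<forall>a\<in>tup n. holds (named M) \<chi> a \<longleftrightarrow> X a"
        using rdef_fms_over[OF X(1)] by blast
      then have "\<chi> \<in> q" using \<pi> X(2) a0 q(2) by blast
      then have Xa: "X a" using qa x(2) a by blast
      obtain R where R: "rdef m C R" "\<forall>c\<in>tuples C m. holds M \<phi> (a @ c) \<longleftrightarrow> R c"
        using definable_of_noladder[OF uq_principal[of a] a C(2) rdef_mono[OF X(1) C(1)] Xa nl \<phi>] by blast
      obtain \<psi> where \<psi>: "\<psi> \<in> fms_over L C m" "\<forall>c\<in>tup m. holds (named M) \<psi> c \<longleftrightarrow> R c"
        using rdef_fms_over[OF R(1)] by blast
      have "inst n \<phi> c \<in> q \<longleftrightarrow> holds (named M) \<psi> c" if c: "c \<in> tuples C m" for c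
      proof -
        have "\<phi> \<in> fms L (n + length c)" "set c \<subseteq> C" "c \<in> tup m" using \<phi> c C(2) by (auto simp: tuples_def)
        then show ?thesis
          using qa inst_fms_over[of \<phi> L n c C] holds_inst[of \<phi> L n c a M] a R(2) \<psi>(2) c by (auto simp: tuples_def)
      qed
      then show "\<exists>\<psi>\<in>fms_over L C m. \<forall>c\<in>tuples C m. inst n \<phi> c \<in> q \<longleftrightarrow> holds (named M) \<psi> c"
        using \<psi>(1) by blast
    qed
  qed
qed

end
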